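(* Let $\mathbb X=(X,\{e_i\}_{i\in I},\{\gamma_i\}_{i\in I},\{\varepsilon_i\}_{i\in I})$ be a finite-dimensional positive $\mathfrak g$-geometric crystal with positive structure $\theta\colon T\to X$, and let $B=\mathcal{UD}_\theta(\mathbb X)$ be the crystal obtained as the ultra-discretization of $\mathbb X$ with respect to $\theta$. If $B$ is a connected crystal, then $\mathbb X$ is prehomogeneous.
   Context: $\mathfrak g$ is a Kac–Moody Lie algebra with symmetrizable generalized Cartan matrix $(a_{ij})_{i,j\in I}$, $a_{ij}=\alpha_j(\alpha_i^\vee)$, $I$ finite. **Geometric crystal.** A $\mathfrak g$-geometric crystal is a quadruple $(X,\{e_i\}_{i\in I},\{\gamma_i\}_{i\in I},\{\varepsilon_i\}_{i\in I})$ where $X$ is a complex algebraic variety, each $e_i\colon\mathbb C^\times\times X\to X$, $(c,x)\mapsto e_i^c(x)$, is a rational $\mathbb C^\times$-action, and $\gamma_i,\varepsilon_i\colon X\to\mathbb C$ are rational functions such that (i) $(\{1\}\times X)\cap \mathrm{dom}(e_i)$ is open dense in $\{1\}\times X$; (ii) $\gamma_j(e_i^c(x))=c^{a_{ij}}\gamma_j(x)$; (iii) (Verma relations) $e_i^{c_1}e_j^{c_2}=e_j^{c_2}e_i^{c_1}$ if $a_{ij}=a_{ji}=0$; $e_i^{c_1}e_j^{c_1c_2}e_i^{c_2}=e_j^{c_2}e_i^{c_1c_2}e_j^{c_1}$ if $a_{ij}=a_{ji}=-1$; $e_i^{c_1}e_j^{c_1^2c_2}e_i^{c_1c_2}e_j^{c_2}=e_j^{c_2}e_i^{c_1c_2}e_j^{c_1^2c_2}e_i^{c_1}$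 if $a_{ij}=-2,a_{ji}=-1$; $e_i^{c_1}e_j^{c_1^3c_2}e_i^{c_1^2c_2}e_j^{c_1^3c_2^2}e_i^{c_1c_2}e_j^{c_2}=e_j^{c_2}e_i^{c_1c_2}e_j^{c_1^3c_2^2}e_i^{c_1^2c_2}e_j^{c_1^3c_2}e_i^{c_1}$ if $a_{ij}=-3,a_{ji}=-1$; (iv) $\varepsilon_i(e_i^c(x))=c^{-1}\varepsilon_i(x)$. **Positivity.** A nonzero rational function on an algebraic torus $T$ is positive if it equals $g/h$ with $g,h$ linear combinations of characters of $T$ with positive coefficients. A rational map $f\colon T\to T'$ between tori is positive if $\chi\circ f$ is positive for every character $\chi$ of $T'$. A positive structure on $\mathbb X$ is a birational map $\theta\colon T\to X$ from an algebraic torus such that for all $i\in I$ the functions $\gamma_i\circ\theta$, $\varepsilon_i\circ\theta$ are positive and the rational map $e_{i,\theta}\colon\mathbb C^\times\times T\to T$, $(c,t)\mapsto\theta^{-1}(e_i^c(\theta(t)))$, is positive. A geometric crystal equipped with a positive structure is called positive. **Ultra-discretization.** For $f\in\mathbb C(c)\setminus\{0\}$ let $v(f)\in\mathbb Z$ be the order of the pole of $f$ at $c=\infty$ (degree of numerator minus degree of denominator). For a positive rational map $f\colon T\to T'$ the map $\mathcal{UD}(f)=\widehat f\colon X_*(T)\to X_*(T')$ on cocharacter lattices is defined by $\langle\chi,\widehat f(\xi)\rangle=v(\chi\circ f\circ\xi)$ for all characters $\chi$ of $T'$ and $\xi\in X_*(T)$. The ultra-discretization $\mathcal{UD}_\theta(\mathbb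 X)$ is the set $X_*(T)$ with the maps $\mathcal{UD}(e_{i,\theta})\colon\mathbb Z\times X_*(T)\to X_*(T)$, written $(n,b)\mapsto\tilde e_i^{\,n}(b)$, and $\mathrm{wt}_i=\mathcal{UD}(\gamma_i\circ\theta)$, $\varepsilon_i=\mathcal{UD}(\varepsilon_i\circ\theta)\colon X_*(T)\to\mathbb Z$; it is a (free) crystal with Kashiwara operators $\tilde e_i=\tilde e_i^{\,1}$, $\tilde f_i=\tilde e_i^{\,-1}$. It is connected if its crystal graph is connected, i.e. any two elements are related by a finite composition of operators $\tilde e_i^{\,n}$ ($i\in I$, $n\in\mathbb Z$). **Prehomogeneous.** $\mathbb X$ is prehomogeneous if there is a Zariski open dense subset $\Omega\subset X$ which is an orbit under the actions of the $e_i^c$ ($i\in I$, $c\in\mathbb C^\times$). *)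

theory Defs
  imports
    "HOL-Analysis.Analysis"
    "HOL-Algebra.Group"
    "HOL-Computational_Algebra.Polynomial"
begin

section \<open>Complex algebraic varieties as spaces with functions\<close>

text \<open>
  Varieties are formalised classically (Serre): a topological space with a sheaf of
  complex-valued functions that is locally isomorphic to a Zariski closed subset of affine space.
  The set \<open>regs S U\<close> consists of total HOL functions, of which only the values on \<open>U\<close> matter.
\<close>

record 'a fspace =
  zar :: "'a topology"
  regs :: "'a set \<Rightarrow> ('a \<Rightarrow> complex) set"

abbreviation pts :: "'a fspace \<Rightarrow> 'a set" where
  "pts S \<equiv> topspace (zar S)"

definition sheaf :: "'a fspace \<Rightarrow> bool" where
  "sheaf S \<longleftrightarrow>
     (\<forall>U f g. openin (zar S) U \<longrightarrow> f \<in> regs S U \<longrightarrow> (\<forall>x\<in>U. g x = f x) \<longrightarrow> g \<in> regs S U) \<and>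
     (\<forall>U V f. openin (zar S) U \<longrightarrow> openin (zar S) V \<longrightarrow> V \<subseteq> U \<longrightarrow> f \<in> regs S U \<longrightarrow> f \<in> regs S V) \<and>
     (\<forall>U f. openin (zar S) U \<longrightarrow>
        (\<forall>x\<in>U. \<exists>V. openin (zar S) V \<and> x \<in> V \<and> V \<subseteq> U \<and> f \<in> regs S V) \<longrightarrow> f \<in> regs S U)"

definition open_subspace :: "'a fspace \<Rightarrow> 'a set \<Rightarrow> 'a fspace" where
  "open_subspace S U = \<lparr>zar = subtopology (zar S) U, regs = regs S\<rparr>"

text \<open>\<open>regular_on S U S' f\<close>: \<open>f\<close> is a morphism of varieties from the open subset \<open>U\<close> of \<open>S\<close> to \<open>S'\<close>.\<close>

definition regular_on :: "'a fspace \<Rightarrow> 'a set \<Rightarrow> 'b fspace \<Rightarrow> ('a \<Rightarrow> 'b) \<Rightarrow> bool" where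
  "regular_on S U S' f \<longleftrightarrow> openin (zar S) U \<and> f ` U \<subseteq> pts S' \<and>
     (\<forall>V. openin (zar S') V \<longrightarrow>
        openin (zar S) {x\<in>U. f x \<in> V} \<and> (\<forall>g\<in>regs S' V. g \<circ> f \<in> regs S {x\<in>U. f x \<in> V}))"

abbreviation morphism :: "'a fspace \<Rightarrow> 'b fspace \<Rightarrow> ('a \<Rightarrow> 'b) \<Rightarrow> bool" where
  "morphism S S' f \<equiv> regular_on S (pts S) S' f"

definition fspace_iso :: "'a fspace \<Rightarrow> 'b fspace \<Rightarrow> ('a \<Rightarrow> 'b) \<Rightarrow> bool" where
  "fspace_iso S S' f \<longleftrightarrow> bij_betw f (pts S) (pts S') \<and>
     morphism S S' f \<and> morphism S' S (inv_into (pts S) f)"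

text \<open>
  The set \<open>Z\<close> with the topology whose basic open sets are the non-vanishing loci of functions in
  \<open>A\<close> and with the functions that are locally quotients of functions in \<open>A\<close> as regular functions.
\<close>

definition quot_space :: "'a set \<Rightarrow> ('a \<Rightarrow> complex) set \<Rightarrow> 'a fspace" where
  "quot_space Z A =
     \<lparr>zar = topology_generated_by {{x\<in>Z. h x \<noteq> 0} |h. h \<in> A},
      regs = (\<lambda>W. {f. \<forall>z\<in>W. \<exists>g\<in>A. \<exists>h\<in>A. h z \<noteq> 0 \<and> (\<forall>w\<in>W. h w \<noteq> 0 \<longrightarrow> f w = g w / h w)})\<rparr>"

text \<open>Polynomial functions in \<open>n\<close> variables.\<close>

inductive_set polyfuns :: "nat \<Rightarrow> ((nat \<Rightarrow> complex) \<Rightarrow> complex) set" for n :: nat where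
  const: "(\<lambda>x. a) \<in> polyfuns n"
| coord: "i < n \<Longrightarrow> (\<lambda>x. x i) \<in> polyfuns n"
| add: "f \<in> polyfuns n \<Longrightarrow> g \<in> polyfuns n \<Longrightarrow> (\<lambda>x. f x + g x) \<in> polyfuns n"
| mult: "f \<in> polyfuns n \<Longrightarrow> g \<in> polyfuns n \<Longrightarrow> (\<lambda>x. f x * g x) \<in> polyfuns n"

definition affine_variety :: "'a fspace \<Rightarrow> bool" where
  "affine_variety S \<longleftrightarrow> (\<exists>n P \<phi>. P \<subseteq> polyfuns n \<and>
     fspace_iso S (quot_space {x \<in> {..<n} \<rightarrow>\<^sub>E UNIV. \<forall>p\<in>P. p x = 0} (polyfuns n)) \<phi>)"

definition tensor_funs ::
    "'a fspace \<Rightarrow> 'a set \<Rightarrow> 'b fspace \<Rightarrow> 'b set \<Rightarrow> ('a \<times> 'b \<Rightarrow> complex) set" where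
  "tensor_funs S U S' V =
     {\<lambda>(x, y). \<Sum>k<n. f k x * g k y |(n::nat) f g.
        (\<forall>k<n. f k \<in> regs S U) \<and> (\<forall>k<n. g k \<in> regs S' V)}"

text \<open>
  The product variety. Its Zariski topology is not the product topology; it is generated by the
  non-vanishing loci of sums of products of regular functions on open subsets of the factors.
\<close>

definition fprod :: "'a fspace \<Rightarrow> 'b fspace \<Rightarrow> ('a \<times> 'b) fspace" where
  "fprod S S' =
     \<lparr>zar = topology_generated_by {{z \<in> U \<times> V. h z \<noteq> 0} |U V h.
        openin (zar S) U \<and> openin (zar S') V \<and> h \<in> tensor_funs S U S' V},
      regs = (\<lambda>W. {f. \<forall>z\<in>W. \<exists>U V. openin (zar S) U \<and> openin (zar S') V \<and> z \<in> U \<times> V \<and>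
        (\<exists>g\<in>tensor_funs S U S' V. \<exists>h\<in>tensor_funs S U S' V. h z \<noteq> 0 \<and>
           (\<forall>w \<in> W \<inter> (U \<times> V). h w \<noteq> 0 \<longrightarrow> f w = g w / h w))})\<rparr>"

text \<open>The last conjunct is separatedness. Irreducibility is not required.\<close>

definition variety :: "'a fspace \<Rightarrow> bool" where
  "variety S \<longleftrightarrow> sheaf S \<and>
     (\<exists>\<U>. finite \<U> \<and> \<Union>\<U> = pts S \<and>
        (\<forall>U\<in>\<U>. openin (zar S) U \<and> affine_variety (open_subspace S U))) \<and>
     closedin (zar (fprod S S)) {(x, x) |x. x \<in> pts S}"

definition affine_line :: "complex fspace" where
  "affine_line = quot_space UNIV (range poly)"


section \<open>Rational maps\<close>

definition open_dense :: "'a fspace \<Rightarrow> 'a set \<Rightarrow> bool" where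
  "open_dense S W \<longleftrightarrow> openin (zar S) W \<and> zar S closure_of W = pts S"

definition generically :: "'a fspace \<Rightarrow> ('a \<Rightarrow> bool) \<Rightarrow> bool" where
  "generically S P \<longleftrightarrow> (\<exists>W. open_dense S W \<and> (\<forall>x\<in>W. P x))"

text \<open>
  A rational map is represented by its representative with the largest domain of definition, as a
  partial function; thus \<open>dom f\<close> is the domain of definition of the rational map.
\<close>

definition rational_map :: "'a fspace \<Rightarrow> 'b fspace \<Rightarrow> ('a \<rightharpoonup> 'b) \<Rightarrow> bool" where
  "rational_map S S' f \<longleftrightarrow> open_dense S (dom f) \<and> regular_on S (dom f) S' (the \<circ> f) \<and>
     (\<forall>U g. dom f \<subseteq> U \<longrightarrow> regular_on S U S' g \<longrightarrow> (\<forall>x\<in>dom f. f x = Some (g x)) \<longrightarrow> U = dom f)"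

text \<open>
  The rational map represented by a partial function whose domain need not be maximal, such as a
  composite of rational maps.
\<close>

definition rational_ext :: "'a fspace \<Rightarrow> 'b fspace \<Rightarrow> ('a \<rightharpoonup> 'b) \<Rightarrow> ('a \<rightharpoonup> 'b)" where
  "rational_ext S S' f =
     (THE F. rational_map S S' F \<and> generically S (\<lambda>x. f x \<noteq> None \<and> F x = f x))"

definition inverse_rational ::
    "'a fspace \<Rightarrow> 'b fspace \<Rightarrow> ('a \<rightharpoonup> 'b) \<Rightarrow> ('b \<rightharpoonup> 'a) \<Rightarrow> bool" where
  "inverse_rational S S' f g \<longleftrightarrow> rational_map S' S g \<and>
     generically S (\<lambda>x. \<exists>y. f x = Some y \<and> g y = Some x) \<and>
     generically S' (\<lambda>y. \<exists>x. g y = Some x \<and> f x = Some y)"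

definition birational_map :: "'a fspace \<Rightarrow> 'b fspace \<Rightarrow> ('a \<rightharpoonup> 'b) \<Rightarrow> bool" where
  "birational_map S S' f \<longleftrightarrow> rational_map S S' f \<and> (\<exists>g. inverse_rational S S' f g)"

definition rational_inv :: "'a fspace \<Rightarrow> 'b fspace \<Rightarrow> ('a \<rightharpoonup> 'b) \<Rightarrow> ('b \<rightharpoonup> 'a)" where
  "rational_inv S S' f = (THE g. inverse_rational S S' f g)"


section \<open>Algebraic tori\<close>

record 'a alg_group = "'a monoid" +
  var :: "'a fspace"

definition Gm :: "complex alg_group" where
  "Gm = \<lparr>carrier = - {0}, monoid.mult = (*), one = 1, var = quot_space (- {0}) (range poly)\<rparr>"

definition std_torus :: "nat \<Rightarrow> (nat \<Rightarrow> complex) alg_group" where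
  "std_torus d =
     \<lparr>carrier = {..<d} \<rightarrow>\<^sub>E - {0},
      monoid.mult = (\<lambda>x y. \<lambda>i\<in>{..<d}. x i * y i),
      one = (\<lambda>i\<in>{..<d}. 1),
      var = quot_space ({..<d} \<rightarrow>\<^sub>E - {0}) (polyfuns d)\<rparr>"

definition prod_group :: "'a alg_group \<Rightarrow> 'b alg_group \<Rightarrow> ('a \<times> 'b) alg_group" where
  "prod_group G H =
     \<lparr>carrier = carrier G \<times> carrier H,
      monoid.mult = (\<lambda>(g, h) (g', h'). (g \<otimes>\<^bsub>G\<^esub> g', h \<otimes>\<^bsub>H\<^esub> h')),
      one = (\<one>\<^bsub>G\<^esub>, \<one>\<^bsub>H\<^esub>),
      var = fprod (var G) (var H)\<rparr>"

definition alg_torus :: "'t alg_group \<Rightarrow> bool" where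
  "alg_torus T \<longleftrightarrow> group T \<and> variety (var T) \<and> pts (var T) = carrier T \<and>
     (\<exists>d \<phi>. \<phi> \<in> iso T (std_torus d) \<and> fspace_iso (var T) (var (std_torus d)) \<phi>)"

definition alg_hom :: "'a alg_group \<Rightarrow> 'b alg_group \<Rightarrow> ('a \<Rightarrow> 'b) set" where
  "alg_hom G H = {f \<in> hom G H. f \<in> extensional (carrier G) \<and> morphism (var G) (var H) f}"

abbreviation characters :: "'t alg_group \<Rightarrow> ('t \<Rightarrow> complex) set" where
  "characters T \<equiv> alg_hom T Gm"

abbreviation cocharacters :: "'t alg_group \<Rightarrow> (complex \<Rightarrow> 't) set" where
  "cocharacters T \<equiv> alg_hom Gm T"

definition pairing :: "('t \<Rightarrow> complex) \<Rightarrow> (complex \<Rightarrow> 't) \<Rightarrow> int" where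
  "pairing \<psi> \<xi> = (THE n. \<forall>c\<in>- {0}. \<psi> (\<xi> c) = c powi n)"


section \<open>Positivity and ultra-discretization\<close>

definition positive_combinations :: "'t alg_group \<Rightarrow> ('t \<Rightarrow> complex) set" where
  "positive_combinations T =
     {\<lambda>t. \<Sum>\<psi>\<in>F. complex_of_real (a \<psi>) * \<psi> t |F a.
        finite F \<and> F \<noteq> {} \<and> F \<subseteq> characters T \<and> (\<forall>\<psi>\<in>F. a \<psi> > 0)}"

definition positive_fun :: "'t alg_group \<Rightarrow> ('t \<rightharpoonup> complex) \<Rightarrow> bool" where
  "positive_fun T f \<longleftrightarrow> (\<exists>g\<in>positive_combinations T. \<exists>h\<in>positive_combinations T.
     generically (var T) (\<lambda>t. h t \<noteq> 0 \<and> f t = Some (g t / h t)))"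

definition positive_map :: "'s alg_group \<Rightarrow> 't alg_group \<Rightarrow> ('s \<rightharpoonup> 't) \<Rightarrow> bool" where
  "positive_map T T' f \<longleftrightarrow> rational_map (var T) (var T') f \<and>
     (\<forall>\<psi>\<in>characters T'. positive_fun T (\<lambda>t. map_option \<psi> (f t)))"

text \<open>The order of the pole at infinity of a nonzero rational function of one variable.\<close>

definition pole_order :: "(complex \<rightharpoonup> complex) \<Rightarrow> int" where
  "pole_order f = (THE n. \<exists>p q :: complex poly. p \<noteq> 0 \<and> q \<noteq> 0 \<and>
     generically (var Gm) (\<lambda>c. poly q c \<noteq> 0 \<and> f c = Some (poly p c / poly q c)) \<and>
     n = int (degree p) - int (degree q))"

definition UD_map ::
    "'s alg_group \<Rightarrow> 't alg_group \<Rightarrow> ('s \<rightharpoonup> 't) \<Rightarrow> (complex \<Rightarrow> 's) \<Rightarrow> (complex \<Rightarrow> 't)" where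
  "UD_map T T' f \<xi> = (THE \<eta>. \<eta> \<in> cocharacters T' \<and>
     (\<forall>\<psi>\<in>characters T'. pairing \<psi> \<eta> = pole_order (\<lambda>c. map_option \<psi> (f (\<xi> c)))))"

text \<open>The case of target \<open>\<complex>\<^sup>\<times>\<close>, with its cocharacter lattice identified with the integers.\<close>

definition UD_fun :: "('t \<rightharpoonup> complex) \<Rightarrow> (complex \<Rightarrow> 't) \<Rightarrow> int" where
  "UD_fun f \<xi> = pole_order (\<lambda>c. f (\<xi> c))"


section \<open>Geometric crystals\<close>

text \<open>A symmetrizable Kac--Moody algebra enters only through its generalized Cartan matrix.\<close>

definition symmetrizable_GCM :: "'i set \<Rightarrow> ('i \<Rightarrow> 'i \<Rightarrow> int) \<Rightarrow> bool" where
  "symmetrizable_GCM I a \<longleftrightarrow> finite I \<and>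
     (\<forall>i\<in>I. a i i = 2) \<and>
     (\<forall>i\<in>I. \<forall>j\<in>I. i \<noteq> j \<longrightarrow> a i j \<le> 0) \<and>
     (\<forall>i\<in>I. \<forall>j\<in>I. a i j = 0 \<longleftrightarrow> a j i = 0) \<and>
     (\<exists>d :: 'i \<Rightarrow> rat. (\<forall>i\<in>I. d i > 0) \<and>
        (\<forall>i\<in>I. \<forall>j\<in>I. d i * of_int (a i j) = d j * of_int (a j i)))"

record ('i, 'a) gcrystal =
  gvar :: "'a fspace"
  act :: "'i \<Rightarrow> complex \<times> 'a \<rightharpoonup> 'a"
  gam :: "'i \<Rightarrow> 'a \<rightharpoonup> complex"
  eps :: "'i \<Rightarrow> 'a \<rightharpoonup> complex"

definition rational_action :: "'a fspace \<Rightarrow> (complex \<times> 'a \<rightharpoonup> 'a) \<Rightarrow> bool" where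
  "rational_action S e \<longleftrightarrow> rational_map (fprod (var Gm) S) S e \<and>
     (\<forall>x. (1, x) \<in> dom e \<longrightarrow> e (1, x) = Some x) \<and>
     generically (fprod (var Gm) (fprod (var Gm) S)) (\<lambda>(c1, c2, x).
       \<exists>y z. e (c2, x) = Some y \<and> e (c1, y) = Some z \<and> e (c1 * c2, x) = Some z)"

text \<open>\<open>act_word X [(i1, c1), \<dots>, (il, cl)] x\<close> is \<open>e_i1^c1 (\<dots> (e_il^cl x))\<close>.\<close>

definition act_word :: "('i, 'a) gcrystal \<Rightarrow> ('i \<times> complex) list \<Rightarrow> 'a \<Rightarrow> 'a option" where
  "act_word X w x = foldr (\<lambda>(i, c) r. Option.bind r (\<lambda>y. act X i (c, y))) w (Some x)"

definition word_relation :: "('i, 'a) gcrystal \<Rightarrow>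
    (complex \<Rightarrow> complex \<Rightarrow> ('i \<times> complex) list) \<Rightarrow>
    (complex \<Rightarrow> complex \<Rightarrow> ('i \<times> complex) list) \<Rightarrow> bool" where
  "word_relation X w w' \<longleftrightarrow>
     generically (fprod (var Gm) (fprod (var Gm) (gvar X))) (\<lambda>(c1, c2, x).
       \<exists>y. act_word X (w c1 c2) x = Some y \<and> act_word X (w' c1 c2) x = Some y)"

definition verma_relations :: "'i set \<Rightarrow> ('i \<Rightarrow> 'i \<Rightarrow> int) \<Rightarrow> ('i, 'a) gcrystal \<Rightarrow> bool" where
  "verma_relations I a X \<longleftrightarrow> (\<forall>i\<in>I. \<forall>j\<in>I.
     (a i j = 0 \<and> a j i = 0 \<longrightarrow>
        word_relation X (\<lambda>c1 c2. [(i, c1), (j, c2)]) (\<lambda>c1 c2. [(j, c2), (i, c1)])) \<and>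
     (a i j = - 1 \<and> a j i = - 1 \<longrightarrow>
        word_relation X
          (\<lambda>c1 c2. [(i, c1), (j, c1 * c2), (i, c2)])
          (\<lambda>c1 c2. [(j, c2), (i, c1 * c2), (j, c1)])) \<and>
     (a i j = - 2 \<and> a j i = - 1 \<longrightarrow>
        word_relation X
          (\<lambda>c1 c2. [(i, c1), (j, c1^2 * c2), (i, c1 * c2), (j, c2)])
          (\<lambda>c1 c2. [(j, c2), (i, c1 * c2), (j, c1^2 * c2), (i, c1)])) \<and>
     (a i j = - 3 \<and> a j i = - 1 \<longrightarrow>
        word_relation X
          (\<lambda>c1 c2. [(i, c1), (j, c1^3 * c2), (i, c1^2 * c2), (j, c1^3 * c2^2), (i, c1 * c2), (j, c2)])
          (\<lambda>c1 c2. [(j, c2), (i, c1 * c2), (j, c1^3 * c2^2), (i, c1^2 * c2), (j, c1^3 * c2), (i, c1)])))"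

definition geometric_crystal :: "'i set \<Rightarrow> ('i \<Rightarrow> 'i \<Rightarrow> int) \<Rightarrow> ('i, 'a) gcrystal \<Rightarrow> bool" where
  "geometric_crystal I a X \<longleftrightarrow> variety (gvar X) \<and>
     (\<forall>i\<in>I. rational_action (gvar X) (act X i) \<and>
        rational_map (gvar X) affine_line (gam X i) \<and>
        rational_map (gvar X) affine_line (eps X i) \<and>
        open_dense (gvar X) {x. (1, x) \<in> dom (act X i)}) \<and>
     (\<forall>i\<in>I. \<forall>j\<in>I. generically (fprod (var Gm) (gvar X)) (\<lambda>(c, x).
        \<exists>y g. act X i (c, x) = Some y \<and> gam X j x = Some g \<and> gam X j y = Some (c powi a i j * g))) \<and>
     verma_relations I a X \<and>
     (\<forall>i\<in>I. generically (fprod (var Gm) (gvar X)) (\<lambda>(c, x).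
        \<exists>y g. act X i (c, x) = Some y \<and> eps X i x = Some g \<and> eps X i y = Some (inverse c * g)))"

definition act_theta :: "('i, 'a) gcrystal \<Rightarrow> 't alg_group \<Rightarrow> ('t \<rightharpoonup> 'a) \<Rightarrow> 'i \<Rightarrow>
    complex \<times> 't \<rightharpoonup> 't" where
  "act_theta X T \<theta> i = rational_ext (var (prod_group Gm T)) (var T) (\<lambda>(c, t).
     Option.bind (\<theta> t) (\<lambda>x. Option.bind (act X i (c, x)) (rational_inv (var T) (gvar X) \<theta>)))"

definition pullback_fun :: "'t alg_group \<Rightarrow> ('t \<rightharpoonup> 'a) \<Rightarrow> ('a \<rightharpoonup> complex) \<Rightarrow> ('t \<rightharpoonup> complex)" where
  "pullback_fun T \<theta> f = rational_ext (var T) affine_line (f \<circ>\<^sub>m \<theta>)"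

definition positive_structure ::
    "'i set \<Rightarrow> ('i, 'a) gcrystal \<Rightarrow> 't alg_group \<Rightarrow> ('t \<rightharpoonup> 'a) \<Rightarrow> bool" where
  "positive_structure I X T \<theta> \<longleftrightarrow> alg_torus T \<and> birational_map (var T) (gvar X) \<theta> \<and>
     (\<forall>i\<in>I. positive_fun T (pullback_fun T \<theta> (gam X i)) \<and>
        positive_fun T (pullback_fun T \<theta> (eps X i)) \<and>
        positive_map (prod_group Gm T) T (act_theta X T \<theta> i))"


section \<open>The ultra-discretization and the conclusion\<close>

text \<open>\<open>cr_e B i n\<close> is the \<open>n\<close>-th power of the Kashiwara operator \<open>e\<^sub>i\<close>.\<close>

record ('i, 'b) free_crystal =
  cr_set :: "'b set"
  cr_e :: "'i \<Rightarrow> int \<Rightarrow> 'b \<Rightarrow> 'b"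
  cr_wt :: "'i \<Rightarrow> 'b \<Rightarrow> int"
  cr_eps :: "'i \<Rightarrow> 'b \<Rightarrow> int"

text \<open>
  A pair \<open>(n, b)\<close> of an integer and a cocharacter of \<open>T\<close> is identified with the cocharacter
  \<open>c \<mapsto> (c\<^sup>n, b c)\<close> of \<open>\<complex>\<^sup>\<times> \<times> T\<close>.
\<close>

definition ultra_discretization ::
    "('i, 'a) gcrystal \<Rightarrow> 't alg_group \<Rightarrow> ('t \<rightharpoonup> 'a) \<Rightarrow> ('i, complex \<Rightarrow> 't) free_crystal" where
  "ultra_discretization X T \<theta> =
     \<lparr>cr_set = cocharacters T,
      cr_e = (\<lambda>i n b. UD_map (prod_group Gm T) T (act_theta X T \<theta> i)
                         (\<lambda>c\<in>carrier Gm. (c powi n, b c))),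
      cr_wt = (\<lambda>i. UD_fun (pullback_fun T \<theta> (gam X i))),
      cr_eps = (\<lambda>i. UD_fun (pullback_fun T \<theta> (eps X i)))\<rparr>"

definition crystal_connected :: "'i set \<Rightarrow> ('i, 'b) free_crystal \<Rightarrow> bool" where
  "crystal_connected I B \<longleftrightarrow> (\<forall>b\<in>cr_set B. \<forall>b'\<in>cr_set B.
     (b, b') \<in> {(b, cr_e B i n b) |b i n. b \<in> cr_set B \<and> i \<in> I}\<^sup>*)"

text \<open>
  The group action is only rational, so \<open>e_i^c\<close> is applied to \<open>x\<close> only where it is
  invertible: \<open>e_i^c\<close> must be defined at \<open>x\<close> and \<open>e_i^(1/c)\<close> at the image \<open>y\<close>, leading back to \<open>x\<close>.
  Definedness at \<open>x\<close> alone gives a relation that is not symmetric and whose dense orbit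
  need not be open: on the surface obtained from \<open>\<complex>\<^sup>2\<close> by identifying \<open>(0,0)\<close> with \<open>(1,1)\<close>, with the two
  scaling actions, no \<open>e_i^c\<close> is defined at the singular point, but that point is the image of
  points of the torus, while its neighbourhoods also contain points of the coordinate axes.
\<close>

definition orbit_relation :: "'i set \<Rightarrow> ('i, 'a) gcrystal \<Rightarrow> ('a \<times> 'a) set" where
  "orbit_relation I X = {(x, y). x \<in> pts (gvar X) \<and> y \<in> pts (gvar X) \<and>
     (\<exists>i\<in>I. \<exists>c. c \<noteq> 0 \<and> act X i (c, x) = Some y \<and> act X i (inverse c, y) = Some x)}\<^sup>*"

definition prehomogeneous :: "'i set \<Rightarrow> ('i, 'a) gcrystal \<Rightarrow> bool" where
  "prehomogeneous I X \<longleftrightarrow> (\<exists>\<Omega>. open_dense (gvar X) \<Omega> \<and>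
     (\<exists>x \<in> pts (gvar X). \<Omega> = orbit_relation I X `` {x}))"

end

theory Submission
  imports Defs "HOL-Computational_Algebra.Fraction_Field"
    "HOL-Computational_Algebra.Fundamental_Theorem_Algebra"
begin

text \<open>
  In the coordinates of the torus, a word of letters acts on positive real points by positive rational
  functions, whatever the domains of definition of the rational maps are. On a curve
  \<open>c \<mapsto> (c\<^sup>b\<^sub>1, \<dots>, c\<^sup>b\<^sub>d)\<close> with \<open>c \<rightarrow> \<infinity>\<close>, the exponents of the result are computed by the
  ultra-discretization. If the crystal is connected, then every exponent vector arises from a constant
  positive curve through a suitable word, and hence no nonzero polynomial relation between a point and its
  image holds for all words. The relations of the single words form a family of prime ideals, which is
  directed under reverse inclusion because words can be concatenated and parameters set to \<open>1\<close>. As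
  transcendence degrees are finite, already one word admits no relation, i.e. its orbit map from a generic
  point is dominant. Therefore an orbit contains a nonempty open set. The letters are generically
  invertible and thus local isomorphisms, so this orbit is open, and it is dense because \<open>X\<close> is irreducible.
\<close>

section \<open>Polynomial functions\<close>

text \<open>Rational maps are partial: a composite of several of them could a priori be defined
  nowhere, and a generic statement says nothing about the special points that a word reaches.
  Positive real points remove both difficulties. They are Zariski dense, every positive function is
  defined and nonzero there, and so identities between positive functions that hold generically hold
  at all of them. Leading coefficients are positive too, so sums do not cancel and the growth
  exponent of a positive function depends only on the exponents of the curve. An arbitrary
  polynomial may cancel, which is why a generic exponent vector is needed to see that a relation
  fails. In the relations both the point and its image vary: this keeps all coefficients in
  \<complex>, and a base point is fixed only after an open set of attained pairs has been found.
  Dimension theory is replaced by division of polynomials with coefficients in a subring, and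
  Chevalley's theorem on images by extending homomorphisms to \<complex> one generator at a
  time.\<close>

lemma polyfuns_mono: "f \<in> polyfuns m \<Longrightarrow> m \<le> n \<Longrightarrow> f \<in> polyfuns n"
  by (induction rule: polyfuns.induct) (auto intro: polyfuns.intros)

lemma polyfuns_uminus: "f \<in> polyfuns n \<Longrightarrow> (\<lambda>x. - f x) \<in> polyfuns n"
  using polyfuns.mult[OF polyfuns.const[of "-1"]] by fastforce

lemma polyfuns_diff: "f \<in> polyfuns n \<Longrightarrow> g \<in> polyfuns n \<Longrightarrow> (\<lambda>x. f x - g x) \<in> polyfuns n"
  using polyfuns.add[OF _ polyfuns_uminus[of g]] by fastforce

lemma polyfuns_cong: "f \<in> polyfuns n \<Longrightarrow> (\<And>i. i < n \<Longrightarrow> x i = y i) \<Longrightarrow> f x = f y"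
  by (induction rule: polyfuns.induct) auto

lemma polyfuns_subst:
  "f \<in> polyfuns n \<Longrightarrow> (\<And>i. i < n \<Longrightarrow> g i \<in> polyfuns m) \<Longrightarrow> (\<lambda>x. f (\<lambda>i. g i x)) \<in> polyfuns m"
  by (induction rule: polyfuns.induct) (auto intro: polyfuns.intros)

text \<open>Reduces questions about zeros in several variables to the finitely many roots of a
  polynomial in one variable.\<close>

lemma polyfuns_line:
  assumes "f \<in> polyfuns n"
  shows "\<exists>p. \<forall>s. f (\<lambda>i. u i + s * w i) = poly p s"
  using assms
proof (induction rule: polyfuns.induct)
  case (const a)
  show ?case by (rule exI[of _ "[:a:]"]) simp
next
  case (coord i)
  show ?case by (rule exI[of _ "[:u i, w i:]"]) simp
next
  case (add f g)
  then obtain p q where "\<forall>s. f (\<lambda>i. u i + s * w i) = poly p s" "\<forall>s. g (\<lambda>i. u i + s * w i) = poly q s"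
    by auto
  then show ?case by (intro exI[of _ "p + q"]) simp
next
  case (mult f g)
  then obtain p q where "\<forall>s. f (\<lambda>i. u i + s * w i) = poly p s" "\<forall>s. g (\<lambda>i. u i + s * w i) = poly q s"
    by auto
  then show ?case by (intro exI[of _ "p * q"]) simp
qed

section \<open>Positive real points\<close>

definition posreal :: "complex set" where
  "posreal = complex_of_real ` {0<..}"

text \<open>All entries of the infinite sequence are positive, also those beyond the number of
  variables in use, so that one predicate serves for points and for points with any number of
  parameters appended.\<close>

definition posvec :: "(nat \<Rightarrow> complex) \<Rightarrow> bool" where
  "posvec z \<longleftrightarrow> (\<forall>i. z i \<in> posreal)"

lemma posreal_closed [simp, intro]:
  "1 \<in> posreal" "x \<in> posreal \<Longrightarrow> y \<in> posreal \<Longrightarrow> x + y \<in> posreal"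
  "x \<in> posreal \<Longrightarrow> y \<in> posreal \<Longrightarrow> x * y \<in> posreal" "x \<in> posreal \<Longrightarrow> inverse x \<in> posreal"
  "r > 0 \<Longrightarrow> complex_of_real r \<in> posreal"
proof -
  assume a: "x \<in> posreal" "y \<in> posreal"
  then obtain r s where rs: "x = of_real r" "y = of_real s" "r > 0" "s > 0" by (auto simp: posreal_def)
  show "x + y \<in> posreal" using rs unfolding posreal_def by (intro image_eqI[of _ _ "r + s"]) auto
  show "x * y \<in> posreal" using rs unfolding posreal_def by (intro image_eqI[of _ _ "r * s"]) auto
next
  assume "x \<in> posreal"
  then obtain r where rs: "x = of_real r" "r > 0" by (auto simp: posreal_def)
  show "inverse x \<in> posreal" using rs unfolding posreal_def by (intro image_eqI[of _ _ "inverse r"]) auto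
qed (auto simp: posreal_def intro: image_eqI[of _ _ "1::real"])

lemma posreal_nonzero: "x \<in> posreal \<Longrightarrow> x \<noteq> 0"
  by (auto simp: posreal_def)

lemma infinite_posreal: "infinite posreal"
proof -
  have "infinite {(0::real)<..}" by (rule infinite_Ioi)
  then show ?thesis unfolding posreal_def
    using finite_imageD[of complex_of_real "{0<..}"] by (auto simp: inj_on_def)
qed

lemma posvec_upd: "posvec z \<Longrightarrow> c \<in> posreal \<Longrightarrow> posvec (z(k := c))"
  by (auto simp: posvec_def)

text \<open>Restrict both factors to the segment between points where they do not vanish.\<close>

lemma polyfuns_prime:
  assumes f: "f \<in> polyfuns n" and g: "g \<in> polyfuns n"
    and fg: "\<And>z. posvec z \<Longrightarrow> f z * g z = 0"
  shows "(\<forall>z. posvec z \<longrightarrow> f z = 0) \<or> (\<forall>z. posvec z \<longrightarrow> g z = 0)"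
proof (rule ccontr)
  assume "\<not> ?thesis"
  then obtain u w where u: "posvec u" "f u \<noteq> 0" and w: "posvec w" "g w \<noteq> 0" by auto
  obtain p q where p: "\<forall>s. f (\<lambda>i. u i + s * (w i - u i)) = poly p s"
    and q: "\<forall>s. g (\<lambda>i. u i + s * (w i - u i)) = poly q s"
    using polyfuns_line[OF f] polyfuns_line[OF g] by metis
  have "p \<noteq> 0" using u p[rule_format, of 0] by auto
  moreover have "q \<noteq> 0" using w q[rule_format, of 1] by auto
  ultimately have fin: "finite {s. poly (p * q) s = 0}" by (intro poly_roots_finite) auto
  have "poly (p * q) (of_real s) = 0" if s: "0 < s" "s < 1" for s :: real
  proof -
    have "u i + of_real s * (w i - u i) \<in> posreal" for i
    proof -
      have "u i + of_real s * (w i - u i) = of_real (1 - s) * u i + of_real s * w i"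
        by (simp add: algebra_simps)
      moreover have "u i \<in> posreal" "w i \<in> posreal" using u w by (auto simp: posvec_def)
      ultimately show ?thesis using s by (metis posreal_closed(2,3,5) diff_gt_0_iff_gt)
    qed
    then have "posvec (\<lambda>i. u i + of_real s * (w i - u i))" by (simp add: posvec_def)
    from fg[OF this] show ?thesis using p q by (metis poly_mult)
  qed
  then have "complex_of_real ` {0<..<1} \<subseteq> {s. poly (p * q) s = 0}"
    by (auto simp del: poly_mult)
  then have "finite (complex_of_real ` {0<..<1})" using fin finite_subset by blast
  then have "finite {0<..<1::real}" using finite_imageD[of complex_of_real "{0<..<1}"] by (auto simp: inj_on_def)
  then show False by (simp add: infinite_Ioo)
qed

text \<open>Positive real points are Zariski dense: the positivity condition is dropped for one
  coordinate after the other, because a polynomial in one variable with infinitely many roots is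
  zero.\<close>

lemma polyfuns_eq_0:
  assumes f: "f \<in> polyfuns n" and 0: "\<And>z. posvec z \<Longrightarrow> f z = 0"
  shows "f z = 0"
proof -
  have "f z = 0" if "\<forall>i\<ge>k. z i \<in> posreal" for k z
    using that
  proof (induction k arbitrary: z)
    case 0
    then show ?case using assms(2) by (auto simp: posvec_def)
  next
    case (Suc k)
    obtain p where p: "\<forall>s. f (\<lambda>i. (z(k := 0)) i + s * (if i = k then 1 else 0)) = poly p s"
      using polyfuns_line[OF f, of "z(k := 0)" "\<lambda>i. if i = k then 1 else 0"] by blast
    have eq: "(\<lambda>i. (z(k := 0)) i + s * (if i = k then 1 else 0)) = z(k := s)" for s
      by auto
    have "poly p s = 0" if "s \<in> posreal" for s
    proof -
      have "f (z(k := s)) = 0"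
        using Suc.prems that by (intro Suc.IH) (auto simp: Suc_le_eq nat_less_le)
      then show ?thesis using p unfolding eq by simp
    qed
    then have "posreal \<subseteq> {s. poly p s = 0}" by auto
    then have "p = 0" using infinite_posreal poly_roots_finite[of p] finite_subset by blast
    then have "f (z(k := z k)) = 0" using p unfolding eq by (metis poly_0)
    then show ?case by simp
  qed
  \<comment> \<open>Coordinates from \<open>n\<close> on do not affect \<open>f\<close>; the value
    \<open>1\<close> meets the positivity condition that is left after \<open>n\<close> coordinates
    have been freed.\<close>
  from this[of n "\<lambda>i. if i < n then z i else 1"]
  have "f (\<lambda>i. if i < n then z i else 1) = 0" by auto
  moreover have "f (\<lambda>i. if i < n then z i else 1) = f z" by (rule polyfuns_cong[OF f]) auto
  ultimately show ?thesis by simp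
qed

lemma polyfuns_no_zero_divisors:
  assumes f: "f \<in> polyfuns n" and g: "g \<in> polyfuns n" and "\<And>z. f z * g z = 0"
  shows "(\<forall>z. f z = 0) \<or> (\<forall>z. g z = 0)"
  using polyfuns_prime[OF f g] polyfuns_eq_0[OF f] polyfuns_eq_0[OF g] assms(3) by blast

lemma polyfuns_nonzero_pos:
  assumes f: "f \<in> polyfuns n" and "f u \<noteq> 0"
  obtains z where "posvec z" "f z \<noteq> 0"
  using polyfuns_eq_0[OF f] assms by blast

subsection \<open>The ring of polynomial functions\<close>

text \<open>Functions take the place of formal polynomials; nothing is lost since \<complex> is
  infinite. A single type for all numbers of variables is an integral domain, so that fraction
  fields and univariate polynomials over it are available.\<close>

typedef mpol = "\<Union>n. polyfuns n" morphisms ev Mp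
  by (auto intro: polyfuns.const)

setup_lifting type_definition_mpol

lemma polyfuns_common:
  assumes "f \<in> (\<Union>n. polyfuns n)" "g \<in> (\<Union>n. polyfuns n)"
  obtains n where "f \<in> polyfuns n" "g \<in> polyfuns n"
  using assms polyfuns_mono by (metis UN_E nle_le)

instantiation mpol :: idom
begin

lift_definition zero_mpol :: mpol is "\<lambda>_. 0" by (auto intro: polyfuns.const)
lift_definition one_mpol :: mpol is "\<lambda>_. 1" by (auto intro: polyfuns.const)
lift_definition plus_mpol :: "mpol \<Rightarrow> mpol \<Rightarrow> mpol" is "\<lambda>f g x. f x + g x"
  by (erule (1) polyfuns_common) (auto intro: polyfuns.add)
lift_definition minus_mpol :: "mpol \<Rightarrow> mpol \<Rightarrow> mpol" is "\<lambda>f g x. f x - g x"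
  by (erule (1) polyfuns_common) (auto intro: polyfuns_diff)
lift_definition times_mpol :: "mpol \<Rightarrow> mpol \<Rightarrow> mpol" is "\<lambda>f g x. f x * g x"
  by (erule (1) polyfuns_common) (auto intro: polyfuns.mult)
lift_definition uminus_mpol :: "mpol \<Rightarrow> mpol" is "\<lambda>f x. - f x"
  by (auto intro: polyfuns_uminus)

instance
proof
  fix a b c :: mpol
  show "a * b * c = a * (b * c)" by transfer (simp add: mult.assoc)
  show "a * b = b * a" by transfer (simp add: mult.commute)
  show "0 * a = 0" "a * 0 = 0" by (transfer, simp)+
  show "a * (b + c) = a * b + a * c" by transfer (simp add: algebra_simps)
  show "1 * a = a" by transfer simp
  show "a + b + c = a + (b + c)" by transfer (simp add: add.assoc)
  show "a + b = b + a" by transfer (simp add: add.commute)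
  show "0 + a = a" by transfer simp
  show "- a + a = 0" by transfer simp
  show "a - b = a + - b" by transfer simp
  show "(a + b) * c = a * c + b * c" by transfer (simp add: algebra_simps)
  show "(0::mpol) \<noteq> 1" by transfer (metis zero_neq_one)
  show "a \<noteq> 0 \<Longrightarrow> b \<noteq> 0 \<Longrightarrow> a * b \<noteq> 0"
  proof transfer
    fix f g :: "(nat \<Rightarrow> complex) \<Rightarrow> complex"
    assume "f \<in> (\<Union>n. polyfuns n)" "g \<in> (\<Union>n. polyfuns n)" "f \<noteq> (\<lambda>_. 0)" "g \<noteq> (\<lambda>_. 0)"
    then show "(\<lambda>x. f x * g x) \<noteq> (\<lambda>_. 0)"
      by (metis polyfuns_common polyfuns_no_zero_divisors)
  qed
qed

end

lemma ev_simps [simp]: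
  "ev 0 x = 0" "ev 1 x = 1" "ev (p + q) x = ev p x + ev q x" "ev (p * q) x = ev p x * ev q x"
  "ev (p - q) x = ev p x - ev q x" "ev (- p) x = - ev p x"
  by (transfer, simp)+

lemma ev_power [simp]: "ev (p ^ k) x = ev p x ^ k"
  by (induction k) auto

lemma ev_eqI: "(\<And>x. ev p x = ev q x) \<Longrightarrow> p = q"
  using ev_inject[of p q] by auto

lemma ev_Mp: "f \<in> polyfuns n \<Longrightarrow> ev (Mp f) = f"
  by (rule Mp_inverse) auto

lemma Mp_eq_0_iff: "f \<in> polyfuns n \<Longrightarrow> Mp f = 0 \<longleftrightarrow> (\<forall>x. f x = 0)"
  by (metis ev_Mp ev_eqI ev_simps(1))

definition mpols :: "nat \<Rightarrow> mpol set" where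
  "mpols n = {p. ev p \<in> polyfuns n}"

lemma Mp_in_mpols: "f \<in> polyfuns n \<Longrightarrow> Mp f \<in> mpols n"
  by (simp add: mpols_def ev_Mp)

lemma ev_of_poly: "ev (poly p q) x = poly (map_poly (\<lambda>a. ev a x) p) (ev q x)"
  by (induction p) (auto simp: map_poly_pCons)

section \<open>Subrings and the adjunction of an element\<close>

definition subring_set :: "'a::comm_ring_1 set \<Rightarrow> bool" where
  "subring_set A \<longleftrightarrow> 1 \<in> A \<and> (\<forall>x\<in>A. \<forall>y\<in>A. x - y \<in> A \<and> x * y \<in> A)"

definition polys_over :: "'a::comm_ring_1 set \<Rightarrow> 'a poly set" where
  "polys_over A = {p. \<forall>k. coeff p k \<in> A}"

text \<open>The subring \<open>A[y]\<close>. Subrings are sets inside one ambient type, because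
  inductions over generators change the ring of coefficients in each step.\<close>

definition adjoin :: "'a::comm_ring_1 set \<Rightarrow> 'a \<Rightarrow> 'a set" where
  "adjoin A y = (\<lambda>p. poly p y) ` polys_over A"

lemma subring_setD:
  assumes "subring_set A"
  shows "0 \<in> A" "1 \<in> A" "x \<in> A \<Longrightarrow> y \<in> A \<Longrightarrow> x + y \<in> A" "x \<in> A \<Longrightarrow> y \<in> A \<Longrightarrow> x - y \<in> A"
    "x \<in> A \<Longrightarrow> y \<in> A \<Longrightarrow> x * y \<in> A" "x \<in> A \<Longrightarrow> - x \<in> A"
proof -
  show 0: "0 \<in> A" and "1 \<in> A" using assms unfolding subring_set_def by (metis diff_self)+
  show m: "x \<in> A \<Longrightarrow> - x \<in> A" for x using assms 0 unfolding subring_set_def by (metis diff_0)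
  show "x \<in> A \<Longrightarrow> y \<in> A \<Longrightarrow> x - y \<in> A" "x \<in> A \<Longrightarrow> y \<in> A \<Longrightarrow> x * y \<in> A"
    using assms unfolding subring_set_def by blast+
  show "x \<in> A \<Longrightarrow> y \<in> A \<Longrightarrow> x + y \<in> A"
    using assms m[of y] unfolding subring_set_def by (metis diff_minus_eq_add)
qed

lemma subring_set_sum:
  "finite S \<Longrightarrow> subring_set A \<Longrightarrow> (\<And>i. i \<in> S \<Longrightarrow> f i \<in> A) \<Longrightarrow> (\<Sum>i\<in>S. f i) \<in> A"
  by (induction S rule: finite_induct) (auto intro: subring_setD)

lemma subring_set_power: "subring_set A \<Longrightarrow> a \<in> A \<Longrightarrow> a ^ k \<in> A"
  by (induction k) (auto intro: subring_setD)

lemma polys_over_subring: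
  assumes "subring_set A"
  shows "subring_set (polys_over A)"
  unfolding subring_set_def[of "polys_over A"]
proof (intro conjI ballI)
  show "1 \<in> polys_over A" by (auto simp: polys_over_def coeff_1 intro: subring_setD[OF assms])
  fix p q assume "p \<in> polys_over A" "q \<in> polys_over A"
  then show "p - q \<in> polys_over A" "p * q \<in> polys_over A"
    by (auto simp: polys_over_def coeff_mult intro!: subring_setD[OF assms] subring_set_sum[OF _ assms])
qed

lemma polys_over_pCons_iff:
  "pCons a p \<in> polys_over A \<longleftrightarrow> a \<in> A \<and> p \<in> polys_over A"
  unfolding polys_over_def by (auto simp: coeff_pCons split: nat.splits)

lemma polys_over_const: "subring_set A \<Longrightarrow> a \<in> A \<Longrightarrow> [:a:] \<in> polys_over A"
  by (auto simp: polys_over_def coeff_pCons subring_setD(1) split: nat.splits)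

lemma polys_over_smult: "subring_set A \<Longrightarrow> a \<in> A \<Longrightarrow> p \<in> polys_over A \<Longrightarrow> smult a p \<in> polys_over A"
  by (auto simp: polys_over_def intro: subring_setD)

lemma polys_over_monom: "subring_set A \<Longrightarrow> a \<in> A \<Longrightarrow> monom a k \<in> polys_over A"
  by (auto simp: polys_over_def intro: subring_setD)

lemma adjoin_subring:
  assumes "subring_set A"
  shows "subring_set (adjoin A y)"
  unfolding subring_set_def adjoin_def
proof (intro conjI ballI)
  note P = subring_setD[OF polys_over_subring[OF assms]]
  show "1 \<in> (\<lambda>p. poly p y) ` polys_over A"
    by (rule image_eqI[of _ _ 1]) (auto intro: P)
  fix u w assume "u \<in> (\<lambda>p. poly p y) ` polys_over A" "w \<in> (\<lambda>p. poly p y) ` polys_over A"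
  then obtain p q where "p \<in> polys_over A" "q \<in> polys_over A" "u = poly p y" "w = poly q y" by auto
  then show "u - w \<in> (\<lambda>p. poly p y) ` polys_over A" "u * w \<in> (\<lambda>p. poly p y) ` polys_over A"
    using image_eqI[of _ _ "p - q"] image_eqI[of _ _ "p * q"] P(4,5) by (metis poly_diff, metis poly_mult)
qed

lemma adjoin_incl: "subring_set A \<Longrightarrow> A \<subseteq> adjoin A y"
  by (auto simp: adjoin_def intro!: image_eqI[of _ _ "[:_:]"] polys_over_const)

lemma adjoin_gen:
  assumes "subring_set A" shows "y \<in> adjoin A y"
  unfolding adjoin_def
  by (rule image_eqI[of _ _ "[:0, 1:]"])
    (auto simp: polys_over_pCons_iff subring_setD[OF assms] subring_setD(1)[OF polys_over_subring[OF assms]])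

lemma mpols_subring: "subring_set (mpols n)"
  unfolding subring_set_def mpols_def
  by (auto simp: fun_eq_iff[symmetric] one_mpol.rep_eq minus_mpol.rep_eq times_mpol.rep_eq
      intro: polyfuns.intros polyfuns_diff)

definition mX :: "nat \<Rightarrow> mpol" where
  "mX i = Mp (\<lambda>x. x i)"

lemma ev_mX [simp]: "ev (mX i) x = x i"
  unfolding mX_def using ev_Mp[OF polyfuns.coord[OF lessI]] by simp

text \<open>Enables inductions on the number of variables in which the last variable is handled by
  univariate polynomials.\<close>

lemma mpols_Suc: "mpols (Suc n) = adjoin (mpols n) (mX n)"
proof (intro equalityI subsetI)
  fix p assume "p \<in> mpols (Suc n)"
  moreover have "Mp f \<in> adjoin (mpols n) (mX n)" if "f \<in> polyfuns (Suc n)" for f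
    using that
  proof (induction rule: polyfuns.induct)
    case (const a)
    then show ?case using adjoin_incl[OF mpols_subring] Mp_in_mpols[OF polyfuns.const] by blast
  next
    case (coord i)
    show ?case
    proof (cases "i = n")
      case True
      then show ?thesis using adjoin_gen[OF mpols_subring, of "mX n" n] by (simp add: mX_def)
    next
      case False
      then show ?thesis using coord adjoin_incl[OF mpols_subring] Mp_in_mpols[OF polyfuns.coord, of i n]
        by (metis less_antisym subsetD)
    qed
  next
    case (add f g)
    have "Mp (\<lambda>x. f x + g x) = Mp f + Mp g"
      by (rule ev_eqI) (simp add: ev_Mp[OF add.hyps(1)] ev_Mp[OF add.hyps(2)] ev_Mp[OF polyfuns.add[OF add.hyps]])
    then show ?case using add.IH subring_setD(3)[OF adjoin_subring[OF mpols_subring]] by metis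
  next
    case (mult f g)
    have "Mp (\<lambda>x. f x * g x) = Mp f * Mp g"
      by (rule ev_eqI) (simp add: ev_Mp[OF mult.hyps(1)] ev_Mp[OF mult.hyps(2)] ev_Mp[OF polyfuns.mult[OF mult.hyps]])
    then show ?case using mult.IH subring_setD(5)[OF adjoin_subring[OF mpols_subring]] by metis
  qed
  ultimately show "p \<in> adjoin (mpols n) (mX n)" by (metis ev_inverse mem_Collect_eq mpols_def)
next
  fix p assume "p \<in> adjoin (mpols n) (mX n)"
  then obtain q where q: "q \<in> polys_over (mpols n)" "p = poly q (mX n)" by (auto simp: adjoin_def)
  have sub: "mpols n \<subseteq> mpols (Suc n)" by (auto simp: mpols_def intro: polyfuns_mono)
  have "mX n \<in> mpols (Suc n)" by (auto simp: mX_def intro: Mp_in_mpols polyfuns.coord)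
  then have "poly q (mX n) \<in> mpols (Suc n)"
    unfolding poly_altdef using q(1) sub
    by (intro subring_set_sum[OF _ mpols_subring] subring_setD(5)[OF mpols_subring] subring_set_power[OF mpols_subring])
      (auto simp: polys_over_def)
  then show "p \<in> mpols (Suc n)" using q by simp
qed

text \<open>The coefficients ignore coordinate \<open>n\<close>, so varying this coordinate
  evaluates one and the same complex polynomial at every number; being zero everywhere, it has zero
  coefficients.\<close>

lemma mX_transcendental:
  assumes q: "q \<in> polys_over (mpols n)" and 0: "poly q (mX n) = 0"
  shows "q = 0"
proof -
  have "ev (coeff q k) x = 0" for k x
  proof -
    have "poly (map_poly (\<lambda>a. ev a x) q) y = 0" for y
    proof -
      have "map_poly (\<lambda>a. ev a x) q = map_poly (\<lambda>a. ev a (x(n := y))) q"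
      proof (rule poly_eqI)
        fix k
        have "ev (coeff q k) \<in> polyfuns n" using q by (auto simp: polys_over_def mpols_def)
        then show "coeff (map_poly (\<lambda>a. ev a x) q) k = coeff (map_poly (\<lambda>a. ev a (x(n := y))) q) k"
          by (auto simp: coeff_map_poly intro: polyfuns_cong)
      qed
      then have "poly (map_poly (\<lambda>a. ev a x) q) y = ev (poly q (mX n)) (x(n := y))"
        by (simp add: ev_of_poly)
      then show ?thesis using 0 by simp
    qed
    then have "map_poly (\<lambda>a. ev a x) q = 0" by (simp add: poly_all_0_iff_0[symmetric])
    then show ?thesis by (metis coeff_0 coeff_map_poly ev_simps(1))
  qed
  then show ?thesis by (intro poly_eqI ev_eqI) simp
qed

section \<open>Positive rational functions and their growth\<close>

text \<open>
  Total functions with the convention \<open>inverse 0 = 0\<close>; they represent the rational functions that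
  are quotients of polynomials with positive coefficients.
\<close>

inductive_set prat :: "nat \<Rightarrow> ((nat \<Rightarrow> complex) \<Rightarrow> complex) set" for n :: nat where
  const: "a \<in> posreal \<Longrightarrow> (\<lambda>x. a) \<in> prat n"
| coord: "i < n \<Longrightarrow> (\<lambda>x. x i) \<in> prat n"
| add: "f \<in> prat n \<Longrightarrow> g \<in> prat n \<Longrightarrow> (\<lambda>x. f x + g x) \<in> prat n"
| mult: "f \<in> prat n \<Longrightarrow> g \<in> prat n \<Longrightarrow> (\<lambda>x. f x * g x) \<in> prat n"
| inv: "f \<in> prat n \<Longrightarrow> (\<lambda>x. inverse (f x)) \<in> prat n"

lemma prat_power: "f \<in> prat n \<Longrightarrow> (\<lambda>x. f x ^ k) \<in> prat n"
  by (induction k) (auto intro: prat.intros)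

lemma prat_powi: "f \<in> prat n \<Longrightarrow> (\<lambda>x. f x powi k) \<in> prat n"
  using prat_power[of f n "nat k"] prat.inv[OF prat_power[of f n "nat (- k)"]]
  by (cases "k \<ge> 0") (simp_all add: power_int_def power_inverse)

lemma prat_prod:
  "finite A \<Longrightarrow> (\<And>i. i \<in> A \<Longrightarrow> f i \<in> prat n) \<Longrightarrow> (\<lambda>x. \<Prod>i\<in>A. f i x) \<in> prat n"
  by (induction A rule: finite_induct) (auto intro: prat.intros)

lemma prat_cong: "f \<in> prat n \<Longrightarrow> (\<And>i. i < n \<Longrightarrow> x i = y i) \<Longrightarrow> f x = f y"
  by (induction rule: prat.induct) auto

lemma prat_subst:
  "f \<in> prat n \<Longrightarrow> (\<And>i. i < n \<Longrightarrow> g i \<in> prat m) \<Longrightarrow> (\<lambda>x. f (\<lambda>i. g i x)) \<in> prat m"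
  by (induction rule: prat.induct) (auto intro: prat.intros)

text \<open>No denominator vanishes at a positive point, so the convention
  \<open>inverse 0 = 0\<close> never interferes there.\<close>

lemma prat_pos: "f \<in> prat n \<Longrightarrow> (\<And>i. i < n \<Longrightarrow> x i \<in> posreal) \<Longrightarrow> f x \<in> posreal"
  by (induction rule: prat.induct) auto

text \<open>Stated through positivity of values rather than of coefficients: the class is closed
  under sums and products, and its members have no zeros at positive points.\<close>

definition pospoly :: "nat \<Rightarrow> ((nat \<Rightarrow> complex) \<Rightarrow> complex) set" where
  "pospoly n = {f \<in> polyfuns n. \<forall>x. posvec x \<longrightarrow> f x \<in> posreal}"

lemma pospoly_closed:
  "a \<in> posreal \<Longrightarrow> (\<lambda>x. a) \<in> pospoly n" "i < n \<Longrightarrow> (\<lambda>x. x i) \<in> pospoly n"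
  "f \<in> pospoly n \<Longrightarrow> g \<in> pospoly n \<Longrightarrow> (\<lambda>x. f x + g x) \<in> pospoly n"
  "f \<in> pospoly n \<Longrightarrow> g \<in> pospoly n \<Longrightarrow> (\<lambda>x. f x * g x) \<in> pospoly n"
  by (auto simp: pospoly_def posvec_def intro: polyfuns.intros)

lemma pospoly_prod:
  "finite A \<Longrightarrow> (\<And>i. i \<in> A \<Longrightarrow> f i \<in> pospoly n) \<Longrightarrow> (\<lambda>x. \<Prod>i\<in>A. f i x) \<in> pospoly n"
  by (induction A rule: finite_induct) (auto intro: pospoly_closed)

text \<open>The numerator has to be nonzero as well, since an inverse turns it into a denominator.
  In the construction, no subterm is an inverse of zero where both polynomials are nonzero.\<close>

lemma prat_quotient:
  assumes "f \<in> prat n"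
  shows "\<exists>p\<in>pospoly n. \<exists>q\<in>pospoly n. \<forall>x. p x \<noteq> 0 \<longrightarrow> q x \<noteq> 0 \<longrightarrow> f x = p x / q x"
  using assms
proof (induction rule: prat.induct)
  case (const a)
  then show ?case
    by (intro bexI[of _ "\<lambda>_. a"] bexI[of _ "\<lambda>_. 1"]) (auto intro: pospoly_closed)
next
  case (coord i)
  then show ?case
    by (intro bexI[of _ "\<lambda>x. x i"] bexI[of _ "\<lambda>_. 1"]) (auto intro: pospoly_closed)
next
  case (add f g)
  then obtain p q p' q' where pq: "p \<in> pospoly n" "q \<in> pospoly n" "p' \<in> pospoly n" "q' \<in> pospoly n"
    "\<And>x. p x \<noteq> 0 \<Longrightarrow> q x \<noteq> 0 \<Longrightarrow> f x = p x / q x" "\<And>x. p' x \<noteq> 0 \<Longrightarrow> q' x \<noteq> 0 \<Longrightarrow> g x = p' x / q' x"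
    by metis
  \<comment> \<open>The extra factor \<open>p x * p' x\<close> makes the new pair vanish wherever
    \<open>p\<close> or \<open>p'\<close> does, so that both induction hypotheses apply off its
    zeros.\<close>
  then have 1: "(\<lambda>x. (p x * q' x + p' x * q x) * (p x * p' x)) \<in> pospoly n"
    and 2: "(\<lambda>x. (q x * q' x) * (p x * p' x)) \<in> pospoly n"
    by (auto intro!: pospoly_closed)
  have 3: "\<forall>x. (p x * q' x + p' x * q x) * (p x * p' x) \<noteq> 0 \<longrightarrow> (q x * q' x) * (p x * p' x) \<noteq> 0 \<longrightarrow>
    f x + g x = ((p x * q' x + p' x * q x) * (p x * p' x)) / ((q x * q' x) * (p x * p' x))"
    using pq(5,6) by (auto simp: add_frac_eq)
  show ?case by (intro bexI[OF _ 1] bexI[OF _ 2]) (rule 3)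
next
  case (mult f g)
  then obtain p q p' q' where pq: "p \<in> pospoly n" "q \<in> pospoly n" "p' \<in> pospoly n" "q' \<in> pospoly n"
    "\<And>x. p x \<noteq> 0 \<Longrightarrow> q x \<noteq> 0 \<Longrightarrow> f x = p x / q x" "\<And>x. p' x \<noteq> 0 \<Longrightarrow> q' x \<noteq> 0 \<Longrightarrow> g x = p' x / q' x"
    by metis
  then have 1: "(\<lambda>x. p x * p' x) \<in> pospoly n" and 2: "(\<lambda>x. q x * q' x) \<in> pospoly n"
    by (auto intro!: pospoly_closed)
  have 3: "\<forall>x. p x * p' x \<noteq> 0 \<longrightarrow> q x * q' x \<noteq> 0 \<longrightarrow> f x * g x = (p x * p' x) / (q x * q' x)"
    using pq(5,6) by auto
  show ?case by (intro bexI[OF _ 1] bexI[OF _ 2]) (rule 3)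
next
  case (inv f)
  then obtain p q where pq: "p \<in> pospoly n" "q \<in> pospoly n"
    "\<And>x. p x \<noteq> 0 \<Longrightarrow> q x \<noteq> 0 \<Longrightarrow> f x = p x / q x"
    by metis
  then show ?case by (intro bexI[of _ q] bexI[of _ p]) auto
qed

text \<open>An arbitrary polynomial may cancel, so the numerator can have zeros anywhere; the common
  denominator is still positive at positive points.\<close>

lemma polyfuns_prat_quotient:
  assumes "f \<in> polyfuns n" and g: "\<And>i. i < n \<Longrightarrow> g i \<in> prat m"
  shows "\<exists>u\<in>polyfuns m. \<exists>v\<in>pospoly m. \<forall>x. v x \<noteq> 0 \<longrightarrow> f (\<lambda>i. g i x) = u x / v x"
  using assms(1)
proof (induction rule: polyfuns.induct)
  case (const a)
  then show ?case
    by (intro bexI[of _ "\<lambda>_. a"] bexI[of _ "\<lambda>_. 1"]) (auto intro: pospoly_closed polyfuns.const)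
next
  case (coord i)
  then obtain p q where pq: "p \<in> pospoly m" "q \<in> pospoly m"
    "\<And>x. p x \<noteq> 0 \<Longrightarrow> q x \<noteq> 0 \<Longrightarrow> g i x = p x / q x"
    using prat_quotient[OF g] by metis
  \<comment> \<open>Expanding \<open>p / q\<close> by \<open>p\<close> turns the nonvanishing of
    \<open>p\<close> into a condition on the denominator.\<close>
  then show ?case
    by (intro bexI[of _ "\<lambda>x. p x * p x"] bexI[of _ "\<lambda>x. p x * q x"])
      (auto intro!: pospoly_closed polyfuns.mult simp: pospoly_def)
next
  case (add f h)
  then obtain p q p' q' where pq: "p \<in> polyfuns m" "q \<in> pospoly m" "p' \<in> polyfuns m" "q' \<in> pospoly m"
    "\<And>x. q x \<noteq> 0 \<Longrightarrow> f (\<lambda>i. g i x) = p x / q x" "\<And>x. q' x \<noteq> 0 \<Longrightarrow> h (\<lambda>i. g i x) = p' x / q' x"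
    by metis
  then show ?case
    by (intro bexI[of _ "\<lambda>x. p x * q' x + p' x * q x"] bexI[of _ "\<lambda>x. q x * q' x"])
      (auto intro!: pospoly_closed polyfuns.intros simp: pospoly_def add_frac_eq)
next
  case (mult f h)
  then obtain p q p' q' where pq: "p \<in> polyfuns m" "q \<in> pospoly m" "p' \<in> polyfuns m" "q' \<in> pospoly m"
    "\<And>x. q x \<noteq> 0 \<Longrightarrow> f (\<lambda>i. g i x) = p x / q x" "\<And>x. q' x \<noteq> 0 \<Longrightarrow> h (\<lambda>i. g i x) = p' x / q' x"
    by metis
  then show ?case
    by (intro bexI[of _ "\<lambda>x. p x * p' x"] bexI[of _ "\<lambda>x. q x * q' x"])
      (auto intro!: pospoly_closed polyfuns.intros simp: pospoly_def)
qed

lemma posvec_ones: "posvec (\<lambda>_. 1)"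
  by (simp add: posvec_def)

lemma pospoly_polyfuns: "f \<in> pospoly n \<Longrightarrow> f \<in> polyfuns n"
  by (simp add: pospoly_def)

lemma pospoly_pos_nonzero: "f \<in> pospoly n \<Longrightarrow> posvec x \<Longrightarrow> f x \<noteq> 0"
  using posreal_nonzero by (auto simp: pospoly_def)

text \<open>After clearing denominators this is a polynomial identity multiplied by a nonzero
  polynomial, which can be cancelled. At positive points the denominators are nonzero, so the
  identity returns to the functions themselves. Its purpose is to spread identities from an open set
  to all positive points.\<close>

lemma prat_identity:
  assumes f: "f \<in> prat n" and g: "g \<in> prat n" and h: "h \<in> polyfuns n" "h u \<noteq> 0"
    and eq: "\<And>x. h x \<noteq> 0 \<Longrightarrow> f x = g x" and z: "posvec z"
  shows "f z = g z"
proof -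
  obtain p q p' q' where pq: "p \<in> pospoly n" "q \<in> pospoly n" "p' \<in> pospoly n" "q' \<in> pospoly n"
    "\<And>x. p x \<noteq> 0 \<Longrightarrow> q x \<noteq> 0 \<Longrightarrow> f x = p x / q x" "\<And>x. p' x \<noteq> 0 \<Longrightarrow> q' x \<noteq> 0 \<Longrightarrow> g x = p' x / q' x"
    using prat_quotient[OF f] prat_quotient[OF g] by metis
  let ?D = "\<lambda>x. h x * (p x * q x * p' x * q' x)"
  let ?N = "\<lambda>x. p x * q' x - p' x * q x"
  have poly: "p \<in> polyfuns n" "q \<in> polyfuns n" "p' \<in> polyfuns n" "q' \<in> polyfuns n"
    using pq(1-4) by (auto simp: pospoly_def)
  have D: "?D \<in> polyfuns n" and N: "?N \<in> polyfuns n"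
    using poly h by (auto intro!: polyfuns.mult polyfuns_diff)
  obtain w where w: "posvec w" "h w \<noteq> 0" using polyfuns_nonzero_pos[OF h] .
  have "?D w \<noteq> 0" using w pq(1-4) pospoly_pos_nonzero by simp
  moreover have "?D x * ?N x = 0" for x
  proof (cases "?D x = 0")
    case False
    then have "p x / q x = p' x / q' x" using eq[of x] pq(5,6)[of x] by auto
    then show ?thesis using False by (simp add: frac_eq_eq)
  qed auto
  ultimately have "?N z = 0" using polyfuns_no_zero_divisors[OF D N] by blast
  moreover have "p z \<noteq> 0" "q z \<noteq> 0" "p' z \<noteq> 0" "q' z \<noteq> 0" using z pq(1-4) pospoly_pos_nonzero by auto
  ultimately show ?thesis using pq(5,6)[of z] by (simp add: frac_eq_eq)
qed

section \<open>Growth along the positive real axis\<close>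

definition growth :: "(real \<Rightarrow> complex) \<Rightarrow> int \<Rightarrow> complex \<Rightarrow> bool" where
  "growth f v L \<longleftrightarrow> ((\<lambda>c. f c / complex_of_real c powi v) \<longlongrightarrow> L) at_top"

text \<open>Positivity of the limit, not merely its being nonzero, is what survives addition. By
  contrast, \<open>growth\<close> with limit \<open>0\<close> is only an upper bound.\<close>

definition has_exp :: "(real \<Rightarrow> complex) \<Rightarrow> int \<Rightarrow> bool" where
  "has_exp f v \<longleftrightarrow> (\<exists>L\<in>posreal. growth f v L)"

lemma growth_add: "growth f v K \<Longrightarrow> growth g v L \<Longrightarrow> growth (\<lambda>c. f c + g c) v (K + L)"
  unfolding growth_def add_divide_distrib by (rule tendsto_add)

lemma growth_cong:
  assumes "growth f v L" "eventually (\<lambda>c. f c = g c) at_top"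
  shows "growth g v L"
  using assms(1) unfolding growth_def
  by (rule Lim_transform_eventually) (use assms(2) in eventually_elim, simp)

lemma growth_mult:
  assumes "growth f v K" "growth g w L"
  shows "growth (\<lambda>c. f c * g c) (v + w) (K * L)"
proof -
  have "((\<lambda>c. (f c / complex_of_real c powi v) * (g c / complex_of_real c powi w)) \<longlongrightarrow> K * L) at_top"
    using assms unfolding growth_def by (rule tendsto_mult)
  moreover have "eventually (\<lambda>c. (f c / complex_of_real c powi v) * (g c / complex_of_real c powi w) =
      f c * g c / complex_of_real c powi (v + w)) at_top"
    using eventually_gt_at_top[of 0] by eventually_elim (simp add: power_int_add)
  ultimately show ?thesis unfolding growth_def by (rule Lim_transform_eventually)
qed

lemma growth_inverse:
  assumes "growth f v L" "L \<noteq> 0"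
  shows "growth (\<lambda>c. inverse (f c)) (- v) (inverse L)"
proof -
  have "((\<lambda>c. inverse (f c / complex_of_real c powi v)) \<longlongrightarrow> inverse L) at_top"
    using assms unfolding growth_def by (rule tendsto_inverse)
  moreover have "eventually (\<lambda>c. inverse (f c / complex_of_real c powi v) =
      inverse (f c) / complex_of_real c powi (- v)) at_top"
    using eventually_gt_at_top[of 0] by eventually_elim (simp add: power_int_minus field_simps)
  ultimately show ?thesis unfolding growth_def by (rule Lim_transform_eventually)
qed

lemma growth_powi: "growth (\<lambda>c. complex_of_real c powi v) v 1"
  unfolding growth_def
  by (rule tendsto_eventually) (use eventually_gt_at_top[of 0] in eventually_elim, simp)

lemma growth_const: "growth (\<lambda>c. a) 0 a"
  by (simp add: growth_def)

lemma growth_higher: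
  assumes "growth f v L" "v < w"
  shows "growth f w 0"
proof -
  have "((\<lambda>c. of_real (inverse c) ^ nat (w - v)) \<longlongrightarrow> complex_of_real 0 ^ nat (w - v)) at_top"
    by (intro tendsto_power tendsto_of_real tendsto_inverse_0_at_top filterlim_ident)
  then have "growth (\<lambda>c. 1) (w - v) 0"
    unfolding growth_def using assms(2)
    by (simp add: power_int_def field_simps zero_power)
  from growth_mult[OF assms(1) this] show ?thesis by simp
qed

lemma growth_unique:
  assumes "growth f v K" "K \<noteq> 0" "growth f w L" "L \<noteq> 0"
  shows "v = w"
proof -
  have "\<not> v < w" if "growth f v K" "growth f w L" "L \<noteq> 0" for v w K L
    using growth_higher[OF that(1)] that(2,3) tendsto_unique[OF trivial_limit_at_top_linorder]
    unfolding growth_def by blast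
  then show ?thesis using assms by (meson linorder_neqE)
qed

lemma growth_nonzero:
  assumes "growth f v L" "L \<noteq> 0"
  shows "eventually (\<lambda>c. f c \<noteq> 0) at_top"
  using tendsto_imp_eventually_ne[OF assms[unfolded growth_def]] by eventually_elim auto

lemma growth_power: "growth f v L \<Longrightarrow> growth (\<lambda>c. f c ^ k) (int k * v) (L ^ k)"
proof (induction k)
  case 0
  then show ?case using growth_const[of 1] by simp
next
  case (Suc k)
  from growth_mult[OF Suc.prems Suc.IH[OF Suc.prems]] show ?case by (simp add: algebra_simps)
qed

lemma growth_sum:
  "finite A \<Longrightarrow> (\<And>i. i \<in> A \<Longrightarrow> growth (f i) v (L i)) \<Longrightarrow> growth (\<lambda>c. \<Sum>i\<in>A. f i c) v (\<Sum>i\<in>A. L i)"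
  unfolding growth_def sum_divide_distrib by (rule tendsto_sum) auto

lemma has_exp_powi: "has_exp (\<lambda>c. complex_of_real c powi v) v"
  unfolding has_exp_def using growth_powi by blast

lemma has_exp_const: "a \<in> posreal \<Longrightarrow> has_exp (\<lambda>c. a) 0"
  unfolding has_exp_def using growth_const by blast

lemma has_exp_mult: "has_exp f v \<Longrightarrow> has_exp g w \<Longrightarrow> has_exp (\<lambda>c. f c * g c) (v + w)"
  unfolding has_exp_def using growth_mult posreal_closed(3) by blast

lemma has_exp_inverse: "has_exp f v \<Longrightarrow> has_exp (\<lambda>c. inverse (f c)) (- v)"
  unfolding has_exp_def using growth_inverse posreal_closed(4) posreal_nonzero by blast

text \<open>Positive leading coefficients cannot cancel; this is where addition becomes the maximum
  of exponents, as in the ultra-discretization.\<close>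

lemma has_exp_add:
  assumes "has_exp f v" "has_exp g w"
  shows "has_exp (\<lambda>c. f c + g c) (max v w)"
proof -
  obtain K L where KL: "K \<in> posreal" "growth f v K" "L \<in> posreal" "growth g w L"
    using assms unfolding has_exp_def by blast
  consider "v < w" | "v = w" | "w < v" by linarith
  then show ?thesis
  proof cases
    case 1
    then have "growth (\<lambda>c. f c + g c) w (0 + L)" using KL by (intro growth_add growth_higher[OF KL(2)])
    then show ?thesis using 1 KL unfolding has_exp_def by (intro bexI[of _ L]) auto
  next
    case 2
    then have "growth (\<lambda>c. f c + g c) w (K + L)" using KL by (intro growth_add) auto
    then show ?thesis using 2 KL unfolding has_exp_def by (intro bexI[of _ "K + L"]) auto
  next
    case 3
    then have "growth (\<lambda>c. f c + g c) v (K + 0)" using KL by (intro growth_add growth_higher[OF KL(4)])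
    then show ?thesis using 3 KL unfolding has_exp_def by (intro bexI[of _ K]) auto
  qed
qed

lemma has_exp_power: "has_exp f v \<Longrightarrow> has_exp (\<lambda>c. f c ^ k) (int k * v)"
proof (induction k)
  case 0
  then show ?case using has_exp_const[of 1] by simp
next
  case (Suc k)
  from has_exp_mult[OF Suc.prems Suc.IH[OF Suc.prems]] show ?case by (simp add: algebra_simps)
qed

lemma has_exp_power_int:
  assumes "has_exp f v"
  shows "has_exp (\<lambda>c. f c powi k) (k * v)"
proof (cases "k \<ge> 0")
  case True
  then show ?thesis using has_exp_power[OF assms, of "nat k"] by (simp add: power_int_def)
next
  case False
  then show ?thesis using has_exp_inverse[OF has_exp_power[OF assms, of "nat (- k)"]]
    by (simp add: power_int_def power_inverse)
qed

lemma has_exp_prod: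
  "finite A \<Longrightarrow> (\<And>i. i \<in> A \<Longrightarrow> has_exp (f i) (v i)) \<Longrightarrow> has_exp (\<lambda>c. \<Prod>i\<in>A. f i c) (\<Sum>i\<in>A. v i)"
  by (induction A rule: finite_induct) (auto intro: has_exp_const has_exp_mult)

text \<open>The exponent is chosen before the curve, so it depends on \<open>b\<close> alone; the
  assignment of \<open>v\<close> to \<open>b\<close> is the tropicalization of
  \<open>f\<close>.\<close>

lemma prat_has_exp:
  assumes "f \<in> prat n"
  shows "\<exists>v. \<forall>y. (\<forall>i<n. has_exp (\<lambda>c. y c i) (b i)) \<longrightarrow> has_exp (\<lambda>c. f (y c)) v"
  using assms
proof (induction rule: prat.induct)
  case (const a)
  then show ?case using has_exp_const by blast
next
  case (coord i)
  then show ?case by (intro exI[of _ "b i"]) auto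
next
  case (add f g)
  then show ?case using has_exp_add by meson
next
  case (mult f g)
  then show ?case using has_exp_mult by meson
next
  case (inv f)
  then show ?case using has_exp_inverse by meson
qed

text \<open>Cancellation can only lower an exponent, so a bound in terms of \<open>b\<close> alone
  exists; the limit \<open>0\<close> says that the function grows strictly slower than the power
  \<open>B\<close>.\<close>

lemma polyfuns_growth_bound:
  assumes "f \<in> polyfuns n"
  shows "\<exists>B. \<forall>y. (\<forall>i<n. has_exp (\<lambda>c. y c i) (b i)) \<longrightarrow> growth (\<lambda>c. f (y c)) B 0"
  using assms
proof (induction rule: polyfuns.induct)
  case (const a)
  show ?case using growth_higher[OF growth_const[of a], of 1] by (intro exI[of _ 1]) simp
next
  case (coord i)
  show ?case
  proof (intro exI allI impI)
    fix y assume "\<forall>i<n. has_exp (\<lambda>c. y c i) (b i)"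
    then obtain L where "growth (\<lambda>c. y c i) (b i) L" using coord by (auto simp: has_exp_def)
    then show "growth (\<lambda>c. y c i) (b i + 1) 0" by (rule growth_higher) simp
  qed
next
  case (add f g)
  then obtain B C where BC: "\<And>y. \<forall>i<n. has_exp (\<lambda>c. y c i) (b i) \<Longrightarrow> growth (\<lambda>c. f (y c)) B 0"
    "\<And>y. \<forall>i<n. has_exp (\<lambda>c. y c i) (b i) \<Longrightarrow> growth (\<lambda>c. g (y c)) C 0" by auto
  show ?case
  proof (intro exI allI impI)
    fix y assume *: "\<forall>i<n. has_exp (\<lambda>c. y c i) (b i)"
    have "growth (\<lambda>c. f (y c)) (max B C + 1) 0" "growth (\<lambda>c. g (y c)) (max B C + 1) 0"
      using growth_higher[OF BC(1)[OF *]] growth_higher[OF BC(2)[OF *]] by auto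
    from growth_add[OF this] show "growth (\<lambda>c. f (y c) + g (y c)) (max B C + 1) 0" by simp
  qed
next
  case (mult f g)
  then obtain B C where BC: "\<And>y. \<forall>i<n. has_exp (\<lambda>c. y c i) (b i) \<Longrightarrow> growth (\<lambda>c. f (y c)) B 0"
    "\<And>y. \<forall>i<n. has_exp (\<lambda>c. y c i) (b i) \<Longrightarrow> growth (\<lambda>c. g (y c)) C 0" by auto
  show ?case
  proof (intro exI allI impI)
    fix y assume *: "\<forall>i<n. has_exp (\<lambda>c. y c i) (b i)"
    from growth_mult[OF BC(1)[OF *] BC(2)[OF *]] show "growth (\<lambda>c. f (y c) * g (y c)) (B + C) 0" by simp
  qed
qed

lemma ev_sum: "ev (\<Sum>i\<in>A. f i) x = (\<Sum>i\<in>A. ev (f i) x)"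
  by (induction A rule: infinite_finite_induct) auto

text \<open>
  A sufficiently general exponent vector: the exponent of the last variable is chosen so large that
  the leading coefficient in this variable dominates.
\<close>

lemma polyfuns_generic_exponents:
  assumes "f \<in> polyfuns n" "f u \<noteq> 0"
  shows "\<exists>b v. \<forall>y. (\<forall>i<n. has_exp (\<lambda>c. y c i) (b i)) \<longrightarrow> (\<exists>L. L \<noteq> 0 \<and> growth (\<lambda>c. f (y c)) v L)"
  using assms
proof (induction n arbitrary: f u)
  case 0
  have "growth (\<lambda>c. f (y c)) 0 (f u)" for y
  proof -
    have "(\<lambda>c. f (y c)) = (\<lambda>c. f u)" by (rule ext) (rule polyfuns_cong[OF 0(1)], simp)
    then show ?thesis by (simp only: growth_const)
  qed
  then show ?case using 0(2) by (intro exI allI) auto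
next
  case (Suc n)
  have "Mp f \<in> adjoin (mpols n) (mX n)" using Mp_in_mpols[OF Suc.prems(1)] mpols_Suc by simp
  then obtain p where p: "p \<in> polys_over (mpols n)" "Mp f = poly p (mX n)" by (auto simp: adjoin_def)
  have f: "f x = (\<Sum>k\<le>degree p. ev (coeff p k) x * x n ^ k)" for x
  proof -
    have "f x = ev (poly p (mX n)) x" using p(2) ev_Mp[OF Suc.prems(1)] by simp
    also have "\<dots> = (\<Sum>k\<le>degree p. ev (coeff p k) x * x n ^ k)"
      unfolding poly_altdef by (simp add: ev_sum)
    finally show ?thesis .
  qed
  let ?m = "degree p"
  let ?a = "\<lambda>k. ev (coeff p k)"
  have a: "?a k \<in> polyfuns n" for k using p(1) by (auto simp: polys_over_def mpols_def)
  have "p \<noteq> 0" using f[of u] Suc.prems(2) by auto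
  then have "coeff p ?m \<noteq> 0" by simp
  then obtain w where "?a ?m w \<noteq> 0" by (metis ev_eqI ev_simps(1))
  from Suc.IH[OF a this] obtain b v where
    b: "\<And>y. (\<forall>i<n. has_exp (\<lambda>c. y c i) (b i)) \<Longrightarrow> (\<exists>L. L \<noteq> 0 \<and> growth (\<lambda>c. ?a ?m (y c)) v L)" by blast
  have "\<exists>B. \<forall>y. (\<forall>i<n. has_exp (\<lambda>c. y c i) (b i)) \<longrightarrow> growth (\<lambda>c. ?a k (y c)) B 0" for k
    by (rule polyfuns_growth_bound[OF a])
  then obtain B where B: "\<And>k y. (\<forall>i<n. has_exp (\<lambda>c. y c i) (b i)) \<Longrightarrow> growth (\<lambda>c. ?a k (y c)) (B k) 0"
    by metis
  \<comment> \<open>Each further power of the last variable gains \<open>M\<close>, which exceeds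
    every \<open>B k - v\<close>, so all terms of degree below \<open>?m\<close> are
    dominated.\<close>
  define M where "M = (\<Sum>k<?m. \<bar>B k\<bar>) + \<bar>v\<bar> + 1"
  have M: "B k + int k * M < v + int ?m * M" if "k < ?m" for k
  proof -
    have "\<bar>B k\<bar> \<le> (\<Sum>k<?m. \<bar>B k\<bar>)" using that by (intro member_le_sum) auto
    then have "B k - v < M" "0 \<le> M" unfolding M_def by linarith+
    moreover have "M \<le> (int ?m - int k) * M"
      using mult_right_mono[of 1 "int ?m - int k" M] that \<open>0 \<le> M\<close> by simp
    ultimately show ?thesis by (simp add: algebra_simps)
  qed
  show ?case
  proof (rule exI[of _ "b(n := M)"], rule exI[of _ "v + int ?m * M"], intro allI impI)
    fix y assume "\<forall>i<Suc n. has_exp (\<lambda>c. y c i) ((b(n := M)) i)"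
    then have y: "\<forall>i<n. has_exp (\<lambda>c. y c i) (b i)" and yn: "has_exp (\<lambda>c. y c n) M"
      by (auto simp: less_Suc_eq split: if_splits)
    obtain L where L: "L \<noteq> 0" "growth (\<lambda>c. ?a ?m (y c)) v L" using b[OF y] by blast
    obtain K where K: "K \<noteq> 0" "growth (\<lambda>c. y c n) M K" using yn posreal_nonzero unfolding has_exp_def by blast
    have top: "growth (\<lambda>c. ?a ?m (y c) * y c n ^ ?m) (v + int ?m * M) (L * K ^ ?m)"
      by (intro growth_mult growth_power L K)
    have "growth (\<lambda>c. ?a k (y c) * y c n ^ k) (v + int ?m * M) 0" if "k < ?m" for k
      by (rule growth_higher[OF growth_mult[OF B[OF y] growth_power[OF K(2)]] M[OF that]])
    then have "growth (\<lambda>c. \<Sum>k<?m. ?a k (y c) * y c n ^ k) (v + int ?m * M) (\<Sum>k<?m. 0)"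
      by (intro growth_sum) auto
    from growth_add[OF this top]
    have "growth (\<lambda>c. f (y c)) (v + int ?m * M) (L * K ^ ?m)"
      by (simp add: f lessThan_Suc_atMost[symmetric])
    then show "\<exists>L. L \<noteq> 0 \<and> growth (\<lambda>c. f (y c)) (v + int ?m * M) L"
      using L(1) K(1) by (metis mult_eq_0_iff power_eq_0_iff)
  qed
qed

section \<open>Prime ideals and homomorphisms\<close>

lemma polys_over_lead: "p \<in> polys_over A \<Longrightarrow> lead_coeff p \<in> A"
  by (simp add: polys_over_def)

text \<open>Division with remainder needs an invertible leading coefficient; multiplying by powers
  of it instead keeps all coefficients in \<open>A\<close>. The case \<open>r = 0\<close> is
  separate because the zero polynomial has degree \<open>0\<close>.\<close>

lemma pseudo_division:
  fixes m :: "'a::idom poly"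
  assumes A: "subring_set A" and m: "m \<in> polys_over A" "m \<noteq> 0" and p: "p \<in> polys_over A"
  shows "\<exists>k. \<exists>q\<in>polys_over A. \<exists>r\<in>polys_over A.
    smult (lead_coeff m ^ k) p = m * q + r \<and> (r = 0 \<or> degree r < degree m)"
proof -
  note P = subring_setD[OF polys_over_subring[OF A]]
  have "\<exists>k. \<exists>q\<in>polys_over A. \<exists>r\<in>polys_over A.
      smult (lead_coeff m ^ k) p = m * q + r \<and> (r = 0 \<or> degree r < degree m)"
    if "p \<in> polys_over A" "p = 0 \<or> degree p < n" for n p
    using that
  proof (induction n arbitrary: p)
    case 0
    then show ?case by (intro exI[of _ 0] bexI[of _ 0]) (auto intro: P)
  next
    case (Suc n)
    show ?case
    proof (cases "p = 0 \<or> degree p < degree m")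
      case True
      then show ?thesis using Suc by (intro exI[of _ 0] bexI[of _ 0] bexI[of _ p]) (auto intro: P)
    next
      case False
      let ?t = "monom (lead_coeff p) (degree p - degree m)"
      let ?p' = "smult (lead_coeff m) p - m * ?t"
      have t: "?t \<in> polys_over A" by (intro polys_over_monom A polys_over_lead Suc)
      have p': "?p' \<in> polys_over A"
        by (intro P polys_over_smult A m t Suc polys_over_lead)
      have "coeff (m * ?t) (degree p) = lead_coeff p * lead_coeff m"
        unfolding mult.commute[of m] coeff_monom_mult using False by simp
      then have c: "coeff ?p' (degree p) = 0" by (simp add: mult.commute)
      have "degree (m * ?t) \<le> degree p"
        using degree_mult_le[of m ?t] degree_monom_le[of "lead_coeff p" "degree p - degree m"] False by linarith
      then have d: "degree ?p' \<le> degree p" by (intro degree_diff_le) (auto intro: degree_smult_le)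
      have "?p' = 0 \<or> degree ?p' < n"
      proof (cases "degree ?p' = degree p")
        case True
        then have "?p' = 0" using c leading_coeff_0_iff by metis
        then show ?thesis by simp
      next
        case False
        then show ?thesis using d Suc.prems by (cases "p = 0") auto
      qed
      from Suc.IH[OF p' this] obtain k q r where kqr: "q \<in> polys_over A" "r \<in> polys_over A"
        "smult (lead_coeff m ^ k) ?p' = m * q + r" "r = 0 \<or> degree r < degree m" by blast
      have "smult (lead_coeff m ^ Suc k) p = m * (q + smult (lead_coeff m ^ k) ?t) + r"
        using kqr(3) by (simp add: smult_diff_right algebra_simps)
      moreover have "q + smult (lead_coeff m ^ k) ?t \<in> polys_over A"
        by (intro P kqr polys_over_smult A t subring_set_power polys_over_lead m)
      ultimately show ?thesis
        using kqr(2,4) by (intro exI[of _ "Suc k"] bexI[of _ "q + smult (lead_coeff m ^ k) ?t"] bexI[of _ r] conjI)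
    qed
  qed
  from this[OF p, of "Suc (degree p)"] show ?thesis by simp
qed

definition prime_in :: "'a::comm_ring_1 set \<Rightarrow> 'a set \<Rightarrow> bool" where
  "prime_in B J \<longleftrightarrow> (\<forall>a\<in>J \<inter> B. \<forall>b\<in>J \<inter> B. a + b \<in> J) \<and> (\<forall>a\<in>J \<inter> B. \<forall>b\<in>B. b * a \<in> J) \<and>
    (\<forall>a\<in>B. \<forall>b\<in>B. a * b \<in> J \<longrightarrow> a \<in> J \<or> b \<in> J)"

lemma prime_in_subset: "prime_in B J \<Longrightarrow> C \<subseteq> B \<Longrightarrow> prime_in C J"
  unfolding prime_in_def by blast

text \<open>
  A polynomial of minimal degree in \<open>J\<^sub>0\<close> divides, up to a factor from \<open>A\<close>, every element of a
  smaller prime \<open>J\<close>, and hence lies in \<open>J\<close> as soon as \<open>J\<close> is nonzero.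
\<close>

lemma directed_primes_step:
  fixes A :: "'a::idom set"
  assumes A: "subring_set A" and x: "\<And>p. p \<in> polys_over A \<Longrightarrow> poly p x = 0 \<Longrightarrow> p = 0"
    and prime: "\<And>J. J \<in> \<J> \<Longrightarrow> prime_in (adjoin A x) J"
    and directed: "\<And>J J'. J \<in> \<J> \<Longrightarrow> J' \<in> \<J> \<Longrightarrow> \<exists>K\<in>\<J>. K \<subseteq> J \<inter> J'"
    and Inter: "\<And>b. b \<in> adjoin A x \<Longrightarrow> (\<And>J. J \<in> \<J> \<Longrightarrow> b \<in> J) \<Longrightarrow> b = 0"
    and J0: "J0 \<in> \<J>" "J0 \<inter> A \<subseteq> {0}"
  shows "\<exists>J\<in>\<J>. J \<inter> adjoin A x \<subseteq> {0}"
proof (rule ccontr)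
  assume contra: "\<not> ?thesis"
  note P = subring_setD[OF polys_over_subring[OF A]]
  have B: "poly p x \<in> adjoin A x" if "p \<in> polys_over A" for p using that by (auto simp: adjoin_def)
  have min: "\<exists>m. m \<in> polys_over A \<and> m \<noteq> 0 \<and> poly m x \<in> J \<and>
      (\<forall>r\<in>polys_over A. poly r x \<in> J \<longrightarrow> r \<noteq> 0 \<longrightarrow> degree m \<le> degree r)" if J: "J \<in> \<J>" for J
  proof -
    obtain b where "b \<in> J" "b \<in> adjoin A x" "b \<noteq> 0" using contra J by blast
    then obtain p where "p \<in> polys_over A" "b = poly p x" by (auto simp: adjoin_def)
    then have p: "p \<in> polys_over A \<and> p \<noteq> 0 \<and> poly p x \<in> J" using \<open>b \<in> J\<close> \<open>b \<noteq> 0\<close> by auto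
    from ex_has_least_nat[of "\<lambda>p. p \<in> polys_over A \<and> p \<noteq> 0 \<and> poly p x \<in> J", OF p, of degree]
    show ?thesis by blast
  qed
  obtain m where m: "m \<in> polys_over A" "m \<noteq> 0" "poly m x \<in> J0"
    and mmin: "\<And>r. r \<in> polys_over A \<Longrightarrow> poly r x \<in> J0 \<Longrightarrow> r \<noteq> 0 \<Longrightarrow> degree m \<le> degree r"
    using min[OF J0(1)] by blast
  \<comment> \<open>A constant would be a nonzero element of \<open>J0 \<inter> A\<close>.\<close>
  have deg: "degree m > 0"
  proof (rule ccontr)
    assume "\<not> degree m > 0"
    then obtain c where c: "m = [:c:]" by (metis degree_eq_zeroE gr0I)
    then have "c \<in> J0 \<inter> A" using m by (auto simp: polys_over_pCons_iff)
    then show False using J0(2) m(2) c by auto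
  qed
  have "poly m x \<in> J" if J: "J \<in> \<J>" "J \<subseteq> J0" for J
  proof -
    obtain p where p: "p \<in> polys_over A" "p \<noteq> 0" "poly p x \<in> J"
      and pmin: "\<And>r. r \<in> polys_over A \<Longrightarrow> poly r x \<in> J \<Longrightarrow> r \<noteq> 0 \<Longrightarrow> degree p \<le> degree r"
      using min[OF J(1)] by blast
    obtain k q r where kqr: "q \<in> polys_over A" "r \<in> polys_over A"
      "smult (lead_coeff m ^ k) p = m * q + r" "r = 0 \<or> degree r < degree m"
      using pseudo_division[OF A m(1,2) p(1)] by blast
    have l: "lead_coeff m ^ k \<in> A" by (intro subring_set_power A polys_over_lead m)
    then have l': "lead_coeff m ^ k \<in> adjoin A x" using adjoin_incl[OF A] by blast
    have lp: "lead_coeff m ^ k * poly p x \<in> J"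
      using prime[OF J(1)] p l' B unfolding prime_in_def by blast
    \<comment> \<open>Because \<open>J \<subseteq> J0\<close>, both summands lie in
      \<open>J0\<close>; so the remainder gives an element of \<open>J0\<close> of degree below the
      minimum, unless it is zero.\<close>
    have "poly r x = lead_coeff m ^ k * poly p x + poly (- q) x * poly m x"
      using arg_cong[OF kqr(3), of "\<lambda>p. poly p x"] by simp
    moreover have "poly (- q) x * poly m x \<in> J0"
      using prime[OF J0(1)] m B[OF P(6)[OF kqr(1)]] B unfolding prime_in_def by blast
    moreover have "lead_coeff m ^ k * poly p x \<in> adjoin A x" "poly (- q) x * poly m x \<in> adjoin A x"
      by (intro subring_setD(5)[OF adjoin_subring[OF A]] l' B p P kqr m)+
    ultimately have rJ: "poly r x \<in> J0" using prime[OF J0(1)] lp J(2) unfolding prime_in_def by (metis IntI subsetD)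
    have "r = 0"
    proof (rule ccontr)
      assume "r \<noteq> 0"
      then have "degree m \<le> degree r" by (rule mmin[OF kqr(2) rJ])
      then show False using kqr(4) \<open>r \<noteq> 0\<close> by simp
    qed
    then have eq: "smult (lead_coeff m ^ k) p = m * q" using kqr(3) by simp
    have "poly m x * poly q x \<in> J" using lp arg_cong[OF eq, of "\<lambda>p. poly p x"] by simp
    then have "poly m x \<in> J \<or> poly q x \<in> J"
      using prime[OF J(1)] B kqr m unfolding prime_in_def by blast
    \<comment> \<open>Otherwise \<open>q\<close>, whose degree is smaller than that of
      \<open>p\<close> since \<open>degree m > 0\<close>, would contradict the minimality of
      \<open>p\<close>.\<close>
    moreover have "poly q x \<notin> J"
    proof
      assume "poly q x \<in> J"
      moreover have "q \<noteq> 0" using eq p m by auto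
      ultimately have "degree p \<le> degree q" using pmin kqr(1) by blast
      moreover have "degree p = degree m + degree q"
        using arg_cong[OF eq, of degree] m(2) \<open>q \<noteq> 0\<close> by (simp add: degree_mult_eq)
      ultimately show False using deg by simp
    qed
    ultimately show ?thesis by blast
  qed
  \<comment> \<open>For an arbitrary \<open>J\<close>, the element already lies in a member of the
    family below both \<open>J0\<close> and \<open>J\<close>.\<close>
  then have "poly m x \<in> J" if "J \<in> \<J>" for J using directed[OF J0(1) that] by blast
  then have "poly m x = 0" using Inter[OF B[OF m(1)]] by blast
  then show False using x m by blast
qed

lemma mpols_mono: "m \<le> n \<Longrightarrow> mpols m \<subseteq> mpols n"
  by (auto simp: mpols_def intro: polyfuns_mono)

text \<open>Each variable costs one application of \<open>directed_primes_step\<close>, which may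
  change the member of the family. Without variables the ring is the field \<complex>, where a
  member that omits \<open>1\<close> contains no nonzero element.\<close>

lemma directed_primes:
  fixes \<J> :: "mpol set set"
  assumes "\<And>J. J \<in> \<J> \<Longrightarrow> prime_in (mpols n) J"
    and "\<And>J J'. J \<in> \<J> \<Longrightarrow> J' \<in> \<J> \<Longrightarrow> \<exists>K\<in>\<J>. K \<subseteq> J \<inter> J'"
    and "\<And>b. b \<in> mpols n \<Longrightarrow> (\<And>J. J \<in> \<J> \<Longrightarrow> b \<in> J) \<Longrightarrow> b = 0"
  shows "\<exists>J\<in>\<J>. J \<inter> mpols n \<subseteq> {0}"
  using assms
proof (induction n)
  case 0
  have one: "1 \<in> mpols 0" by (rule subring_setD(2)[OF mpols_subring])
  have "\<exists>J\<in>\<J>. 1 \<notin> J"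
  proof (rule ccontr)
    assume "\<not> ?thesis"
    then have "(1::mpol) = 0" by (intro 0(3)[OF one]) blast
    then show False by simp
  qed
  then obtain J where J: "J \<in> \<J>" "1 \<notin> J" by blast
  have "c = 0" if c: "c \<in> J \<inter> mpols 0" for c
  proof (rule ccontr)
    assume "c \<noteq> 0"
    have ev: "ev c x = ev c (\<lambda>_. 0)" for x using c by (rule_tac polyfuns_cong[of _ 0]) (auto simp: mpols_def)
    then have "ev c (\<lambda>_. 0) \<noteq> 0" using \<open>c \<noteq> 0\<close> by (metis ev_eqI ev_simps(1))
    \<comment> \<open>A nonzero constant is a unit, so it would bring \<open>1\<close> into
      \<open>J\<close>.\<close>
    let ?i = "Mp (\<lambda>_. inverse (ev c (\<lambda>_. 0)))"
    have "?i * c = 1" using \<open>ev c (\<lambda>_. 0) \<noteq> 0\<close> ev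
      by (intro ev_eqI) (simp add: ev_Mp[OF polyfuns.const] del: inverse_eq_divide, metis left_inverse)
    moreover have "?i \<in> mpols 0" by (intro Mp_in_mpols polyfuns.const)
    ultimately show False using 0(1)[OF J(1)] c J(2) unfolding prime_in_def by metis
  qed
  then show ?case using J by blast
next
  case (Suc n)
  have sub: "mpols n \<subseteq> mpols (Suc n)" by (simp add: mpols_mono)
  have "\<exists>J\<in>\<J>. J \<inter> mpols n \<subseteq> {0}"
  proof (rule Suc.IH)
    show "prime_in (mpols n) J" if "J \<in> \<J>" for J
      by (rule prime_in_subset[OF Suc.prems(1)[OF that] sub])
    show "\<exists>K\<in>\<J>. K \<subseteq> J \<inter> J'" if "J \<in> \<J>" "J' \<in> \<J>" for J J'
      by (rule Suc.prems(2)[OF that])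
    show "b = 0" if "b \<in> mpols n" "\<And>J. J \<in> \<J> \<Longrightarrow> b \<in> J" for b
      using that sub by (intro Suc.prems(3)) auto
  qed
  then obtain J0 where J0: "J0 \<in> \<J>" "J0 \<inter> mpols n \<subseteq> {0}" by blast
  show ?case unfolding mpols_Suc
    by (rule directed_primes_step[OF mpols_subring mX_transcendental
          Suc.prems(1)[unfolded mpols_Suc] Suc.prems(2) Suc.prems(3)[unfolded mpols_Suc] J0])
qed

section \<open>Extension of homomorphisms\<close>

definition hom_on :: "'a::comm_ring_1 set \<Rightarrow> ('a \<Rightarrow> 'b::comm_ring_1) \<Rightarrow> bool" where
  "hom_on A \<phi> \<longleftrightarrow> \<phi> 1 = 1 \<and> (\<forall>x\<in>A. \<forall>y\<in>A. \<phi> (x + y) = \<phi> x + \<phi> y \<and> \<phi> (x * y) = \<phi> x * \<phi> y)"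

lemma hom_onD:
  assumes "hom_on A \<phi>"
  shows "\<phi> 1 = 1" "x \<in> A \<Longrightarrow> y \<in> A \<Longrightarrow> \<phi> (x + y) = \<phi> x + \<phi> y"
    "x \<in> A \<Longrightarrow> y \<in> A \<Longrightarrow> \<phi> (x * y) = \<phi> x * \<phi> y"
  using assms by (auto simp: hom_on_def)

lemma hom_on_0: "hom_on A \<phi> \<Longrightarrow> subring_set A \<Longrightarrow> \<phi> 0 = 0"
  by (metis add_cancel_right_right hom_onD(2) subring_setD(1))

lemma hom_on_sum:
  assumes "finite S" "hom_on A \<phi>" "subring_set A" "\<And>i. i \<in> S \<Longrightarrow> f i \<in> A"
  shows "\<phi> (\<Sum>i\<in>S. f i) = (\<Sum>i\<in>S. \<phi> (f i))"
  using assms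
  by (induction S rule: finite_induct) (auto simp: hom_on_0 hom_onD subring_set_sum)

lemma hom_on_power: "hom_on A \<phi> \<Longrightarrow> subring_set A \<Longrightarrow> a \<in> A \<Longrightarrow> \<phi> (a ^ k) = \<phi> a ^ k"
  by (induction k) (auto simp: hom_onD subring_set_power)

definition eval_hom :: "('a::comm_ring_1 \<Rightarrow> 'b::comm_ring_1) \<Rightarrow> 'b \<Rightarrow> 'a poly \<Rightarrow> 'b" where
  "eval_hom \<phi> \<eta> p = poly (map_poly \<phi> p) \<eta>"

lemma eval_hom_simps:
  assumes A: "subring_set A" and \<phi>: "hom_on A \<phi>"
  shows "eval_hom \<phi> \<eta> [:a:] = \<phi> a"
    "p \<in> polys_over A \<Longrightarrow> q \<in> polys_over A \<Longrightarrow> eval_hom \<phi> \<eta> (p + q) = eval_hom \<phi> \<eta> p + eval_hom \<phi> \<eta> q"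
    "p \<in> polys_over A \<Longrightarrow> q \<in> polys_over A \<Longrightarrow> eval_hom \<phi> \<eta> (p * q) = eval_hom \<phi> \<eta> p * eval_hom \<phi> \<eta> q"
proof -
  note c = coeff_map_poly[of \<phi>, OF hom_on_0[OF \<phi> A]]
  show "eval_hom \<phi> \<eta> [:a:] = \<phi> a"
    using hom_on_0[OF \<phi> A] by (simp add: eval_hom_def map_poly_pCons)
  assume pq: "p \<in> polys_over A" "q \<in> polys_over A"
  then have co: "coeff p k \<in> A" "coeff q k \<in> A" for k by (auto simp: polys_over_def)
  have "map_poly \<phi> (p + q) = map_poly \<phi> p + map_poly \<phi> q"
    by (rule poly_eqI) (simp add: c hom_onD(2)[OF \<phi> co])
  then show "eval_hom \<phi> \<eta> (p + q) = eval_hom \<phi> \<eta> p + eval_hom \<phi> \<eta> q" by (simp add: eval_hom_def)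
  have "map_poly \<phi> (p * q) = map_poly \<phi> p * map_poly \<phi> q"
  proof (rule poly_eqI)
    fix n
    have "\<phi> (\<Sum>i\<le>n. coeff p i * coeff q (n - i)) = (\<Sum>i\<le>n. \<phi> (coeff p i * coeff q (n - i)))"
      by (intro hom_on_sum[OF _ \<phi> A] subring_setD(5)[OF A] co) simp
    then show "coeff (map_poly \<phi> (p * q)) n = coeff (map_poly \<phi> p * map_poly \<phi> q) n"
      by (simp add: c coeff_mult hom_onD(3)[OF \<phi> co])
  qed
  then show "eval_hom \<phi> \<eta> (p * q) = eval_hom \<phi> \<eta> p * eval_hom \<phi> \<eta> q" by (simp add: eval_hom_def)
qed

text \<open>\<open>A[y]\<close> is the quotient of the polynomial ring over \<open>A\<close> by the
  relations of \<open>y\<close>; the homomorphism given by \<open>\<phi>\<close> and the image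
  \<open>\<eta>\<close> of \<open>y\<close> descends when it kills these relations.\<close>

lemma hom_extend:
  assumes A: "subring_set A" and \<phi>: "hom_on A \<phi>"
    and ker: "\<And>r. r \<in> polys_over A \<Longrightarrow> poly r y = 0 \<Longrightarrow> eval_hom \<phi> \<eta> r = 0"
  shows "\<exists>\<psi>. hom_on (adjoin A y) \<psi> \<and> (\<forall>a\<in>A. \<psi> a = \<phi> a) \<and>
    (\<forall>p\<in>polys_over A. \<psi> (poly p y) = eval_hom \<phi> \<eta> p)"
proof -
  note P = subring_setD[OF polys_over_subring[OF A]]
  note E = eval_hom_simps[OF A \<phi>]
  define \<psi> where "\<psi> w = eval_hom \<phi> \<eta> (SOME p. p \<in> polys_over A \<and> poly p y = w)" for w
  have \<psi>: "\<psi> (poly p y) = eval_hom \<phi> \<eta> p" if p: "p \<in> polys_over A" for p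
  proof -
    let ?q = "SOME q. q \<in> polys_over A \<and> poly q y = poly p y"
    have q: "?q \<in> polys_over A \<and> poly ?q y = poly p y"
      by (rule someI[of _ p]) (use p in simp)
    then have "eval_hom \<phi> \<eta> (?q - p) = 0" by (intro ker P p) auto
    moreover have "eval_hom \<phi> \<eta> ((?q - p) + p) = eval_hom \<phi> \<eta> (?q - p) + eval_hom \<phi> \<eta> p"
      using q p by (intro E P) auto
    ultimately show ?thesis unfolding \<psi>_def by simp
  qed
  have "hom_on (adjoin A y) \<psi>"
    unfolding hom_on_def adjoin_def
  proof (intro conjI ballI)
    show "\<psi> 1 = 1" using \<psi>[OF P(2)] E(1)[of \<eta> 1] hom_onD(1)[OF \<phi>] by (simp add: one_pCons)
    fix u w assume "u \<in> (\<lambda>p. poly p y) ` polys_over A" "w \<in> (\<lambda>p. poly p y) ` polys_over A"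
    then obtain p q where pq: "p \<in> polys_over A" "q \<in> polys_over A" "u = poly p y" "w = poly q y" by auto
    show "\<psi> (u + w) = \<psi> u + \<psi> w"
      using \<psi>[OF P(3)[OF pq(1,2)]] E(2)[OF pq(1,2)] pq \<psi> by simp
    show "\<psi> (u * w) = \<psi> u * \<psi> w"
      using \<psi>[OF P(5)[OF pq(1,2)]] E(3)[OF pq(1,2)] pq \<psi> by simp
  qed
  moreover have "\<forall>a\<in>A. \<psi> a = \<phi> a" using \<psi>[OF polys_over_const[OF A]] E(1) by simp
  ultimately show ?thesis using \<psi> by blast
qed

text \<open>The inductive step of Chevalley's theorem. If \<open>y\<close> is transcendental over
  \<open>A\<close>, its image may be any number that is not a root of the image of a polynomial
  representing \<open>b\<close>. If \<open>y\<close> is algebraic, its image is a root of a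
  polynomial of minimal degree, and a nonzero multiple of \<open>b\<close> that lies in
  \<open>A\<close> controls the value at \<open>b\<close>.\<close>

lemma hom_extend_nonzero:
  fixes A :: "'a::idom set" and y :: 'a
  assumes A: "subring_set A" and b: "b \<in> adjoin A y" "b \<noteq> 0"
  shows "\<exists>a\<in>A. a \<noteq> 0 \<and> (\<forall>\<phi>::'a \<Rightarrow> complex. hom_on A \<phi> \<longrightarrow> \<phi> a \<noteq> 0 \<longrightarrow>
    (\<exists>\<psi>. hom_on (adjoin A y) \<psi> \<and> (\<forall>x\<in>A. \<psi> x = \<phi> x) \<and> \<psi> b \<noteq> 0))"
proof -
  note P = subring_setD[OF polys_over_subring[OF A]]
  obtain B where B: "B \<in> polys_over A" "b = poly B y" using b by (auto simp: adjoin_def)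
  show ?thesis
  proof (cases "\<forall>r\<in>polys_over A. poly r y = 0 \<longrightarrow> r = 0")
    case True
    show ?thesis
    proof (intro bexI[of _ "lead_coeff B"] conjI allI impI)
      show "lead_coeff B \<noteq> 0" using B b by auto
      show "lead_coeff B \<in> A" by (intro polys_over_lead B)
      fix \<phi> :: "'a \<Rightarrow> complex"
      assume \<phi>: "hom_on A \<phi>" "\<phi> (lead_coeff B) \<noteq> 0"
      then have "map_poly \<phi> B \<noteq> 0"
        by (metis coeff_0 coeff_map_poly hom_on_0[OF \<phi>(1) A])
      then obtain \<eta> where \<eta>: "poly (map_poly \<phi> B) \<eta> \<noteq> 0" using poly_all_0_iff_0 by blast
      have "eval_hom \<phi> \<eta> r = 0" if "r \<in> polys_over A" "poly r y = 0" for r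
      proof -
        have "r = 0" using True that by blast
        then show ?thesis by (simp add: eval_hom_def)
      qed
      from hom_extend[OF A \<phi>(1) this] obtain \<psi> where \<psi>: "hom_on (adjoin A y) \<psi>" "\<forall>a\<in>A. \<psi> a = \<phi> a"
        "\<forall>p\<in>polys_over A. \<psi> (poly p y) = eval_hom \<phi> \<eta> p" by blast
      then have "\<psi> b \<noteq> 0" using B \<eta> by (simp add: eval_hom_def)
      then show "\<exists>\<psi>. hom_on (adjoin A y) \<psi> \<and> (\<forall>x\<in>A. \<psi> x = \<phi> x) \<and> \<psi> b \<noteq> 0" using \<psi> by blast
    qed
  next
    case False
    then obtain M0 where M0: "M0 \<in> polys_over A \<and> M0 \<noteq> 0 \<and> poly M0 y = 0" by blast
    from ex_has_least_nat[of "\<lambda>M. M \<in> polys_over A \<and> M \<noteq> 0 \<and> poly M y = 0", OF M0, of degree]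
    obtain M where M: "M \<in> polys_over A" "M \<noteq> 0" "poly M y = 0"
      and "\<And>r. r \<in> polys_over A \<Longrightarrow> r \<noteq> 0 \<Longrightarrow> poly r y = 0 \<Longrightarrow> degree M \<le> degree r" by blast
    then have Mmin: "r = 0" if "r \<in> polys_over A" "poly r y = 0" "r = 0 \<or> degree r < degree M" for r
      using that leD by blast
    have degM: "degree M > 0"
      using M by (metis degree_eq_zeroE gr0I mult_zero_right add_0_right poly_pCons poly_0 pCons_0_0)
    \<comment> \<open>These polynomials represent the nonzero multiples of \<open>b\<close>; one of
      minimal degree turns out to be constant, which gives the multiple in \<open>A\<close>.\<close>
    let ?Q = "\<lambda>N. N \<in> polys_over A \<and> poly N y \<noteq> 0 \<and> (\<exists>U\<in>polys_over A. poly N y = poly U y * b)"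
    have "?Q B" using B b by (auto intro!: bexI[of _ 1] P)
    from ex_has_least_nat[of ?Q, OF this, of degree]
    obtain N U where N: "N \<in> polys_over A" "poly N y \<noteq> 0" "U \<in> polys_over A" "poly N y = poly U y * b"
      and "\<And>r. ?Q r \<Longrightarrow> degree N \<le> degree r" by blast
    then have Nmin: "degree N \<le> degree r"
      if "r \<in> polys_over A" "poly r y \<noteq> 0" "V \<in> polys_over A" "poly r y = poly V y * b" for r V
      using that by blast
    have "N \<noteq> 0" using N by auto
    have NM: "degree N < degree M"
    proof -
      obtain k q r where kqr: "q \<in> polys_over A" "r \<in> polys_over A"
        "smult (lead_coeff M ^ k) N = M * q + r" "r = 0 \<or> degree r < degree M"
        using pseudo_division[OF A M(1,2) N(1)] by blast
      have eq: "poly r y = lead_coeff M ^ k * poly N y"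
        using arg_cong[OF kqr(3), of "\<lambda>p. poly p y"] M(3) by simp
      then have r: "poly r y \<noteq> 0" using M(2) N(2) by simp
      have "smult (lead_coeff M ^ k) U \<in> polys_over A"
        by (intro polys_over_smult A subring_set_power polys_over_lead M N)
      moreover have "poly r y = poly (smult (lead_coeff M ^ k) U) y * b" using eq N(4) by simp
      ultimately have "degree N \<le> degree r" by (rule Nmin[OF kqr(2) r])
      moreover have "r \<noteq> 0" using r by auto
      ultimately show ?thesis using kqr(4) by simp
    qed
    \<comment> \<open>Dividing \<open>M\<close> by \<open>N\<close> leaves a multiple of
      \<open>b\<close> of smaller degree, which must vanish at \<open>y\<close>. Then
      \<open>M\<close> is, up to a factor from \<open>A\<close>, the product of \<open>N\<close> and
      \<open>q\<close>, and \<open>q\<close> vanishes at \<open>y\<close> against the minimality of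
      \<open>M\<close>.\<close>
    have "degree N = 0"
    proof (rule ccontr)
      assume degN: "degree N \<noteq> 0"
      obtain k q r where kqr: "q \<in> polys_over A" "r \<in> polys_over A"
        "smult (lead_coeff N ^ k) M = N * q + r" "r = 0 \<or> degree r < degree N"
        using pseudo_division[OF A N(1) \<open>N \<noteq> 0\<close> M(1)] by blast
      have eq: "poly r y = - (poly q y * poly N y)"
        using arg_cong[OF kqr(3), of "\<lambda>p. poly p y"] M(3) by (simp add: eq_neg_iff_add_eq_0 algebra_simps)
      have r0: "poly r y = 0"
      proof (rule ccontr)
        assume "poly r y \<noteq> 0"
        moreover have "- (q * U) \<in> polys_over A" by (intro P kqr N)
        moreover have "poly r y = poly (- (q * U)) y * b" using eq N(4) by simp
        ultimately have "degree N \<le> degree r" by (rule Nmin[OF kqr(2)])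
        then show False using kqr(4) \<open>poly r y \<noteq> 0\<close> by auto
      qed
      then have "r = 0" using kqr(2,4) NM by (intro Mmin) auto
      then have eq': "smult (lead_coeff N ^ k) M = N * q" using kqr(3) by simp
      then have "q \<noteq> 0" using M(2) \<open>N \<noteq> 0\<close> by auto
      then have "degree M = degree N + degree q"
        using arg_cong[OF eq', of degree] \<open>N \<noteq> 0\<close> by (simp add: degree_mult_eq)
      then have "degree q < degree M" using degN by simp
      moreover have "poly q y = 0" using eq r0 N(2) by simp
      ultimately show False using Mmin kqr(1) \<open>q \<noteq> 0\<close> by blast
    qed
    then obtain c where c: "N = [:c:]" by (metis degree_eq_zeroE)
    have cA: "c \<in> A" using N(1) c by (simp add: polys_over_pCons_iff)
    have "c \<noteq> 0" using \<open>N \<noteq> 0\<close> c by simp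
    \<comment> \<open>\<open>\<phi> c \<noteq> 0\<close> keeps the value at \<open>b\<close> away
      from zero, and \<open>\<phi> (lead_coeff M) \<noteq> 0\<close> keeps the image of
      \<open>M\<close> nonconstant, so that it has a root.\<close>
    show ?thesis
    proof (intro bexI[of _ "c * lead_coeff M"] conjI allI impI)
      show "c * lead_coeff M \<noteq> 0" using \<open>c \<noteq> 0\<close> M by simp
      show "c * lead_coeff M \<in> A" by (intro subring_setD(5)[OF A] cA polys_over_lead M)
      fix \<phi> :: "'a \<Rightarrow> complex"
      assume \<phi>: "hom_on A \<phi>" "\<phi> (c * lead_coeff M) \<noteq> 0"
      note E = eval_hom_simps[OF A \<phi>(1)]
      have \<phi>c: "\<phi> c \<noteq> 0" "\<phi> (lead_coeff M) \<noteq> 0"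
        using \<phi>(2) hom_onD(3)[OF \<phi>(1) cA polys_over_lead[OF M(1)]] by auto
      have "coeff (map_poly \<phi> M) (degree M) \<noteq> 0"
        using \<phi>c(2) by (simp add: coeff_map_poly hom_on_0[OF \<phi>(1) A])
      then have "degree (map_poly \<phi> M) > 0" using degM le_degree by (metis gr_zeroI le_zero_eq not_gr_zero)
      then have "\<not> constant (poly (map_poly \<phi> M))" by (simp add: constant_degree)
      then obtain \<eta> where \<eta>: "eval_hom \<phi> \<eta> M = 0"
        using fundamental_theorem_of_algebra unfolding eval_hom_def by blast
      \<comment> \<open>Every relation of \<open>y\<close> is, up to a power of the leading
        coefficient, a multiple of \<open>M\<close>, and \<open>\<eta>\<close> is a root of the
        image of \<open>M\<close>.\<close>
      have "eval_hom \<phi> \<eta> r = 0" if r: "r \<in> polys_over A" "poly r y = 0" for r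
      proof -
        obtain k q s where kqs: "q \<in> polys_over A" "s \<in> polys_over A"
          "smult (lead_coeff M ^ k) r = M * q + s" "s = 0 \<or> degree s < degree M"
          using pseudo_division[OF A M(1,2) r(1)] by blast
        have "poly s y = 0"
          using arg_cong[OF kqs(3), of "\<lambda>p. poly p y"] M(3) r(2) by simp
        then have "s = 0" using kqs by (intro Mmin) auto
        then have "[:lead_coeff M ^ k:] * r = M * q" using kqs(3) by simp
        moreover have "[:lead_coeff M ^ k:] \<in> polys_over A"
          by (intro polys_over_const A subring_set_power polys_over_lead M)
        ultimately have "\<phi> (lead_coeff M ^ k) * eval_hom \<phi> \<eta> r = 0"
          using E(3)[OF _ r(1)] E(3)[OF M(1) kqs(1)] E(1) \<eta> by (metis mult_zero_left)
        then show ?thesis using \<phi>c(2) hom_on_power[OF \<phi>(1) A polys_over_lead[OF M(1)]] by simp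
      qed
      from hom_extend[OF A \<phi>(1) this] obtain \<psi> where \<psi>: "hom_on (adjoin A y) \<psi>" "\<forall>a\<in>A. \<psi> a = \<phi> a" by blast
      have "poly U y \<in> adjoin A y" using N(3) by (auto simp: adjoin_def)
      then have "\<psi> (poly U y * b) = \<psi> (poly U y) * \<psi> b" using hom_onD(3)[OF \<psi>(1)] b(1) by blast
      moreover have "poly U y * b = c" using N(4) c by simp
      ultimately have "\<psi> b \<noteq> 0" using \<psi>(2) cA \<phi>c(1) by auto
      then show "\<exists>\<psi>. hom_on (adjoin A y) \<psi> \<and> (\<forall>x\<in>A. \<psi> x = \<phi> x) \<and> \<psi> b \<noteq> 0" using \<psi> by blast
    qed
  qed
qed

primrec adjoins :: "'a::comm_ring_1 set \<Rightarrow> 'a list \<Rightarrow> 'a set" where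
  "adjoins A [] = A"
| "adjoins A (y # ys) = adjoins (adjoin A y) ys"

lemma adjoins_props:
  "subring_set A \<Longrightarrow> subring_set (adjoins A ys) \<and> A \<subseteq> adjoins A ys \<and> set ys \<subseteq> adjoins A ys"
proof (induction ys arbitrary: A)
  case (Cons y ys)
  then show ?case using adjoin_subring[OF Cons.prems, of y] adjoin_incl[OF Cons.prems, of y]
    adjoin_gen[OF Cons.prems, of y] by fastforce
qed auto

text \<open>The condition on \<open>b\<close> is pushed down from the top of the tower to
  \<open>A\<close>; homomorphisms are then extended from the bottom up.\<close>

lemma hom_extend_list:
  fixes A :: "'a::idom set"
  assumes "subring_set A" "b \<in> adjoins A ys" "b \<noteq> 0"
  shows "\<exists>a\<in>A. a \<noteq> 0 \<and> (\<forall>\<phi>::'a \<Rightarrow> complex. hom_on A \<phi> \<longrightarrow> \<phi> a \<noteq> 0 \<longrightarrow>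
    (\<exists>\<psi>. hom_on (adjoins A ys) \<psi> \<and> (\<forall>x\<in>A. \<psi> x = \<phi> x) \<and> \<psi> b \<noteq> 0))"
  using assms
proof (induction ys arbitrary: A)
  case Nil
  then show ?case by auto
next
  case (Cons y ys)
  obtain a where a: "a \<in> adjoin A y" "a \<noteq> 0" "\<And>\<phi>::'a \<Rightarrow> complex. hom_on (adjoin A y) \<phi> \<Longrightarrow> \<phi> a \<noteq> 0 \<Longrightarrow>
    (\<exists>\<psi>. hom_on (adjoins (adjoin A y) ys) \<psi> \<and> (\<forall>x\<in>adjoin A y. \<psi> x = \<phi> x) \<and> \<psi> b \<noteq> 0)"
    using Cons.IH[OF adjoin_subring[OF Cons.prems(1)]] Cons.prems(2,3) by (metis adjoins.simps(2))
  obtain a' where a': "a' \<in> A" "a' \<noteq> 0" "\<And>\<phi>::'a \<Rightarrow> complex. hom_on A \<phi> \<Longrightarrow> \<phi> a' \<noteq> 0 \<Longrightarrow>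
    (\<exists>\<psi>. hom_on (adjoin A y) \<psi> \<and> (\<forall>x\<in>A. \<psi> x = \<phi> x) \<and> \<psi> a \<noteq> 0)"
    using hom_extend_nonzero[OF Cons.prems(1) a(1,2)] by blast
  show ?case
  proof (intro bexI[of _ a'] conjI allI impI a')
    fix \<phi> :: "'a \<Rightarrow> complex" assume "hom_on A \<phi>" "\<phi> a' \<noteq> 0"
    from a'(3)[OF this] obtain \<psi> where \<psi>: "hom_on (adjoin A y) \<psi>" "\<forall>x\<in>A. \<psi> x = \<phi> x" "\<psi> a \<noteq> 0" by blast
    from a(3)[OF \<psi>(1,3)] obtain \<omega> where
      "hom_on (adjoins (adjoin A y) ys) \<omega>" "\<forall>x\<in>adjoin A y. \<omega> x = \<psi> x" "\<omega> b \<noteq> 0" by blast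
    moreover have "A \<subseteq> adjoin A y" by (rule adjoin_incl[OF Cons.prems(1)])
    ultimately show "\<exists>\<psi>. hom_on (adjoins A (y # ys)) \<psi> \<and> (\<forall>x\<in>A. \<psi> x = \<phi> x) \<and> \<psi> b \<noteq> 0"
      using \<psi>(2) by (intro exI[of _ \<omega>]) (auto simp: subset_iff)
  qed
qed

section \<open>Images of dominant rational maps\<close>

text \<open>A relation, since a polynomial function does not come with an expression for it.\<close>

inductive subst_rel :: "(nat \<Rightarrow> mpol fract) \<Rightarrow> nat \<Rightarrow> ((nat \<Rightarrow> complex) \<Rightarrow> complex) \<Rightarrow> mpol fract \<Rightarrow> bool"
  for F n where
  const: "subst_rel F n (\<lambda>x. a) (Fract (Mp (\<lambda>x. a)) 1)"
| coord: "i < n \<Longrightarrow> subst_rel F n (\<lambda>x. x i) (F i)"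
| add: "subst_rel F n f k \<Longrightarrow> subst_rel F n g l \<Longrightarrow> subst_rel F n (\<lambda>x. f x + g x) (k + l)"
| mult: "subst_rel F n f k \<Longrightarrow> subst_rel F n g l \<Longrightarrow> subst_rel F n (\<lambda>x. f x * g x) (k * l)"

lemma subst_rel_polyfuns: "subst_rel F n f k \<Longrightarrow> f \<in> polyfuns n"
  by (induction rule: subst_rel.induct) (auto intro: polyfuns.intros)

lemma ev_Mp_const [simp]: "ev (Mp (\<lambda>x. a)) z = a"
  using ev_Mp[OF polyfuns.const] by simp

text \<open>
  The subring \<open>A\<close> generated by the coordinates of \<open>\<Phi>\<close> is a polynomial ring, so every point \<open>x\<close> defines
  a homomorphism \<open>A \<rightarrow> \<complex>\<close>; away from the zeros of \<open>a\<close> it extends to the ring of all polynomial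
  functions with \<open>D\<close> mapped to a nonzero number, and the images of the variables form the point \<open>z\<close>.
\<close>

lemma dominant_image:
  assumes g: "\<And>j. j < n \<Longrightarrow> g j \<in> polyfuns N" and h: "\<And>j. j < n \<Longrightarrow> h j \<in> polyfuns N"
    and D: "D \<in> polyfuns N" "D z0 \<noteq> 0"
    and \<Phi>: "\<And>z j. D z \<noteq> 0 \<Longrightarrow> j < n \<Longrightarrow> h j z \<noteq> 0 \<and> \<Phi> z j = g j z / h j z"
    and indep: "\<And>P x. P \<in> polyfuns n \<Longrightarrow> (\<And>z. D z \<noteq> 0 \<Longrightarrow> P (\<Phi> z) = 0) \<Longrightarrow> P x = 0"
  shows "\<exists>a\<in>polyfuns n. (\<exists>x. a x \<noteq> 0) \<and> (\<forall>x. a x \<noteq> 0 \<longrightarrow> (\<exists>z. D z \<noteq> 0 \<and> (\<forall>j<n. \<Phi> z j = x j)))"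
proof -
  define F where "F j = Fract (Mp (g j)) (Mp (h j))" for j
  define emb where "emb p = Fract p 1" for p :: mpol
  have emb: "emb (p + q) = emb p + emb q" "emb (p * q) = emb p * emb q" "emb p = 0 \<longleftrightarrow> p = 0" "emb 1 = 1" for p q
    by (auto simp: emb_def eq_fract Zero_fract_def One_fract_def)
  have ev0: "v \<noteq> 0" if "\<And>z. D z \<noteq> 0 \<Longrightarrow> ev v z \<noteq> 0" for v
    using that[OF D(2)] by auto
  \<comment> \<open>Substitution in the fraction field and substitution of values agree wherever
    \<open>D\<close> is nonzero.\<close>
  have sem: "\<exists>u v. k = Fract u v \<and> (\<forall>z. D z \<noteq> 0 \<longrightarrow> ev v z \<noteq> 0 \<and> f (\<Phi> z) = ev u z / ev v z)"
    if "subst_rel F n f k" for f k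
    using that
  proof (induction rule: subst_rel.induct)
    case (const a)
    show ?case by (rule exI[of _ "Mp (\<lambda>x. a)"], rule exI[of _ 1]) simp
  next
    case (coord i)
    then show ?case unfolding F_def using \<Phi>
      by (intro exI[of _ "Mp (g i)"] exI[of _ "Mp (h i)"]) (auto simp: ev_Mp[OF g] ev_Mp[OF h])
  next
    case (add f k f' k')
    then obtain u v u' v' where uv: "k = Fract u v" "\<And>z. D z \<noteq> 0 \<Longrightarrow> ev v z \<noteq> 0 \<and> f (\<Phi> z) = ev u z / ev v z"
      "k' = Fract u' v'" "\<And>z. D z \<noteq> 0 \<Longrightarrow> ev v' z \<noteq> 0 \<and> f' (\<Phi> z) = ev u' z / ev v' z" by metis
    then have "v \<noteq> 0" "v' \<noteq> 0" using ev0 by blast+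
    then show ?case using uv
      by (intro exI[of _ "u * v' + u' * v"] exI[of _ "v * v'"]) (auto simp: add_frac_eq)
  next
    case (mult f k f' k')
    then obtain u v u' v' where uv: "k = Fract u v" "\<And>z. D z \<noteq> 0 \<Longrightarrow> ev v z \<noteq> 0 \<and> f (\<Phi> z) = ev u z / ev v z"
      "k' = Fract u' v'" "\<And>z. D z \<noteq> 0 \<Longrightarrow> ev v' z \<noteq> 0 \<and> f' (\<Phi> z) = ev u' z / ev v' z" by metis
    then show ?case
      by (intro exI[of _ "u * u'"] exI[of _ "v * v'"]) auto
  qed
  \<comment> \<open>Two polynomials with the same image agree at all values of
    \<open>\<Phi>\<close>, hence everywhere by \<open>indep\<close>; so the elements
    \<open>F j\<close> satisfy no polynomial relation.\<close>
  have inj: "f = f'" if s: "subst_rel F n f k" "subst_rel F n f' k" for f f' k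
  proof -
    obtain u v u' v' where uv: "k = Fract u v" "\<And>z. D z \<noteq> 0 \<Longrightarrow> ev v z \<noteq> 0 \<and> f (\<Phi> z) = ev u z / ev v z"
      "k = Fract u' v'" "\<And>z. D z \<noteq> 0 \<Longrightarrow> ev v' z \<noteq> 0 \<and> f' (\<Phi> z) = ev u' z / ev v' z"
      using sem[OF s(1)] sem[OF s(2)] by metis
    then have "v \<noteq> 0" "v' \<noteq> 0" using ev0 by blast+
    then have "u * v' = u' * v" using uv(1,3) by (simp add: eq_fract)
    then have eq: "ev u z * ev v' z = ev u' z * ev v z" for z by (metis ev_simps(4))
    have "f (\<Phi> z) - f' (\<Phi> z) = 0" if "D z \<noteq> 0" for z
      using uv(2,4)[OF that] eq[of z] by (simp add: frac_eq_eq)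
    then have "f x - f' x = 0" for x
      using polyfuns_diff[OF subst_rel_polyfuns[OF s(1)] subst_rel_polyfuns[OF s(2)]]
      by (rule_tac indep) auto
    then show ?thesis by auto
  qed
  define A where "A = {k. \<exists>f. subst_rel F n f k}"
  have neg1: "Fract (Mp (\<lambda>x. - 1)) 1 = (- 1 :: mpol fract)"
  proof -
    have "Mp (\<lambda>x. - 1) = - 1" by (rule ev_eqI) simp
    then show ?thesis by (simp add: One_fract_def)
  qed
  have one: "subst_rel F n (\<lambda>x. 1) 1"
  proof -
    have "Mp (\<lambda>x. 1) = 1" by (rule ev_eqI) simp
    then show ?thesis using subst_rel.const[of F n 1] by (simp add: One_fract_def)
  qed
  have A: "subring_set A"
    unfolding subring_set_def
  proof (intro conjI ballI)
    show "1 \<in> A" using one by (auto simp: A_def)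
    fix k l assume "k \<in> A" "l \<in> A"
    then obtain f f' where ff: "subst_rel F n f k" "subst_rel F n f' l" by (auto simp: A_def)
    show "k * l \<in> A" using subst_rel.mult[OF ff] by (auto simp: A_def)
    show "k - l \<in> A"
      using subst_rel.add[OF ff(1) subst_rel.mult[OF subst_rel.const[of F n "- 1"] ff(2)]]
      unfolding neg1 by (auto simp: A_def)
  qed
  define lft where "lft k = (THE f. subst_rel F n f k)" for k
  have lft: "lft k = f" if "subst_rel F n f k" for k f
    unfolding lft_def using that inj by blast
  have hom: "hom_on A (\<lambda>k. lft k x)" for x
    unfolding hom_on_def
  proof (intro conjI ballI)
    show "lft 1 x = 1" by (simp add: lft[OF one])
    fix k l assume "k \<in> A" "l \<in> A"
    then obtain f f' where ff: "subst_rel F n f k" "subst_rel F n f' l" by (auto simp: A_def)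
    show "lft (k + l) x = lft k x + lft l x" by (simp add: lft[OF ff(1)] lft[OF ff(2)] lft[OF subst_rel.add[OF ff]])
    show "lft (k * l) x = lft k x * lft l x" by (simp add: lft[OF ff(1)] lft[OF ff(2)] lft[OF subst_rel.mult[OF ff]])
  qed
  \<comment> \<open>Adjoining the variables to \<open>A\<close> yields a ring that contains all
    polynomial functions in \<open>N\<close> variables, in particular \<open>D\<close>.\<close>
  define ys where "ys = map (\<lambda>i. emb (mX i)) [0..<N]"
  note R = subring_setD[OF conjunct1[OF adjoins_props[OF A, of ys]]]
  have incl: "A \<subseteq> adjoins A ys" "set ys \<subseteq> adjoins A ys" using adjoins_props[OF A, of ys] by auto
  have constA: "emb (Mp (\<lambda>x. a)) \<in> A" for a unfolding A_def emb_def using subst_rel.const by blast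
  have Mp_add: "Mp (\<lambda>x. f x + f' x) = Mp f + Mp f'" "Mp (\<lambda>x. f x * f' x) = Mp f * Mp f'"
    if "f \<in> polyfuns N" "f' \<in> polyfuns N" for f f'
    by (auto intro!: ev_eqI simp: ev_Mp[OF that(1)] ev_Mp[OF that(2)] ev_Mp[OF polyfuns.add[OF that]] ev_Mp[OF polyfuns.mult[OF that]])
  have emb_in: "emb (Mp p) \<in> adjoins A ys" if "p \<in> polyfuns N" for p
    using that
  proof (induction rule: polyfuns.induct)
    case (const a)
    then show ?case using constA incl by blast
  next
    case (coord i)
    then show ?case using incl(2) by (auto simp: ys_def mX_def)
  qed (simp_all add: Mp_add emb R)
  have "emb (Mp D) \<noteq> 0" using D by (auto simp: emb Mp_eq_0_iff)
  from hom_extend_list[OF A emb_in[OF D(1)] this] obtain a where a: "a \<in> A" "a \<noteq> 0"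
    and ext: "\<And>\<phi> :: _ \<Rightarrow> complex. hom_on A \<phi> \<Longrightarrow> \<phi> a \<noteq> 0 \<Longrightarrow>
      \<exists>\<psi>. hom_on (adjoins A ys) \<psi> \<and> (\<forall>x\<in>A. \<psi> x = \<phi> x) \<and> \<psi> (emb (Mp D)) \<noteq> 0" by blast
  obtain f where f: "subst_rel F n f a" using a by (auto simp: A_def)
  show ?thesis
  proof (intro bexI[of _ f] conjI allI impI)
    show "f \<in> polyfuns n" by (rule subst_rel_polyfuns[OF f])
    show "\<exists>x. f x \<noteq> 0"
    proof (rule ccontr)
      assume "\<nexists>x. f x \<noteq> 0"
      then have "f = (\<lambda>x. 0)" by auto
      obtain u v where uv: "a = Fract u v" "\<And>z. D z \<noteq> 0 \<Longrightarrow> ev v z \<noteq> 0 \<and> f (\<Phi> z) = ev u z / ev v z"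
        using sem[OF f] by blast
      \<comment> \<open>The factor \<open>D\<close> extends the vanishing of the numerator to all
        points.\<close>
      have "ev (u * Mp D) z = 0" for z
        using uv(2)[of z] by (cases "D z = 0") (auto simp: ev_Mp[OF D(1)] \<open>f = _\<close>)
      then have "u * Mp D = 0" by (intro ev_eqI) simp
      then have "u = 0" using D by (auto simp: Mp_eq_0_iff)
      then show False using a(2) uv(1) by (simp add: fract_collapse)
    qed
    fix x assume "f x \<noteq> 0"
    then have "lft a x \<noteq> 0" by (simp add: lft[OF f])
    from ext[OF hom this] obtain \<psi> where \<psi>: "hom_on (adjoins A ys) \<psi>" "\<And>k. k \<in> A \<Longrightarrow> \<psi> k = lft k x"
      "\<psi> (emb (Mp D)) \<noteq> 0" by blast
    define z where "z i = \<psi> (emb (mX i))" for i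
    have \<psi>p: "\<psi> (emb (Mp p)) = p z" if "p \<in> polyfuns N" for p
      using that
    proof (induction rule: polyfuns.induct)
      case (const a)
      have "\<psi> (emb (Mp (\<lambda>x. a))) = lft (emb (Mp (\<lambda>x. a))) x" by (rule \<psi>(2)[OF constA])
      also have "\<dots> = a" unfolding emb_def lft[OF subst_rel.const] ..
      finally show ?case .
    next
      case (coord i)
      then show ?case by (simp add: z_def mX_def)
    next
      case (add p q)
      then show ?case using hom_onD(2)[OF \<psi>(1) emb_in emb_in] by (simp add: Mp_add emb)
    next
      case (mult p q)
      then show ?case using hom_onD(3)[OF \<psi>(1) emb_in emb_in] by (simp add: Mp_add emb)
    qed
    have Dz: "D z \<noteq> 0" using \<psi>(3) \<psi>p[OF D(1)] by simp
    moreover have "\<Phi> z j = x j" if j: "j < n" for j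
    proof -
      have hz: "h j z \<noteq> 0" "\<Phi> z j = g j z / h j z" using \<Phi>[OF Dz j] by auto
      have FA: "F j \<in> A" using subst_rel.coord[OF j] by (auto simp: A_def)
      have "Mp (h j) \<noteq> 0" using hz(1) h[OF j] by (auto simp: Mp_eq_0_iff)
      \<comment> \<open>Applying \<open>\<psi>\<close> to this equation identifies
        \<open>x j\<close> with the value of the quotient at \<open>z\<close>.\<close>
      then have "F j * emb (Mp (h j)) = emb (Mp (g j))" by (simp add: F_def emb_def eq_fract)
      then have "\<psi> (F j) * \<psi> (emb (Mp (h j))) = \<psi> (emb (Mp (g j)))"
        using hom_onD(3)[OF \<psi>(1), of "F j" "emb (Mp (h j))"] FA incl(1) emb_in[OF h[OF j]] by auto
      moreover have "\<psi> (F j) = x j" using \<psi>(2)[OF FA] lft[OF subst_rel.coord[OF j, of F]] by simp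
      ultimately show ?thesis using hz \<psi>p[OF g[OF j]] \<psi>p[OF h[OF j]] by (metis nonzero_mult_div_cancel_right)
    qed
    ultimately show "\<exists>z. D z \<noteq> 0 \<and> (\<forall>j<n. \<Phi> z j = x j)" by blast
  qed
qed

section \<open>Orbits of positive rational actions\<close>

lemma polyfuns_mult_nonzero:
  assumes "f \<in> polyfuns n" "g \<in> polyfuns n" "f u \<noteq> 0" "g w \<noteq> 0"
  shows "\<exists>z. f z * g z \<noteq> 0"
  using polyfuns_no_zero_divisors[OF assms(1,2)] assms(3,4) by blast

locale positive_action =
  fixes I :: "'i set" and d :: nat
    and E :: "'i \<Rightarrow> nat \<Rightarrow> (nat \<Rightarrow> complex) \<Rightarrow> complex"
  assumes E: "i \<in> I \<Longrightarrow> j < d \<Longrightarrow> E i j \<in> prat (Suc d)"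
begin

text \<open>The coordinate \<open>d\<close> of the argument of \<open>E i j\<close> is the parameter of the action.\<close>

definition stp :: "'i \<Rightarrow> complex \<Rightarrow> (nat \<Rightarrow> complex) \<Rightarrow> nat \<Rightarrow> complex" where
  "stp i c s = (\<lambda>j. if j < d then E i j (s(d := c)) else 1)"

text \<open>The letters of the word \<open>u\<close> act with the parameters \<open>z p, z (p + 1), \<dots>\<close>\<close>

primrec word_act :: "'i list \<Rightarrow> nat \<Rightarrow> (nat \<Rightarrow> complex) \<Rightarrow> (nat \<Rightarrow> complex) \<Rightarrow> nat \<Rightarrow> complex" where
  "word_act [] p z s = s"
| "word_act (i # u) p z s = stp i (z p) (word_act u (Suc p) z s)"

lemma stp_cong: "i \<in> I \<Longrightarrow> (\<And>j. j < d \<Longrightarrow> s j = s' j) \<Longrightarrow> stp i c s = stp i c s'"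
  unfolding stp_def by (intro ext) (auto intro!: prat_cong[OF E])

text \<open>All coordinates are covered, also those from \<open>d\<close> on, because
  \<open>stp\<close> sets them to \<open>1\<close>.\<close>

lemma stp_pos:
  assumes "i \<in> I" "\<And>j. j < d \<Longrightarrow> s j \<in> posreal" "c \<in> posreal"
  shows "stp i c s j \<in> posreal"
  using assms prat_pos[OF E[OF assms(1)], of j "s(d := c)"] by (auto simp: stp_def)

text \<open>The parameters may also be moved to another position, as happens when a word becomes
  part of a longer one.\<close>

lemma word_act_cong:
  assumes "set u \<subseteq> I" "\<And>k. k < length u \<Longrightarrow> z (p + k) = z' (p' + k)" "\<And>j. j < d \<Longrightarrow> s j = s' j" "j < d"
  shows "word_act u p z s j = word_act u p' z' s' j"
  using assms
proof (induction u arbitrary: p p' j)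
  case (Cons i u)
  have "word_act u (Suc p) z s j = word_act u (Suc p') z' s' j" if "j < d" for j
  proof (rule Cons.IH[OF _ _ _ that])
    show "z (Suc p + k) = z' (Suc p' + k)" if "k < length u" for k
      using Cons.prems(2)[of "Suc k"] that by simp
  qed (use Cons.prems in auto)
  moreover have "z p = z' p'" using Cons.prems(2)[of 0] by simp
  ultimately show ?case using Cons.prems(1) stp_cong[of i "word_act u (Suc p) z s"] by simp
qed simp

text \<open>\<open>v\<close> acts before \<open>u\<close> and reads the parameters behind those of
  \<open>u\<close>.\<close>

lemma word_act_append:
  "word_act (u @ v) p z s = word_act u p z (word_act v (p + length u) z s)"
  by (induction u arbitrary: p) auto

lemma word_act_pos:
  assumes "set u \<subseteq> I" "posvec z" "\<And>j. j < d \<Longrightarrow> s j \<in> posreal" "j < d"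
  shows "word_act u p z s j \<in> posreal"
  using assms by (induction u arbitrary: p j) (auto intro: stp_pos simp: posvec_def)

text \<open>One sequence \<open>z\<close> holds both the point, in the coordinates below
  \<open>d\<close>, and the parameters, from \<open>p\<close> on; thus the action of a word is a
  single function in which point and parameters vary together.\<close>

lemma word_act_prat:
  assumes "set u \<subseteq> I" "p + length u \<le> N" "d \<le> N" "j < d"
  shows "(\<lambda>z. word_act u p z z j) \<in> prat N"
  using assms
proof (induction u arbitrary: p j)
  case Nil
  then show ?case by (auto intro: prat.coord)
next
  case (Cons i u)
  have "(\<lambda>z. E i j (\<lambda>k. (\<lambda>z. if k < d then word_act u (Suc p) z z k else z p) z)) \<in> prat N"
  proof (rule prat_subst[where f = "E i j" and g = "\<lambda>k z. if k < d then word_act u (Suc p) z z k else z p"])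
    show "E i j \<in> prat (Suc d)" using Cons.prems by (intro E) auto
    fix k assume "k < Suc d"
    show "(\<lambda>z. if k < d then word_act u (Suc p) z z k else z p) \<in> prat N"
    proof (cases "k < d")
      case True
      then show ?thesis using Cons.IH[of "Suc p" k] Cons.prems by simp
    next
      case False
      then show ?thesis using Cons.prems by (auto intro: prat.coord)
    qed
  qed
  moreover have "E i j (\<lambda>k. if k < d then word_act u (Suc p) z z k else z p) =
      E i j ((word_act u (Suc p) z z)(d := z p))" for z
    using Cons.prems by (intro prat_cong[OF E]) auto
  ultimately show ?case using Cons.prems(4) by (simp add: stp_def)
qed

end

text \<open>\<open>R\<close> stands for lying in one orbit, and \<open>f i\<close> is a guard: where
  it is nonzero, the letter \<open>i\<close> moves a point inside its orbit. In
  \<open>tropical\<close> the word and the exponents of its parameters depend on \<open>b\<close>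
  only, not on the starting point.\<close>

locale positive_orbits = positive_action I d E for I :: "'i set" and d E +
  fixes f :: "'i \<Rightarrow> (nat \<Rightarrow> complex) \<Rightarrow> complex"
    and R :: "(nat \<Rightarrow> complex) \<Rightarrow> (nat \<Rightarrow> complex) \<Rightarrow> bool"
  assumes act_one: "i \<in> I \<Longrightarrow> posvec s \<Longrightarrow> j < d \<Longrightarrow> stp i 1 s j = s j"
    and act_inverse: "i \<in> I \<Longrightarrow> posvec s \<Longrightarrow> c \<in> posreal \<Longrightarrow> j < d \<Longrightarrow> stp i c (stp i (inverse c) s) j = s j"
    and f: "i \<in> I \<Longrightarrow> f i \<in> polyfuns (Suc d)" "i \<in> I \<Longrightarrow> \<exists>z. f i z \<noteq> 0"
    and R_refl: "R s s" and R_trans: "R s s' \<Longrightarrow> R s' s'' \<Longrightarrow> R s s''"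
    and R_cong: "R s s' \<Longrightarrow> (\<And>j. j < d \<Longrightarrow> s j = r j) \<Longrightarrow> (\<And>j. j < d \<Longrightarrow> s' j = r' j) \<Longrightarrow> R r r'"
    and R_step: "i \<in> I \<Longrightarrow> f i (s(d := c)) \<noteq> 0 \<Longrightarrow> R s (stp i c s)"
    and tropical: "\<exists>u n. set u \<subseteq> I \<and> (\<forall>s. posvec s \<longrightarrow>
      (\<forall>j<d. has_exp (\<lambda>c. word_act u 0 (\<lambda>k. complex_of_real c powi n k) s j) (b j)))"
begin

lemma word_act_one:
  assumes "set u \<subseteq> I" "\<And>k. k < length u \<Longrightarrow> z (p + k) = 1" "posvec s" "j < d"
  shows "word_act u p z s j = s j"
  using assms
proof (induction u arbitrary: p j)
  case (Cons i u)
  have "word_act u (Suc p) z s j = s j" if "j < d" for j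
  proof (rule Cons.IH[OF _ _ _ that])
    show "z (Suc p + k) = 1" if "k < length u" for k
      using Cons.prems(2)[of "Suc k"] that by simp
  qed (use Cons.prems in auto)
  then have "stp i (z p) (word_act u (Suc p) z s) = stp i (z p) s"
    using Cons.prems(1) by (intro stp_cong) auto
  then show ?case using Cons.prems act_one[of i s j] Cons.prems(2)[of 0] by simp
qed simp

text \<open>Each letter is undone by the same letter with the inverse parameter. Used to place the
  image of a word at a point where a guard does not vanish.\<close>

lemma word_act_surj:
  assumes "set u \<subseteq> I" "posvec z" "posvec w"
  shows "\<exists>s. posvec s \<and> (\<forall>j<d. word_act u p z s j = w j)"
  using assms
proof (induction u arbitrary: p w)
  case (Cons i u)
  have zp: "z p \<in> posreal" using Cons.prems by (auto simp: posvec_def)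
  let ?w = "stp i (inverse (z p)) w"
  have "posvec ?w" using Cons.prems zp by (auto simp: posvec_def intro!: stp_pos)
  from Cons.IH[OF _ Cons.prems(2) this, of "Suc p"] Cons.prems(1)
  obtain s where s: "posvec s" "\<forall>j<d. word_act u (Suc p) z s j = ?w j" by auto
  then have "stp i (z p) (word_act u (Suc p) z s) = stp i (z p) ?w"
    using Cons.prems(1) by (intro stp_cong) auto
  then show ?case using s(1) act_inverse[of i w "z p"] Cons.prems zp by (intro exI[of _ s]) auto
qed auto

text \<open>All intermediate points must avoid the zeros of the guards. Pulled back along a word, a
  guard becomes a quotient with positive denominator, and it is not identically zero because words
  are surjective on positive points.\<close>

lemma word_act_related:
  assumes "set u \<subseteq> I" "d \<le> p"
  shows "\<exists>G\<in>polyfuns (p + length u). (\<exists>z. G z \<noteq> 0) \<and> (\<forall>z. G z \<noteq> 0 \<longrightarrow> R z (word_act u p z z))"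
  using assms
proof (induction u arbitrary: p)
  case Nil
  then show ?case by (intro bexI[of _ "\<lambda>_. 1"]) (auto intro: R_refl polyfuns.const)
next
  case (Cons i u)
  let ?N = "p + length (i # u)"
  have i: "i \<in> I" "set u \<subseteq> I" using Cons.prems by auto
  obtain G where G: "G \<in> polyfuns ?N" "\<exists>z. G z \<noteq> 0" "\<And>z. G z \<noteq> 0 \<Longrightarrow> R z (word_act u (Suc p) z z)"
    using Cons.IH[of "Suc p"] Cons.prems by auto
  let ?g = "\<lambda>k z. if k < d then word_act u (Suc p) z z k else z p"
  have "?g k \<in> prat ?N" if "k < Suc d" for k
    using word_act_prat[of u "Suc p" ?N k] i Cons.prems(2) by (cases "k < d") (auto intro: prat.coord)
  from polyfuns_prat_quotient[OF f(1)[OF i(1)], where g = ?g, OF this]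
  obtain U V where UV: "U \<in> polyfuns ?N" "V \<in> pospoly ?N"
    "\<And>z. V z \<noteq> 0 \<Longrightarrow> f i (\<lambda>k. ?g k z) = U z / V z" by auto
  have fg: "f i (\<lambda>k. ?g k z) = f i ((word_act u (Suc p) z z)(d := z p))" for z
    by (rule polyfuns_cong[OF f(1)[OF i(1)]]) auto
  obtain w where w: "posvec w" "f i w \<noteq> 0" using f[OF i(1)] polyfuns_nonzero_pos by metis
  obtain s where s: "posvec s" "\<forall>j<d. word_act u (Suc p) (\<lambda>_. 1) s j = w j"
    using word_act_surj[OF i(2) posvec_ones w(1), of "Suc p"] by auto
  \<comment> \<open>The point \<open>s\<close> occupies the first \<open>d\<close> coordinates and
    the parameter of the new letter \<open>i\<close> the position \<open>p\<close>; the inner word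
    runs with all parameters equal to \<open>1\<close>.\<close>
  define z where "z = (\<lambda>k. if k < d then s k else if k = p then w d else 1)"
  have "posvec z" using s(1) w(1) by (auto simp: z_def posvec_def)
  have "word_act u (Suc p) z z j = w j" if "j < d" for j
    using s(2) that Cons.prems(2) word_act_cong[OF i(2), of z "Suc p" "\<lambda>_. 1" "Suc p" z s j]
    by (auto simp: z_def)
  then have "f i (\<lambda>k. ?g k z) = f i w"
    using Cons.prems(2) by (intro polyfuns_cong[OF f(1)[OF i(1)]]) (auto simp: z_def less_Suc_eq)
  moreover have "V z \<noteq> 0" by (rule pospoly_pos_nonzero[OF UV(2) \<open>posvec z\<close>])
  ultimately have "U z * V z \<noteq> 0" using UV(3) w(2) by auto
  moreover have UVp: "(\<lambda>z. U z * V z) \<in> polyfuns ?N" using UV by (auto intro: polyfuns.mult pospoly_polyfuns)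
  ultimately have "\<exists>z. G z * (U z * V z) \<noteq> 0" using polyfuns_mult_nonzero[OF G(1) UVp] G(2) by blast
  moreover have "R z (word_act (i # u) p z z)" if "G z * (U z * V z) \<noteq> 0" for z
  proof -
    have "f i ((word_act u (Suc p) z z)(d := z p)) \<noteq> 0" using that UV(3)[of z] unfolding fg by auto
    from R_step[OF i(1) this] G(3)[of z] that show ?thesis using R_trans by auto
  qed
  ultimately show ?case
    using polyfuns.mult[OF G(1) UVp] by (intro bexI[of _ "\<lambda>z. G z * (U z * V z)"]) auto
qed

section \<open>Relations between a point and its image\<close>

definition graph :: "'i list \<Rightarrow> (nat \<Rightarrow> complex) \<Rightarrow> nat \<Rightarrow> complex" where
  "graph u z k = (if k < d then z k else if k < d + d then word_act u d z z (k - d) else 0)"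

lemma graph_eqI:
  "(\<And>j. j < d \<Longrightarrow> z' j = z j) \<Longrightarrow> (\<And>j. j < d \<Longrightarrow> word_act w' d z' z' j = word_act w d z z j) \<Longrightarrow>
    graph w' z' = graph w z"
  by (rule ext) (auto simp: graph_def)

text \<open>The vanishing ideal of the Zariski closure of all pairs of a positive point and its
  image under the word with positive parameters.\<close>

definition relations :: "'i list \<Rightarrow> mpol set" where
  "relations u = {P. \<forall>z. posvec z \<longrightarrow> ev P (graph u z) = 0}"

lemma graph_prat: "set u \<subseteq> I \<Longrightarrow> k < d + d \<Longrightarrow> (\<lambda>z. graph u z k) \<in> prat (d + length u)"
  unfolding graph_def by (cases "k < d") (auto intro!: prat.coord word_act_prat)

lemma graph_quotient:
  assumes "set u \<subseteq> I" "P \<in> polyfuns (d + d)"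
  obtains U V where "U \<in> polyfuns (d + length u)" "V \<in> pospoly (d + length u)"
    "\<And>z. V z \<noteq> 0 \<Longrightarrow> P (graph u z) = U z / V z"
  using polyfuns_prat_quotient[OF assms(2), where g = "\<lambda>k z. graph u z k", OF graph_prat[OF assms(1)]] that
  by metis

text \<open>Composition with the graph turns polynomials into quotients with positive denominators.
  If a product is a relation, then the product of the numerators vanishes at all positive points,
  and so does one of them.\<close>

lemma relations_prime:
  assumes u: "set u \<subseteq> I"
  shows "prime_in (mpols (d + d)) (relations u)"
  unfolding prime_in_def
proof (intro conjI ballI impI)
  fix P Q assume PQ: "P \<in> mpols (d + d)" "Q \<in> mpols (d + d)" "P * Q \<in> relations u"
  obtain U V where UV: "U \<in> polyfuns (d + length u)" "V \<in> pospoly (d + length u)"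
    "\<And>z. V z \<noteq> 0 \<Longrightarrow> ev P (graph u z) = U z / V z"
    using graph_quotient[OF u, of "ev P"] PQ by (auto simp: mpols_def)
  obtain U' V' where UV': "U' \<in> polyfuns (d + length u)" "V' \<in> pospoly (d + length u)"
    "\<And>z. V' z \<noteq> 0 \<Longrightarrow> ev Q (graph u z) = U' z / V' z"
    using graph_quotient[OF u, of "ev Q"] PQ by (auto simp: mpols_def)
  have "U z * U' z = 0" if z: "posvec z" for z
    using PQ(3) z UV(3)[of z] UV'(3)[of z] pospoly_pos_nonzero[OF UV(2) z] pospoly_pos_nonzero[OF UV'(2) z]
    by (auto simp: relations_def)
  from polyfuns_prime[OF UV(1) UV'(1) this]
  show "P \<in> relations u \<or> Q \<in> relations u"
  proof
    assume "\<forall>z. posvec z \<longrightarrow> U z = 0"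
    then have "P \<in> relations u" using UV(3) pospoly_pos_nonzero[OF UV(2)] by (simp add: relations_def)
    then show ?thesis ..
  next
    assume "\<forall>z. posvec z \<longrightarrow> U' z = 0"
    then have "Q \<in> relations u" using UV'(3) pospoly_pos_nonzero[OF UV'(2)] by (simp add: relations_def)
    then show ?thesis ..
  qed
qed (auto simp: relations_def)

text \<open>Parameters equal to \<open>1\<close> turn one part of the word into the identity, so a
  relation of the whole word is also a relation of the other part.\<close>

lemma relations_append:
  assumes u: "set u \<subseteq> I" "set v \<subseteq> I"
  shows "relations (u @ v) \<subseteq> relations u \<inter> relations v"
proof (intro subsetI IntI)
  fix P assume P: "P \<in> relations (u @ v)"
  show "P \<in> relations u" unfolding relations_def
  proof (intro CollectI allI impI)
    fix z assume z: "posvec z"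
    let ?z = "\<lambda>k. if k < d + length u then z k else 1"
    have pos: "posvec ?z" using z by (auto simp: posvec_def)
    have "word_act v (d + length u) ?z ?z j = z j" if "j < d" for j
      using word_act_one[OF u(2) _ pos that, where p = "d + length u"] that by simp
    then have "word_act (u @ v) d ?z ?z j = word_act u d z z j" if "j < d" for j
      unfolding word_act_append by (rule_tac word_act_cong[OF u(1) _ _ that]) auto
    then have eq: "graph (u @ v) ?z = graph u z" by (intro graph_eqI) auto
    have "ev P (graph (u @ v) ?z) = 0" using P pos unfolding relations_def by blast
    then show "ev P (graph u z) = 0" unfolding eq .
  qed
  show "P \<in> relations v" unfolding relations_def
  proof (intro CollectI allI impI)
    fix z assume z: "posvec z"
    \<comment> \<open>The parameters of \<open>u\<close> are inserted as \<open>1\<close> in front,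
      which shifts those of \<open>v\<close> by \<open>length u\<close>.\<close>
    let ?z = "\<lambda>k. if k < d then z k else if k < d + length u then 1 else z (k - length u)"
    let ?s = "word_act v (d + length u) ?z ?z"
    have pos: "posvec ?z" using z by (auto simp: posvec_def)
    have s: "?s j = word_act v d z z j" if "j < d" for j
      by (rule word_act_cong[OF u(2) _ _ that]) auto
    \<comment> \<open>Positivity of the image is known below \<open>d\<close>; the other entries are
      replaced by \<open>1\<close>, which does not affect the action.\<close>
    have pos': "posvec (\<lambda>j. if j < d then ?s j else 1)"
    proof -
      have "?s j \<in> posreal" if "j < d" for j
        by (rule word_act_pos[OF u(2) pos _ that]) (rule pos[unfolded posvec_def, rule_format])
      then show ?thesis by (simp add: posvec_def)
    qed
    have "word_act u d ?z ?s j = word_act u d ?z (\<lambda>j. if j < d then ?s j else 1) j" if "j < d" for j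
      by (rule word_act_cong[OF u(1) _ _ that]) auto
    then have "word_act (u @ v) d ?z ?z j = word_act v d z z j" if "j < d" for j
      unfolding word_act_append using word_act_one[OF u(1) _ pos' that, where z = ?z and p = d] that s by simp
    then have eq: "graph (u @ v) ?z = graph v z" by (intro graph_eqI) auto
    have "ev P (graph (u @ v) ?z) = 0" using P pos unfolding relations_def by blast
    then show "ev P (graph v z) = 0" unfolding eq .
  qed
qed

text \<open>Freezing the point at a positive value leaves a nonzero polynomial in the image. By
  \<open>tropical\<close> the image can be given exponents that are generic for this polynomial, so
  its value is eventually nonzero.\<close>

lemma relations_Inter:
  assumes P: "P \<in> mpols (d + d)" and rel: "\<And>u. set u \<subseteq> I \<Longrightarrow> P \<in> relations u"
  shows "P = 0"
proof (rule ccontr)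
  assume "P \<noteq> 0"
  then obtain z0 where "ev P z0 \<noteq> 0" by (metis ev_eqI ev_simps(1))
  have evP: "ev P \<in> polyfuns (d + d)" using P by (simp add: mpols_def)
  obtain z where z: "posvec z" "ev P z \<noteq> 0" using polyfuns_nonzero_pos[OF evP \<open>ev P z0 \<noteq> 0\<close>] .
  let ?Q = "\<lambda>s. ev P (\<lambda>k. if k < d then z k else s (k - d))"
  have "(\<lambda>s. if k < d then z k else s (k - d)) \<in> polyfuns d" if "k < d + d" for k
    using that by (cases "k < d") (auto intro: polyfuns.intros)
  from polyfuns_subst[OF evP this] have Q: "?Q \<in> polyfuns d" by simp
  have "?Q (\<lambda>k. z (d + k)) = ev P z" by (rule polyfuns_cong[OF evP]) auto
  then have "?Q (\<lambda>k. z (d + k)) \<noteq> 0" using z by simp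
  from polyfuns_generic_exponents[OF Q this] obtain b v where
    b: "\<And>y. (\<forall>i<d. has_exp (\<lambda>c. y c i) (b i)) \<Longrightarrow> \<exists>L. L \<noteq> 0 \<and> growth (\<lambda>c. ?Q (y c)) v L" by blast
  obtain u n where u: "set u \<subseteq> I"
    and un: "\<And>s. posvec s \<Longrightarrow> \<forall>j<d. has_exp (\<lambda>c. word_act u 0 (\<lambda>k. complex_of_real c powi n k) s j) (b j)"
    using tropical[of b] by blast
  let ?y = "\<lambda>c. word_act u 0 (\<lambda>k. complex_of_real c powi n k) z"
  obtain L where "L \<noteq> 0" "growth (\<lambda>c. ?Q (?y c)) v L" using b[OF un[OF z(1)]] by blast
  from eventually_conj[OF growth_nonzero[OF this(2,1)] eventually_gt_at_top[of 0]]
  obtain c :: real where c: "?Q (?y c) \<noteq> 0" "c > 0"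
    using eventually_happens'[OF trivial_limit_at_top_linorder] by blast
  \<comment> \<open>In \<open>graph\<close> the parameters start at position \<open>d\<close>,
    whereas the curve counts them from \<open>0\<close>.\<close>
  define z' where "z' = (\<lambda>k. if k < d then z k else complex_of_real c powi n (k - d))"
  have "complex_of_real c powi m \<in> posreal" for m
    using c(2) posreal_closed(5)[of "c powi m"] by (simp add: of_real_power_int[symmetric] del: of_real_power_int)
  then have "posvec z'" using z by (auto simp: posvec_def z'_def)
  have "word_act u d z' z' j = ?y c j" if "j < d" for j
    by (rule word_act_cong[OF u _ _ that]) (auto simp: z'_def)
  then have "ev P (graph u z') = ?Q (?y c)"
    by (intro polyfuns_cong[OF evP]) (auto simp: graph_def z'_def)
  then show False using rel[OF u] \<open>posvec z'\<close> c(1) by (auto simp: relations_def)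
qed

text \<open>For a word without relations the pairs of point and image contain a nonempty open set;
  its slice over one fixed first component is open in the second.\<close>

theorem open_orbit: "\<exists>s0. \<exists>N\<in>polyfuns d. (\<exists>s. N s \<noteq> 0) \<and> (\<forall>s. N s \<noteq> 0 \<longrightarrow> R s0 s)"
proof -
  have "\<exists>J\<in>relations ` {u. set u \<subseteq> I}. J \<inter> mpols (d + d) \<subseteq> {0}"
  proof (rule directed_primes)
    show "prime_in (mpols (d + d)) J" if "J \<in> relations ` {u. set u \<subseteq> I}" for J
      using that relations_prime by auto
    show "\<exists>K\<in>relations ` {u. set u \<subseteq> I}. K \<subseteq> J \<inter> J'" if J: "J \<in> relations ` {u. set u \<subseteq> I}" "J' \<in> relations ` {u. set u \<subseteq> I}" for J J'
    proof -
      obtain u v where uv: "J = relations u" "J' = relations v" "set u \<subseteq> I" "set v \<subseteq> I"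
        using J by auto
      show ?thesis
        using relations_append[OF uv(3,4)] uv by (intro bexI[of _ "relations (u @ v)"]) auto
    qed
    show "b = 0" if "b \<in> mpols (d + d)" "\<And>J. J \<in> relations ` {u. set u \<subseteq> I} \<Longrightarrow> b \<in> J" for b
      using relations_Inter[OF that(1)] that(2) by auto
  qed
  then obtain u where u: "set u \<subseteq> I" and rel: "relations u \<inter> mpols (d + d) \<subseteq> {0}" by auto
  let ?N = "d + length u"
  obtain G where G: "G \<in> polyfuns ?N" "\<exists>z. G z \<noteq> 0" "\<And>z. G z \<noteq> 0 \<Longrightarrow> R z (word_act u d z z)"
    using word_act_related[OF u order.refl] by auto
  have "\<forall>j\<in>{..<d + d}. \<exists>p\<in>pospoly ?N. \<exists>q\<in>pospoly ?N. \<forall>x. p x \<noteq> 0 \<longrightarrow> q x \<noteq> 0 \<longrightarrow> graph u x j = p x / q x"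
    using prat_quotient[OF graph_prat[OF u]] by auto
  then obtain p q where pq: "\<And>j. j < d + d \<Longrightarrow> p j \<in> pospoly ?N \<and> q j \<in> pospoly ?N"
    "\<And>j x. j < d + d \<Longrightarrow> p j x \<noteq> 0 \<Longrightarrow> q j x \<noteq> 0 \<Longrightarrow> graph u x j = p j x / q j x"
    by (metis lessThan_iff)
  have H: "(\<lambda>x. \<Prod>j<d + d. p j x * q j x) \<in> pospoly ?N"
    using pq(1) by (intro pospoly_prod pospoly_closed) auto
  \<comment> \<open>Where \<open>?D\<close> is nonzero, the point and its image are related and all
    coordinates of the graph are genuine quotients.\<close>
  let ?D = "\<lambda>x. G x * (\<Prod>j<d + d. p j x * q j x)"
  have D: "?D \<in> polyfuns ?N" by (rule polyfuns.mult[OF G(1) pospoly_polyfuns[OF H]])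
  obtain z0 where z0: "?D z0 \<noteq> 0"
    using polyfuns_mult_nonzero[OF G(1) pospoly_polyfuns[OF H]] G(2) pospoly_pos_nonzero[OF H posvec_ones] by blast
  have "\<exists>a\<in>polyfuns (d + d). (\<exists>x. a x \<noteq> 0) \<and>
      (\<forall>x. a x \<noteq> 0 \<longrightarrow> (\<exists>z. ?D z \<noteq> 0 \<and> (\<forall>j<d + d. graph u z j = x j)))"
  proof (rule dominant_image[OF _ _ D z0])
    show "p j \<in> polyfuns ?N" "q j \<in> polyfuns ?N" if "j < d + d" for j
      using pq(1)[OF that] pospoly_polyfuns by auto
    show "q j z \<noteq> 0 \<and> graph u z j = p j z / q j z" if "?D z \<noteq> 0" "j < d + d" for z j
      using that pq(2)[OF that(2)] by auto
    \<comment> \<open>\<open>?D\<close> and the denominator can be cancelled, so such a polynomial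
      is a relation of \<open>u\<close> and hence zero.\<close>
    fix P x assume P: "P \<in> polyfuns (d + d)" and 0: "\<And>z. ?D z \<noteq> 0 \<Longrightarrow> P (graph u z) = 0"
    obtain U V where UV: "U \<in> polyfuns ?N" "V \<in> pospoly ?N" "\<And>z. V z \<noteq> 0 \<Longrightarrow> P (graph u z) = U z / V z"
      using graph_quotient[OF u P] by metis
    have DV: "(\<lambda>z. ?D z * V z) \<in> polyfuns ?N" by (rule polyfuns.mult[OF D pospoly_polyfuns[OF UV(2)]])
    have "?D z * V z * U z = 0" for z
      using 0[of z] UV(3)[of z] by (cases "?D z = 0"; cases "V z = 0") auto
    moreover have "\<exists>z. ?D z * V z \<noteq> 0"
      using polyfuns_mult_nonzero[OF D pospoly_polyfuns[OF UV(2)] z0 pospoly_pos_nonzero[OF UV(2) posvec_ones]] .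
    ultimately have "U z = 0" for z using polyfuns_no_zero_divisors[OF DV UV(1)] by blast
    then have "Mp P \<in> relations u"
      using UV(3) pospoly_pos_nonzero[OF UV(2)] by (auto simp: relations_def ev_Mp[OF P])
    then have "Mp P = 0" using rel Mp_in_mpols[OF P] by blast
    then show "P x = 0" using Mp_eq_0_iff[OF P] by blast
  qed
  then obtain a x0 where a: "a \<in> polyfuns (d + d)" "a x0 \<noteq> 0"
    and im: "\<And>x. a x \<noteq> 0 \<Longrightarrow> \<exists>z. ?D z \<noteq> 0 \<and> (\<forall>j<d + d. graph u z j = x j)" by blast
  \<comment> \<open>The first half is frozen at that of a point \<open>x0\<close> where
    \<open>a\<close> is nonzero, so the slice is not empty.\<close>
  let ?M = "\<lambda>s. a (\<lambda>k. if k < d then x0 k else s (k - d))"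
  have "(\<lambda>s. if k < d then x0 k else s (k - d)) \<in> polyfuns d" if "k < d + d" for k
    using that by (cases "k < d") (auto intro: polyfuns.intros)
  from polyfuns_subst[OF a(1) this] have M: "?M \<in> polyfuns d" by simp
  have "?M (\<lambda>k. x0 (d + k)) = a x0" by (rule polyfuns_cong[OF a(1)]) auto
  then have ex: "\<exists>s. ?M s \<noteq> 0" using a(2) by (intro exI[of _ "\<lambda>k. x0 (d + k)"]) simp
  have R: "R x0 s" if s: "?M s \<noteq> 0" for s
  proof -
    obtain z where z: "?D z \<noteq> 0" "\<And>j. j < d + d \<Longrightarrow> graph u z j = (if j < d then x0 j else s (j - d))"
      using im[OF s] by blast
    have "R z (word_act u d z z)" using G(3) z(1) by auto
    then show ?thesis
    proof (rule R_cong)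
      show "z j = x0 j" if "j < d" for j using z(2)[of j] that by (simp add: graph_def)
      show "word_act u d z z j = s j" if "j < d" for j using z(2)[of "d + j"] that by (simp add: graph_def)
    qed
  qed
  show ?thesis by (rule exI[of _ x0], rule bexI[OF _ M], intro conjI ex allI impI, rule R)
qed

end

section \<open>Spaces with functions\<close>

text \<open>
  The common generalisation of the structure sheaves of varieties and of their products in which
  regular functions form rings and have open non-vanishing loci.
\<close>

locale ringed_space =
  fixes S :: "'a fspace"
  assumes sheaf: "sheaf S"
    and const: "openin (zar S) U \<Longrightarrow> (\<lambda>_. a) \<in> regs S U"
    and add: "openin (zar S) U \<Longrightarrow> f \<in> regs S U \<Longrightarrow> g \<in> regs S U \<Longrightarrow> (\<lambda>x. f x + g x) \<in> regs S U"
    and mult: "openin (zar S) U \<Longrightarrow> f \<in> regs S U \<Longrightarrow> g \<in> regs S U \<Longrightarrow> (\<lambda>x. f x * g x) \<in> regs S U"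
    and inv: "openin (zar S) U \<Longrightarrow> f \<in> regs S U \<Longrightarrow> (\<And>x. x \<in> U \<Longrightarrow> f x \<noteq> 0) \<Longrightarrow>
      (\<lambda>x. inverse (f x)) \<in> regs S U"
    and nonzero_open: "openin (zar S) U \<Longrightarrow> f \<in> regs S U \<Longrightarrow> openin (zar S) {x \<in> U. f x \<noteq> 0}"

lemma sheaf_cong:
  assumes "sheaf S" "openin (zar S) U" "f \<in> regs S U" "\<And>x. x \<in> U \<Longrightarrow> g x = f x"
  shows "g \<in> regs S U"
proof -
  have "\<forall>U f g. openin (zar S) U \<longrightarrow> f \<in> regs S U \<longrightarrow> (\<forall>x\<in>U. g x = f x) \<longrightarrow> g \<in> regs S U"
    using assms(1) unfolding sheaf_def by (rule conjunct1)
  from this[rule_format, OF assms(2,3)] assms(4) show ?thesis by blast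
qed

lemma sheaf_restrict:
  assumes "sheaf S" "openin (zar S) U" "openin (zar S) V" "V \<subseteq> U" "f \<in> regs S U"
  shows "f \<in> regs S V"
proof -
  have "\<forall>U V f. openin (zar S) U \<longrightarrow> openin (zar S) V \<longrightarrow> V \<subseteq> U \<longrightarrow> f \<in> regs S U \<longrightarrow> f \<in> regs S V"
    using assms(1) unfolding sheaf_def by (rule conjunct2[THEN conjunct1])
  from this[rule_format, OF assms(2-)] show ?thesis .
qed

lemma sheaf_glue:
  assumes "sheaf S" "openin (zar S) U"
    and "\<And>x. x \<in> U \<Longrightarrow> \<exists>V. openin (zar S) V \<and> x \<in> V \<and> V \<subseteq> U \<and> f \<in> regs S V"
  shows "f \<in> regs S U"
proof -
  have "\<forall>U f. openin (zar S) U \<longrightarrow>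
      (\<forall>x\<in>U. \<exists>V. openin (zar S) V \<and> x \<in> V \<and> V \<subseteq> U \<and> f \<in> regs S V) \<longrightarrow> f \<in> regs S U"
    using assms(1) unfolding sheaf_def by (rule conjunct2[THEN conjunct2])
  from this[rule_format, OF assms(2-)] show ?thesis .
qed

context ringed_space
begin

lemma sum: "finite A \<Longrightarrow> openin (zar S) U \<Longrightarrow> (\<And>i. i \<in> A \<Longrightarrow> f i \<in> regs S U) \<Longrightarrow>
    (\<lambda>x. \<Sum>i\<in>A. f i x) \<in> regs S U"
  by (induction A rule: finite_induct) (auto intro: const add)

lemma prod: "finite A \<Longrightarrow> openin (zar S) U \<Longrightarrow> (\<And>i. i \<in> A \<Longrightarrow> f i \<in> regs S U) \<Longrightarrow>
    (\<lambda>x. \<Prod>i\<in>A. f i x) \<in> regs S U"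
  by (induction A rule: finite_induct) (auto intro: const mult)

lemmas restrict = sheaf_restrict[OF sheaf]
lemmas cong = sheaf_cong[OF sheaf]
lemmas glue = sheaf_glue[OF sheaf]

end

subsection \<open>Spaces generated by rings of functions\<close>

text \<open>
  \<open>\<D>\<close> consists of pairs \<open>(D, A)\<close> of a basic domain \<open>D\<close> and a ring \<open>A\<close> of functions on it. This covers
  both the quotient construction (a single pair) and products (the pairs \<open>(U \<times> V, \<dots>)\<close>).
\<close>

definition gen_topology :: "('a set \<times> ('a \<Rightarrow> complex) set) set \<Rightarrow> 'a topology" where
  "gen_topology \<D> = topology_generated_by {{z \<in> D. h z \<noteq> 0} |D A h. (D, A) \<in> \<D> \<and> h \<in> A}"

definition gen_regs :: "('a set \<times> ('a \<Rightarrow> complex) set) set \<Rightarrow> 'a set \<Rightarrow> ('a \<Rightarrow> complex) set" where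
  "gen_regs \<D> W = {f. \<forall>z\<in>W. \<exists>D A. (D, A) \<in> \<D> \<and> z \<in> D \<and>
     (\<exists>g\<in>A. \<exists>h\<in>A. h z \<noteq> 0 \<and> (\<forall>w\<in>W \<inter> D. h w \<noteq> 0 \<longrightarrow> f w = g w / h w))}"

text \<open>Functions are total, so restricting them to a smaller domain does not change them; hence
  \<open>gInt\<close> can express restriction to an intersection by inclusions.\<close>

locale generated_space =
  fixes S :: "'a fspace" and \<D> :: "('a set \<times> ('a \<Rightarrow> complex) set) set"
  assumes zar_eq: "zar S = gen_topology \<D>"
    and regs_eq: "openin (zar S) W \<Longrightarrow> regs S W = gen_regs \<D> W"
    and gconst: "(D, A) \<in> \<D> \<Longrightarrow> (\<lambda>_. a) \<in> A"
    and gadd: "(D, A) \<in> \<D> \<Longrightarrow> f \<in> A \<Longrightarrow> g \<in> A \<Longrightarrow> (\<lambda>x. f x + g x) \<in> A"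
    and gmult: "(D, A) \<in> \<D> \<Longrightarrow> f \<in> A \<Longrightarrow> g \<in> A \<Longrightarrow> (\<lambda>x. f x * g x) \<in> A"
    and gInt: "(D, A) \<in> \<D> \<Longrightarrow> (D', A') \<in> \<D> \<Longrightarrow> \<exists>B. (D \<inter> D', B) \<in> \<D> \<and> A \<subseteq> B \<and> A' \<subseteq> B"
begin

lemma basic_open: "(D, A) \<in> \<D> \<Longrightarrow> h \<in> A \<Longrightarrow> openin (zar S) {z \<in> D. h z \<noteq> 0}"
  unfolding zar_eq gen_topology_def by (intro topology_generated_by_Basis) blast

lemma domain_open: "(D, A) \<in> \<D> \<Longrightarrow> openin (zar S) D"
  using basic_open[of D A "\<lambda>_. 1"] gconst by simp

text \<open>The intersection of two generating sets is again one, with the product of both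
  functions; so they form a basis and not just a subbasis.\<close>

lemma basis:
  assumes "openin (zar S) W" "z \<in> W"
  obtains D A h where "(D, A) \<in> \<D>" "h \<in> A" "z \<in> D" "h z \<noteq> 0" "{w \<in> D. h w \<noteq> 0} \<subseteq> W"
proof -
  let ?P = "\<lambda>W z. \<exists>D A h. (D, A) \<in> \<D> \<and> h \<in> A \<and> z \<in> D \<and> h z \<noteq> 0 \<and> {w \<in> D. h w \<noteq> 0} \<subseteq> W"
  have "generate_topology_on {{z \<in> D. h z \<noteq> 0} |D A h. (D, A) \<in> \<D> \<and> h \<in> A} W"
    using assms(1) unfolding zar_eq gen_topology_def openin_topology_generated_by_iff .
  then have "\<forall>z\<in>W. ?P W z"
  proof (induction rule: generate_topology_on.induct)
    case (Int a b)
    show ?case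
    proof
      fix z assume z: "z \<in> a \<inter> b"
      then have "?P a z" "?P b z" using Int.IH by simp_all
      then obtain D A h D' A' h' where *: "(D, A) \<in> \<D>" "h \<in> A" "z \<in> D" "h z \<noteq> 0" "{w \<in> D. h w \<noteq> 0} \<subseteq> a"
        "(D', A') \<in> \<D>" "h' \<in> A'" "z \<in> D'" "h' z \<noteq> 0" "{w \<in> D'. h' w \<noteq> 0} \<subseteq> b"
        by (elim exE conjE)
      obtain B where B: "(D \<inter> D', B) \<in> \<D>" "A \<subseteq> B" "A' \<subseteq> B" using gInt[OF *(1,6)] by blast
      have "(\<lambda>w. h w * h' w) \<in> B" using B * by (intro gmult[OF B(1)]) auto
      then show "?P (a \<inter> b) z" using B(1) *
        by (intro exI[of _ "D \<inter> D'"] exI[of _ B] exI[of _ "\<lambda>w. h w * h' w"]) auto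
    qed
  next
    case (UN K)
    show ?case
    proof
      fix z assume "z \<in> \<Union> K"
      then obtain k where k: "k \<in> K" "z \<in> k" by auto
      then have "?P k z" using UN.IH by simp
      then obtain D A h where *: "(D, A) \<in> \<D>" "h \<in> A" "z \<in> D" "h z \<noteq> 0" "{w \<in> D. h w \<noteq> 0} \<subseteq> k"
        by (elim exE conjE)
      moreover have "k \<subseteq> \<Union> K" using k by auto
      ultimately show "?P (\<Union> K) z" by (intro exI[of _ D] exI[of _ A] exI[of _ h]) auto
    qed
  next
    case (Basis s)
    then show ?case by blast
  qed auto
  then have "?P W z" using assms(2) by simp
  then show ?thesis using that by (elim exE conjE)
qed

lemma points: "pts S = \<Union> (fst ` \<D>)"
proof
  show "pts S \<subseteq> \<Union> (fst ` \<D>)"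
  proof
    fix z assume "z \<in> pts S"
    then obtain D A h where "(D, A) \<in> \<D>" "z \<in> D" by (metis basis openin_topspace)
    then show "z \<in> \<Union> (fst ` \<D>)" by force
  qed
  show "\<Union> (fst ` \<D>) \<subseteq> pts S" using domain_open openin_subset by fastforce
qed

lemma regsI:
  assumes W: "openin (zar S) W"
    and loc: "\<And>z. z \<in> W \<Longrightarrow> \<exists>D A g h. (D, A) \<in> \<D> \<and> z \<in> D \<and> g \<in> A \<and> h \<in> A \<and> h z \<noteq> 0 \<and>
      (\<forall>w\<in>W \<inter> D. h w \<noteq> 0 \<longrightarrow> f w = g w / h w)"
  shows "f \<in> regs S W"
  unfolding regs_eq[OF W] gen_regs_def mem_Collect_eq
proof
  fix z assume "z \<in> W"
  from loc[OF this] obtain D A g h where "(D, A) \<in> \<D>" "z \<in> D" "g \<in> A" "h \<in> A" "h z \<noteq> 0"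
    "\<forall>w\<in>W \<inter> D. h w \<noteq> 0 \<longrightarrow> f w = g w / h w" by (elim exE conjE)
  then show "\<exists>D A. (D, A) \<in> \<D> \<and> z \<in> D \<and> (\<exists>g\<in>A. \<exists>h\<in>A. h z \<noteq> 0 \<and> (\<forall>w\<in>W \<inter> D. h w \<noteq> 0 \<longrightarrow> f w = g w / h w))"
    by (intro exI[of _ D] exI[of _ A] conjI bexI[of _ g] bexI[of _ h])
qed

lemma regsD:
  assumes "f \<in> regs S W" "openin (zar S) W" "z \<in> W"
  obtains D A g h where "(D, A) \<in> \<D>" "z \<in> D" "g \<in> A" "h \<in> A" "h z \<noteq> 0"
    "\<forall>w\<in>W \<inter> D. h w \<noteq> 0 \<longrightarrow> f w = g w / h w"
proof -
  have "\<exists>D A. (D, A) \<in> \<D> \<and> z \<in> D \<and> (\<exists>g\<in>A. \<exists>h\<in>A. h z \<noteq> 0 \<and> (\<forall>w\<in>W \<inter> D. h w \<noteq> 0 \<longrightarrow> f w = g w / h w))"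
    using assms(1,3) unfolding regs_eq[OF assms(2)] gen_regs_def mem_Collect_eq by (rule bspec)
  then obtain D A g h where "(D, A) \<in> \<D>" "z \<in> D" "g \<in> A" "h \<in> A" "h z \<noteq> 0"
    "\<forall>w\<in>W \<inter> D. h w \<noteq> 0 \<longrightarrow> f w = g w / h w" by (elim exE conjE bexE)
  then show ?thesis by (intro that[of D A g h]) auto
qed

lemma regsD2:
  assumes "f \<in> regs S W" "f' \<in> regs S W" "openin (zar S) W" "z \<in> W"
  obtains D A g h g' h' where "(D, A) \<in> \<D>" "z \<in> D" "g \<in> A" "h \<in> A" "g' \<in> A" "h' \<in> A" "h z \<noteq> 0" "h' z \<noteq> 0"
    "\<forall>w\<in>W \<inter> D. h w \<noteq> 0 \<longrightarrow> f w = g w / h w"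
    "\<forall>w\<in>W \<inter> D. h' w \<noteq> 0 \<longrightarrow> f' w = g' w / h' w"
proof -
  obtain D A g h where 1: "(D, A) \<in> \<D>" "z \<in> D" "g \<in> A" "h \<in> A" "h z \<noteq> 0"
    "\<forall>w\<in>W \<inter> D. h w \<noteq> 0 \<longrightarrow> f w = g w / h w"
    by (rule regsD[OF assms(1,3,4)])
  obtain D' A' g' h' where 2: "(D', A') \<in> \<D>" "z \<in> D'" "g' \<in> A'" "h' \<in> A'" "h' z \<noteq> 0"
    "\<forall>w\<in>W \<inter> D'. h' w \<noteq> 0 \<longrightarrow> f' w = g' w / h' w"
    by (rule regsD[OF assms(2,3,4)])
  obtain B where B: "(D \<inter> D', B) \<in> \<D>" "A \<subseteq> B" "A' \<subseteq> B" using gInt[OF 1(1) 2(1)] by blast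
  show ?thesis
    by (rule that[OF B(1), of g h g' h']) (use 1 2 B in auto)
qed

sublocale ringed_space S
proof
  show "sheaf S" unfolding sheaf_def
  proof (intro conjI allI impI)
    fix U f g assume U: "openin (zar S) U" "f \<in> regs S U" "\<forall>x\<in>U. g x = f x"
    show "g \<in> regs S U"
    proof (rule regsI[OF U(1)])
      fix z assume "z \<in> U"
      then obtain D A g' h where *: "(D, A) \<in> \<D>" "z \<in> D" "g' \<in> A" "h \<in> A" "h z \<noteq> 0"
        "\<forall>w\<in>U \<inter> D. h w \<noteq> 0 \<longrightarrow> f w = g' w / h w"
        by (rule regsD[OF U(2,1)])
      show "\<exists>D A g' h. (D, A) \<in> \<D> \<and> z \<in> D \<and> g' \<in> A \<and> h \<in> A \<and> h z \<noteq> 0 \<and>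
          (\<forall>w\<in>U \<inter> D. h w \<noteq> 0 \<longrightarrow> g w = g' w / h w)"
        by (rule exI[of _ D], rule exI[of _ A], rule exI[of _ g'], rule exI[of _ h]) (use * U(3) in auto)
    qed
  next
    fix U V f assume U: "openin (zar S) U" "openin (zar S) V" "V \<subseteq> U" "f \<in> regs S U"
    show "f \<in> regs S V"
    proof (rule regsI[OF U(2)])
      fix z assume "z \<in> V"
      then have "z \<in> U" using U(3) by auto
      then obtain D A g' h where *: "(D, A) \<in> \<D>" "z \<in> D" "g' \<in> A" "h \<in> A" "h z \<noteq> 0"
        "\<forall>w\<in>U \<inter> D. h w \<noteq> 0 \<longrightarrow> f w = g' w / h w"
        by (rule regsD[OF U(4,1)])
      show "\<exists>D A g' h. (D, A) \<in> \<D> \<and> z \<in> D \<and> g' \<in> A \<and> h \<in> A \<and> h z \<noteq> 0 \<and>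
          (\<forall>w\<in>V \<inter> D. h w \<noteq> 0 \<longrightarrow> f w = g' w / h w)"
        by (rule exI[of _ D], rule exI[of _ A], rule exI[of _ g'], rule exI[of _ h]) (use * U(3) in auto)
    qed
  next
    fix U f assume U: "openin (zar S) U"
      and loc: "\<forall>x\<in>U. \<exists>V. openin (zar S) V \<and> x \<in> V \<and> V \<subseteq> U \<and> f \<in> regs S V"
    show "f \<in> regs S U"
    proof (rule regsI[OF U])
      fix z assume "z \<in> U"
      then obtain V where V: "openin (zar S) V" "z \<in> V" "V \<subseteq> U" "f \<in> regs S V" using loc by blast
      obtain D A g h where *: "(D, A) \<in> \<D>" "z \<in> D" "g \<in> A" "h \<in> A" "h z \<noteq> 0"
        "\<forall>w\<in>V \<inter> D. h w \<noteq> 0 \<longrightarrow> f w = g w / h w"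
        by (rule regsD[OF V(4,1,2)])
      obtain D' A' h' where **: "(D', A') \<in> \<D>" "h' \<in> A'" "z \<in> D'" "h' z \<noteq> 0" "{w \<in> D'. h' w \<noteq> 0} \<subseteq> V"
        by (rule basis[OF V(1,2)])
      obtain B where B: "(D \<inter> D', B) \<in> \<D>" "A \<subseteq> B" "A' \<subseteq> B" using gInt[OF *(1) **(1)] by blast
      \<comment> \<open>The factor \<open>h'\<close> confines the representation to the smaller set
        on which it is known.\<close>
      have "(\<lambda>w. g w * h' w) \<in> B" "(\<lambda>w. h w * h' w) \<in> B" using B * ** by (auto intro!: gmult[OF B(1)])
      then show "\<exists>D A g' h. (D, A) \<in> \<D> \<and> z \<in> D \<and> g' \<in> A \<and> h \<in> A \<and> h z \<noteq> 0 \<and>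
          (\<forall>w\<in>U \<inter> D. h w \<noteq> 0 \<longrightarrow> f w = g' w / h w)"
        by (intro exI[of _ "D \<inter> D'"] exI[of _ B] exI[of _ "\<lambda>w. g w * h' w"] exI[of _ "\<lambda>w. h w * h' w"])
          (use B * ** in auto)
    qed
  qed
next
  fix U a assume U: "openin (zar S) U"
  show "(\<lambda>_. a) \<in> regs S U"
  proof (rule regsI[OF U])
    fix z assume "z \<in> U"
    then obtain D A h where D: "(D, A) \<in> \<D>" "z \<in> D" using basis[OF U] by metis
    show "\<exists>D A g' h. (D, A) \<in> \<D> \<and> z \<in> D \<and> g' \<in> A \<and> h \<in> A \<and> h z \<noteq> 0 \<and>
        (\<forall>w\<in>U \<inter> D. h w \<noteq> 0 \<longrightarrow> a = g' w / h w)"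
      by (intro exI[of _ D] exI[of _ A] exI[of _ "\<lambda>_. a"] exI[of _ "\<lambda>_. 1"]) (use D gconst in auto)
  qed
next
  fix U f f' assume U: "openin (zar S) U" "f \<in> regs S U" "f' \<in> regs S U"
  show "(\<lambda>x. f x + f' x) \<in> regs S U"
  proof (rule regsI[OF U(1)])
    fix z assume "z \<in> U"
    then obtain D A g h g' h' where *: "(D, A) \<in> \<D>" "z \<in> D" "g \<in> A" "h \<in> A" "g' \<in> A" "h' \<in> A" "h z \<noteq> 0" "h' z \<noteq> 0"
      "\<forall>w\<in>U \<inter> D. h w \<noteq> 0 \<longrightarrow> f w = g w / h w"
      "\<forall>w\<in>U \<inter> D. h' w \<noteq> 0 \<longrightarrow> f' w = g' w / h' w"
      by (rule regsD2[OF U(2,3,1)])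
    have "(\<lambda>w. g w * h' w + g' w * h w) \<in> A" "(\<lambda>w. h w * h' w) \<in> A"
      using * by (auto intro!: gmult[OF *(1)] gadd[OF *(1)])
    then show "\<exists>D A g' h. (D, A) \<in> \<D> \<and> z \<in> D \<and> g' \<in> A \<and> h \<in> A \<and> h z \<noteq> 0 \<and>
        (\<forall>w\<in>U \<inter> D. h w \<noteq> 0 \<longrightarrow> f w + f' w = g' w / h w)"
      by (intro exI[of _ D] exI[of _ A] exI[of _ "\<lambda>w. g w * h' w + g' w * h w"] exI[of _ "\<lambda>w. h w * h' w"])
        (use * in \<open>auto simp: add_frac_eq\<close>)
  qed
  show "(\<lambda>x. f x * f' x) \<in> regs S U"
  proof (rule regsI[OF U(1)])
    fix z assume "z \<in> U"
    then obtain D A g h g' h' where *: "(D, A) \<in> \<D>" "z \<in> D" "g \<in> A" "h \<in> A" "g' \<in> A" "h' \<in> A" "h z \<noteq> 0" "h' z \<noteq> 0"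
      "\<forall>w\<in>U \<inter> D. h w \<noteq> 0 \<longrightarrow> f w = g w / h w"
      "\<forall>w\<in>U \<inter> D. h' w \<noteq> 0 \<longrightarrow> f' w = g' w / h' w"
      by (rule regsD2[OF U(2,3,1)])
    have "(\<lambda>w. g w * g' w) \<in> A" "(\<lambda>w. h w * h' w) \<in> A"
      using * by (auto intro!: gmult[OF *(1)])
    then show "\<exists>D A g' h. (D, A) \<in> \<D> \<and> z \<in> D \<and> g' \<in> A \<and> h \<in> A \<and> h z \<noteq> 0 \<and>
        (\<forall>w\<in>U \<inter> D. h w \<noteq> 0 \<longrightarrow> f w * f' w = g' w / h w)"
      by (intro exI[of _ D] exI[of _ A] exI[of _ "\<lambda>w. g w * g' w"] exI[of _ "\<lambda>w. h w * h' w"])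
        (use * in auto)
  qed
next
  fix U f assume U: "openin (zar S) U" "f \<in> regs S U" and nz: "\<And>x. x \<in> U \<Longrightarrow> f x \<noteq> 0"
  show "(\<lambda>x. inverse (f x)) \<in> regs S U"
  proof (rule regsI[OF U(1)])
    fix z assume z: "z \<in> U"
    then obtain D A g h where *: "(D, A) \<in> \<D>" "z \<in> D" "g \<in> A" "h \<in> A" "h z \<noteq> 0"
      "\<forall>w\<in>U \<inter> D. h w \<noteq> 0 \<longrightarrow> f w = g w / h w"
      by (rule regsD[OF U(2,1)])
    have gz: "g z * h z \<noteq> 0" using *(2,5) *(6)[rule_format, of z] z nz[OF z] by auto
    have "(\<lambda>w. h w * h w) \<in> A" "(\<lambda>w. g w * h w) \<in> A" using * by (auto intro!: gmult[OF *(1)])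
    then show "\<exists>D A g' h. (D, A) \<in> \<D> \<and> z \<in> D \<and> g' \<in> A \<and> h \<in> A \<and> h z \<noteq> 0 \<and>
        (\<forall>w\<in>U \<inter> D. h w \<noteq> 0 \<longrightarrow> inverse (f w) = g' w / h w)"
      by (intro exI[of _ D] exI[of _ A] exI[of _ "\<lambda>w. h w * h w"] exI[of _ "\<lambda>w. g w * h w"])
        (use * gz in auto)
  qed
next
  fix U f assume U: "openin (zar S) U" "f \<in> regs S U"
  show "openin (zar S) {x \<in> U. f x \<noteq> 0}"
  proof (subst openin_subopen, intro ballI)
    fix z assume z: "z \<in> {x \<in> U. f x \<noteq> 0}"
    then have zU: "z \<in> U" by auto
    obtain D A g h where *: "(D, A) \<in> \<D>" "z \<in> D" "g \<in> A" "h \<in> A" "h z \<noteq> 0"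
      "\<forall>w\<in>U \<inter> D. h w \<noteq> 0 \<longrightarrow> f w = g w / h w"
      by (rule regsD[OF U(2,1) zU])
    have "(\<lambda>w. g w * h w) \<in> A" using * by (auto intro!: gmult[OF *(1)])
    from openin_Int[OF U(1) basic_open[OF *(1) this]]
    show "\<exists>T. openin (zar S) T \<and> z \<in> T \<and> T \<subseteq> {x \<in> U. f x \<noteq> 0}"
      by (intro exI[of _ "U \<inter> {w \<in> D. g w * h w \<noteq> 0}"]) (use z *(2,5,6) in auto)
  qed
qed

lemma generator_regular:
  assumes "(D, A) \<in> \<D>" "a \<in> A"
  shows "a \<in> regs S D"
proof (rule regsI[OF domain_open[OF assms(1)]])
  fix z assume "z \<in> D"
  then show "\<exists>D' A g h. (D', A) \<in> \<D> \<and> z \<in> D' \<and> g \<in> A \<and> h \<in> A \<and> h z \<noteq> 0 \<and>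
      (\<forall>w\<in>D \<inter> D'. h w \<noteq> 0 \<longrightarrow> a w = g w / h w)"
    using assms gconst[OF assms(1)]
    by (intro exI[of _ D] exI[of _ A] exI[of _ a] exI[of _ "\<lambda>_. 1"]) auto
qed

end

lemma quot_space_generated:
  assumes "\<And>a. (\<lambda>_. a) \<in> A" "\<And>f g. f \<in> A \<Longrightarrow> g \<in> A \<Longrightarrow> (\<lambda>x. f x + g x) \<in> A"
    "\<And>f g. f \<in> A \<Longrightarrow> g \<in> A \<Longrightarrow> (\<lambda>x. f x * g x) \<in> A"
  shows "generated_space (quot_space Z A) {(Z, A)}"
proof
  show zar: "zar (quot_space Z A) = gen_topology {(Z, A)}"
    unfolding quot_space_def gen_topology_def
    by simp
  fix W assume "openin (zar (quot_space Z A)) W"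
  then have "W \<subseteq> \<Union> {{x \<in> Z. h x \<noteq> 0} |h. h \<in> A}"
    using openin_subset[of "zar (quot_space Z A)" W] by (simp add: quot_space_def)
  also have "\<dots> \<subseteq> Z" by blast
  finally have "W \<subseteq> Z" .
  then have "W \<inter> Z = W" "\<And>z. z \<in> W \<Longrightarrow> z \<in> Z" by auto
  then show "regs (quot_space Z A) W = gen_regs {(Z, A)} W"
    unfolding quot_space_def gen_regs_def by simp
qed (use assms in auto)

lemma (in generated_space) ringed: "ringed_space S"
  by (rule ringed_space_axioms)

lemma polyfuns_generated: "generated_space (quot_space Z (polyfuns n)) {(Z, polyfuns n)}"
  by (rule quot_space_generated) (auto intro: polyfuns.intros)

lemma poly_generated: "generated_space (quot_space Z (range (poly :: complex poly \<Rightarrow> _))) {(Z, range poly)}"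
proof (rule quot_space_generated)
  show "(\<lambda>_. a) \<in> range (poly :: complex poly \<Rightarrow> _)" for a by (rule range_eqI[of _ _ "[:a:]"]) auto
next
  fix f g :: "complex \<Rightarrow> complex" assume "f \<in> range poly" "g \<in> range poly"
  then obtain p q where pq: "f = poly p" "g = poly q" by auto
  show "(\<lambda>x. f x + g x) \<in> range poly" by (rule range_eqI[of _ _ "p + q"]) (auto simp: pq)
  show "(\<lambda>x. f x * g x) \<in> range poly" by (rule range_eqI[of _ _ "p * q"]) (auto simp: pq)
qed

subsection \<open>Products\<close>

lemma tensor_funsI:
  "(\<And>k. k < n \<Longrightarrow> f k \<in> regs S U) \<Longrightarrow> (\<And>k. k < n \<Longrightarrow> g k \<in> regs S' V) \<Longrightarrow>
    (\<lambda>(x, y). \<Sum>k<(n::nat). f k x * g k y) \<in> tensor_funs S U S' V"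
  unfolding tensor_funs_def by blast

lemma tensor_funsE:
  assumes "h \<in> tensor_funs S U S' V"
  obtains n :: nat and f g where "h = (\<lambda>(x, y). \<Sum>k<n. f k x * g k y)"
    "\<And>k. k < n \<Longrightarrow> f k \<in> regs S U" "\<And>k. k < n \<Longrightarrow> g k \<in> regs S' V"
  using assms unfolding tensor_funs_def by blast

lemma tensor_single:
  assumes "f \<in> regs S U" "g \<in> regs S' V"
  shows "(\<lambda>(x, y). f x * g y) \<in> tensor_funs S U S' V"
  using tensor_funsI[of 1 "\<lambda>_. f" S U "\<lambda>_. g" S' V] assms by simp

lemma tensor_add:
  assumes "h \<in> tensor_funs S U S' V" "h' \<in> tensor_funs S U S' V"
  shows "(\<lambda>z. h z + h' z) \<in> tensor_funs S U S' V"
proof -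
  obtain n f g where h: "h = (\<lambda>(x, y). \<Sum>k<(n::nat). f k x * g k y)"
    "\<And>k. k < n \<Longrightarrow> f k \<in> regs S U" "\<And>k. k < n \<Longrightarrow> g k \<in> regs S' V" by (rule tensor_funsE[OF assms(1)]) blast
  obtain n' f' g' where h': "h' = (\<lambda>(x, y). \<Sum>k<(n'::nat). f' k x * g' k y)"
    "\<And>k. k < n' \<Longrightarrow> f' k \<in> regs S U" "\<And>k. k < n' \<Longrightarrow> g' k \<in> regs S' V" by (rule tensor_funsE[OF assms(2)]) blast
  let ?f = "\<lambda>k. if k < n then f k else f' (k - n)" and ?g = "\<lambda>k. if k < n then g k else g' (k - n)"
  have "(\<Sum>k<n + n'. ?f k x * ?g k y) = (\<Sum>k<n. f k x * g k y) + (\<Sum>k<n'. f' k x * g' k y)" for x y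
  proof -
    have "(\<Sum>k<n + n'. ?f k x * ?g k y) = (\<Sum>k<n. ?f k x * ?g k y) + (\<Sum>k=n..<n + n'. ?f k x * ?g k y)"
      by (metis (no_types, lifting) atLeast0LessThan le_add1 sum.atLeastLessThan_concat zero_le)
    also have "(\<Sum>k=n..<n + n'. ?f k x * ?g k y) = (\<Sum>k<n'. f' k x * g' k y)"
      using sum.shift_bounds_nat_ivl[of "\<lambda>k. ?f k x * ?g k y" 0 n n'] by (simp add: atLeast0LessThan add.commute)
    finally show ?thesis by simp
  qed
  then have "(\<lambda>z. h z + h' z) = (\<lambda>(x, y). \<Sum>k<n + n'. ?f k x * ?g k y)" by (auto simp: h(1) h'(1) fun_eq_iff)
  moreover have "(\<lambda>(x, y). \<Sum>k<n + n'. ?f k x * ?g k y) \<in> tensor_funs S U S' V"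
    using h h' by (intro tensor_funsI) auto
  ultimately show ?thesis by simp
qed

lemma tensor_sum:
  assumes "finite A" "(\<lambda>_. 0) \<in> tensor_funs S U S' V" "\<And>i. i \<in> A \<Longrightarrow> h i \<in> tensor_funs S U S' V"
  shows "(\<lambda>z. \<Sum>i\<in>A. h i z) \<in> tensor_funs S U S' V"
  using assms by (induction A rule: finite_induct) (auto intro: tensor_add)

definition prod_gens :: "'a fspace \<Rightarrow> 'b fspace \<Rightarrow> (('a \<times> 'b) set \<times> ('a \<times> 'b \<Rightarrow> complex) set) set" where
  "prod_gens S S' = {(U \<times> V, tensor_funs S U S' V) |U V. openin (zar S) U \<and> openin (zar S') V}"

lemma tensor_const:
  assumes "ringed_space S" "ringed_space S'" "openin (zar S) U" "openin (zar S') V"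
  shows "(\<lambda>_. a) \<in> tensor_funs S U S' V"
  using tensor_single[OF ringed_space.const[OF assms(1,3), of a] ringed_space.const[OF assms(2,4), of 1]]
  by (simp add: split_def)

lemma tensor_mult:
  assumes S: "ringed_space S" "ringed_space S'" and U: "openin (zar S) U" "openin (zar S') V"
    and h: "h \<in> tensor_funs S U S' V" and h': "h' \<in> tensor_funs S U S' V"
  shows "(\<lambda>z. h z * h' z) \<in> tensor_funs S U S' V"
proof -
  obtain n f g where hh: "h = (\<lambda>(x, y). \<Sum>k<(n::nat). f k x * g k y)"
    "\<And>k. k < n \<Longrightarrow> f k \<in> regs S U" "\<And>k. k < n \<Longrightarrow> g k \<in> regs S' V" by (rule tensor_funsE[OF h]) blast
  obtain n' f' g' where hh': "h' = (\<lambda>(x, y). \<Sum>k<(n'::nat). f' k x * g' k y)"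
    "\<And>k. k < n' \<Longrightarrow> f' k \<in> regs S U" "\<And>k. k < n' \<Longrightarrow> g' k \<in> regs S' V" by (rule tensor_funsE[OF h']) blast
  let ?t = "\<lambda>k z. \<Sum>l<n'. (case z of (x, y) \<Rightarrow> (f k x * f' l x) * (g k y * g' l y))"
  have t: "?t k \<in> tensor_funs S U S' V" if "k < n" for k
  proof (rule tensor_sum[OF _ tensor_const[OF S U]])
    fix l assume "l \<in> {..<n'}"
    then have "(\<lambda>x. f k x * f' l x) \<in> regs S U" "(\<lambda>y. g k y * g' l y) \<in> regs S' V"
      using that hh(2,3) hh'(2,3) by (auto intro: ringed_space.mult[OF S(1) U(1)] ringed_space.mult[OF S(2) U(2)])
    then show "(\<lambda>z. case z of (x, y) \<Rightarrow> f k x * f' l x * (g k y * g' l y)) \<in> tensor_funs S U S' V"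
      by (rule tensor_single)
  qed simp
  have "(\<lambda>z. \<Sum>k<n. ?t k z) \<in> tensor_funs S U S' V"
    by (rule tensor_sum[OF _ tensor_const[OF S U]]) (use t in auto)
  moreover have "(\<lambda>z. \<Sum>k<n. ?t k z) = (\<lambda>z. h z * h' z)"
    by (auto simp: hh(1) hh'(1) fun_eq_iff sum_product intro!: sum.cong)
  ultimately show ?thesis by simp
qed

lemma tensor_restrict:
  assumes S: "ringed_space S" "ringed_space S'"
    and U: "openin (zar S) U" "openin (zar S') V" "openin (zar S) U'" "openin (zar S') V'" "U' \<subseteq> U" "V' \<subseteq> V"
  shows "tensor_funs S U S' V \<subseteq> tensor_funs S U' S' V'"
proof
  fix h assume "h \<in> tensor_funs S U S' V"
  then obtain n f g where hh: "h = (\<lambda>(x, y). \<Sum>k<(n::nat). f k x * g k y)"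
    "\<And>k. k < n \<Longrightarrow> f k \<in> regs S U" "\<And>k. k < n \<Longrightarrow> g k \<in> regs S' V" by (rule tensor_funsE) blast
  show "h \<in> tensor_funs S U' S' V'"
    unfolding hh(1)
  proof (rule tensor_funsI)
    show "f k \<in> regs S U'" if "k < n" for k
      by (rule ringed_space.restrict[OF S(1) U(1,3,5) hh(2)[OF that]])
    show "g k \<in> regs S' V'" if "k < n" for k
      by (rule ringed_space.restrict[OF S(2) U(2,4,6) hh(3)[OF that]])
  qed
qed

text \<open>Makes the results on generated spaces available for products; restricting tensors to
  smaller boxes gives the common refinement.\<close>

lemma fprod_generated:
  assumes S: "ringed_space S" "ringed_space S'"
  shows "generated_space (fprod S S') (prod_gens S S')"
proof
  have "{{z \<in> U \<times> V. h z \<noteq> 0} |U V h. openin (zar S) U \<and> openin (zar S') V \<and> h \<in> tensor_funs S U S' V} =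
      {{z \<in> D. h z \<noteq> 0} |D A h. (D, A) \<in> prod_gens S S' \<and> h \<in> A}" (is "?L = ?R")
  proof (intro equalityI subsetI)
    fix X assume "X \<in> ?L"
    then obtain U V h where "X = {z \<in> U \<times> V. h z \<noteq> 0}" "openin (zar S) U" "openin (zar S') V"
      "h \<in> tensor_funs S U S' V" by (elim CollectE exE conjE)
    then show "X \<in> ?R"
      by (intro CollectI exI[of _ "U \<times> V"] exI[of _ "tensor_funs S U S' V"] exI[of _ h] conjI)
        (auto simp: prod_gens_def)
  next
    fix X assume "X \<in> ?R"
    then obtain D A h where X: "X = {z \<in> D. h z \<noteq> 0}" "(D, A) \<in> prod_gens S S'" "h \<in> A"
      by (elim CollectE exE conjE)
    then obtain U V where "D = U \<times> V" "A = tensor_funs S U S' V" "openin (zar S) U" "openin (zar S') V"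
      by (auto simp: prod_gens_def)
    then show "X \<in> ?L" using X(1,3)
      by (intro CollectI exI[of _ U] exI[of _ V] exI[of _ h] conjI) simp_all
  qed
  then show "zar (fprod S S') = gen_topology (prod_gens S S')"
    unfolding fprod_def gen_topology_def by simp
  fix W
  show "regs (fprod S S') W = gen_regs (prod_gens S S') W"
  proof (intro equalityI subsetI)
    fix f assume f: "f \<in> regs (fprod S S') W"
    show "f \<in> gen_regs (prod_gens S S') W"
      unfolding gen_regs_def mem_Collect_eq
    proof
      fix z assume "z \<in> W"
      with f have "\<exists>U V. openin (zar S) U \<and> openin (zar S') V \<and> z \<in> U \<times> V \<and>
        (\<exists>g\<in>tensor_funs S U S' V. \<exists>h\<in>tensor_funs S U S' V. h z \<noteq> 0 \<and>
           (\<forall>w \<in> W \<inter> (U \<times> V). h w \<noteq> 0 \<longrightarrow> f w = g w / h w))"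
        by (simp add: fprod_def)
      then obtain U V where *: "openin (zar S) U" "openin (zar S') V" "z \<in> U \<times> V"
        "\<exists>g\<in>tensor_funs S U S' V. \<exists>h\<in>tensor_funs S U S' V. h z \<noteq> 0 \<and>
           (\<forall>w \<in> W \<inter> (U \<times> V). h w \<noteq> 0 \<longrightarrow> f w = g w / h w)" by (elim exE conjE)
      show "\<exists>D A. (D, A) \<in> prod_gens S S' \<and> z \<in> D \<and>
        (\<exists>g\<in>A. \<exists>h\<in>A. h z \<noteq> 0 \<and> (\<forall>w\<in>W \<inter> D. h w \<noteq> 0 \<longrightarrow> f w = g w / h w))"
        using * by (intro exI[of _ "U \<times> V"] exI[of _ "tensor_funs S U S' V"] conjI) (auto simp: prod_gens_def)
    qed
  next
    fix f assume f: "f \<in> gen_regs (prod_gens S S') W"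
    have "\<exists>U V. openin (zar S) U \<and> openin (zar S') V \<and> z \<in> U \<times> V \<and>
        (\<exists>g\<in>tensor_funs S U S' V. \<exists>h\<in>tensor_funs S U S' V. h z \<noteq> 0 \<and>
           (\<forall>w \<in> W \<inter> (U \<times> V). h w \<noteq> 0 \<longrightarrow> f w = g w / h w))" if "z \<in> W" for z
    proof -
      have "\<exists>D A. (D, A) \<in> prod_gens S S' \<and> z \<in> D \<and>
        (\<exists>g\<in>A. \<exists>h\<in>A. h z \<noteq> 0 \<and> (\<forall>w\<in>W \<inter> D. h w \<noteq> 0 \<longrightarrow> f w = g w / h w))"
        using f that unfolding gen_regs_def mem_Collect_eq by (rule bspec)
      then obtain D A where DA: "(D, A) \<in> prod_gens S S'" "z \<in> D"
        "\<exists>g\<in>A. \<exists>h\<in>A. h z \<noteq> 0 \<and> (\<forall>w\<in>W \<inter> D. h w \<noteq> 0 \<longrightarrow> f w = g w / h w)"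
        by (elim exE conjE)
      from DA(1) obtain U V where "D = U \<times> V" "A = tensor_funs S U S' V" "openin (zar S) U" "openin (zar S') V"
        by (auto simp: prod_gens_def)
      then show ?thesis using DA(2,3) by (intro exI[of _ U] exI[of _ V] conjI) simp_all
    qed
    then show "f \<in> regs (fprod S S') W" by (simp add: fprod_def)
  qed
next
  fix D A assume "(D, A) \<in> prod_gens S S'"
  then obtain U V where UV: "D = U \<times> V" "A = tensor_funs S U S' V" "openin (zar S) U" "openin (zar S') V"
    by (auto simp: prod_gens_def)
  show "(\<lambda>_. a) \<in> A" for a unfolding UV(2) by (rule tensor_const[OF S UV(3,4)])
  fix f g assume "f \<in> A" "g \<in> A"
  then show "(\<lambda>x. f x + g x) \<in> A" "(\<lambda>x. f x * g x) \<in> A"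
    unfolding UV(2) by (auto intro: tensor_add tensor_mult[OF S UV(3,4)])
next
  fix D A D' A' assume "(D, A) \<in> prod_gens S S'" "(D', A') \<in> prod_gens S S'"
  then obtain U V U' V' where UV: "D = U \<times> V" "A = tensor_funs S U S' V" "openin (zar S) U" "openin (zar S') V"
    "D' = U' \<times> V'" "A' = tensor_funs S U' S' V'" "openin (zar S) U'" "openin (zar S') V'"
    by (auto simp: prod_gens_def)
  have "(D \<inter> D', tensor_funs S (U \<inter> U') S' (V \<inter> V')) \<in> prod_gens S S'"
    unfolding prod_gens_def UV Times_Int_Times using UV by blast
  moreover have "A \<subseteq> tensor_funs S (U \<inter> U') S' (V \<inter> V')"
    unfolding UV(2) by (rule tensor_restrict[OF S UV(3,4)]) (use UV in auto)
  moreover have "A' \<subseteq> tensor_funs S (U \<inter> U') S' (V \<inter> V')"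
    unfolding UV(6) by (rule tensor_restrict[OF S UV(7,8)]) (use UV in auto)
  ultimately show "\<exists>B. (D \<inter> D', B) \<in> prod_gens S S' \<and> A \<subseteq> B \<and> A' \<subseteq> B" by blast
qed

lemma fprod_ringed: "ringed_space S \<Longrightarrow> ringed_space S' \<Longrightarrow> ringed_space (fprod S S')"
  by (rule generated_space.ringed[OF fprod_generated])

lemma fprod_pts:
  assumes "ringed_space S" "ringed_space S'"
  shows "pts (fprod S S') = pts S \<times> pts S'"
proof -
  have "\<Union> (fst ` prod_gens S S') = pts S \<times> pts S'"
  proof (intro equalityI subsetI)
    fix z assume "z \<in> \<Union> (fst ` prod_gens S S')"
    then obtain U V where "openin (zar S) U" "openin (zar S') V" "z \<in> U \<times> V" by (auto simp: prod_gens_def)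
    then show "z \<in> pts S \<times> pts S'" using openin_subset[of "zar S" U] openin_subset[of "zar S'" V] by blast
  next
    fix z assume "z \<in> pts S \<times> pts S'"
    moreover have "(pts S \<times> pts S', tensor_funs S (pts S) S' (pts S')) \<in> prod_gens S S'"
      unfolding prod_gens_def by blast
    ultimately show "z \<in> \<Union> (fst ` prod_gens S S')" by force
  qed
  then show ?thesis using generated_space.points[OF fprod_generated[OF assms]] by simp
qed

subsection \<open>Morphisms\<close>

lemma regular_on_open: "regular_on S U S' f \<Longrightarrow> openin (zar S) U"
  by (simp add: regular_on_def)

lemma regular_on_image: "regular_on S U S' f \<Longrightarrow> x \<in> U \<Longrightarrow> f x \<in> pts S'"
  by (auto simp: regular_on_def)

lemma regular_on_preimage:
  "regular_on S U S' f \<Longrightarrow> openin (zar S') V \<Longrightarrow> openin (zar S) {x \<in> U. f x \<in> V}"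
  by (simp add: regular_on_def)

lemma regular_on_pull:
  "regular_on S U S' f \<Longrightarrow> openin (zar S') V \<Longrightarrow> g \<in> regs S' V \<Longrightarrow> (\<lambda>x. g (f x)) \<in> regs S {x \<in> U. f x \<in> V}"
  unfolding regular_on_def comp_def by blast

lemma regular_onI:
  assumes "openin (zar S) U" "\<And>x. x \<in> U \<Longrightarrow> f x \<in> pts S'"
    and "\<And>V. openin (zar S') V \<Longrightarrow> openin (zar S) {x \<in> U. f x \<in> V}"
    and "\<And>V g. openin (zar S') V \<Longrightarrow> g \<in> regs S' V \<Longrightarrow> (\<lambda>x. g (f x)) \<in> regs S {x \<in> U. f x \<in> V}"
  shows "regular_on S U S' f"
  unfolding regular_on_def comp_def using assms by blast

lemma regular_on_compose:
  assumes f: "regular_on S U S' f" and g: "regular_on S' V S'' g"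
  shows "regular_on S {x \<in> U. f x \<in> V} S'' (\<lambda>x. g (f x))"
proof (rule regular_onI)
  have V: "openin (zar S') V" by (rule regular_on_open[OF g])
  show "openin (zar S) {x \<in> U. f x \<in> V}" by (rule regular_on_preimage[OF f V])
  show "g (f x) \<in> pts S''" if "x \<in> {x \<in> U. f x \<in> V}" for x
    using that regular_on_image[OF g] by blast
  fix W assume W: "openin (zar S'') W"
  have eq: "{x \<in> {x \<in> U. f x \<in> V}. g (f x) \<in> W} = {x \<in> U. f x \<in> {y \<in> V. g y \<in> W}}" by auto
  show "openin (zar S) {x \<in> {x \<in> U. f x \<in> V}. g (f x) \<in> W}"
    unfolding eq by (rule regular_on_preimage[OF f regular_on_preimage[OF g W]])
  fix h assume h: "h \<in> regs S'' W"
  show "(\<lambda>x. h (g (f x))) \<in> regs S {x \<in> {x \<in> U. f x \<in> V}. g (f x) \<in> W}"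
    unfolding eq using regular_on_pull[OF f regular_on_preimage[OF g W] regular_on_pull[OF g W h]] .
qed

lemma regular_on_compose':
  assumes f: "regular_on S U S' f" and g: "regular_on S' V S'' g" and "\<And>x. x \<in> U \<Longrightarrow> f x \<in> V"
  shows "regular_on S U S'' (\<lambda>x. g (f x))"
proof -
  have "{x \<in> U. f x \<in> V} = U" using assms(3) by blast
  then show ?thesis using regular_on_compose[OF f g] by simp
qed

lemma regular_on_subset:
  assumes "sheaf S" "regular_on S U S' f" "openin (zar S) V" "V \<subseteq> U"
  shows "regular_on S V S' f"
proof (rule regular_onI)
  show "f x \<in> pts S'" if "x \<in> V" for x by (rule regular_on_image[OF assms(2) subsetD[OF assms(4) that]])
  fix W assume W: "openin (zar S') W"
  have eq: "{x \<in> V. f x \<in> W} = V \<inter> {x \<in> U. f x \<in> W}" using assms(4) by blast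
  show o: "openin (zar S) {x \<in> V. f x \<in> W}"
    unfolding eq by (intro openin_Int assms regular_on_preimage[OF assms(2) W])
  fix g assume g: "g \<in> regs S' W"
  show "(\<lambda>x. g (f x)) \<in> regs S {x \<in> V. f x \<in> W}"
    by (rule sheaf_restrict[OF assms(1) _ o _ regular_on_pull[OF assms(2) W g]])
      (use assms(4) regular_on_preimage[OF assms(2) W] in auto)
qed (rule assms)

lemma regular_on_cong:
  assumes "sheaf S" "regular_on S U S' f" "\<And>x. x \<in> U \<Longrightarrow> g x = f x"
  shows "regular_on S U S' g"
proof (rule regular_onI)
  show "openin (zar S) U" by (rule regular_on_open[OF assms(2)])
  show "g x \<in> pts S'" if "x \<in> U" for x using regular_on_image[OF assms(2) that] assms(3)[OF that] by simp
  fix W assume W: "openin (zar S') W"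
  have eq: "{x \<in> U. g x \<in> W} = {x \<in> U. f x \<in> W}" using assms(3) by auto
  show "openin (zar S) {x \<in> U. g x \<in> W}"
    unfolding eq by (rule regular_on_preimage[OF assms(2) W])
  fix h assume h: "h \<in> regs S' W"
  show "(\<lambda>x. h (g x)) \<in> regs S {x \<in> U. g x \<in> W}" unfolding eq
    by (rule sheaf_cong[OF assms(1) regular_on_preimage[OF assms(2) W] regular_on_pull[OF assms(2) W h]])
      (use assms(3) in auto)
qed

lemma regular_on_Union:
  assumes S: "sheaf S" and f: "\<And>U. U \<in> \<U> \<Longrightarrow> regular_on S U S' f"
  shows "regular_on S (\<Union>\<U>) S' f"
proof (rule regular_onI)
  show "openin (zar S) (\<Union>\<U>)" using regular_on_open[OF f] by (rule openin_Union)
  show "f x \<in> pts S'" if "x \<in> \<Union>\<U>" for x using that regular_on_image[OF f] by blast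
  fix W assume W: "openin (zar S') W"
  have eq: "{x \<in> \<Union>\<U>. f x \<in> W} = \<Union> ((\<lambda>U. {x \<in> U. f x \<in> W}) ` \<U>)" by auto
  show o: "openin (zar S) {x \<in> \<Union>\<U>. f x \<in> W}"
    unfolding eq using regular_on_preimage[OF f W] by (intro openin_Union) auto
  fix g assume g: "g \<in> regs S' W"
  show "(\<lambda>x. g (f x)) \<in> regs S {x \<in> \<Union>\<U>. f x \<in> W}"
  proof (rule sheaf_glue[OF S o])
    fix x assume "x \<in> {x \<in> \<Union>\<U>. f x \<in> W}"
    then obtain U where U: "U \<in> \<U>" "x \<in> U" "f x \<in> W" by auto
    show "\<exists>V. openin (zar S) V \<and> x \<in> V \<and> V \<subseteq> {x \<in> \<Union>\<U>. f x \<in> W} \<and> (\<lambda>x. g (f x)) \<in> regs S V"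
      by (rule exI[of _ "{x \<in> U. f x \<in> W}"])
        (use U regular_on_preimage[OF f W] regular_on_pull[OF f W g] in auto)
  qed
qed

lemma regular_on_id:
  assumes "sheaf S" "openin (zar S) U"
  shows "regular_on S U S (\<lambda>x. x)"
proof (rule regular_onI)
  show "x \<in> pts S" if "x \<in> U" for x using that openin_subset[OF assms(2)] by auto
  fix W assume W: "openin (zar S) W"
  have eq: "{x \<in> U. x \<in> W} = U \<inter> W" by auto
  show o: "openin (zar S) {x \<in> U. x \<in> W}" unfolding eq by (intro openin_Int assms W)
  fix g assume g: "g \<in> regs S W"
  show "g \<in> regs S {x \<in> U. x \<in> W}" by (rule sheaf_restrict[OF assms(1) W o _ g]) auto
qed (rule assms)

lemma regular_on_const:
  assumes "ringed_space S" "openin (zar S) U" "y \<in> pts S'"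
  shows "regular_on S U S' (\<lambda>x. y)"
proof (rule regular_onI)
  interpret ringed_space S by (rule assms)
  fix W
  show o: "openin (zar S) {x \<in> U. y \<in> W}" using assms(2) by (cases "y \<in> W") auto
  show "(\<lambda>x. g y) \<in> regs S {x \<in> U. y \<in> W}" for g by (rule const[OF o])
qed (use assms in auto)

text \<open>Preimages of basic open sets are nonvanishing loci of pulled back generators, and every
  regular function is locally a quotient of generators; so it suffices to test the
  generators.\<close>

lemma regular_on_generated:
  assumes S: "ringed_space S" and S': "generated_space S' \<D>" and U: "openin (zar S) U"
    and img: "\<And>x. x \<in> U \<Longrightarrow> f x \<in> pts S'"
    and dom: "\<And>D A. (D, A) \<in> \<D> \<Longrightarrow> openin (zar S) {x \<in> U. f x \<in> D}"
    and reg: "\<And>D A a. (D, A) \<in> \<D> \<Longrightarrow> a \<in> A \<Longrightarrow> (\<lambda>x. a (f x)) \<in> regs S {x \<in> U. f x \<in> D}"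
  shows "regular_on S U S' f"
proof (rule regular_onI[OF U img])
  interpret S: ringed_space S by (rule S)
  interpret S': generated_space S' \<D> by (rule S')
  fix V assume V: "openin (zar S') V"
  show o: "openin (zar S) {x \<in> U. f x \<in> V}"
  proof (subst openin_subopen, intro ballI)
    fix x assume x: "x \<in> {x \<in> U. f x \<in> V}"
    then have "f x \<in> V" by simp
    obtain D A h where *: "(D, A) \<in> \<D>" "h \<in> A" "f x \<in> D" "h (f x) \<noteq> 0" "{w \<in> D. h w \<noteq> 0} \<subseteq> V"
      by (rule S'.basis[OF V \<open>f x \<in> V\<close>])
    show "\<exists>T. openin (zar S) T \<and> x \<in> T \<and> T \<subseteq> {x \<in> U. f x \<in> V}"
      by (rule exI[of _ "{y \<in> {x \<in> U. f x \<in> D}. h (f y) \<noteq> 0}"])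
        (use x * S.nonzero_open[OF dom[OF *(1)] reg[OF *(1,2)]] in auto)
  qed
  fix g assume g: "g \<in> regs S' V"
  show "(\<lambda>x. g (f x)) \<in> regs S {x \<in> U. f x \<in> V}"
  proof (rule S.glue[OF o])
    fix x assume x: "x \<in> {x \<in> U. f x \<in> V}"
    then have fx: "f x \<in> V" by simp
    obtain D A a h where *: "(D, A) \<in> \<D>" "f x \<in> D" "a \<in> A" "h \<in> A" "h (f x) \<noteq> 0"
      "\<forall>w\<in>V \<inter> D. h w \<noteq> 0 \<longrightarrow> g w = a w / h w"
      by (rule S'.regsD[OF g V fx])
    let ?N = "{y \<in> {x \<in> U. f x \<in> D}. h (f y) \<noteq> 0}"
    let ?T = "{x \<in> U. f x \<in> V} \<inter> ?N"
    have N: "openin (zar S) ?N" by (rule S.nonzero_open[OF dom[OF *(1)] reg[OF *(1,4)]])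
    have T: "openin (zar S) ?T" by (rule openin_Int[OF o N])
    have a: "(\<lambda>x. a (f x)) \<in> regs S ?T"
      by (rule S.restrict[OF dom[OF *(1)] T _ reg[OF *(1,3)]]) auto
    have h: "(\<lambda>x. h (f x)) \<in> regs S ?T"
      by (rule S.restrict[OF dom[OF *(1)] T _ reg[OF *(1,4)]]) auto
    have "(\<lambda>x. g (f x)) \<in> regs S ?T"
      by (rule S.cong[OF T S.mult[OF T a S.inv[OF T h]]]) (use * in \<open>auto simp: divide_inverse\<close>)
    then show "\<exists>T. openin (zar S) T \<and> x \<in> T \<and> T \<subseteq> {x \<in> U. f x \<in> V} \<and> (\<lambda>x. g (f x)) \<in> regs S T"
      using T x * by (intro exI[of _ ?T]) auto
  qed
qed

text \<open>The universal property of the product: tensors pull back to sums of products of regular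
  functions.\<close>

lemma regular_on_Pair:
  assumes S: "ringed_space S" and S': "ringed_space S1" "ringed_space S2"
    and f: "regular_on S U S1 f" and g: "regular_on S U S2 g"
  shows "regular_on S U (fprod S1 S2) (\<lambda>x. (f x, g x))"
proof (rule regular_on_generated[OF S fprod_generated[OF S']])
  interpret S: ringed_space S by (rule S)
  show "openin (zar S) U" by (rule regular_on_open[OF f])
  show "(f x, g x) \<in> pts (fprod S1 S2)" if "x \<in> U" for x
    using that regular_on_image[OF f] regular_on_image[OF g] by (simp add: fprod_pts[OF S'])
  fix D A assume "(D, A) \<in> prod_gens S1 S2"
  then obtain V W where VW: "D = V \<times> W" "A = tensor_funs S1 V S2 W" "openin (zar S1) V" "openin (zar S2) W"
    by (auto simp: prod_gens_def)
  have eq: "{x \<in> U. (f x, g x) \<in> D} = {x \<in> U. f x \<in> V} \<inter> {x \<in> U. g x \<in> W}" by (auto simp: VW)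
  have fV: "openin (zar S) {x \<in> U. f x \<in> V}" by (rule regular_on_preimage[OF f VW(3)])
  have gW: "openin (zar S) {x \<in> U. g x \<in> W}" by (rule regular_on_preimage[OF g VW(4)])
  show o: "openin (zar S) {x \<in> U. (f x, g x) \<in> D}"
    unfolding eq by (intro openin_Int fV gW)
  fix a assume "a \<in> A"
  then have "a \<in> tensor_funs S1 V S2 W" by (simp add: VW)
  then obtain n p q where a: "a = (\<lambda>(x, y). \<Sum>k<(n::nat). p k x * q k y)"
    "\<And>k. k < n \<Longrightarrow> p k \<in> regs S1 V" "\<And>k. k < n \<Longrightarrow> q k \<in> regs S2 W" by (rule tensor_funsE) blast
  have "(\<lambda>x. p k (f x)) \<in> regs S {x \<in> U. (f x, g x) \<in> D}" if "k < n" for k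
    by (rule S.restrict[OF fV o _ regular_on_pull[OF f VW(3) a(2)[OF that]]]) (auto simp: eq)
  moreover have "(\<lambda>x. q k (g x)) \<in> regs S {x \<in> U. (f x, g x) \<in> D}" if "k < n" for k
    by (rule S.restrict[OF gW o _ regular_on_pull[OF g VW(4) a(3)[OF that]]]) (auto simp: eq)
  ultimately show "(\<lambda>x. a (f x, g x)) \<in> regs S {x \<in> U. (f x, g x) \<in> D}"
    unfolding a(1) prod.case by (intro S.sum[OF _ o] S.mult[OF o]) auto
qed

lemma regular_on_fst:
  assumes S: "ringed_space S" "ringed_space S'"
  shows "morphism (fprod S S') S fst"
proof (rule regular_onI)
  show "openin (zar (fprod S S')) (pts (fprod S S'))" by simp
  show "fst x \<in> pts S" if "x \<in> pts (fprod S S')" for x using that by (auto simp: fprod_pts[OF S])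
  interpret P: generated_space "fprod S S'" "prod_gens S S'" by (rule fprod_generated[OF S])
  fix V assume V: "openin (zar S) V"
  have eq: "{x \<in> pts (fprod S S'). fst x \<in> V} = V \<times> pts S'"
    using openin_subset[OF V] by (auto simp: fprod_pts[OF S])
  have D: "(V \<times> pts S', tensor_funs S V S' (pts S')) \<in> prod_gens S S'"
    using V by (auto simp: prod_gens_def)
  show "openin (zar (fprod S S')) {x \<in> pts (fprod S S'). fst x \<in> V}"
    unfolding eq by (rule P.domain_open[OF D])
  fix g assume g: "g \<in> regs S V"
  have "(\<lambda>x. g (fst x)) \<in> tensor_funs S V S' (pts S')"
    using tensor_single[OF g ringed_space.const[OF S(2), of "pts S'" 1]] by (simp add: split_def)
  then show "(\<lambda>x. g (fst x)) \<in> regs (fprod S S') {x \<in> pts (fprod S S'). fst x \<in> V}"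
    unfolding eq by (rule P.generator_regular[OF D])
qed

lemma regular_on_snd:
  assumes S: "ringed_space S" "ringed_space S'"
  shows "morphism (fprod S S') S' snd"
proof (rule regular_onI)
  show "openin (zar (fprod S S')) (pts (fprod S S'))" by simp
  show "snd x \<in> pts S'" if "x \<in> pts (fprod S S')" for x using that by (auto simp: fprod_pts[OF S])
  interpret P: generated_space "fprod S S'" "prod_gens S S'" by (rule fprod_generated[OF S])
  fix V assume V: "openin (zar S') V"
  have eq: "{x \<in> pts (fprod S S'). snd x \<in> V} = pts S \<times> V"
    using openin_subset[OF V] by (auto simp: fprod_pts[OF S])
  have D: "(pts S \<times> V, tensor_funs S (pts S) S' V) \<in> prod_gens S S'"
    using V by (auto simp: prod_gens_def)
  show "openin (zar (fprod S S')) {x \<in> pts (fprod S S'). snd x \<in> V}"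
    unfolding eq by (rule P.domain_open[OF D])
  fix g assume g: "g \<in> regs S' V"
  have "(\<lambda>x. g (snd x)) \<in> tensor_funs S (pts S) S' V"
    using tensor_single[OF ringed_space.const[OF S(1), of "pts S" 1] g] by (simp add: split_def)
  then show "(\<lambda>x. g (snd x)) \<in> regs (fprod S S') {x \<in> pts (fprod S S'). snd x \<in> V}"
    unfolding eq by (rule P.generator_regular[OF D])
qed

subsection \<open>Varieties\<close>

text \<open>The axioms are local, so they may be checked inside the members of an open cover and
  glued.\<close>

lemma ringed_space_cover:
  assumes S: "sheaf S" and cover: "\<Union>\<U> = pts S" "\<And>U. U \<in> \<U> \<Longrightarrow> openin (zar S) U"
    and const: "\<And>U W a. U \<in> \<U> \<Longrightarrow> W \<subseteq> U \<Longrightarrow> openin (zar S) W \<Longrightarrow> (\<lambda>_. a) \<in> regs S W"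
    and add: "\<And>U W f g. U \<in> \<U> \<Longrightarrow> W \<subseteq> U \<Longrightarrow> openin (zar S) W \<Longrightarrow> f \<in> regs S W \<Longrightarrow> g \<in> regs S W \<Longrightarrow>
      (\<lambda>x. f x + g x) \<in> regs S W"
    and mult: "\<And>U W f g. U \<in> \<U> \<Longrightarrow> W \<subseteq> U \<Longrightarrow> openin (zar S) W \<Longrightarrow> f \<in> regs S W \<Longrightarrow> g \<in> regs S W \<Longrightarrow>
      (\<lambda>x. f x * g x) \<in> regs S W"
    and inv: "\<And>U W f. U \<in> \<U> \<Longrightarrow> W \<subseteq> U \<Longrightarrow> openin (zar S) W \<Longrightarrow> f \<in> regs S W \<Longrightarrow>
      (\<And>x. x \<in> W \<Longrightarrow> f x \<noteq> 0) \<Longrightarrow> (\<lambda>x. inverse (f x)) \<in> regs S W"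
    and nonzero: "\<And>U W f. U \<in> \<U> \<Longrightarrow> W \<subseteq> U \<Longrightarrow> openin (zar S) W \<Longrightarrow> f \<in> regs S W \<Longrightarrow>
      openin (zar S) {x \<in> W. f x \<noteq> 0}"
  shows "ringed_space S"
proof
  show "sheaf S" by (rule S)
  have glue: "f \<in> regs S W" if W: "openin (zar S) W" and
    loc: "\<And>U. U \<in> \<U> \<Longrightarrow> openin (zar S) (W \<inter> U) \<Longrightarrow> f \<in> regs S (W \<inter> U)" for W f
  proof (rule sheaf_glue[OF S W])
    fix x assume x: "x \<in> W"
    then have "x \<in> \<Union>\<U>" using cover(1) openin_subset[OF W] by auto
    then obtain U where U: "U \<in> \<U>" "x \<in> U" by auto
    have o: "openin (zar S) (W \<inter> U)" by (intro openin_Int W cover U)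
    show "\<exists>V. openin (zar S) V \<and> x \<in> V \<and> V \<subseteq> W \<and> f \<in> regs S V"
      by (rule exI[of _ "W \<inter> U"]) (use U x o loc[OF U(1) o] in auto)
  qed
  have res: "f \<in> regs S (W \<inter> U)" if "openin (zar S) W" "openin (zar S) (W \<inter> U)" "f \<in> regs S W" for W U f
    using sheaf_restrict[OF S that(1,2) _ that(3)] by blast
  fix W assume W: "openin (zar S) W"
  show "(\<lambda>_. a) \<in> regs S W" for a
    by (rule glue[OF W], rule const) auto
  fix f assume f: "f \<in> regs S W"
  show "(\<lambda>x. f x + g x) \<in> regs S W" if g: "g \<in> regs S W" for g
    by (rule glue[OF W], rule add) (use res[OF W _ f] res[OF W _ g] in auto)
  show "(\<lambda>x. f x * g x) \<in> regs S W" if g: "g \<in> regs S W" for g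
    by (rule glue[OF W], rule mult) (use res[OF W _ f] res[OF W _ g] in auto)
  show "(\<lambda>x. inverse (f x)) \<in> regs S W" if "\<And>x. x \<in> W \<Longrightarrow> f x \<noteq> 0"
    by (rule glue[OF W], rule inv) (use res[OF W _ f] that in auto)
  have "{x \<in> W. f x \<noteq> 0} = \<Union> ((\<lambda>U. {x \<in> W \<inter> U. f x \<noteq> 0}) ` \<U>)"
    using cover(1) openin_subset[OF W] by auto
  moreover have "openin (zar S) {x \<in> W \<inter> U. f x \<noteq> 0}" if U: "U \<in> \<U>" for U
  proof -
    have o: "openin (zar S) (W \<inter> U)" by (intro openin_Int W cover U)
    show ?thesis by (rule nonzero[OF U _ o res[OF W o f]]) auto
  qed
  then have "openin (zar S) (\<Union> ((\<lambda>U. {x \<in> W \<inter> U. f x \<noteq> 0}) ` \<U>))" by (intro openin_Union) blast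
  ultimately show "openin (zar S) {x \<in> W. f x \<noteq> 0}" by simp
qed

text \<open>The sheaf axioms do not say that regular functions form rings; this is inherited from
  the affine pieces, whose regular functions are local quotients of polynomials.\<close>

lemma variety_ringed:
  assumes "variety S"
  shows "ringed_space S"
proof -
  have S: "sheaf S" using assms by (simp add: variety_def)
  obtain \<U> where \<U>: "\<Union>\<U> = pts S" "\<And>U. U \<in> \<U> \<Longrightarrow> openin (zar S) U"
    "\<And>U. U \<in> \<U> \<Longrightarrow> affine_variety (open_subspace S U)"
    using assms unfolding variety_def by blast
  have iso: "\<exists>(Q :: (nat \<Rightarrow> complex) fspace) \<phi> \<psi>. ringed_space Q \<and> (\<forall>W. openin (zar S) W \<longrightarrow> W \<subseteq> U \<longrightarrow> openin (zar Q) {z \<in> pts Q. \<psi> z \<in> W} \<and>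
      (\<forall>f\<in>regs S W. (\<lambda>z. f (\<psi> z)) \<in> regs Q {z \<in> pts Q. \<psi> z \<in> W})) \<and>
      (\<forall>V. openin (zar Q) V \<longrightarrow> openin (zar S) {x \<in> U. \<phi> x \<in> V} \<and>
      (\<forall>f\<in>regs Q V. (\<lambda>x. f (\<phi> x)) \<in> regs S {x \<in> U. \<phi> x \<in> V})) \<and>
      (\<forall>x\<in>U. \<psi> (\<phi> x) = x \<and> \<phi> x \<in> pts Q)" if U: "U \<in> \<U>" for U
  proof -
    let ?S = "open_subspace S U"
    have UO: "openin (zar S) U" by (rule \<U>(2)[OF U])
    have pU: "pts ?S = U" using openin_subset[OF UO] by (auto simp: open_subspace_def)
    have oU: "openin (zar ?S) W \<longleftrightarrow> openin (zar S) W \<and> W \<subseteq> U" for W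
      by (simp add: open_subspace_def openin_open_subtopology[OF UO])
    have rU: "regs ?S = regs S" by (simp add: open_subspace_def)
    obtain n P \<phi> where "P \<subseteq> polyfuns n" and i: "fspace_iso ?S (quot_space {x \<in> {..<n} \<rightarrow>\<^sub>E UNIV. \<forall>p\<in>P. p x = 0} (polyfuns n)) \<phi>"
      using \<U>(3)[OF U] unfolding affine_variety_def by (elim exE conjE)
    define Q where "Q = quot_space {x \<in> {..<n} \<rightarrow>\<^sub>E UNIV. \<forall>p\<in>P. p x = 0} (polyfuns n)"
    define \<psi> where "\<psi> = inv_into U \<phi>"
    have Q: "ringed_space Q" unfolding Q_def by (rule generated_space.ringed[OF polyfuns_generated])
    have bij: "bij_betw \<phi> U (pts Q)" and \<phi>: "regular_on ?S U Q \<phi>" and \<psi>: "regular_on Q (pts Q) ?S \<psi>"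
      using i unfolding fspace_iso_def Q_def[symmetric] pU \<psi>_def by blast+
    show ?thesis
    proof (rule exI[of _ Q], rule exI[of _ \<phi>], rule exI[of _ \<psi>], intro conjI allI impI ballI Q)
      fix W assume W: "openin (zar S) W" "W \<subseteq> U"
      then have W': "openin (zar ?S) W" by (simp add: oU)
      show "openin (zar Q) {z \<in> pts Q. \<psi> z \<in> W}" by (rule regular_on_preimage[OF \<psi> W'])
      show "(\<lambda>z. f (\<psi> z)) \<in> regs Q {z \<in> pts Q. \<psi> z \<in> W}" if "f \<in> regs S W" for f
        by (rule regular_on_pull[OF \<psi> W']) (use that rU in simp)
    next
      fix V assume V: "openin (zar Q) V"
      show "openin (zar S) {x \<in> U. \<phi> x \<in> V}" using regular_on_preimage[OF \<phi> V] oU by blast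
      show "(\<lambda>x. f (\<phi> x)) \<in> regs S {x \<in> U. \<phi> x \<in> V}" if "f \<in> regs Q V" for f
        using regular_on_pull[OF \<phi> V that] by (simp add: rU)
    next
      fix x assume x: "x \<in> U"
      show "\<psi> (\<phi> x) = x" unfolding \<psi>_def by (rule bij_betw_inv_into_left[OF bij x])
      show "\<phi> x \<in> pts Q" using bij x by (auto simp: bij_betw_def)
    qed
  qed
  \<comment> \<open>\<open>W'\<close> corresponds to \<open>W\<close> in the affine model
    \<open>Q\<close>; functions travel in both directions along \<open>\<phi>\<close> and
    \<open>\<psi>\<close>.\<close>
  have transport: "\<exists>(Q :: (nat \<Rightarrow> complex) fspace) W' \<phi> \<psi>. ringed_space Q \<and> openin (zar Q) W' \<and> (\<forall>f\<in>regs S W. (\<lambda>z. f (\<psi> z)) \<in> regs Q W') \<and>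
      (\<forall>f\<in>regs Q W'. (\<lambda>x. f (\<phi> x)) \<in> regs S W) \<and> (\<forall>x\<in>W. \<psi> (\<phi> x) = x) \<and> (\<forall>z\<in>W'. \<psi> z \<in> W) \<and>
      (\<forall>V. openin (zar Q) V \<longrightarrow> V \<subseteq> W' \<longrightarrow> openin (zar S) {x \<in> W. \<phi> x \<in> V}) \<and> (\<forall>x\<in>W. \<phi> x \<in> W')"
    if U: "U \<in> \<U>" and W: "W \<subseteq> U" "openin (zar S) W" for U W
  proof -
    obtain Q :: "(nat \<Rightarrow> complex) fspace" and \<phi> \<psi> where Q: "ringed_space Q"
      and to: "\<forall>W. openin (zar S) W \<longrightarrow> W \<subseteq> U \<longrightarrow> openin (zar Q) {z \<in> pts Q. \<psi> z \<in> W} \<and>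
        (\<forall>f\<in>regs S W. (\<lambda>z. f (\<psi> z)) \<in> regs Q {z \<in> pts Q. \<psi> z \<in> W})"
      and fro: "\<forall>V. openin (zar Q) V \<longrightarrow> openin (zar S) {x \<in> U. \<phi> x \<in> V} \<and>
        (\<forall>f\<in>regs Q V. (\<lambda>x. f (\<phi> x)) \<in> regs S {x \<in> U. \<phi> x \<in> V})"
      and inv: "\<forall>x\<in>U. \<psi> (\<phi> x) = x \<and> \<phi> x \<in> pts Q"
      using iso[OF U] by (elim exE conjE)
    let ?W' = "{z \<in> pts Q. \<psi> z \<in> W}"
    have W': "openin (zar Q) ?W'" "\<forall>f\<in>regs S W. (\<lambda>z. f (\<psi> z)) \<in> regs Q ?W'"
      using to[rule_format, OF W(2,1)] by (rule conjunct1, rule conjunct2)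
    have eq: "{x \<in> U. \<phi> x \<in> ?W'} = W" using inv W(1) by auto
    have ret: "\<forall>f\<in>regs Q ?W'. (\<lambda>x. f (\<phi> x)) \<in> regs S W"
      using fro[rule_format, OF W'(1), unfolded eq] by (rule conjunct2)
    have "openin (zar S) {x \<in> W. \<phi> x \<in> V}" if "openin (zar Q) V" for V
    proof -
      have "{x \<in> W. \<phi> x \<in> V} = W \<inter> {x \<in> U. \<phi> x \<in> V}" using W by auto
      then show ?thesis using openin_Int[OF W(2) conjunct1[OF fro[rule_format, OF that]]] by simp
    qed
    then show ?thesis
      using Q W' ret inv W(1)
      by (intro exI[of _ Q] exI[of _ ?W'] exI[of _ \<phi>] exI[of _ \<psi>] conjI) auto
  qed
  show ?thesis
  proof (rule ringed_space_cover[OF S \<U>(1,2)])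
    fix U W assume U: "U \<in> \<U>" "W \<subseteq> U" "openin (zar S) W"
    obtain Q :: "(nat \<Rightarrow> complex) fspace" and W' \<phi> \<psi> where Q': "ringed_space Q" "openin (zar Q) W'"
      "\<forall>f\<in>regs S W. (\<lambda>z. f (\<psi> z)) \<in> regs Q W'"
      and ret': "\<forall>f\<in>regs Q W'. (\<lambda>x. f (\<phi> x)) \<in> regs S W"
      and \<psi>\<phi>: "\<forall>x\<in>W. \<psi> (\<phi> x) = x" "\<forall>z\<in>W'. \<psi> z \<in> W"
      and opn': "\<forall>V. openin (zar Q) V \<longrightarrow> V \<subseteq> W' \<longrightarrow> openin (zar S) {x \<in> W. \<phi> x \<in> V}"
      and \<phi>W: "\<forall>x\<in>W. \<phi> x \<in> W'"
      using transport[OF U] by (elim exE conjE)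
    note Q = Q'(1,2) Q'(3)[rule_format] and ret = ret'[rule_format] and opn = opn'[rule_format]
    interpret Q: ringed_space Q by (rule Q)
    have retI: "g \<in> regs S W" if "f \<in> regs Q W'" "\<And>x. x \<in> W \<Longrightarrow> g x = f (\<phi> x)" for f g
      by (rule sheaf_cong[OF S U(3) ret[OF that(1)] that(2)])
    show "(\<lambda>_. a) \<in> regs S W" for a by (rule retI[OF Q.const[OF Q(2)]]) simp
    fix f assume f: "f \<in> regs S W"
    show "(\<lambda>x. f x + g x) \<in> regs S W" if g: "g \<in> regs S W" for g
      by (rule retI[OF Q.add[OF Q(2) Q(3)[OF f] Q(3)[OF g]]]) (simp add: \<psi>\<phi>)
    show "(\<lambda>x. f x * g x) \<in> regs S W" if g: "g \<in> regs S W" for g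
      by (rule retI[OF Q.mult[OF Q(2) Q(3)[OF f] Q(3)[OF g]]]) (simp add: \<psi>\<phi>)
    show "(\<lambda>x. inverse (f x)) \<in> regs S W" if nz: "\<And>x. x \<in> W \<Longrightarrow> f x \<noteq> 0"
    proof (rule retI)
      have "f (\<psi> z) \<noteq> 0" if "z \<in> W'" for z by (rule nz) (use \<psi>\<phi>(2) that in simp)
      then show "(\<lambda>z. inverse (f (\<psi> z))) \<in> regs Q W'" by (rule Q.inv[OF Q(2) Q(3)[OF f]])
      show "inverse (f x) = inverse (f (\<psi> (\<phi> x)))" if "x \<in> W" for x using \<psi>\<phi>(1) that by simp
    qed
    have "openin (zar S) {x \<in> W. \<phi> x \<in> {z \<in> W'. f (\<psi> z) \<noteq> 0}}"
      by (rule opn[OF Q.nonzero_open[OF Q(2) Q(3)[OF f]]]) auto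
    moreover have "{x \<in> W. \<phi> x \<in> {z \<in> W'. f (\<psi> z) \<noteq> 0}} = {x \<in> W. f x \<noteq> 0}" using \<psi>\<phi> \<phi>W by auto
    ultimately show "openin (zar S) {x \<in> W. f x \<noteq> 0}" by simp
  qed
qed

text \<open>The locus of inequality is the preimage of the complement of the diagonal under the pair
  of both maps.\<close>

lemma separated:
  assumes S: "ringed_space S" and S': "variety S'" and f: "regular_on S U S' f" and g: "regular_on S U S' g"
  shows "openin (zar S) {x \<in> U. f x \<noteq> g x}"
proof -
  have r: "ringed_space S'" by (rule variety_ringed[OF S'])
  have "closedin (zar (fprod S' S')) {(x, x) |x. x \<in> pts S'}" using S' by (simp add: variety_def)
  then have "openin (zar (fprod S' S')) (pts (fprod S' S') - {(x, x) |x. x \<in> pts S'})"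
    by (rule openin_diff[OF openin_topspace])
  from regular_on_preimage[OF regular_on_Pair[OF S r r f g] this]
  moreover have "{x \<in> U. (f x, g x) \<in> pts (fprod S' S') - {(x, x) |x. x \<in> pts S'}} = {x \<in> U. f x \<noteq> g x}"
    using regular_on_image[OF f] regular_on_image[OF g] by (auto simp: fprod_pts[OF r r])
  ultimately show ?thesis by simp
qed

section \<open>Rational maps\<close>

lemma open_dense_meets:
  assumes "open_dense S W" "openin (zar S) V" "V \<noteq> {}"
  shows "V \<inter> W \<noteq> {}"
  using assms openin_Int_closure_of_eq_empty[of "zar S" V W] openin_subset[of "zar S" V]
  by (auto simp: open_dense_def)

lemma open_denseI:
  assumes "openin (zar S) W" "\<And>V. openin (zar S) V \<Longrightarrow> V \<noteq> {} \<Longrightarrow> V \<inter> W \<noteq> {}"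
  shows "open_dense S W"
  unfolding open_dense_def
proof (intro conjI assms equalityI subsetI)
  show "x \<in> pts S" if "x \<in> zar S closure_of W" for x using that by (simp add: in_closure_of)
  show "x \<in> zar S closure_of W" if "x \<in> pts S" for x
    using that assms(2) by (auto simp: in_closure_of)
qed

lemma open_dense_open: "open_dense S W \<Longrightarrow> openin (zar S) W"
  by (simp add: open_dense_def)

lemma open_dense_Int:
  assumes "open_dense S V" "open_dense S W"
  shows "open_dense S (V \<inter> W)"
proof (rule open_denseI)
  show "openin (zar S) (V \<inter> W)" using assms by (intro openin_Int open_dense_open)
  fix U assume U: "openin (zar S) U" "U \<noteq> {}"
  then have "openin (zar S) (U \<inter> V)" "U \<inter> V \<noteq> {}"
    using open_dense_open[OF assms(1)] open_dense_meets[OF assms(1)] by auto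
  from open_dense_meets[OF assms(2) this] show "U \<inter> (V \<inter> W) \<noteq> {}" by (simp add: Int_assoc)
qed

lemma open_dense_superset:
  assumes "open_dense S V" "openin (zar S) W" "V \<subseteq> W"
  shows "open_dense S W"
  by (rule open_denseI[OF assms(2)]) (use open_dense_meets[OF assms(1)] assms(3) in blast)

text \<open>The locus of inequality is open and misses a dense set.\<close>

lemma regular_eq_dense:
  assumes S: "ringed_space S" and S': "variety S'" and f: "regular_on S U S' f" and g: "regular_on S U S' g"
    and W: "open_dense S W" and eq: "\<And>x. x \<in> U \<Longrightarrow> x \<in> W \<Longrightarrow> f x = g x" and x: "x \<in> U"
  shows "f x = g x"
proof (rule ccontr)
  assume "f x \<noteq> g x"
  then have "{x \<in> U. f x \<noteq> g x} \<noteq> {}" using x by auto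
  from open_dense_meets[OF W separated[OF S S' f g] this] show False using eq by auto
qed

lemma rational_map_regular: "rational_map S S' f \<Longrightarrow> regular_on S (dom f) S' (\<lambda>x. the (f x))"
  by (simp add: rational_map_def comp_def)

lemma rational_map_maximal:
  "rational_map S S' f \<Longrightarrow> dom f \<subseteq> U \<Longrightarrow> regular_on S U S' g \<Longrightarrow> (\<And>x. x \<in> dom f \<Longrightarrow> f x = Some (g x)) \<Longrightarrow> U = dom f"
  unfolding rational_map_def by blast

text \<open>Gluing the representative of \<open>f\<close> with \<open>g\<close> gives a morphism on
  the union of both domains; by maximality this union is the domain of \<open>f\<close>.\<close>

lemma rational_map_extends:
  assumes S: "ringed_space S" and S': "variety S'" and f: "rational_map S S' f" and g: "regular_on S U S' g"
    and W: "open_dense S W" and eq: "\<And>x. x \<in> W \<Longrightarrow> x \<in> U \<Longrightarrow> x \<in> dom f \<Longrightarrow> f x = Some (g x)"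
    and x: "x \<in> U"
  shows "f x = Some (g x)"
proof -
  interpret S: ringed_space S by (rule S)
  note r = rational_map_regular[OF f]
  have o: "openin (zar S) (U \<inter> dom f)" using regular_on_open[OF g] regular_on_open[OF r] by auto
  have agree: "the (f x) = g x" if "x \<in> U \<inter> dom f" for x
    by (rule regular_eq_dense[OF S S' regular_on_subset[OF S.sheaf r o] regular_on_subset[OF S.sheaf g o] W _ that])
      (use eq in auto)
  define h where "h x = (if x \<in> dom f then the (f x) else g x)" for x
  have "regular_on S (dom f) S' h" by (rule regular_on_cong[OF S.sheaf r]) (simp add: h_def)
  moreover have "regular_on S U S' h"
    by (rule regular_on_cong[OF S.sheaf g]) (use agree in \<open>auto simp: h_def\<close>)
  ultimately have "regular_on S (\<Union>{dom f, U}) S' h" by (intro regular_on_Union S.sheaf) auto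
  then have "\<Union>{dom f, U} = dom f"
    by (rule rational_map_maximal[OF f, rotated]) (auto simp: h_def)
  then have "x \<in> dom f" using x by auto
  then show ?thesis using agree x by fastforce
qed

lemma rational_map_eq:
  assumes S: "ringed_space S" and S': "variety S'" and f: "rational_map S S' f" and g: "rational_map S S' g"
    and W: "open_dense S W" and eq: "\<And>x. x \<in> W \<Longrightarrow> f x = g x"
  shows "f = g"
proof
  fix x
  have *: "f x = g x" if f: "rational_map S S' f" and g: "rational_map S S' g" and "x \<in> dom g"
    and eq: "\<And>x. x \<in> W \<Longrightarrow> f x = g x" for f g
  proof -
    have "f x = Some (the (g x))"
      by (rule rational_map_extends[OF S S' f rational_map_regular[OF g] W _ that(3)]) (use eq in auto)
    then show ?thesis using that(3) by auto
  qed
  show "f x = g x"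
  proof (cases "x \<in> dom g")
    case True then show ?thesis using *[OF f g] eq by blast
  next
    case False
    have "x \<notin> dom f"
    proof
      assume "x \<in> dom f"
      from *[OF g f this eq[symmetric]] show False using False \<open>x \<in> dom f\<close> by (simp add: domIff)
    qed
    then show ?thesis using False by (simp add: domIff)
  qed
qed

text \<open>Any two extensions agree on their overlap by separatedness, so all of them glue to one
  with the largest domain. It is the only rational map that agrees generically with
  \<open>h\<close>, which justifies the definite description.\<close>

lemma rational_ext:
  assumes S: "ringed_space S" and S': "variety S'" and h: "open_dense S (dom h)" "regular_on S (dom h) S' (\<lambda>x. the (h x))"
  shows "rational_map S S' (rational_ext S S' h)" "x \<in> dom h \<Longrightarrow> rational_ext S S' h x = h x"
proof -
  interpret S: ringed_space S by (rule S)
  define \<G> where "\<G> = {(U, g). dom h \<subseteq> U \<and> regular_on S U S' g \<and> (\<forall>x\<in>dom h. h x = Some (g x))}"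
  have hG: "(dom h, \<lambda>x. the (h x)) \<in> \<G>" using h by (auto simp: \<G>_def)
  have agree: "g x = g' x" if "(U, g) \<in> \<G>" "(U', g') \<in> \<G>" "x \<in> U" "x \<in> U'" for U g U' g' x
  proof -
    have r: "regular_on S U S' g" "regular_on S U' S' g'" using that by (auto simp: \<G>_def)
    have o: "openin (zar S) (U \<inter> U')" using regular_on_open[OF r(1)] regular_on_open[OF r(2)] by auto
    show ?thesis
    proof (rule regular_eq_dense[OF S S' regular_on_subset[OF S.sheaf r(1) o] regular_on_subset[OF S.sheaf r(2) o] h(1)])
      fix x assume "x \<in> dom h"
      then have "h x = Some (g x)" "h x = Some (g' x)" using that by (auto simp: \<G>_def)
      then show "g x = g' x" by simp
    qed (use that in auto)
  qed
  define G where "G x = (SOME y. \<exists>U g. (U, g) \<in> \<G> \<and> x \<in> U \<and> y = g x)" for x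
  have G: "G x = g x" if "(U, g) \<in> \<G>" "x \<in> U" for U g x
  proof -
    have "\<exists>U g'. (U, g') \<in> \<G> \<and> x \<in> U \<and> G x = g' x"
      unfolding G_def by (rule someI[of _ "g x"]) (use that in blast)
    then show ?thesis using agree that by metis
  qed
  define D where "D = \<Union> (fst ` \<G>)"
  define F where "F x = (if x \<in> D then Some (G x) else None)" for x
  have domF: "dom F = D" by (auto simp: F_def split: if_splits)
  have hD: "dom h \<subseteq> D" using hG by (force simp: D_def)
  have Fh: "F x = h x" if "x \<in> dom h" for x using G[OF hG that] that hD by (auto simp: F_def)
  have reg: "regular_on S D S' G"
    unfolding D_def
  proof (rule regular_on_Union[OF S.sheaf])
    fix U assume "U \<in> fst ` \<G>"
    then obtain g where g: "(U, g) \<in> \<G>" by auto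
    show "regular_on S U S' G"
      by (rule regular_on_cong[OF S.sheaf, of U S' g]) (use g G in \<open>auto simp: \<G>_def\<close>)
  qed
  have F: "rational_map S S' F"
    unfolding rational_map_def domF
  proof (intro conjI allI impI)
    show "open_dense S D" by (rule open_dense_superset[OF h(1) regular_on_open[OF reg] hD])
    show "regular_on S D S' (the \<circ> F)"
      by (rule regular_on_cong[OF S.sheaf reg]) (simp add: F_def)
    fix U g assume U: "D \<subseteq> U" "regular_on S U S' g" "\<forall>x\<in>D. F x = Some (g x)"
    have "h x = Some (g x)" if "x \<in> dom h" for x
      using Fh[OF that] U(3) hD that by (metis subsetD)
    then have "(U, g) \<in> \<G>" using hD U(1,2) by (auto simp: \<G>_def)
    then show "U = D" using U(1) by (force simp: D_def)
  qed
  have ex: "rational_ext S S' h = F"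
    unfolding rational_ext_def
  proof (rule the_equality)
    show "rational_map S S' F \<and> generically S (\<lambda>x. h x \<noteq> None \<and> F x = h x)"
      unfolding generically_def using F h(1) Fh by blast
    fix F' assume F': "rational_map S S' F' \<and> generically S (\<lambda>x. h x \<noteq> None \<and> F' x = h x)"
    then obtain W where W: "open_dense S W" "\<And>x. x \<in> W \<Longrightarrow> h x \<noteq> None \<and> F' x = h x"
      unfolding generically_def by blast
    show "F' = F"
    proof (rule rational_map_eq[OF S S' conjunct1[OF F'] F W(1)])
      fix x assume "x \<in> W"
      then show "F' x = F x" using W(2)[of x] Fh[of x] by (simp add: domIff)
    qed
  qed
  show "rational_map S S' (rational_ext S S' h)" unfolding ex by (rule F)
  show "rational_ext S S' h x = h x" if "x \<in> dom h" unfolding ex by (rule Fh[OF that])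
qed

section \<open>Irreducibility\<close>

definition irreducible_space :: "'a fspace \<Rightarrow> bool" where
  "irreducible_space S \<longleftrightarrow> (\<forall>U V. openin (zar S) U \<longrightarrow> openin (zar S) V \<longrightarrow> U \<noteq> {} \<longrightarrow> V \<noteq> {} \<longrightarrow> U \<inter> V \<noteq> {})"

lemma irreducible_open_dense:
  "irreducible_space S \<Longrightarrow> openin (zar S) W \<Longrightarrow> W \<noteq> {} \<Longrightarrow> open_dense S W"
  unfolding irreducible_space_def by (intro open_denseI) blast+

text \<open>The preimages of two nonempty open sets are nonempty by density of the image, and
  therefore meet.\<close>

lemma irreducible_image:
  assumes S: "irreducible_space S" and f: "regular_on S U S' f" and dense: "\<And>V. openin (zar S') V \<Longrightarrow> V \<noteq> {} \<Longrightarrow> \<exists>x\<in>U. f x \<in> V"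
  shows "irreducible_space S'"
  unfolding irreducible_space_def
proof (intro allI impI)
  fix A B assume A: "openin (zar S') A" "A \<noteq> {}" and B: "openin (zar S') B" "B \<noteq> {}"
  have "{x \<in> U. f x \<in> A} \<noteq> {}" "{x \<in> U. f x \<in> B} \<noteq> {}" using dense A B by blast+
  then have "{x \<in> U. f x \<in> A} \<inter> {x \<in> U. f x \<in> B} \<noteq> {}"
    using S regular_on_preimage[OF f] A B unfolding irreducible_space_def by blast
  then show "A \<inter> B \<noteq> {}" by blast
qed

section \<open>Tori and their characters\<close>

context ringed_space
begin

lemma poly_regular:
  assumes "openin (zar S) U" "f \<in> regs S U"
  shows "(\<lambda>x. poly p (f x)) \<in> regs S U"
  by (induction p) (auto intro!: const add mult assms)

lemma polyfun_regular:
  assumes "h \<in> polyfuns n" "openin (zar S) U" "\<And>i. i < n \<Longrightarrow> (\<lambda>x. f x i) \<in> regs S U"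
  shows "(\<lambda>x. h (f x)) \<in> regs S U"
  using assms(1) by (induction rule: polyfuns.induct) (auto intro!: const add mult assms)

lemma power_regular:
  assumes "openin (zar S) U" "f \<in> regs S U"
  shows "(\<lambda>x. f x ^ k) \<in> regs S U"
  by (induction k) (auto intro!: const mult assms)

lemma powi_regular:
  assumes "openin (zar S) U" "f \<in> regs S U" "\<And>x. x \<in> U \<Longrightarrow> f x \<noteq> 0"
  shows "(\<lambda>x. f x powi k) \<in> regs S U"
proof (cases "k \<ge> 0")
  case True
  then show ?thesis using power_regular[OF assms(1,2), of "nat k"] by (simp add: power_int_def)
next
  case False
  have "(\<lambda>x. inverse (f x ^ nat (- k))) \<in> regs S U"
    by (intro inv power_regular assms) (use assms(3) in simp)
  then show ?thesis using False by (simp add: power_int_def power_inverse)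
qed

end

section \<open>The multiplicative group\<close>

abbreviation cpoly :: "complex poly \<Rightarrow> complex \<Rightarrow> complex" where
  "cpoly \<equiv> poly"

lemma Gm_generated: "generated_space (var Gm) {(- {0}, range cpoly)}"
  using poly_generated[of "- {0}"] by (simp add: Gm_def)

interpretation Gm: generated_space "var Gm" "{(- {0}, range cpoly)}"
  by (rule Gm_generated)

lemma Gm_pts [simp]: "pts (var Gm) = - {0}"
  using Gm.points by simp

lemma Gm_simps [simp]: "carrier Gm = - {0}" "x \<otimes>\<^bsub>Gm\<^esub> y = x * y" "\<one>\<^bsub>Gm\<^esub> = 1"
  by (simp_all add: Gm_def)

lemma Gm_open_cofinite:
  assumes "openin (zar (var Gm)) W" "W \<noteq> {}"
  shows "\<exists>p. p \<noteq> 0 \<and> (\<forall>c. c \<noteq> 0 \<longrightarrow> poly p c \<noteq> 0 \<longrightarrow> c \<in> W)"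
proof -
  obtain c where "c \<in> W" using assms by auto
  then obtain D A h where *: "(D, A) \<in> {(- {0}, range cpoly)}" "h \<in> A" "c \<in> D" "h c \<noteq> 0" "{w \<in> D. h w \<noteq> 0} \<subseteq> W"
    by (rule Gm.basis[OF assms(1)])
  then obtain p where p: "h = poly p" by auto
  have "p \<noteq> 0" using *(4) p by auto
  then show ?thesis using * p by (intro exI[of _ p]) auto
qed

lemma Gm_open_poly: "openin (zar (var Gm)) {c. c \<noteq> 0 \<and> poly p c \<noteq> 0}"
proof -
  have "{c \<in> - {0}. poly p c \<noteq> 0} = {c. c \<noteq> 0 \<and> poly p c \<noteq> 0}" by auto
  then show ?thesis using Gm.basic_open[of "- {0}" "range cpoly" "poly p"] by simp
qed

lemma cofinite_nonempty:
  assumes "p \<noteq> (0 :: complex poly)"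
  shows "\<exists>c. c \<noteq> 0 \<and> poly p c \<noteq> 0"
proof -
  have "finite {c. poly ([:0, 1:] * p) c = 0}" using assms by (intro poly_roots_finite) auto
  then obtain c where "poly ([:0, 1:] * p) c \<noteq> 0" using infinite_UNIV_char_0[where 'a = complex]
    by (metis (mono_tags, lifting) UNIV_eq_I mem_Collect_eq)
  then show ?thesis by (intro exI[of _ c]) auto
qed

lemma Gm_irreducible: "irreducible_space (var Gm)"
  unfolding irreducible_space_def
proof (intro allI impI)
  fix U V assume UV: "openin (zar (var Gm)) U" "openin (zar (var Gm)) V" "U \<noteq> {}" "V \<noteq> {}"
  obtain p where p: "p \<noteq> 0" "\<forall>c. c \<noteq> 0 \<longrightarrow> poly p c \<noteq> 0 \<longrightarrow> c \<in> U" using Gm_open_cofinite[OF UV(1,3)] by auto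
  obtain q where q: "q \<noteq> 0" "\<forall>c. c \<noteq> 0 \<longrightarrow> poly q c \<noteq> 0 \<longrightarrow> c \<in> V" using Gm_open_cofinite[OF UV(2,4)] by auto
  obtain c where "c \<noteq> 0" "poly (p * q) c \<noteq> 0" using cofinite_nonempty[of "p * q"] p q by auto
  then show "U \<inter> V \<noteq> {}" using p q by auto
qed

lemma regular_on_Gm:
  assumes S: "ringed_space S" and U: "openin (zar S) U" and f: "f \<in> regs S U" "\<And>x. x \<in> U \<Longrightarrow> f x \<noteq> 0"
  shows "regular_on S U (var Gm) f"
proof (rule regular_on_generated[OF S Gm_generated U])
  show "f x \<in> pts (var Gm)" if "x \<in> U" for x using f(2) that by simp
  have eq: "{x \<in> U. f x \<in> - {0}} = U" using f(2) by auto
  fix D A assume DA: "(D, A) \<in> {(- {0 :: complex}, range cpoly)}"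
  then have D: "{x \<in> U. f x \<in> D} = U" using eq by auto
  show "openin (zar S) {x \<in> U. f x \<in> D}" unfolding D by (rule U)
  fix a assume "a \<in> A"
  then obtain p where "a = poly p" using DA by auto
  then show "(\<lambda>x. a (f x)) \<in> regs S {x \<in> U. f x \<in> D}"
    unfolding D using ringed_space.poly_regular[OF S U f(1)] by simp
qed

lemma Gm_id_regular: "(\<lambda>c. c) \<in> regs (var Gm) (- {0})"
proof -
  have "(\<lambda>c. c) = poly [:0, 1 :: complex:]" by auto
  then show ?thesis by (intro Gm.generator_regular[of _ "range cpoly"]) auto
qed

lemma regs_of_Gm:
  assumes "regular_on S U (var Gm) f"
  shows "f \<in> regs S U"
proof -
  have o: "openin (zar (var Gm)) (- {0})" by (rule Gm.domain_open[of _ "range cpoly"]) simp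
  have "{x \<in> U. f x \<in> - {0}} = U" using regular_on_image[OF assms] by auto
  then show ?thesis using regular_on_pull[OF assms o Gm_id_regular] by simp
qed

text \<open>The only possible root is \<open>0\<close>; by the fundamental theorem of algebra,
  linear factors can be split off there until a constant remains.\<close>

lemma poly_no_nonzero_roots:
  assumes "p \<noteq> (0 :: complex poly)" "\<And>r. r \<noteq> 0 \<Longrightarrow> poly p r \<noteq> 0"
  shows "\<exists>a k. a \<noteq> 0 \<and> (\<forall>c. poly p c = a * c ^ k)"
  using assms
proof (induction "degree p" arbitrary: p)
  case 0
  then obtain a where "p = [:a:]" by (metis degree_eq_zeroE)
  then show ?case using 0 by (intro exI[of _ a] exI[of _ 0]) auto
next
  case (Suc n)
  then have "\<not> constant (poly p)" by (simp add: constant_degree)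
  then obtain r where "poly p r = 0" using fundamental_theorem_of_algebra by blast
  then have "poly p 0 = 0" using Suc.prems(2) by metis
  then obtain q where q: "p = [:0, 1:] * q" by (metis dvdE poly_eq_0_iff_dvd minus_zero)
  have "q \<noteq> 0" using Suc.prems(1) q by auto
  then have "degree p = Suc (degree q)" unfolding q by (subst degree_mult_eq) auto
  moreover have "poly q r \<noteq> 0" if "r \<noteq> 0" for r using Suc.prems(2)[OF that] q by auto
  ultimately obtain a k where "a \<noteq> 0" "\<forall>c. poly q c = a * c ^ k"
    using Suc.hyps(1)[of q] Suc.hyps(2) \<open>q \<noteq> 0\<close> by auto
  then show ?case by (intro exI[of _ a] exI[of _ "Suc k"]) (simp add: q)
qed

text \<open>
  A quotient representation of minimal degree has no zeros or poles outside \<open>0\<close>, since \<open>f\<close> is a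
  quotient with nonvanishing denominator near every point.
\<close>

lemma Gm_regular_monomial:
  assumes f: "f \<in> regs (var Gm) (- {0})" and nz: "\<And>c. c \<noteq> 0 \<Longrightarrow> f c \<noteq> 0" and one: "f 1 = 1"
  shows "\<exists>n. \<forall>c. c \<noteq> 0 \<longrightarrow> f c = c powi n"
proof -
  have o: "openin (zar (var Gm)) (- {0})" by (rule Gm.domain_open[of _ "range cpoly"]) simp
  have loc: "\<exists>P Q. poly Q r \<noteq> 0 \<and> (\<forall>c. c \<noteq> 0 \<longrightarrow> poly Q c \<noteq> 0 \<longrightarrow> f c = poly P c / poly Q c)" if "r \<noteq> 0" for r
  proof -
    have r: "r \<in> - {0}" using that by simp
    obtain D A g h where *: "(D, A) \<in> {(- {0}, range cpoly)}" "r \<in> D" "g \<in> A" "h \<in> A" "h r \<noteq> 0"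
      "\<forall>w\<in>- {0} \<inter> D. h w \<noteq> 0 \<longrightarrow> f w = g w / h w" by (rule Gm.regsD[OF f o r])
    then obtain P Q where "g = poly P" "h = poly Q" by auto
    then show ?thesis using * by (intro exI[of _ P] exI[of _ Q]) auto
  qed
  let ?rep = "\<lambda>P Q. Q \<noteq> 0 \<and> (\<forall>c. c \<noteq> 0 \<longrightarrow> f c * poly Q c = poly P c)"
  have repI: "\<exists>Q P. ?rep P Q"
  proof -
    obtain P Q where PQ: "poly Q 1 \<noteq> 0" "\<forall>c. c \<noteq> 0 \<longrightarrow> poly Q c \<noteq> 0 \<longrightarrow> f c = poly P c / poly Q c"
      using loc[of 1] by auto
    \<comment> \<open>Multiplying by \<open>Q\<close> once more includes the points where
      \<open>Q\<close> vanishes.\<close>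
    have "f c * poly (Q * Q) c = poly (P * Q) c" if "c \<noteq> 0" for c
      using PQ(2) that by (cases "poly Q c = 0") auto
    moreover have "Q * Q \<noteq> 0" using PQ(1) by auto
    ultimately have "?rep (P * Q) (Q * Q)" by simp
    then show ?thesis by blast
  qed
  obtain P Q where PQ: "?rep P Q" and min: "\<And>P' Q'. ?rep P' Q' \<Longrightarrow> degree Q \<le> degree Q'"
  proof -
    obtain Q0 where Q0: "\<exists>P. ?rep P Q0" using repI by (rule exE)
    from ex_has_least_nat[of "\<lambda>Q. \<exists>P. ?rep P Q" Q0 degree, OF Q0]
    obtain Q where Q: "\<exists>P. ?rep P Q" "\<forall>Q'. (\<exists>P. ?rep P Q') \<longrightarrow> degree Q \<le> degree Q'"
      by (elim exE conjE) blast
    obtain P where P: "?rep P Q" using Q(1) by (elim exE)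
    show ?thesis by (rule that[OF P]) (use Q(2) in blast)
  qed
  have Q0: "Q \<noteq> 0" and fPQ: "\<And>c. c \<noteq> 0 \<Longrightarrow> f c * poly Q c = poly P c" using PQ by auto
  have Qr: "poly Q r \<noteq> 0" if r: "r \<noteq> 0" for r
  proof
    assume "poly Q r = 0"
    moreover then have "poly P r = 0" using fPQ[OF r] by simp
    ultimately obtain P' Q' where P': "P = [:- r, 1:] * P'" "Q = [:- r, 1:] * Q'"
      by (metis dvdE poly_eq_0_iff_dvd)
    have "Q' \<noteq> 0" using Q0 P' by auto
    obtain P1 Q1 where loc1: "poly Q1 r \<noteq> 0" "\<forall>c. c \<noteq> 0 \<longrightarrow> poly Q1 c \<noteq> 0 \<longrightarrow> f c = poly P1 c / poly Q1 c"
      using loc[OF r] by auto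
    \<comment> \<open>The local representation at \<open>r\<close> and the global one agree off
      finitely many points, hence as fractions; so the global equation survives at \<open>r\<close>
      when the common linear factor is cancelled.\<close>
    have eq: "P1 * Q' = P' * Q1"
    proof -
      have "poly ([:0, 1:] * Q1 * [:- r, 1:] * (P1 * Q' - P' * Q1)) c = 0" for c
      proof (cases "c = 0 \<or> c = r \<or> poly Q1 c = 0")
        case False
        then have "(c - r) * (f c * poly Q' c) = (c - r) * poly P' c"
          using fPQ[of c] by (simp add: P' algebra_simps)
        moreover have "c - r \<noteq> 0" using False by simp
        ultimately have "f c * poly Q' c = poly P' c" by (metis mult_left_cancel)
        moreover have "f c * poly Q1 c = poly P1 c" using loc1 False by simp
        ultimately have "poly P1 c * poly Q' c = poly P' c * poly Q1 c" by (metis mult.assoc mult.commute)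
        then show ?thesis by simp
      qed auto
      then have "[:0, 1:] * Q1 * [:- r, 1:] * (P1 * Q' - P' * Q1) = 0" using poly_all_0_iff_0 by blast
      moreover have "Q1 \<noteq> 0" using loc1 by auto
      then have "[:0, 1:] * Q1 * [:- r, 1:] \<noteq> 0"
        by (simp only: mult_eq_0_iff) (simp add: pCons_eq_0_iff)
      ultimately have "P1 * Q' - P' * Q1 = 0" by (simp only: mult_eq_0_iff) blast
      then show ?thesis by simp
    qed
    have "f c * poly Q' c = poly P' c" if c: "c \<noteq> 0" for c
    proof (cases "c = r")
      case True
      have "f r * poly Q1 r = poly P1 r" using loc1 r by simp
      moreover have "poly P1 r * poly Q' r = poly P' r * poly Q1 r"
        using arg_cong[OF eq, of "\<lambda>p. poly p r"] by simp
      ultimately have "f r * poly Q' r * poly Q1 r = poly P' r * poly Q1 r" by (metis mult.assoc mult.commute)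
      then show ?thesis using loc1(1) True by simp
    next
      case False
      then have "(c - r) * (f c * poly Q' c) = (c - r) * poly P' c"
        using fPQ[OF c] by (simp add: P' algebra_simps)
      moreover have "c - r \<noteq> 0" using False by simp
      ultimately show ?thesis by (metis mult_left_cancel)
    qed
    then have "?rep P' Q'" using \<open>Q' \<noteq> 0\<close> by simp
    from min[OF this] have "degree Q \<le> degree Q'" .
    moreover have "degree Q = Suc (degree Q')" unfolding P' using \<open>Q' \<noteq> 0\<close> by (subst degree_mult_eq) auto
    ultimately show False by simp
  qed
  have Pr: "poly P r \<noteq> 0" if r: "r \<noteq> 0" for r using fPQ[OF r] Qr[OF r] nz[OF r] by auto
  have "P \<noteq> 0" using Pr[of 1] by auto
  obtain \<alpha> a where a: "\<alpha> \<noteq> 0" "\<forall>c. poly P c = \<alpha> * c ^ a" using poly_no_nonzero_roots[OF \<open>P \<noteq> 0\<close> Pr] by auto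
  obtain \<beta> b where b: "\<beta> \<noteq> 0" "\<forall>c. poly Q c = \<beta> * c ^ b" using poly_no_nonzero_roots[OF Q0 Qr] by auto
  have "\<alpha> = \<beta>" using fPQ[of 1] a b one by simp
  show ?thesis
  proof (intro exI[of _ "int a - int b"] allI impI)
    fix c :: complex assume c: "c \<noteq> 0"
    have "f c * (\<beta> * c ^ b) = \<beta> * c ^ a" using fPQ[OF c] a b \<open>\<alpha> = \<beta>\<close> by simp
    then show "f c = c powi (int a - int b)"
      using c b(1) by (simp add: power_int_diff field_simps)
  qed
qed

section \<open>The standard torus\<close>

lemma std_torus_generated: "generated_space (var (std_torus n)) {({..<n} \<rightarrow>\<^sub>E - {0}, polyfuns n)}"
  using polyfuns_generated[of "{..<n} \<rightarrow>\<^sub>E - {0}" n] by (simp add: std_torus_def)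

interpretation std_torus: generated_space "var (std_torus n)" "{({..<n} \<rightarrow>\<^sub>E - {0}, polyfuns n)}" for n
  by (rule std_torus_generated)

lemma std_torus_simps [simp]:
  "carrier (std_torus n) = {..<n} \<rightarrow>\<^sub>E - {0}"
  "x \<otimes>\<^bsub>std_torus n\<^esub> y = (\<lambda>i\<in>{..<n}. x i * y i)" "\<one>\<^bsub>std_torus n\<^esub> = (\<lambda>i\<in>{..<n}. 1)"
  by (simp_all add: std_torus_def)

lemma std_torus_pts [simp]: "pts (var (std_torus n)) = {..<n} \<rightarrow>\<^sub>E - {0}"
  using std_torus.points by simp

lemma restrict_mem_std_torus: "restrict g {..<n} \<in> {..<n} \<rightarrow>\<^sub>E - {0} \<longleftrightarrow> (\<forall>i<n. g i \<noteq> 0)"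
  by (auto simp: restrict_PiE_iff Pi_iff)

lemma std_torus_open:
  assumes "openin (zar (var (std_torus n))) W" "W \<noteq> {}"
  shows "\<exists>h\<in>polyfuns n. (\<exists>z. h z \<noteq> 0) \<and> (\<forall>z\<in>{..<n} \<rightarrow>\<^sub>E - {0}. h z \<noteq> 0 \<longrightarrow> z \<in> W)"
proof -
  obtain z where "z \<in> W" using assms by auto
  then obtain D A h where *: "(D, A) \<in> {({..<n} \<rightarrow>\<^sub>E - {0}, polyfuns n)}" "h \<in> A" "z \<in> D" "h z \<noteq> 0" "{w \<in> D. h w \<noteq> 0} \<subseteq> W"
    by (rule std_torus.basis[OF assms(1)])
  then show ?thesis by (intro bexI[of _ h]) auto
qed

lemma std_torus_irreducible: "irreducible_space (var (std_torus n))"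
  unfolding irreducible_space_def
proof (intro allI impI)
  fix U V assume UV: "openin (zar (var (std_torus n))) U" "openin (zar (var (std_torus n))) V" "U \<noteq> {}" "V \<noteq> {}"
  obtain f where f: "f \<in> polyfuns n" "\<exists>z. f z \<noteq> 0" "\<forall>z\<in>{..<n} \<rightarrow>\<^sub>E - {0}. f z \<noteq> 0 \<longrightarrow> z \<in> U"
    using std_torus_open[OF UV(1,3)] by auto
  obtain g where g: "g \<in> polyfuns n" "\<exists>z. g z \<noteq> 0" "\<forall>z\<in>{..<n} \<rightarrow>\<^sub>E - {0}. g z \<noteq> 0 \<longrightarrow> z \<in> V"
    using std_torus_open[OF UV(2,4)] by auto
  obtain u where "f u * g u \<noteq> 0" using polyfuns_mult_nonzero[OF f(1) g(1)] f(2) g(2) by auto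
  from polyfuns_nonzero_pos[OF polyfuns.mult[OF f(1) g(1)] this]
  obtain z where z: "posvec z" "f z * g z \<noteq> 0" .
  let ?z = "restrict z {..<n}"
  have "?z \<in> {..<n} \<rightarrow>\<^sub>E - {0}" using z(1) posreal_nonzero by (auto simp: posvec_def)
  moreover have "f ?z = f z" "g ?z = g z" by (auto intro!: polyfuns_cong[OF f(1)] polyfuns_cong[OF g(1)])
  ultimately have "?z \<in> U" "?z \<in> V" using z(2) f(3) g(3) by auto
  then show "U \<inter> V \<noteq> {}" by blast
qed

lemma std_torus_coord_regular: "i < n \<Longrightarrow> (\<lambda>z. z i) \<in> regs (var (std_torus n)) ({..<n} \<rightarrow>\<^sub>E - {0})"
  by (rule std_torus.generator_regular[of _ "polyfuns n"]) (auto intro: polyfuns.coord)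

lemma regular_on_std_torus:
  assumes S: "ringed_space S" and U: "openin (zar S) U"
    and f: "\<And>i. i < n \<Longrightarrow> (\<lambda>x. f x i) \<in> regs S U" "\<And>x. x \<in> U \<Longrightarrow> f x \<in> {..<n} \<rightarrow>\<^sub>E - {0}"
  shows "regular_on S U (var (std_torus n)) f"
proof (rule regular_on_generated[OF S std_torus_generated U])
  show "f x \<in> pts (var (std_torus n))" if "x \<in> U" for x using f(2) that by simp
  have eq: "{x \<in> U. f x \<in> {..<n} \<rightarrow>\<^sub>E - {0}} = U" using f(2) by auto
  fix D A assume DA: "(D, A) \<in> {({..<n} \<rightarrow>\<^sub>E - {0 :: complex}, polyfuns n)}"
  then have D: "{x \<in> U. f x \<in> D} = U" using eq by auto
  show "openin (zar S) {x \<in> U. f x \<in> D}" unfolding D by (rule U)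
  fix a assume "a \<in> A"
  then have a: "a \<in> polyfuns n" using DA by auto
  show "(\<lambda>x. a (f x)) \<in> regs S {x \<in> U. f x \<in> D}"
    unfolding D by (rule ringed_space.polyfun_regular[OF S a U f(1)])
qed

lemma regs_of_std_torus:
  assumes "regular_on S U (var (std_torus n)) f" "i < n"
  shows "(\<lambda>x. f x i) \<in> regs S U"
proof -
  have o: "openin (zar (var (std_torus n))) ({..<n} \<rightarrow>\<^sub>E - {0})"
    by (rule std_torus.domain_open[of _ "polyfuns n"]) simp
  have "{x \<in> U. f x \<in> {..<n} \<rightarrow>\<^sub>E - {0}} = U" using regular_on_image[OF assms(1)] by auto
  then show ?thesis using regular_on_pull[OF assms(1) o std_torus_coord_regular[OF assms(2)]] by simp
qed

text \<open>A point is the product of its coordinates, embedded as one-parameter subgroups, and on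
  each of these the character is a power.\<close>

lemma std_torus_character:
  assumes hom: "\<sigma> \<in> hom (std_torus n) Gm" and reg: "morphism (var (std_torus n)) (var Gm) \<sigma>"
  shows "\<exists>m. \<forall>z\<in>{..<n} \<rightarrow>\<^sub>E - {0}. \<sigma> z = (\<Prod>j<n. z j powi m j)"
proof -
  have mult: "\<sigma> (\<lambda>i\<in>{..<n}. x i * y i) = \<sigma> x * \<sigma> y" if "x \<in> {..<n} \<rightarrow>\<^sub>E - {0}" "y \<in> {..<n} \<rightarrow>\<^sub>E - {0}" for x y
    using hom that by (auto simp: hom_def)
  have nz: "\<sigma> x \<noteq> 0" if "x \<in> {..<n} \<rightarrow>\<^sub>E - {0}" for x using hom that by (auto simp: hom_def)
  have one: "\<sigma> (\<lambda>i\<in>{..<n}. 1) = 1"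
  proof -
    have e: "(\<lambda>i\<in>{..<n}. 1 :: complex) \<in> {..<n} \<rightarrow>\<^sub>E - {0}" by auto
    have "(\<lambda>i\<in>{..<n}. (\<lambda>i\<in>{..<n}. 1 :: complex) i * (\<lambda>i\<in>{..<n}. 1) i) = (\<lambda>i\<in>{..<n}. 1)" by auto
    then have "\<sigma> (\<lambda>i\<in>{..<n}. 1) * \<sigma> (\<lambda>i\<in>{..<n}. 1) = \<sigma> (\<lambda>i\<in>{..<n}. 1)" using mult[OF e e] by simp
    then show ?thesis using nz[OF e] by simp
  qed
  let ?\<iota> = "\<lambda>j c. \<lambda>i\<in>{..<n}. if i = j then c else 1"
  have "\<exists>m. \<forall>c. c \<noteq> 0 \<longrightarrow> \<sigma> (?\<iota> j c) = c powi m" for j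
  proof (rule Gm_regular_monomial)
    have "regular_on (var Gm) (- {0}) (var (std_torus n)) (?\<iota> j)"
    proof (rule regular_on_std_torus[OF Gm.ringed])
      show o: "openin (zar (var Gm)) (- {0})" by (rule Gm.domain_open[of _ "range cpoly"]) simp
      show "(\<lambda>x. ?\<iota> j x i) \<in> regs (var Gm) (- {0})" if "i < n" for i
        using that Gm_id_regular Gm.const[OF o, of 1] by (cases "i = j") auto
    qed auto
    from regular_on_compose'[OF this reg]
    show "(\<lambda>c. \<sigma> (?\<iota> j c)) \<in> regs (var Gm) (- {0})" by (intro regs_of_Gm) auto
    show "\<sigma> (?\<iota> j c) \<noteq> 0" if "c \<noteq> 0" for c by (rule nz) (use that in \<open>simp add: restrict_mem_std_torus\<close>)
    have "?\<iota> j 1 = (\<lambda>i\<in>{..<n}. 1)" by auto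
    then show "\<sigma> (?\<iota> j 1) = 1" using one by simp
  qed
  then obtain m where m: "\<And>j c. c \<noteq> 0 \<Longrightarrow> \<sigma> (?\<iota> j c) = c powi m j" by metis
  have partial: "\<sigma> (\<lambda>i\<in>{..<n}. if i < k then z i else 1) = (\<Prod>j<k. z j powi m j)"
    if z: "z \<in> {..<n} \<rightarrow>\<^sub>E - {0}" and "k \<le> n" for z k
    using that(2)
  proof (induction k)
    case 0
    have "(\<lambda>i\<in>{..<n}. if i < 0 then z i else 1) = (\<lambda>i\<in>{..<n}. 1)" by auto
    then show ?case using one by (simp only: lessThan_0 prod.empty)
  next
    case (Suc k)
    let ?a = "\<lambda>i\<in>{..<n}. if i < k then z i else 1"
    have zk: "z k \<noteq> 0" using PiE_mem[OF z, of k] Suc.prems by simp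
    have e: "(\<lambda>i\<in>{..<n}. if i < Suc k then z i else 1) = (\<lambda>i\<in>{..<n}. ?a i * ?\<iota> k (z k) i)"
    proof (rule ext)
      fix i
      have "i < Suc k \<longleftrightarrow> i < k \<or> i = k" by auto
      then show "(\<lambda>i\<in>{..<n}. if i < Suc k then z i else 1) i = (\<lambda>i\<in>{..<n}. ?a i * ?\<iota> k (z k) i) i"
        by (cases "i = k"; cases "i < k"; cases "i < n") simp_all
    qed
    have m12: "?a \<in> {..<n} \<rightarrow>\<^sub>E - {0}" "?\<iota> k (z k) \<in> {..<n} \<rightarrow>\<^sub>E - {0}"
      unfolding restrict_mem_std_torus using PiE_mem[OF z] zk by simp_all
    have "\<sigma> (\<lambda>i\<in>{..<n}. if i < Suc k then z i else 1) = \<sigma> ?a * \<sigma> (?\<iota> k (z k))"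
      unfolding e by (rule mult[OF m12])
    moreover have "\<sigma> ?a = (\<Prod>j<k. z j powi m j)" by (rule Suc.IH) (use Suc.prems in simp)
    ultimately show ?case using m[OF zk] by (simp only: prod.lessThan_Suc)
  qed
  have "\<sigma> z = (\<Prod>j<n. z j powi m j)" if z: "z \<in> {..<n} \<rightarrow>\<^sub>E - {0}" for z
  proof -
    have "(\<lambda>i\<in>{..<n}. if i < n then z i else 1) = restrict z {..<n}" by (rule restrict_ext) simp
    also have "\<dots> = z" using z by (rule PiE_restrict)
    finally show ?thesis using partial[OF z order.refl] by simp
  qed
  then show ?thesis by blast
qed

subsection \<open>Exponents as pole orders\<close>

lemma growth_poly: "growth (\<lambda>c. poly p (complex_of_real c)) (int (degree p)) (lead_coeff p)"
proof -
  have id: "growth (\<lambda>c. complex_of_real c) 1 1" using growth_powi[of 1] by simp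
  have "growth (\<lambda>c. coeff p k * complex_of_real c ^ k) (int (degree p)) (if k = degree p then lead_coeff p else 0)"
    if "k \<le> degree p" for k
  proof -
    have "growth (\<lambda>c. coeff p k * complex_of_real c ^ k) (0 + int k * 1) (coeff p k * 1 ^ k)"
      by (intro growth_mult growth_const growth_power id)
    then have g: "growth (\<lambda>c. coeff p k * complex_of_real c ^ k) (int k) (coeff p k)" by simp
    show ?thesis
    proof (cases "k = degree p")
      case False
      then show ?thesis using growth_higher[OF g, of "int (degree p)"] that by simp
    qed (use g in simp)
  qed
  then have "growth (\<lambda>c. \<Sum>k\<le>degree p. coeff p k * complex_of_real c ^ k) (int (degree p))
      (\<Sum>k\<le>degree p. if k = degree p then lead_coeff p else 0)"
    by (intro growth_sum) auto
  then show ?thesis by (simp add: poly_altdef)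
qed

text \<open>Along a monomial curve a positive function becomes a function of one variable.
  Positivity on the positive axis is carried through the induction in order to know that numerator
  and denominator are nonzero polynomials.\<close>

lemma prat_curve:
  assumes "f \<in> prat n"
  shows "\<exists>p q. p \<noteq> 0 \<and> q \<noteq> 0 \<and> (\<forall>c. c \<noteq> 0 \<longrightarrow> poly p c \<noteq> 0 \<longrightarrow> poly q c \<noteq> 0 \<longrightarrow>
    f (\<lambda>i. c powi b i) = poly p c / poly q c)"
proof -
  let ?pos = "\<lambda>p. \<forall>c>0. poly p (complex_of_real c) \<in> posreal"
  have pos1: "?pos 1" by simp
  have posm: "?pos (p * q)" "?pos (p + q)" if "?pos p" "?pos q" for p q using that by auto
  have "\<exists>p q. ?pos p \<and> ?pos q \<and> (\<forall>c. c \<noteq> 0 \<longrightarrow> poly p c \<noteq> 0 \<longrightarrow> poly q c \<noteq> 0 \<longrightarrow>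
      f (\<lambda>i. c powi b i) = poly p c / poly q c)"
    using assms
  proof (induction rule: prat.induct)
    case (const a)
    then show ?case by (intro exI[of _ "[:a:]"] exI[of _ 1]) auto
  next
    case (coord i)
    have pm: "?pos (monom 1 k)" for k using posreal_closed(5)[of "_ ^ k"] by (auto simp: poly_monom)
    show ?case
    proof (cases "b i \<ge> 0")
      case True
      then show ?thesis using pm pos1
        by (intro exI[of _ "monom 1 (nat (b i))"] exI[of _ 1]) (auto simp: poly_monom power_int_def)
    next
      case False
      then show ?thesis using pm pos1
        by (intro exI[of _ 1] exI[of _ "monom 1 (nat (- b i))"])
          (auto simp: poly_monom power_int_def divide_inverse power_inverse)
    qed
  next
    case (add f g)
    then obtain p q p' q' where pq: "?pos p" "?pos q" "?pos p'" "?pos q'"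
      "\<forall>c. c \<noteq> 0 \<longrightarrow> poly p c \<noteq> 0 \<longrightarrow> poly q c \<noteq> 0 \<longrightarrow> f (\<lambda>i. c powi b i) = poly p c / poly q c"
      "\<forall>c. c \<noteq> 0 \<longrightarrow> poly p' c \<noteq> 0 \<longrightarrow> poly q' c \<noteq> 0 \<longrightarrow> g (\<lambda>i. c powi b i) = poly p' c / poly q' c"
      by (elim exE conjE)
    have "?pos ((p * q' + p' * q) * (p * p'))" "?pos ((q * q') * (p * p'))" by (intro posm pq)+
    moreover have "\<forall>c. c \<noteq> 0 \<longrightarrow> poly ((p * q' + p' * q) * (p * p')) c \<noteq> 0 \<longrightarrow> poly ((q * q') * (p * p')) c \<noteq> 0 \<longrightarrow>
      f (\<lambda>i. c powi b i) + g (\<lambda>i. c powi b i) = poly ((p * q' + p' * q) * (p * p')) c / poly ((q * q') * (p * p')) c"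
      using pq(5,6) by (auto simp: add_frac_eq)
    ultimately show ?case by (intro exI conjI)
  next
    case (mult f g)
    then obtain p q p' q' where pq: "?pos p" "?pos q" "?pos p'" "?pos q'"
      "\<forall>c. c \<noteq> 0 \<longrightarrow> poly p c \<noteq> 0 \<longrightarrow> poly q c \<noteq> 0 \<longrightarrow> f (\<lambda>i. c powi b i) = poly p c / poly q c"
      "\<forall>c. c \<noteq> 0 \<longrightarrow> poly p' c \<noteq> 0 \<longrightarrow> poly q' c \<noteq> 0 \<longrightarrow> g (\<lambda>i. c powi b i) = poly p' c / poly q' c"
      by (elim exE conjE)
    have "?pos (p * p')" "?pos (q * q')" by (intro posm pq)+
    moreover have "\<forall>c. c \<noteq> 0 \<longrightarrow> poly (p * p') c \<noteq> 0 \<longrightarrow> poly (q * q') c \<noteq> 0 \<longrightarrow>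
      f (\<lambda>i. c powi b i) * g (\<lambda>i. c powi b i) = poly (p * p') c / poly (q * q') c"
      using pq(5,6) by auto
    ultimately show ?case by (intro exI conjI)
  next
    case (inv f)
    then obtain p q where pq: "?pos p" "?pos q"
      "\<forall>c. c \<noteq> 0 \<longrightarrow> poly p c \<noteq> 0 \<longrightarrow> poly q c \<noteq> 0 \<longrightarrow> f (\<lambda>i. c powi b i) = poly p c / poly q c"
      by (elim exE conjE)
    then show ?case by (intro exI[of _ q] exI[of _ p]) auto
  qed
  then obtain p q where pq: "?pos p" "?pos q" "\<forall>c. c \<noteq> 0 \<longrightarrow> poly p c \<noteq> 0 \<longrightarrow> poly q c \<noteq> 0 \<longrightarrow>
      f (\<lambda>i. c powi b i) = poly p c / poly q c" by blast
  have "p \<noteq> 0" if "?pos p" for p using that[rule_format, of 1] posreal_nonzero[of 0] by auto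
  then show ?thesis using pq by blast
qed

lemma prat_curve_nonzero:
  assumes "f \<in> prat n"
  shows "\<exists>r. r \<noteq> 0 \<and> (\<forall>c. c \<noteq> 0 \<longrightarrow> poly r c \<noteq> 0 \<longrightarrow> f (\<lambda>i. c powi b i) \<noteq> 0)"
proof -
  obtain p q where pq: "p \<noteq> 0" "q \<noteq> 0" "\<forall>c. c \<noteq> 0 \<longrightarrow> poly p c \<noteq> 0 \<longrightarrow> poly q c \<noteq> 0 \<longrightarrow>
      f (\<lambda>i. c powi b i) = poly p c / poly q c" using prat_curve[OF assms] by metis
  then show ?thesis by (intro exI[of _ "p * q"]) auto
qed

text \<open>Identifies the algebraic pole order with the growth exponent for real \<open>c\<close>.
  Two representations by polynomials agree off finitely many points and thus have the same
  difference of degrees.\<close>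

lemma pole_order_eq:
  assumes f: "f \<in> prat n" and v: "has_exp (\<lambda>c. f (\<lambda>i. complex_of_real c powi b i)) v"
    and r: "r \<noteq> 0" "\<And>c. c \<noteq> 0 \<Longrightarrow> poly r c \<noteq> 0 \<Longrightarrow> F c = Some (f (\<lambda>i. c powi b i))"
  shows "pole_order F = v"
proof -
  obtain p q where pq: "p \<noteq> 0" "q \<noteq> 0" "\<forall>c. c \<noteq> 0 \<longrightarrow> poly p c \<noteq> 0 \<longrightarrow> poly q c \<noteq> 0 \<longrightarrow>
      f (\<lambda>i. c powi b i) = poly p c / poly q c" using prat_curve[OF f] by metis
  have gp: "growth (\<lambda>c. poly p (complex_of_real c)) (int (degree p)) (lead_coeff p)" and
    gq: "growth (\<lambda>c. poly q (complex_of_real c)) (int (degree q)) (lead_coeff q)" by (rule growth_poly)+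
  have "growth (\<lambda>c. poly p (complex_of_real c) * inverse (poly q (complex_of_real c)))
      (int (degree p) + - int (degree q)) (lead_coeff p * inverse (lead_coeff q))"
    using pq by (intro growth_mult growth_inverse gp gq) auto
  moreover have "eventually (\<lambda>c. poly p (complex_of_real c) * inverse (poly q (complex_of_real c)) =
      f (\<lambda>i. complex_of_real c powi b i)) at_top"
  proof -
    have "lead_coeff p \<noteq> 0" "lead_coeff q \<noteq> 0" using pq by auto
    from growth_nonzero[OF gp this(1)] growth_nonzero[OF gq this(2)] eventually_gt_at_top[of 0]
    show ?thesis
    proof eventually_elim
      case (elim c)
      then show ?case using pq(3)[rule_format, of "complex_of_real c"] by (simp add: divide_inverse)
    qed
  qed
  ultimately have g: "growth (\<lambda>c. f (\<lambda>i. complex_of_real c powi b i))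
      (int (degree p) + - int (degree q)) (lead_coeff p * inverse (lead_coeff q))" by (rule growth_cong)
  have "v = int (degree p) - int (degree q)"
  proof -
    obtain L where "L \<in> posreal" "growth (\<lambda>c. f (\<lambda>i. complex_of_real c powi b i)) v L" using v by (auto simp: has_exp_def)
    from growth_unique[OF this(2) posreal_nonzero[OF this(1)] g] pq show ?thesis by simp
  qed
  show ?thesis unfolding pole_order_def
  proof (rule the_equality)
    let ?W = "{c. c \<noteq> 0 \<and> poly (p * q * r) c \<noteq> 0}"
    have "?W \<noteq> {}" using cofinite_nonempty[of "p * q * r"] pq r by auto
    then have "open_dense (var Gm) ?W" by (intro irreducible_open_dense Gm_irreducible Gm_open_poly)
    then have "generically (var Gm) (\<lambda>c. poly q c \<noteq> 0 \<and> F c = Some (poly p c / poly q c))"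
      unfolding generically_def using pq r by (intro exI[of _ ?W]) auto
    then show "\<exists>p q. p \<noteq> 0 \<and> q \<noteq> 0 \<and> generically (var Gm) (\<lambda>c. poly q c \<noteq> 0 \<and> F c = Some (poly p c / poly q c)) \<and>
        v = int (degree p) - int (degree q)"
      using pq \<open>v = _\<close> by blast
  next
    fix k assume "\<exists>p q. p \<noteq> 0 \<and> q \<noteq> 0 \<and> generically (var Gm) (\<lambda>c. poly q c \<noteq> 0 \<and> F c = Some (poly p c / poly q c)) \<and>
        k = int (degree p) - int (degree q)"
    then obtain p' q' W where pq': "p' \<noteq> 0" "q' \<noteq> 0" "open_dense (var Gm) W"
      "\<forall>c\<in>W. poly q' c \<noteq> 0 \<and> F c = Some (poly p' c / poly q' c)" "k = int (degree p') - int (degree q')"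
      unfolding generically_def by blast
    have "W \<noteq> {}" using open_dense_meets[OF pq'(3), of "- {0}"] Gm.domain_open[of "- {0}" "range cpoly"] by auto
    then obtain w where w: "w \<noteq> 0" "\<forall>c. c \<noteq> 0 \<longrightarrow> poly w c \<noteq> 0 \<longrightarrow> c \<in> W"
      using Gm_open_cofinite[OF open_dense_open[OF pq'(3)]] by auto
    have "poly ([:0, 1:] * (p * q * r * w) * (p' * q - p * q')) c = 0" for c
    proof (cases "poly ([:0, 1:] * (p * q * r * w)) c = 0")
      case False
      then have c: "c \<noteq> 0" "poly p c \<noteq> 0" "poly q c \<noteq> 0" "poly r c \<noteq> 0" "c \<in> W" using w by auto
      then have "poly p' c / poly q' c = poly p c / poly q c" "poly q' c \<noteq> 0" using pq'(4) r(2) pq(3) by auto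
      then show ?thesis using c by (simp add: frac_eq_eq)
    qed auto
    then have "[:0, 1:] * (p * q * r * w) * (p' * q - p * q') = 0" using poly_all_0_iff_0 by blast
    then have "p' * q = p * q'" using pq r w by auto
    from arg_cong[OF this, of degree] have "degree p' + degree q = degree p + degree q'"
      using pq pq' by (simp add: degree_mult_eq)
    then show "k = v" using pq'(5) \<open>v = _\<close> by linarith
  qed
qed

subsection \<open>Tori in coordinates\<close>

lemma homI: "(\<And>x. x \<in> carrier G \<Longrightarrow> h x \<in> carrier H) \<Longrightarrow>
    (\<And>x y. x \<in> carrier G \<Longrightarrow> y \<in> carrier G \<Longrightarrow> h (x \<otimes>\<^bsub>G\<^esub> y) = h x \<otimes>\<^bsub>H\<^esub> h y) \<Longrightarrow> h \<in> hom G H"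
  by (auto simp: hom_def)

lemma alg_homI:
  assumes "h \<in> hom G H" "h \<in> extensional (carrier G)" "morphism (var G) (var H) h"
  shows "h \<in> alg_hom G H"
  using assms by (simp add: alg_hom_def)

lemma alg_homD:
  assumes "h \<in> alg_hom G H"
  shows "h \<in> hom G H" "h \<in> extensional (carrier G)" "morphism (var G) (var H) h"
  using assms by (auto simp: alg_hom_def)

locale torus_chart =
  fixes T :: "'t alg_group" and d :: nat and \<phi> :: "'t \<Rightarrow> nat \<Rightarrow> complex"
  assumes variety_T: "variety (var T)" and pts_T: "pts (var T) = carrier T" and group_T: "group T"
    and iso_\<phi>: "\<phi> \<in> iso T (std_torus d)" and fspace_iso_\<phi>: "fspace_iso (var T) (var (std_torus d)) \<phi>"
begin

text \<open>Inverse of the chart. The truncation to \<open>d\<close> coordinates lets arbitrary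
  sequences serve as points, in particular those with parameters appended.\<close>

definition pt :: "(nat \<Rightarrow> complex) \<Rightarrow> 't" where
  "pt s = inv_into (carrier T) \<phi> (restrict s {..<d})"

abbreviation GT :: "(complex \<times> 't) fspace" where
  "GT \<equiv> fprod (var Gm) (var T)"

sublocale T: ringed_space "var T"
  by (rule variety_ringed[OF variety_T])

sublocale GT: ringed_space GT
  by (rule fprod_ringed[OF Gm.ringed T.ringed_space_axioms])

lemma GT_pts [simp]: "pts GT = (- {0}) \<times> carrier T"
  using fprod_pts[OF Gm.ringed T.ringed_space_axioms] by (simp add: pts_T)

lemma bij: "bij_betw \<phi> (carrier T) ({..<d} \<rightarrow>\<^sub>E - {0})"
  using iso_\<phi> by (simp add: iso_def)

lemma \<phi>_mem: "t \<in> carrier T \<Longrightarrow> \<phi> t \<in> {..<d} \<rightarrow>\<^sub>E - {0}"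
  using bij by (auto simp: bij_betw_def)

lemma \<phi>_nonzero: "t \<in> carrier T \<Longrightarrow> j < d \<Longrightarrow> \<phi> t j \<noteq> 0"
  using PiE_mem[OF \<phi>_mem, of t j] by simp

lemma \<phi>_mult: "t \<in> carrier T \<Longrightarrow> u \<in> carrier T \<Longrightarrow> j < d \<Longrightarrow> \<phi> (t \<otimes>\<^bsub>T\<^esub> u) j = \<phi> t j * \<phi> u j"
  using iso_\<phi> by (simp add: iso_def hom_def)

lemma pt_mem: "(\<And>j. j < d \<Longrightarrow> s j \<noteq> 0) \<Longrightarrow> pt s \<in> carrier T"
  unfolding pt_def using restrict_mem_std_torus[of s d] bij_betw_imp_surj_on[OF bij]
  by (intro inv_into_into) auto

lemma \<phi>_pt: "(\<And>j. j < d \<Longrightarrow> s j \<noteq> 0) \<Longrightarrow> \<phi> (pt s) = restrict s {..<d}"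
  unfolding pt_def using restrict_mem_std_torus[of s d] bij_betw_imp_surj_on[OF bij]
  by (intro f_inv_into_f) auto

lemma pt_\<phi>: "t \<in> carrier T \<Longrightarrow> pt (\<phi> t) = t"
  unfolding pt_def using PiE_restrict[OF \<phi>_mem] bij_betw_inv_into_left[OF bij] by simp

lemma pt_cong: "(\<And>j. j < d \<Longrightarrow> s j = s' j) \<Longrightarrow> pt s = pt s'"
  unfolding pt_def by (rule arg_cong[of _ _ "inv_into (carrier T) \<phi>"]) auto

lemma eqI:
  assumes "t \<in> carrier T" "u \<in> carrier T" "\<And>j. j < d \<Longrightarrow> \<phi> t j = \<phi> u j"
  shows "t = u"
  using pt_cong[of "\<phi> t" "\<phi> u"] assms pt_\<phi> by metis

lemma pt_mult:
  assumes "\<And>j. j < d \<Longrightarrow> s j \<noteq> 0" "\<And>j. j < d \<Longrightarrow> s' j \<noteq> 0"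
  shows "pt (\<lambda>j. s j * s' j) = pt s \<otimes>\<^bsub>T\<^esub> pt s'"
proof -
  interpret Tg: group T by (rule group_T)
  have m: "pt s \<in> carrier T" "pt s' \<in> carrier T" by (intro pt_mem assms; assumption)+
  show ?thesis
  proof (rule eqI)
    show "pt (\<lambda>j. s j * s' j) \<in> carrier T" by (rule pt_mem) (use assms in simp)
    show "pt s \<otimes>\<^bsub>T\<^esub> pt s' \<in> carrier T" by (rule Tg.m_closed[OF m])
    fix j assume j: "j < d"
    have "\<phi> (pt (\<lambda>j. s j * s' j)) = (\<lambda>j\<in>{..<d}. s j * s' j)" by (rule \<phi>_pt) (use assms in simp)
    then show "\<phi> (pt (\<lambda>j. s j * s' j)) j = \<phi> (pt s \<otimes>\<^bsub>T\<^esub> pt s') j"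
      using \<phi>_mult[OF m j] \<phi>_pt[OF assms(1)] \<phi>_pt[OF assms(2)] j by simp
  qed
qed

lemma T_open: "openin (zar (var T)) (carrier T)"
  using openin_topspace[of "zar (var T)"] by (simp add: pts_T)

lemma coord_regular: "j < d \<Longrightarrow> (\<lambda>t. \<phi> t j) \<in> regs (var T) (carrier T)"
  using fspace_iso_\<phi> by (intro regs_of_std_torus) (auto simp: fspace_iso_def pts_T)

lemma pt_regular:
  assumes S: "ringed_space S" and U: "openin (zar S) U"
    and f: "\<And>j. j < d \<Longrightarrow> (\<lambda>x. f x j) \<in> regs S U" "\<And>x j. x \<in> U \<Longrightarrow> j < d \<Longrightarrow> f x j \<noteq> 0"
  shows "regular_on S U (var T) (\<lambda>x. pt (f x))"
  unfolding pt_def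
proof (rule regular_on_compose'[where f = "\<lambda>x. restrict (f x) {..<d}" and g = "inv_into (carrier T) \<phi>"])
  show "regular_on S U (var (std_torus d)) (\<lambda>x. restrict (f x) {..<d})"
    by (rule regular_on_std_torus[OF S U]) (use f in \<open>simp_all add: restrict_mem_std_torus\<close>)
  show "regular_on (var (std_torus d)) ({..<d} \<rightarrow>\<^sub>E - {0}) (var T) (inv_into (carrier T) \<phi>)"
    using fspace_iso_\<phi> by (simp add: fspace_iso_def pts_T)
  show "restrict (f x) {..<d} \<in> {..<d} \<rightarrow>\<^sub>E - {0}" if "x \<in> U" for x
    using f(2)[OF that] by (simp add: restrict_mem_std_torus)
qed

lemma std_open: "openin (zar (var (std_torus n))) ({..<n} \<rightarrow>\<^sub>E - {0})"
  using openin_topspace[of "zar (var (std_torus n))"] by simp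

lemma pt_regular_std: "regular_on (var (std_torus d)) ({..<d} \<rightarrow>\<^sub>E - {0}) (var T) pt"
  by (rule pt_regular[OF std_torus.ringed std_open])
    (simp_all add: std_torus_coord_regular, metis ComplD PiE_mem lessThan_iff singletonI)

text \<open>The parameter sits at index \<open>d\<close>, as in the arguments of a positive
  action.\<close>

lemma \<Theta>_regular: "regular_on (var (std_torus (Suc d))) ({..<Suc d} \<rightarrow>\<^sub>E - {0}) GT (\<lambda>z. (z d, pt z))"
proof (rule regular_on_Pair[OF std_torus.ringed Gm.ringed T.ringed_space_axioms])
  have nz: "x j \<noteq> 0" if "x \<in> {..<Suc d} \<rightarrow>\<^sub>E - {0 :: complex}" "j < Suc d" for x j
    using PiE_mem[OF that(1), of j] that(2) by simp
  show "regular_on (var (std_torus (Suc d))) ({..<Suc d} \<rightarrow>\<^sub>E - {0}) (var Gm) (\<lambda>z. z d)"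
    by (rule regular_on_Gm[OF std_torus.ringed std_open std_torus_coord_regular]) (use nz in auto)
  show "regular_on (var (std_torus (Suc d))) ({..<Suc d} \<rightarrow>\<^sub>E - {0}) (var T) pt"
    by (rule pt_regular[OF std_torus.ringed std_open std_torus_coord_regular]) (use nz in auto)
qed

lemma T_irreducible: "irreducible_space (var T)"
proof (rule irreducible_image[OF std_torus_irreducible pt_regular_std])
  fix V assume V: "openin (zar (var T)) V" "V \<noteq> {}"
  then obtain t where "t \<in> V" by auto
  then have "t \<in> carrier T" using openin_subset[OF V(1)] by (auto simp: pts_T)
  then show "\<exists>x\<in>{..<d} \<rightarrow>\<^sub>E - {0}. pt x \<in> V"
    using \<phi>_mem pt_\<phi> \<open>t \<in> V\<close> by (intro bexI[of _ "\<phi> t"]) auto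
qed

lemma upd_mem: "c \<noteq> 0 \<Longrightarrow> t \<in> carrier T \<Longrightarrow> (\<phi> t)(d := c) \<in> {..<Suc d} \<rightarrow>\<^sub>E - {0}"
  using \<phi>_nonzero[of t] PiE_arb[OF \<phi>_mem, of t] by (auto simp: PiE_iff extensional_def less_Suc_eq)

lemma pt_upd: "t \<in> carrier T \<Longrightarrow> pt ((\<phi> t)(d := c)) = t"
  using pt_cong[of "(\<phi> t)(d := c)" "\<phi> t"] pt_\<phi> by simp

lemma GT_irreducible: "irreducible_space GT"
proof (rule irreducible_image[OF std_torus_irreducible \<Theta>_regular])
  fix V assume V: "openin (zar GT) V" "V \<noteq> {}"
  then obtain c t where ct: "(c, t) \<in> V" by auto
  then have "c \<noteq> 0" "t \<in> carrier T" using openin_subset[OF V(1)] by auto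
  then show "\<exists>x\<in>{..<Suc d} \<rightarrow>\<^sub>E - {0}. (x d, pt x) \<in> V"
    using upd_mem pt_upd ct by (intro bexI[of _ "(\<phi> t)(d := c)"]) auto
qed

text \<open>Turns generic statements about parameter and point into polynomial conditions on
  coordinates, by pulling the open set back to the standard torus.\<close>

lemma GT_open_contains:
  assumes W: "openin (zar GT) W" "W \<noteq> {}"
  shows "\<exists>h\<in>polyfuns (Suc d). (\<exists>z. h z \<noteq> 0) \<and>
    (\<forall>c t. c \<noteq> 0 \<longrightarrow> t \<in> carrier T \<longrightarrow> h ((\<phi> t)(d := c)) \<noteq> 0 \<longrightarrow> (c, t) \<in> W)"
proof -
  let ?V = "{z \<in> {..<Suc d} \<rightarrow>\<^sub>E - {0}. (z d, pt z) \<in> W}"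
  obtain c t where ct: "(c, t) \<in> W" using W by auto
  then have "c \<noteq> 0" "t \<in> carrier T" using openin_subset[OF W(1)] by auto
  then have "(\<phi> t)(d := c) \<in> ?V" using ct upd_mem pt_upd by simp
  then have "?V \<noteq> {}" by blast
  from std_torus_open[OF regular_on_preimage[OF \<Theta>_regular W(1)] this] obtain h where
    h: "h \<in> polyfuns (Suc d)" "\<exists>z. h z \<noteq> 0" "\<forall>z\<in>{..<Suc d} \<rightarrow>\<^sub>E - {0}. h z \<noteq> 0 \<longrightarrow> z \<in> ?V" by blast
  have "(c, t) \<in> W" if "c \<noteq> 0" "t \<in> carrier T" "h ((\<phi> t)(d := c)) \<noteq> 0" for c t
    using h(3)[rule_format, OF upd_mem[OF that(1,2)] that(3)] pt_upd[OF that(2)] by simp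
  then show ?thesis using h by blast
qed

lemma T_open_contains:
  assumes W: "openin (zar (var T)) W" "W \<noteq> {}"
  shows "\<exists>h\<in>polyfuns d. (\<exists>z. h z \<noteq> 0) \<and> (\<forall>t\<in>carrier T. h (\<phi> t) \<noteq> 0 \<longrightarrow> t \<in> W)"
proof -
  let ?V = "{z \<in> {..<d} \<rightarrow>\<^sub>E - {0}. pt z \<in> W}"
  obtain t where t: "t \<in> W" using W by auto
  then have "t \<in> carrier T" using openin_subset[OF W(1)] by (auto simp: pts_T)
  then have "\<phi> t \<in> ?V" using t \<phi>_mem pt_\<phi> by simp
  then have "?V \<noteq> {}" by blast
  from std_torus_open[OF regular_on_preimage[OF pt_regular_std W(1)] this] obtain h where
    h: "h \<in> polyfuns d" "\<exists>z. h z \<noteq> 0" "\<forall>z\<in>{..<d} \<rightarrow>\<^sub>E - {0}. h z \<noteq> 0 \<longrightarrow> z \<in> ?V" by blast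
  have "t \<in> W" if "t \<in> carrier T" "h (\<phi> t) \<noteq> 0" for t
    using h(3)[rule_format, OF \<phi>_mem[OF that(1)] that(2)] pt_\<phi>[OF that(1)] by simp
  then show ?thesis using h by blast
qed

subsection \<open>Characters and cocharacters\<close>

lemma coord_character:
  assumes j: "j < d"
  shows "(\<lambda>t\<in>carrier T. \<phi> t j) \<in> characters T"
proof (rule alg_homI)
  interpret Tg: group T by (rule group_T)
  show "(\<lambda>t\<in>carrier T. \<phi> t j) \<in> hom T Gm"
    by (rule homI) (use j in \<open>simp_all add: \<phi>_nonzero \<phi>_mult\<close>)
  show "(\<lambda>t\<in>carrier T. \<phi> t j) \<in> extensional (carrier T)" by simp
  have "regular_on (var T) (carrier T) (var Gm) (\<lambda>t. \<phi> t j)"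
    by (rule regular_on_Gm[OF T.ringed_space_axioms T_open coord_regular[OF j]]) (use \<phi>_nonzero j in auto)
  then show "morphism (var T) (var Gm) (\<lambda>t\<in>carrier T. \<phi> t j)"
    unfolding pts_T by (rule regular_on_cong[OF T.sheaf]) simp
qed

lemma character_monomial:
  assumes \<sigma>: "\<sigma> \<in> characters T"
  shows "\<exists>m. \<forall>t\<in>carrier T. \<sigma> t = (\<Prod>j<d. \<phi> t j powi m j)"
proof -
  note s = alg_homD[OF \<sigma>]
  have nz: "z j \<noteq> 0" if "z \<in> {..<d} \<rightarrow>\<^sub>E - {0 :: complex}" "j < d" for z j
    using PiE_mem[OF that(1), of j] that(2) by simp
  have "(\<lambda>z. \<sigma> (pt z)) \<in> hom (std_torus d) Gm"
  proof (rule homI)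
    show "\<sigma> (pt z) \<in> carrier Gm" if "z \<in> carrier (std_torus d)" for z
      using s(1) pt_mem[of z] nz[of z] that by (auto simp: hom_def)
    fix z w assume zw: "z \<in> carrier (std_torus d)" "w \<in> carrier (std_torus d)"
    have m: "pt z \<in> carrier T" "pt w \<in> carrier T" using pt_mem nz zw by simp_all
    have "pt (z \<otimes>\<^bsub>std_torus d\<^esub> w) = pt (\<lambda>j. z j * w j)" by (rule pt_cong) simp
    also have "\<dots> = pt z \<otimes>\<^bsub>T\<^esub> pt w" by (rule pt_mult) (use nz zw in auto)
    finally show "\<sigma> (pt (z \<otimes>\<^bsub>std_torus d\<^esub> w)) = \<sigma> (pt z) \<otimes>\<^bsub>Gm\<^esub> \<sigma> (pt w)"
      using s(1) m by (simp add: hom_def)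
  qed
  moreover have "morphism (var (std_torus d)) (var Gm) (\<lambda>z. \<sigma> (pt z))"
    unfolding std_torus_pts
    by (rule regular_on_compose'[OF pt_regular_std s(3)]) (use regular_on_image[OF pt_regular_std] in auto)
  ultimately obtain m where m: "\<forall>z\<in>{..<d} \<rightarrow>\<^sub>E - {0}. \<sigma> (pt z) = (\<Prod>j<d. z j powi m j)"
    using std_torus_character by blast
  show ?thesis
  proof (intro exI ballI)
    fix t assume t: "t \<in> carrier T"
    show "\<sigma> t = (\<Prod>j<d. \<phi> t j powi m j)" using m[rule_format, OF \<phi>_mem[OF t]] pt_\<phi>[OF t] by simp
  qed
qed

lemma prod_group_simps [simp]:
  "carrier (prod_group Gm T) = (- {0}) \<times> carrier T" "var (prod_group Gm T) = GT"
  "(c, t) \<otimes>\<^bsub>prod_group Gm T\<^esub> (c', t') = (c * c', t \<otimes>\<^bsub>T\<^esub> t')"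
  by (simp_all add: prod_group_def)

lemma prod_character_monomial:
  assumes \<sigma>: "\<sigma> \<in> characters (prod_group Gm T)"
  shows "\<exists>m. \<forall>c t. c \<noteq> 0 \<longrightarrow> t \<in> carrier T \<longrightarrow> \<sigma> (c, t) = (\<Prod>j<Suc d. ((\<phi> t)(d := c)) j powi m j)"
proof -
  note s = alg_homD[OF \<sigma>]
  have nz: "z j \<noteq> 0" if "z \<in> {..<Suc d} \<rightarrow>\<^sub>E - {0 :: complex}" "j < Suc d" for z j
    using PiE_mem[OF that(1), of j] that(2) by simp
  have "(\<lambda>z. \<sigma> (z d, pt z)) \<in> hom (std_torus (Suc d)) Gm"
  proof (rule homI)
    fix z assume z: "z \<in> carrier (std_torus (Suc d))"
    have "(z d, pt z) \<in> carrier (prod_group Gm T)" using pt_mem[of z] nz[of z] z by simp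
    then show "\<sigma> (z d, pt z) \<in> carrier Gm" using s(1) by (auto simp: hom_def)
    fix w assume w: "w \<in> carrier (std_torus (Suc d))"
    have m: "pt z \<in> carrier T" "pt w \<in> carrier T" "z d \<noteq> 0" "w d \<noteq> 0" using pt_mem nz z w by simp_all
    have "pt (z \<otimes>\<^bsub>std_torus (Suc d)\<^esub> w) = pt (\<lambda>j. z j * w j)" by (rule pt_cong) simp
    also have "\<dots> = pt z \<otimes>\<^bsub>T\<^esub> pt w" by (rule pt_mult) (use nz z w in auto)
    finally have "((z \<otimes>\<^bsub>std_torus (Suc d)\<^esub> w) d, pt (z \<otimes>\<^bsub>std_torus (Suc d)\<^esub> w)) =
        (z d, pt z) \<otimes>\<^bsub>prod_group Gm T\<^esub> (w d, pt w)" by simp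
    moreover have "\<sigma> ((z d, pt z) \<otimes>\<^bsub>prod_group Gm T\<^esub> (w d, pt w)) = \<sigma> (z d, pt z) \<otimes>\<^bsub>Gm\<^esub> \<sigma> (w d, pt w)"
      by (rule hom_mult[OF s(1)]) (use m in simp_all)
    ultimately show "\<sigma> ((z \<otimes>\<^bsub>std_torus (Suc d)\<^esub> w) d, pt (z \<otimes>\<^bsub>std_torus (Suc d)\<^esub> w)) =
        \<sigma> (z d, pt z) \<otimes>\<^bsub>Gm\<^esub> \<sigma> (w d, pt w)" by simp
  qed
  moreover have "morphism (var (std_torus (Suc d))) (var Gm) (\<lambda>z. \<sigma> (z d, pt z))"
    unfolding std_torus_pts
    by (rule regular_on_compose'[OF \<Theta>_regular s(3)[unfolded prod_group_simps]])
      (use regular_on_image[OF \<Theta>_regular] in blast)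
  ultimately obtain m where m: "\<forall>z\<in>{..<Suc d} \<rightarrow>\<^sub>E - {0}. \<sigma> (z d, pt z) = (\<Prod>j<Suc d. z j powi m j)"
    using std_torus_character by blast
  show ?thesis
  proof (intro exI allI impI)
    fix c t assume t: "c \<noteq> (0 :: complex)" "t \<in> carrier T"
    show "\<sigma> (c, t) = (\<Prod>j<Suc d. ((\<phi> t)(d := c)) j powi m j)"
      using m[rule_format, OF upd_mem[OF t]] pt_upd[OF t(2)] by simp
  qed
qed

text \<open>Identifies the cocharacter lattice with integer vectors; only the entries below
  \<open>d\<close> matter.\<close>

definition cochar :: "(nat \<Rightarrow> int) \<Rightarrow> complex \<Rightarrow> 't" where
  "cochar b = (\<lambda>c\<in>- {0}. pt (\<lambda>j. c powi b j))"

lemma cochar_mem: "c \<noteq> 0 \<Longrightarrow> cochar b c \<in> carrier T"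
  by (simp add: cochar_def pt_mem)

lemma \<phi>_cochar: "c \<noteq> 0 \<Longrightarrow> j < d \<Longrightarrow> \<phi> (cochar b c) j = c powi b j"
  by (simp add: cochar_def \<phi>_pt)

lemma cochar_cong: "(\<And>j. j < d \<Longrightarrow> b j = b' j) \<Longrightarrow> cochar b = cochar b'"
  unfolding cochar_def by (intro restrict_ext pt_cong) simp

lemma cochar_cocharacter: "cochar b \<in> cocharacters T"
proof (rule alg_homI)
  show "cochar b \<in> hom Gm T"
  proof (rule homI)
    show "cochar b c \<in> carrier T" if "c \<in> carrier Gm" for c using that by (simp add: cochar_mem)
    fix c c' assume "c \<in> carrier Gm" "c' \<in> carrier Gm"
    then show "cochar b (c \<otimes>\<^bsub>Gm\<^esub> c') = cochar b c \<otimes>\<^bsub>T\<^esub> cochar b c'"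
      by (simp add: cochar_def pt_mult[symmetric] power_int_mult_distrib)
  qed
  show "cochar b \<in> extensional (carrier Gm)" by (simp add: cochar_def)
  have o: "openin (zar (var Gm)) (- {0})" using openin_topspace[of "zar (var Gm)"] by simp
  have "regular_on (var Gm) (- {0}) (var T) (\<lambda>c. pt (\<lambda>j. c powi b j))"
    by (rule pt_regular[OF Gm.ringed o Gm.powi_regular[OF o Gm_id_regular]]) auto
  then show "morphism (var Gm) (var T) (cochar b)"
    unfolding Gm_pts by (rule regular_on_cong[OF Gm.sheaf]) (simp add: cochar_def)
qed

lemma powi_exponent_unique:
  assumes "\<And>c. c \<noteq> 0 \<Longrightarrow> (c :: complex) powi m = c powi n"
  shows "m = n"
proof -
  have "growth (\<lambda>c. complex_of_real c powi n) m 1"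
    by (rule growth_cong[OF growth_powi]) (use eventually_gt_at_top[of 0] in eventually_elim, use assms in simp)
  from growth_unique[OF this _ growth_powi] show ?thesis by simp
qed

text \<open>Each coordinate of a cocharacter is a nowhere vanishing regular function on
  \<open>Gm\<close> with value \<open>1\<close> at \<open>1\<close>, hence a power.\<close>

lemma cocharacter_cochar:
  assumes \<xi>: "\<xi> \<in> cocharacters T"
  shows "\<exists>b. \<xi> = cochar b"
proof -
  note x = alg_homD[OF \<xi>]
  have mem: "\<xi> c \<in> carrier T" if "c \<noteq> 0" for c using x(1) that by (auto simp: hom_def)
  have reg: "regular_on (var Gm) (- {0}) (var T) \<xi>" using x(3) by simp
  have "\<exists>b. \<forall>c. c \<noteq> 0 \<longrightarrow> \<phi> (\<xi> c) j = c powi b" if j: "j < d" for j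
  proof (rule Gm_regular_monomial)
    have "regular_on (var T) (carrier T) (var Gm) (\<lambda>t. \<phi> t j)"
      by (rule regular_on_Gm[OF T.ringed_space_axioms T_open coord_regular[OF j]]) (use \<phi>_nonzero j in auto)
    from regular_on_compose'[OF reg this]
    show "(\<lambda>c. \<phi> (\<xi> c) j) \<in> regs (var Gm) (- {0})" by (intro regs_of_Gm) (use mem in auto)
    show "\<phi> (\<xi> c) j \<noteq> 0" if "c \<noteq> 0" for c by (rule \<phi>_nonzero[OF mem[OF that] j])
    have "\<xi> (1 \<otimes>\<^bsub>Gm\<^esub> 1) = \<xi> 1 \<otimes>\<^bsub>T\<^esub> \<xi> 1" by (rule hom_mult[OF x(1)]) auto
    then have "\<phi> (\<xi> 1) j = \<phi> (\<xi> 1) j * \<phi> (\<xi> 1) j" using \<phi>_mult[OF mem mem j, of 1 1] by simp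
    then show "\<phi> (\<xi> 1) j = 1" using \<phi>_nonzero[OF mem j, of 1] by simp
  qed
  then obtain b where b: "\<And>j c. j < d \<Longrightarrow> c \<noteq> 0 \<Longrightarrow> \<phi> (\<xi> c) j = c powi b j" by metis
  have "\<xi> c = cochar b c" for c
  proof (cases "c = 0")
    case True
    then show ?thesis using x(2) by (simp add: cochar_def extensional_def)
  next
    case False
    show ?thesis by (rule eqI[OF mem[OF False] cochar_mem[OF False]]) (simp add: b \<phi>_cochar False)
  qed
  then show ?thesis by blast
qed

lemma pairing_cochar:
  assumes "\<forall>t\<in>carrier T. \<sigma> t = (\<Prod>j<d. \<phi> t j powi m j)"
  shows "pairing \<sigma> (cochar b) = (\<Sum>j<d. m j * b j)"
proof -
  have s: "\<sigma> (cochar b c) = c powi (\<Sum>j<d. m j * b j)" if c: "c \<noteq> 0" for c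
  proof -
    have "\<sigma> (cochar b c) = (\<Prod>j<d. c powi (m j * b j))"
      using assms[rule_format, OF cochar_mem[OF c]]
      by (auto intro!: prod.cong simp: \<phi>_cochar[OF c] power_int_mult[symmetric] mult.commute)
    also have "\<dots> = c powi (\<Sum>j<d. m j * b j)"
      using c by (induction d) (auto simp: power_int_add)
    finally show ?thesis .
  qed
  show ?thesis unfolding pairing_def
    by (rule the_equality) (use s powi_exponent_unique in auto)
qed

end

subsection \<open>Positive maps and their ultra-discretization\<close>

lemma prat_sum:
  "finite A \<Longrightarrow> A \<noteq> {} \<Longrightarrow> (\<And>i. i \<in> A \<Longrightarrow> f i \<in> prat n) \<Longrightarrow> (\<lambda>x. \<Sum>i\<in>A. f i x) \<in> prat n"
  by (induction A rule: finite_ne_induct) (auto intro: prat.add)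

lemma open_dense_finite_INT:
  "finite A \<Longrightarrow> (\<And>i. i \<in> A \<Longrightarrow> open_dense S (W i)) \<Longrightarrow> open_dense S (pts S \<inter> (\<Inter>i\<in>A. W i))"
proof (induction A rule: finite_induct)
  case empty
  then show ?case by (simp add: open_dense_def)
next
  case (insert a A)
  have e: "pts S \<inter> (\<Inter>i\<in>insert a A. W i) = W a \<inter> (pts S \<inter> (\<Inter>i\<in>A. W i))" by auto
  show ?case unfolding e by (rule open_dense_Int) (use insert in simp_all)
qed

context torus_chart
begin

text \<open>Characters of the product are Laurent monomials in the coordinates, so a positive
  combination of them is a positive function.\<close>

lemma positive_combination_prat:
  assumes "g \<in> positive_combinations (prod_group Gm T)"
  shows "g \<in> regs GT ((- {0}) \<times> carrier T)"
    and "\<exists>L\<in>prat (Suc d). \<forall>c t. c \<noteq> 0 \<longrightarrow> t \<in> carrier T \<longrightarrow> g (c, t) = L ((\<phi> t)(d := c))"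
proof -
  obtain F a where g: "g = (\<lambda>t. \<Sum>\<psi>\<in>F. complex_of_real (a \<psi>) * \<psi> t)" and F: "finite F" "F \<noteq> {}"
    "F \<subseteq> characters (prod_group Gm T)" "\<forall>\<psi>\<in>F. a \<psi> > 0"
    using assms unfolding positive_combinations_def by (elim CollectE exE conjE)
  have o: "openin (zar GT) ((- {0}) \<times> carrier T)" using openin_topspace[of "zar GT"] by simp
  have "\<psi> \<in> regs GT ((- {0}) \<times> carrier T)" if "\<psi> \<in> F" for \<psi>
  proof -
    have "\<psi> \<in> characters (prod_group Gm T)" using F(3) that by blast
    from alg_homD(3)[OF this] show ?thesis by (intro regs_of_Gm) simp
  qed
  then show "g \<in> regs GT ((- {0}) \<times> carrier T)"
    unfolding g by (intro GT.sum F(1) o GT.mult GT.const) auto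
  have "\<forall>\<psi>\<in>F. \<exists>m. \<forall>c t. c \<noteq> 0 \<longrightarrow> t \<in> carrier T \<longrightarrow> \<psi> (c, t) = (\<Prod>j<Suc d. ((\<phi> t)(d := c)) j powi m j)"
    using F(3) prod_character_monomial by blast
  then obtain m where m: "\<forall>\<psi>\<in>F. \<forall>c t. c \<noteq> 0 \<longrightarrow> t \<in> carrier T \<longrightarrow>
      \<psi> (c, t) = (\<Prod>j<Suc d. ((\<phi> t)(d := c)) j powi m \<psi> j)" by (rule bchoice[THEN exE])
  let ?L = "\<lambda>z. \<Sum>\<psi>\<in>F. complex_of_real (a \<psi>) * (\<Prod>j<Suc d. z j powi m \<psi> j)"
  have L: "?L \<in> prat (Suc d)"
    by (intro prat_sum F prat.mult prat.const prat_prod prat_powi prat.coord posreal_closed(5)) (use F(4) in auto)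
  have gL: "g (c, t) = ?L ((\<phi> t)(d := c))" if "c \<noteq> 0" "t \<in> carrier T" for c t
    unfolding g using m that by (intro sum.cong refl) auto
  show "\<exists>L\<in>prat (Suc d). \<forall>c t. c \<noteq> 0 \<longrightarrow> t \<in> carrier T \<longrightarrow> g (c, t) = L ((\<phi> t)(d := c))"
    by (rule bexI[OF _ L]) (intro allI impI gL)
qed

text \<open>
  The maximal domain of a positive map contains every point where numerators and denominators of
  its coordinates do not vanish, in particular all positive points.
\<close>

lemma positive_map_coordinates:
  assumes A: "positive_map (prod_group Gm T) T A"
  shows "\<exists>G H. (\<forall>j<d. G j \<in> prat (Suc d) \<and> H j \<in> prat (Suc d)) \<and>
    (\<forall>c t. c \<noteq> 0 \<longrightarrow> t \<in> carrier T \<longrightarrow> (\<forall>j<d. G j ((\<phi> t)(d := c)) \<noteq> 0 \<and> H j ((\<phi> t)(d := c)) \<noteq> 0) \<longrightarrow>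
      A (c, t) = Some (pt (\<lambda>j. G j ((\<phi> t)(d := c)) * inverse (H j ((\<phi> t)(d := c))))))"
proof -
  let ?P = "(- {0 :: complex}) \<times> carrier T"
  have rat: "rational_map GT (var T) A" using A by (simp add: positive_map_def)
  have o: "openin (zar GT) ?P" using openin_topspace[of "zar GT"] by simp
  have "\<exists>g h W. g \<in> positive_combinations (prod_group Gm T) \<and> h \<in> positive_combinations (prod_group Gm T) \<and>
      open_dense GT W \<and> (\<forall>x\<in>W. h x \<noteq> 0 \<and> map_option (\<lambda>t\<in>carrier T. \<phi> t j) (A x) = Some (g x / h x))"
    if j: "j < d" for j
  proof -
    have "positive_fun (prod_group Gm T) (\<lambda>x. map_option (\<lambda>t\<in>carrier T. \<phi> t j) (A x))"
      using A coord_character[OF j] unfolding positive_map_def by blast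
    then obtain g h W where "g \<in> positive_combinations (prod_group Gm T)" "h \<in> positive_combinations (prod_group Gm T)"
      "open_dense GT W" "\<forall>x\<in>W. h x \<noteq> 0 \<and> map_option (\<lambda>t\<in>carrier T. \<phi> t j) (A x) = Some (g x / h x)"
      unfolding positive_fun_def generically_def prod_group_simps by (elim bexE exE conjE)
    then show ?thesis by (intro exI[of _ g] exI[of _ h] exI[of _ W] conjI)
  qed
  then obtain g h W where ghW: "\<And>j. j < d \<Longrightarrow> g j \<in> positive_combinations (prod_group Gm T)"
    "\<And>j. j < d \<Longrightarrow> h j \<in> positive_combinations (prod_group Gm T)" "\<And>j. j < d \<Longrightarrow> open_dense GT (W j)"
    "\<And>j x. j < d \<Longrightarrow> x \<in> W j \<Longrightarrow> h j x \<noteq> 0 \<and> map_option (\<lambda>t\<in>carrier T. \<phi> t j) (A x) = Some (g j x / h j x)"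
    by metis
  have greg: "g j \<in> regs GT ?P" "h j \<in> regs GT ?P" if "j < d" for j
    using positive_combination_prat(1) ghW(1,2)[OF that] by auto
  have "\<forall>j. \<exists>L. j < d \<longrightarrow> L \<in> prat (Suc d) \<and> (\<forall>c t. c \<noteq> 0 \<longrightarrow> t \<in> carrier T \<longrightarrow> g j (c, t) = L ((\<phi> t)(d := c)))"
    using positive_combination_prat(2)[OF ghW(1)] by blast
  then obtain G where G: "\<forall>j. j < d \<longrightarrow> G j \<in> prat (Suc d) \<and>
      (\<forall>c t. c \<noteq> 0 \<longrightarrow> t \<in> carrier T \<longrightarrow> g j (c, t) = G j ((\<phi> t)(d := c)))" by (rule choice[THEN exE])
  have "\<forall>j. \<exists>L. j < d \<longrightarrow> L \<in> prat (Suc d) \<and> (\<forall>c t. c \<noteq> 0 \<longrightarrow> t \<in> carrier T \<longrightarrow> h j (c, t) = L ((\<phi> t)(d := c)))"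
    using positive_combination_prat(2)[OF ghW(2)] by blast
  then obtain H where H: "\<forall>j. j < d \<longrightarrow> H j \<in> prat (Suc d) \<and>
      (\<forall>c t. c \<noteq> 0 \<longrightarrow> t \<in> carrier T \<longrightarrow> h j (c, t) = H j ((\<phi> t)(d := c)))" by (rule choice[THEN exE])
  let ?U = "{x \<in> ?P. (\<Prod>j<d. g j x * h j x) \<noteq> 0}"
  have U: "openin (zar GT) ?U"
    by (rule GT.nonzero_open[OF o]) (use greg in \<open>intro GT.prod o GT.mult, auto\<close>)
  have nzU: "g j x \<noteq> 0" "h j x \<noteq> 0" if "x \<in> ?U" "j < d" for j x using that by auto
  have regU: "g j \<in> regs GT ?U" "h j \<in> regs GT ?U" if "j < d" for j
    by (rule GT.restrict[OF o U _ greg(1)[OF that]], blast, rule GT.restrict[OF o U _ greg(2)[OF that]], blast)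
  have B: "regular_on GT ?U (var T) (\<lambda>x. pt (\<lambda>j. g j x * inverse (h j x)))"
  proof (rule pt_regular[OF GT.ringed_space_axioms U])
    show "(\<lambda>x. g j x * inverse (h j x)) \<in> regs GT ?U" if "j < d" for j
      by (intro GT.mult GT.inv U regU that) (use nzU that in blast)
    show "g j x * inverse (h j x) \<noteq> 0" if "x \<in> ?U" "j < d" for x j
      using nzU[OF that] by simp
  qed
  let ?W = "pts GT \<inter> (\<Inter>j\<in>{..<d}. W j)"
  have W: "open_dense GT ?W" using ghW(3) by (intro open_dense_finite_INT) auto
  \<comment> \<open>Generically the value of \<open>A\<close> is determined by the coordinate
    characters; by maximality of its domain, \<open>A\<close> then contains the whole morphism on
    \<open>?U\<close>.\<close>
  have AB: "A x = Some (pt (\<lambda>j. g j x * inverse (h j x)))" if x: "x \<in> ?U" for x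
  proof (rule rational_map_extends[OF GT.ringed_space_axioms variety_T rat B W _ x])
    fix x assume x: "x \<in> ?W" "x \<in> ?U" "x \<in> dom A"
    then obtain y where y: "A x = Some y" by auto
    have yT: "y \<in> carrier T" using regular_on_image[OF rational_map_regular[OF rat] x(3)] y by (simp add: pts_T)
    have "y = pt (\<lambda>j. g j x * inverse (h j x))"
    proof (rule eqI[OF yT])
      show "pt (\<lambda>j. g j x * inverse (h j x)) \<in> carrier T" by (rule pt_mem) (use nzU[OF x(2)] in simp)
      fix j assume j: "j < d"
      have "\<phi> (pt (\<lambda>j. g j x * inverse (h j x))) = (\<lambda>j\<in>{..<d}. g j x * inverse (h j x))"
        by (rule \<phi>_pt) (use nzU[OF x(2)] in simp)
      moreover have "\<phi> y j = g j x / h j x" using ghW(4)[OF j, of x] x(1) j y yT by simp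
      ultimately show "\<phi> y j = \<phi> (pt (\<lambda>j. g j x * inverse (h j x))) j" using j by (simp add: divide_inverse)
    qed
    then show "A x = Some (pt (\<lambda>j. g j x * inverse (h j x)))" using y by simp
  qed
  have "A (c, t) = Some (pt (\<lambda>j. G j ((\<phi> t)(d := c)) * inverse (H j ((\<phi> t)(d := c)))))"
    if ct: "c \<noteq> 0" "t \<in> carrier T" and nz: "\<forall>j<d. G j ((\<phi> t)(d := c)) \<noteq> 0 \<and> H j ((\<phi> t)(d := c)) \<noteq> 0" for c t
  proof -
    have e: "g j (c, t) = G j ((\<phi> t)(d := c))" "h j (c, t) = H j ((\<phi> t)(d := c))" if "j < d" for j
      using G H ct that by simp_all
    have "(c, t) \<in> ?U" using ct nz e by simp
    then have "A (c, t) = Some (pt (\<lambda>j. g j (c, t) * inverse (h j (c, t))))" by (rule AB)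
    also have "pt (\<lambda>j. g j (c, t) * inverse (h j (c, t))) = pt (\<lambda>j. G j ((\<phi> t)(d := c)) * inverse (H j ((\<phi> t)(d := c))))"
      by (rule pt_cong) (simp add: e)
    finally show ?thesis .
  qed
  then show ?thesis using G H by (intro exI[of _ G] exI[of _ H]) simp
qed

text \<open>Along a cocharacter every character of the image is a monomial in positive functions, so
  its pole order is the corresponding combination of the exponents \<open>b'\<close>. This is the
  pairing with \<open>cochar b'\<close>, and the coordinate characters show that no other
  cocharacter has these pairings.\<close>

lemma UD_map_cochar:
  assumes GH: "\<And>j. j < d \<Longrightarrow> G j \<in> prat (Suc d) \<and> H j \<in> prat (Suc d)"
    and A: "\<And>c t. c \<noteq> 0 \<Longrightarrow> t \<in> carrier T \<Longrightarrow>
      (\<forall>j<d. G j ((\<phi> t)(d := c)) \<noteq> 0 \<and> H j ((\<phi> t)(d := c)) \<noteq> 0) \<Longrightarrow>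
      A (c, t) = Some (pt (\<lambda>j. G j ((\<phi> t)(d := c)) * inverse (H j ((\<phi> t)(d := c)))))"
    and b': "\<And>j. j < d \<Longrightarrow> has_exp (\<lambda>c. G j (\<lambda>i. complex_of_real c powi (b(d := n)) i) *
      inverse (H j (\<lambda>i. complex_of_real c powi (b(d := n)) i))) (b' j)"
  shows "UD_map (prod_group Gm T) T A (\<lambda>c\<in>carrier Gm. (c powi n, cochar b c)) = cochar b'"
proof -
  let ?\<xi> = "\<lambda>c\<in>carrier Gm. (c powi n, cochar b c)"
  let ?z = "\<lambda>c i. c powi (b(d := n)) i"
  \<comment> \<open>The roots of these polynomials collect the finitely many parameters where the
    formula for \<open>A\<close> may fail on the curve.\<close>
  have "\<forall>j. \<exists>r. j < d \<longrightarrow> r \<noteq> 0 \<and> (\<forall>c. c \<noteq> 0 \<longrightarrow> poly r c \<noteq> 0 \<longrightarrow> G j (?z c) * H j (?z c) \<noteq> 0)"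
    using prat_curve_nonzero[OF prat.mult] GH by blast
  then obtain r where r: "\<forall>j. j < d \<longrightarrow> r j \<noteq> 0 \<and> (\<forall>c. c \<noteq> 0 \<longrightarrow> poly (r j) c \<noteq> 0 \<longrightarrow> G j (?z c) * H j (?z c) \<noteq> 0)"
    by (rule choice[THEN exE])
  have pole: "pole_order (\<lambda>c. map_option \<sigma> (A (?\<xi> c))) = (\<Sum>j<d. m j * b' j)"
    if m: "\<forall>t\<in>carrier T. \<sigma> t = (\<Prod>j<d. \<phi> t j powi m j)" for \<sigma> m
  proof (rule pole_order_eq)
    let ?f = "\<lambda>z. \<Prod>j<d. (G j z * inverse (H j z)) powi m j"
    show "?f \<in> prat (Suc d)" using GH by (intro prat_prod prat_powi prat.mult prat.inv) auto
    show "has_exp (\<lambda>c. ?f (?z (complex_of_real c))) (\<Sum>j<d. m j * b' j)"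
    proof (rule has_exp_prod)
      fix j assume "j \<in> {..<d}"
      then have "j < d" by simp
      from has_exp_power_int[OF b'[OF this]]
      show "has_exp (\<lambda>c. (G j (?z (complex_of_real c)) * inverse (H j (?z (complex_of_real c)))) powi m j) (m j * b' j)" .
    qed simp
    show "(\<Prod>j<d. r j) \<noteq> 0" using r by simp
    fix c :: complex assume c: "c \<noteq> 0" "poly (\<Prod>j<d. r j) c \<noteq> 0"
    let ?t = "cochar b c"
    have t: "?t \<in> carrier T" by (rule cochar_mem[OF c(1)])
    have eG: "G j ((\<phi> ?t)(d := c powi n)) = G j (?z c)" "H j ((\<phi> ?t)(d := c powi n)) = H j (?z c)" if j: "j < d" for j
    proof -
      have e: "((\<phi> ?t)(d := c powi n)) i = ?z c i" if "i < Suc d" for i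
        using that \<phi>_cochar[OF c(1), of i b] by (cases "i = d") auto
      show "G j ((\<phi> ?t)(d := c powi n)) = G j (?z c)" by (rule prat_cong[OF conjunct1[OF GH[OF j]]]) (rule e)
      show "H j ((\<phi> ?t)(d := c powi n)) = H j (?z c)" by (rule prat_cong[OF conjunct2[OF GH[OF j]]]) (rule e)
    qed
    have nz: "G j (?z c) \<noteq> 0" "H j (?z c) \<noteq> 0" if j: "j < d" for j
      using r c j by (auto simp: poly_prod)
    have "A (c powi n, ?t) = Some (pt (\<lambda>j. G j ((\<phi> ?t)(d := c powi n)) * inverse (H j ((\<phi> ?t)(d := c powi n)))))"
      by (rule A) (use c t nz eG in auto)
    also have "pt (\<lambda>j. G j ((\<phi> ?t)(d := c powi n)) * inverse (H j ((\<phi> ?t)(d := c powi n)))) =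
        pt (\<lambda>j. G j (?z c) * inverse (H j (?z c)))" by (rule pt_cong) (simp add: eG)
    finally have Ac: "A (c powi n, ?t) = Some (pt (\<lambda>j. G j (?z c) * inverse (H j (?z c))))" .
    have "pt (\<lambda>j. G j (?z c) * inverse (H j (?z c))) \<in> carrier T" by (rule pt_mem) (use nz in simp)
    then have "\<sigma> (pt (\<lambda>j. G j (?z c) * inverse (H j (?z c)))) = ?f (?z c)"
      using m \<phi>_pt[of "\<lambda>j. G j (?z c) * inverse (H j (?z c))"] nz by simp
    then show "map_option \<sigma> (A (?\<xi> c)) = Some (?f (?z c))" using Ac c(1) by simp
  qed
  show ?thesis unfolding UD_map_def
  proof (rule the_equality)
    show "cochar b' \<in> cocharacters T \<and>
        (\<forall>\<psi>\<in>characters T. pairing \<psi> (cochar b') = pole_order (\<lambda>c. map_option \<psi> (A (?\<xi> c))))"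
    proof (intro conjI ballI cochar_cocharacter)
      fix \<sigma> assume "\<sigma> \<in> characters T"
      then obtain m where m: "\<forall>t\<in>carrier T. \<sigma> t = (\<Prod>j<d. \<phi> t j powi m j)"
        using character_monomial by blast
      show "pairing \<sigma> (cochar b') = pole_order (\<lambda>c. map_option \<sigma> (A (?\<xi> c)))"
        unfolding pole[OF m] by (rule pairing_cochar[OF m])
    qed
  next
    fix \<eta> assume \<eta>: "\<eta> \<in> cocharacters T \<and>
        (\<forall>\<psi>\<in>characters T. pairing \<psi> \<eta> = pole_order (\<lambda>c. map_option \<psi> (A (?\<xi> c))))"
    then obtain b'' where b'': "\<eta> = cochar b''" using cocharacter_cochar by blast
    have "b'' j = b' j" if j: "j < d" for j
    proof -
      let ?m = "\<lambda>k. if k = j then 1 else 0 :: int"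
      have m: "\<forall>t\<in>carrier T. (\<lambda>t\<in>carrier T. \<phi> t j) t = (\<Prod>k<d. \<phi> t k powi ?m k)"
      proof
        fix t assume t: "t \<in> carrier T"
        have "(\<Prod>k<d. \<phi> t k powi ?m k) = (\<Prod>k<d. if k = j then \<phi> t k else 1)" by (rule prod.cong) auto
        then show "(\<lambda>t\<in>carrier T. \<phi> t j) t = (\<Prod>k<d. \<phi> t k powi ?m k)" using j t by simp
      qed
      have "(\<Sum>k<d. ?m k * b'' k) = pairing (\<lambda>t\<in>carrier T. \<phi> t j) \<eta>"
        unfolding b'' by (rule pairing_cochar[OF m, symmetric])
      also have "\<dots> = pole_order (\<lambda>c. map_option (\<lambda>t\<in>carrier T. \<phi> t j) (A (?\<xi> c)))"
        by (rule bspec[OF conjunct2[OF \<eta>] coord_character[OF j]])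
      also have "\<dots> = (\<Sum>k<d. ?m k * b' k)" by (rule pole[OF m])
      finally have "(\<Sum>k<d. ?m k * b'' k) = (\<Sum>k<d. ?m k * b' k)" .
      moreover have "(\<Sum>k<d. ?m k * x k) = x j" for x
      proof -
        have "(\<Sum>k<d. ?m k * x k) = (\<Sum>k<d. if k = j then x k else 0)" by (rule sum.cong) auto
        then show ?thesis using j by simp
      qed
      ultimately show ?thesis by simp
    qed
    then show "\<eta> = cochar b'" unfolding b'' by (rule cochar_cong)
  qed
qed

end

section \<open>Rational actions\<close>

text \<open>Both inverses agree at generic points that \<open>g\<close> sends into the set where
  \<open>h\<close> inverts \<open>f\<close>. The points sent there form a nonempty open set, which
  is dense by irreducibility.\<close>

lemma inverse_rational_unique:
  assumes S: "variety S" "irreducible_space S" "pts S \<noteq> {}" and S': "ringed_space S'" "irreducible_space S'"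
    and g: "inverse_rational S S' f g" and h: "inverse_rational S S' f h"
  shows "g = h"
proof -
  obtain U where U: "open_dense S U" "\<forall>x\<in>U. \<exists>y. f x = Some y \<and> h y = Some x"
    using h unfolding inverse_rational_def generically_def by (elim conjE exE)
  obtain U' where U': "open_dense S U'" "\<forall>x\<in>U'. \<exists>y. f x = Some y \<and> g y = Some x"
    using g unfolding inverse_rational_def generically_def by (elim conjE exE)
  obtain V where V: "open_dense S' V" "\<forall>y\<in>V. \<exists>x. g y = Some x \<and> f x = Some y"
    using g unfolding inverse_rational_def generically_def by (elim conjE exE)
  have rg: "rational_map S' S g" and rh: "rational_map S' S h"
    using g h by (auto simp: inverse_rational_def)
  let ?W = "{y \<in> dom g. the (g y) \<in> U}"
  have o: "openin (zar S') ?W"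
    by (rule regular_on_preimage[OF rational_map_regular[OF rg] open_dense_open[OF U(1)]])
  have "U \<inter> U' \<noteq> {}"
    using open_dense_meets[OF open_dense_Int[OF U(1) U'(1)] openin_topspace S(3)] by auto
  then obtain x where "x \<in> U" "x \<in> U'" by auto
  then obtain y where "f x = Some y" "g y = Some x" using U'(2) by auto
  then have "y \<in> ?W" using \<open>x \<in> U\<close> by auto
  then have "open_dense S' ?W" using irreducible_open_dense[OF S'(2) o] by blast
  then have W: "open_dense S' (?W \<inter> V)" by (rule open_dense_Int[OF _ V(1)])
  show ?thesis
  proof (rule rational_map_eq[OF S'(1) S(1) rg rh W])
    fix y assume y: "y \<in> ?W \<inter> V"
    then obtain x where x: "g y = Some x" "f x = Some y" using V(2) by auto
    then have "x \<in> U" using y by auto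
    then obtain y' where "f x = Some y'" "h y' = Some x" using U(2) by auto
    then show "g y = h y" using x by simp
  qed
qed

section \<open>The geometric crystal in the chart\<close>

locale geometric_chart = torus_chart T d \<phi> for T :: "'t alg_group" and d \<phi> +
  fixes I :: "'i set" and X :: "('i, 'a) gcrystal" and \<theta> :: "'t \<rightharpoonup> 'a"
  assumes variety_X: "variety (gvar X)"
    and action: "i \<in> I \<Longrightarrow> rational_action (gvar X) (act X i)"
    and unit_dense: "i \<in> I \<Longrightarrow> open_dense (gvar X) {x. (1, x) \<in> dom (act X i)}"
    and birational: "birational_map (var T) (gvar X) \<theta>"
begin

abbreviation GX :: "(complex \<times> 'a) fspace" where
  "GX \<equiv> fprod (var Gm) (gvar X)"

abbreviation \<theta>_inv :: "'a \<rightharpoonup> 't" where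
  "\<theta>_inv \<equiv> rational_inv (var T) (gvar X) \<theta>"

sublocale X: ringed_space "gvar X"
  by (rule variety_ringed[OF variety_X])

sublocale GX: ringed_space GX
  by (rule fprod_ringed[OF Gm.ringed X.ringed_space_axioms])

lemma GX_pts [simp]: "pts GX = (- {0}) \<times> pts (gvar X)"
  using fprod_pts[OF Gm.ringed X.ringed_space_axioms] by simp

lemma \<theta>_rational: "rational_map (var T) (gvar X) \<theta>"
  using birational by (simp add: birational_map_def)

lemma T_nonempty: "pts (var T) \<noteq> {}"
  using group.is_monoid[OF group_T] monoid.one_closed by (auto simp: pts_T)

text \<open>The image of \<open>\<theta>\<close> is dense, since generic points of \<open>X\<close>
  have a preimage.\<close>

lemma X_irreducible: "irreducible_space (gvar X)"
proof (rule irreducible_image[OF T_irreducible rational_map_regular[OF \<theta>_rational]])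
  fix V assume V: "openin (zar (gvar X)) V" "V \<noteq> {}"
  obtain g where "inverse_rational (var T) (gvar X) \<theta> g" using birational unfolding birational_map_def by blast
  then obtain W where W: "open_dense (gvar X) W" "\<forall>y\<in>W. \<exists>x. g y = Some x \<and> \<theta> x = Some y"
    unfolding inverse_rational_def generically_def by (elim conjE exE)
  obtain y where "y \<in> V" "y \<in> W" using open_dense_meets[OF W(1) V] by auto
  moreover then obtain x where "\<theta> x = Some y" using W(2) by blast
  ultimately show "\<exists>x\<in>dom \<theta>. the (\<theta> x) \<in> V" by (intro bexI[of _ x]) auto
qed

lemma inverse_\<theta>: "inverse_rational (var T) (gvar X) \<theta> \<theta>_inv"
proof -
  obtain g where g: "inverse_rational (var T) (gvar X) \<theta> g" using birational unfolding birational_map_def by blast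
  show ?thesis unfolding rational_inv_def
    by (rule theI[of _ g])
      (use g inverse_rational_unique[OF variety_T T_irreducible T_nonempty X.ringed_space_axioms X_irreducible] in auto)
qed

lemma Gm_mult_regular:
  assumes "ringed_space S" "regular_on S U (var Gm) f" "regular_on S U (var Gm) g"
  shows "regular_on S U (var Gm) (\<lambda>x. f x * g x)" "regular_on S U (var Gm) (\<lambda>x. inverse (f x))"
proof -
  interpret S: ringed_space S by (rule assms)
  have o: "openin (zar S) U" by (rule regular_on_open[OF assms(2)])
  have nz: "f x \<noteq> 0" "g x \<noteq> 0" if "x \<in> U" for x
    using regular_on_image[OF assms(2) that] regular_on_image[OF assms(3) that] by auto
  show "regular_on S U (var Gm) (\<lambda>x. f x * g x)"
    by (rule regular_on_Gm[OF assms(1) o S.mult[OF o regs_of_Gm[OF assms(2)] regs_of_Gm[OF assms(3)]]]) (use nz in auto)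
  show "regular_on S U (var Gm) (\<lambda>x. inverse (f x))"
    by (rule regular_on_Gm[OF assms(1) o S.inv[OF o regs_of_Gm[OF assms(2)]]]) (use nz in auto)
qed

lemma act_rational: "i \<in> I \<Longrightarrow> rational_map GX (gvar X) (act X i)"
  using action by (simp add: rational_action_def)

lemma act_one_eq: "i \<in> I \<Longrightarrow> (1, x) \<in> dom (act X i) \<Longrightarrow> act X i (1, x) = Some x"
  using action unfolding rational_action_def by blast

text \<open>The group law holds wherever all terms are defined, by separatedness.\<close>

lemma group_law:
  assumes i: "i \<in> I" and c: "c1 \<noteq> 0" "c2 \<noteq> 0"
    and y: "act X i (c2, x) = Some y" and dom: "(c1, y) \<in> dom (act X i)" "(c1 * c2, x) \<in> dom (act X i)"
  shows "act X i (c1, y) = act X i (c1 * c2, x)"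
proof -
  let ?e = "act X i"
  let ?P = "fprod (var Gm) GX"
  note re = rational_map_regular[OF act_rational[OF i]]
  have P: "ringed_space ?P" by (rule fprod_ringed[OF Gm.ringed GX.ringed_space_axioms])
  interpret P: ringed_space ?P by (rule P)
  have Ppts: "pts ?P = (- {0}) \<times> (- {0}) \<times> pts (gvar X)"
    using fprod_pts[OF Gm.ringed GX.ringed_space_axioms] by simp
  note sn = regular_on_snd[OF Gm.ringed GX.ringed_space_axioms]
  note fs = regular_on_fst[OF Gm.ringed GX.ringed_space_axioms]
  note sn' = regular_on_compose'[OF sn regular_on_snd[OF Gm.ringed X.ringed_space_axioms]]
  note fs' = regular_on_compose'[OF sn regular_on_fst[OF Gm.ringed X.ringed_space_axioms]]
  let ?D1 = "{z \<in> pts ?P. snd z \<in> dom ?e}"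
  have r1: "regular_on ?P ?D1 (gvar X) (\<lambda>z. the (?e (snd z)))" by (rule regular_on_compose[OF sn re])
  have k: "regular_on ?P ?D1 GX (\<lambda>z. (fst z, the (?e (snd z))))"
    by (rule regular_on_Pair[OF P Gm.ringed X.ringed_space_axioms regular_on_subset[OF P.sheaf fs regular_on_open[OF r1]] r1]) auto
  note r2 = regular_on_compose[OF k re]
  have l: "regular_on ?P (pts ?P) GX (\<lambda>z. (fst z * fst (snd z), snd (snd z)))"
    by (intro regular_on_Pair[OF P Gm.ringed X.ringed_space_axioms] Gm_mult_regular[OF P] fs fs' sn') (auto simp: Ppts)
  note r3 = regular_on_compose[OF l re]
  let ?D2 = "{z \<in> ?D1. (fst z, the (?e (snd z))) \<in> dom ?e}"
  let ?D3 = "{z \<in> pts ?P. (fst z * fst (snd z), snd (snd z)) \<in> dom ?e}"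
  have o: "openin (zar ?P) (?D2 \<inter> ?D3)" by (intro openin_Int regular_on_open[OF r2] regular_on_open[OF r3])
  have "generically ?P (\<lambda>(c1, c2, x). \<exists>y z. ?e (c2, x) = Some y \<and> ?e (c1, y) = Some z \<and> ?e (c1 * c2, x) = Some z)"
    using action[OF i] by (simp add: rational_action_def)
  then obtain W where W: "open_dense ?P W" and Weq: "\<forall>z\<in>W. case z of (c1, c2, x) \<Rightarrow>
      \<exists>y z. ?e (c2, x) = Some y \<and> ?e (c1, y) = Some z \<and> ?e (c1 * c2, x) = Some z"
    unfolding generically_def by (elim exE conjE)
  have "x \<in> pts (gvar X)"
    using openin_subset[OF regular_on_open[OF re]] y by auto
  then have "(c1, c2, x) \<in> ?D2 \<inter> ?D3" using c y dom by (simp add: Ppts domI)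
  then have "the (?e (fst (c1, c2, x), the (?e (snd (c1, c2, x))))) =
      the (?e (fst (c1, c2, x) * fst (snd (c1, c2, x)), snd (snd (c1, c2, x))))"
  proof (rule regular_eq_dense[OF P variety_X regular_on_subset[OF P.sheaf r2 o] regular_on_subset[OF P.sheaf r3 o] W, rotated -1])
    fix z assume z: "z \<in> W"
    obtain c1 c2 x where zz: "z = (c1, c2, x)" by (cases z) auto
    obtain y v where "?e (c2, x) = Some y" "?e (c1, y) = Some v" "?e (c1 * c2, x) = Some v"
      using Weq z zz by auto
    then show "the (?e (fst z, the (?e (snd z)))) = the (?e (fst z * fst (snd z), snd (snd z)))" by (simp add: zz)
  qed auto
  then show ?thesis using y dom by (auto simp: dom_def)
qed

lemma slice_regular: "c \<noteq> 0 \<Longrightarrow> regular_on (gvar X) (pts (gvar X)) GX (\<lambda>x. (c, x))"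
  by (intro regular_on_Pair[OF X.ringed_space_axioms Gm.ringed X.ringed_space_axioms]
      regular_on_const[OF X.ringed_space_axioms] regular_on_id[OF X.sheaf]) auto

lemma act_dom_pts:
  assumes "i \<in> I" "act X i (c, x) = Some y"
  shows "c \<noteq> 0" "x \<in> pts (gvar X)" "y \<in> pts (gvar X)"
proof -
  note re = rational_map_regular[OF act_rational[OF assms(1)]]
  have "(c, x) \<in> dom (act X i)" using assms(2) by auto
  then have "(c, x) \<in> pts GX" using openin_subset[OF regular_on_open[OF re]] by auto
  then show "c \<noteq> 0" "x \<in> pts (gvar X)" by auto
  show "y \<in> pts (gvar X)" using regular_on_image[OF re \<open>(c, x) \<in> dom (act X i)\<close>] assms(2) by simp
qed

lemma inverse_domain_open:
  assumes i: "i \<in> I" and c: "c \<noteq> 0"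
  shows "regular_on (gvar X) {x \<in> pts (gvar X). (c, x) \<in> dom (act X i)} (gvar X) (\<lambda>x. the (act X i (c, x)))"
    and "regular_on (gvar X) {x \<in> {x \<in> pts (gvar X). (c, x) \<in> dom (act X i)}. the (act X i (c, x)) \<in>
      {y \<in> pts (gvar X). (inverse c, y) \<in> dom (act X i)}} (gvar X) (\<lambda>x. the (act X i (inverse c, the (act X i (c, x)))))"
proof -
  note re = rational_map_regular[OF act_rational[OF i]]
  have *: "regular_on (gvar X) {x \<in> pts (gvar X). (c, x) \<in> dom (act X i)} (gvar X) (\<lambda>x. the (act X i (c, x)))"
    if "c \<noteq> 0" for c by (rule regular_on_compose[OF slice_regular[OF that] re])
  show "regular_on (gvar X) {x \<in> pts (gvar X). (c, x) \<in> dom (act X i)} (gvar X) (\<lambda>x. the (act X i (c, x)))"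
    by (rule *[OF c])
  have "inverse c \<noteq> 0" using c by simp
  from regular_on_compose[OF *[OF c] *[OF this]]
  show "regular_on (gvar X) {x \<in> {x \<in> pts (gvar X). (c, x) \<in> dom (act X i)}. the (act X i (c, x)) \<in>
      {y \<in> pts (gvar X). (inverse c, y) \<in> dom (act X i)}} (gvar X) (\<lambda>x. the (act X i (inverse c, the (act X i (c, x)))))" .
qed

text \<open>Where \<open>e_i^1\<close> is defined as well, the group law gives
  \<open>e_i^(1/c) e_i^c = e_i^1 = id\<close>. These points are dense, so the identity extends by
  separatedness to all points where the left side is defined.\<close>

lemma inverse_law:
  assumes i: "i \<in> I" and y: "act X i (c, x) = Some y" and dom: "(inverse c, y) \<in> dom (act X i)"
  shows "act X i (inverse c, y) = Some x"
proof -
  have c: "c \<noteq> 0" and x: "x \<in> pts (gvar X)" and yp: "y \<in> pts (gvar X)" using act_dom_pts[OF i y] by auto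
  note r = inverse_domain_open(2)[OF i c]
  let ?V = "{x \<in> {x \<in> pts (gvar X). (c, x) \<in> dom (act X i)}. the (act X i (c, x)) \<in>
      {y \<in> pts (gvar X). (inverse c, y) \<in> dom (act X i)}}"
  have "x \<in> ?V" using x yp y dom by auto
  then have "the (act X i (inverse c, the (act X i (c, x)))) = x"
  proof (rule regular_eq_dense[OF X.ringed_space_axioms variety_X r regular_on_id[OF X.sheaf regular_on_open[OF r]] unit_dense[OF i], rotated])
    fix x assume x: "x \<in> ?V" "x \<in> {x. (1, x) \<in> dom (act X i)}"
    then obtain y where y: "act X i (c, x) = Some y" by auto
    have "act X i (inverse c, y) = act X i (inverse c * c, x)"
      by (rule group_law[OF i _ c y]) (use x y c in auto)
    also have "\<dots> = Some x" using act_one_eq[OF i, of x] x c by simp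
    finally show "the (act X i (inverse c, the (act X i (c, x)))) = x" using y by simp
  qed
  then show ?thesis using y dom by auto
qed

definition step_rel :: "('a \<times> 'a) set" where
  "step_rel = {(x, y). x \<in> pts (gvar X) \<and> y \<in> pts (gvar X) \<and>
     (\<exists>i\<in>I. \<exists>c. c \<noteq> 0 \<and> act X i (c, x) = Some y \<and> act X i (inverse c, y) = Some x)}"

lemma orbit_relation_eq: "orbit_relation I X = step_rel\<^sup>*"
  by (simp add: orbit_relation_def step_rel_def)

lemma step_rel_sym: "sym step_rel"
proof (rule symI)
  fix x y assume "(x, y) \<in> step_rel"
  then obtain i c where "x \<in> pts (gvar X)" "y \<in> pts (gvar X)" "i \<in> I" "c \<noteq> 0"
    "act X i (c, x) = Some y" "act X i (inverse c, y) = Some x" by (auto simp: step_rel_def)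
  then show "(y, x) \<in> step_rel" unfolding step_rel_def
    by (intro CollectI case_prodI conjI bexI[of _ i] exI[of _ "inverse c"]) auto
qed

lemma orbit_sym: "(x, y) \<in> orbit_relation I X \<Longrightarrow> (y, x) \<in> orbit_relation I X"
  unfolding orbit_relation_eq using sym_rtrancl[OF step_rel_sym] by (rule symD)

text \<open>An invertible step is a local isomorphism, so it transports neighbourhoods inside an orbit.\<close>

lemma orbit_open:
  assumes N: "openin (zar (gvar X)) N" "N \<noteq> {}" "N \<subseteq> orbit_relation I X `` {x0}"
  shows "openin (zar (gvar X)) (orbit_relation I X `` {x0})"
proof -
  let ?\<Omega> = "orbit_relation I X `` {x0}"
  obtain z where z: "z \<in> N" using N by auto
  have nbhd: "\<exists>M. openin (zar (gvar X)) M \<and> w \<in> M \<and> M \<subseteq> ?\<Omega>" if "(w, z) \<in> step_rel\<^sup>*" for w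
    using that
  proof (induction rule: converse_rtrancl_induct)
    case base
    then show ?case using N z by blast
  next
    case (step w w')
    obtain M where M: "openin (zar (gvar X)) M" "w' \<in> M" "M \<subseteq> ?\<Omega>" using step.IH by blast
    obtain i c where ic: "w \<in> pts (gvar X)" "w' \<in> pts (gvar X)" "i \<in> I" "c \<noteq> 0"
      "act X i (c, w) = Some w'" "act X i (inverse c, w') = Some w" using step.hyps(1) by (auto simp: step_rel_def)
    note r = inverse_domain_open[OF ic(3,4)]
    let ?V = "{x \<in> {x \<in> pts (gvar X). (c, x) \<in> dom (act X i)}. the (act X i (c, x)) \<in>
      {y \<in> pts (gvar X). (inverse c, y) \<in> dom (act X i)}}"
    \<comment> \<open>The points that the same invertible step sends into \<open>M\<close>; they
      belong to the orbit because \<open>M\<close> does.\<close>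
    let ?M = "?V \<inter> {x \<in> {x \<in> pts (gvar X). (c, x) \<in> dom (act X i)}. the (act X i (c, x)) \<in> M}"
    have o: "openin (zar (gvar X)) ?M"
      by (intro openin_Int regular_on_open[OF r(2)] regular_on_preimage[OF r(1) M(1)])
    have "x \<in> ?\<Omega>" if x: "x \<in> ?M" for x
    proof -
      obtain y where y1: "act X i (c, x) = Some y" using x by auto
      have y: "act X i (c, x) = Some y" "y \<in> pts (gvar X)" "(inverse c, y) \<in> dom (act X i)" "y \<in> M"
        using x y1 by (simp_all add: domI)
      have "act X i (inverse c, y) = Some x" by (rule inverse_law[OF ic(3) y(1,3)])
      then have "(x, y) \<in> step_rel" using x y ic(3,4) by (auto simp: step_rel_def)
      then have "(y, x) \<in> step_rel" by (rule symD[OF step_rel_sym])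
      moreover have "(x0, y) \<in> step_rel\<^sup>*" using M(3) y(4) by (auto simp: orbit_relation_eq)
      ultimately show ?thesis by (auto simp: orbit_relation_eq)
    qed
    then show ?case using o ic M(2) by (intro exI[of _ ?M]) auto
  qed
  show ?thesis
  proof (subst openin_subopen, intro ballI)
    fix w assume "w \<in> ?\<Omega>"
    then have "(x0, w) \<in> orbit_relation I X" by simp
    then have "(w, x0) \<in> orbit_relation I X" by (rule orbit_sym)
    moreover have "(x0, z) \<in> orbit_relation I X" using N(3) z by blast
    ultimately have "(w, z) \<in> step_rel\<^sup>*" unfolding orbit_relation_eq by (rule rtrancl_trans)
    from nbhd[OF this] show "\<exists>M. openin (zar (gvar X)) M \<and> w \<in> M \<and> M \<subseteq> ?\<Omega>" .
  qed
qed

text \<open>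
  The conditions below are open in \<open>(c, t)\<close> and hold at \<open>(1, t)\<close> for generic \<open>t\<close>.
\<close>

lemma good_set:
  assumes i: "i \<in> I"
  shows "\<exists>D Y. openin (zar GT) D \<and> D \<noteq> {} \<and> openin (zar (var T)) Y \<and> Y \<noteq> {} \<and>
    (\<forall>t\<in>Y. act_theta X T \<theta> i (1, t) = Some t) \<and>
    (\<forall>c t. (c, t) \<in> D \<longrightarrow> (\<exists>t'. act_theta X T \<theta> i (c, t) = Some t' \<and>
      act_theta X T \<theta> i (inverse c, t') = Some t \<and> (the (\<theta> t), the (\<theta> t')) \<in> step_rel))"
proof -
  let ?e = "act X i" and ?A = "act_theta X T \<theta> i"
  note re = rational_map_regular[OF act_rational[OF i]]
  note rt = rational_map_regular[OF \<theta>_rational]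
  have ri: "regular_on (gvar X) (dom \<theta>_inv) (var T) (\<lambda>y. the (\<theta>_inv y))"
    using inverse_\<theta> by (intro rational_map_regular) (simp add: inverse_rational_def)
  obtain U where U: "open_dense (var T) U" "\<forall>t\<in>U. \<exists>y. \<theta> t = Some y \<and> \<theta>_inv y = Some t"
    using inverse_\<theta> unfolding inverse_rational_def generically_def by (elim conjE exE)
  obtain V where V: "open_dense (gvar X) V" "\<forall>y\<in>V. \<exists>t. \<theta>_inv y = Some t \<and> \<theta> t = Some y"
    using inverse_\<theta> unfolding inverse_rational_def generically_def by (elim conjE exE)
  note sn = regular_on_snd[OF Gm.ringed T.ringed_space_axioms]
  note fs = regular_on_fst[OF Gm.ringed T.ringed_space_axioms]
  let ?D1 = "{z \<in> pts GT. snd z \<in> dom \<theta>}"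
  have t1: "regular_on GT ?D1 (gvar X) (\<lambda>z. the (\<theta> (snd z)))" by (rule regular_on_compose[OF sn rt])
  have k: "regular_on GT ?D1 GX (\<lambda>z. (fst z, the (\<theta> (snd z))))"
    by (rule regular_on_Pair[OF GT.ringed_space_axioms Gm.ringed X.ringed_space_axioms
          regular_on_subset[OF GT.sheaf fs regular_on_open[OF t1]] t1]) auto
  let ?y = "\<lambda>z. the (?e (fst z, the (\<theta> (snd z))))"
  let ?D2 = "{z \<in> ?D1. (fst z, the (\<theta> (snd z))) \<in> dom ?e}"
  have y: "regular_on GT ?D2 (gvar X) ?y" by (rule regular_on_compose[OF k re])
  let ?D3 = "{z \<in> ?D2. ?y z \<in> dom \<theta>_inv}"
  have t': "regular_on GT ?D3 (var T) (\<lambda>z. the (\<theta>_inv (?y z)))" by (rule regular_on_compose[OF y ri])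
  have f2: "regular_on GT ?D2 (var Gm) fst"
    by (rule regular_on_subset[OF GT.sheaf fs regular_on_open[OF y]]) blast
  have l: "regular_on GT ?D2 GX (\<lambda>z. (inverse (fst z), ?y z))"
    by (rule regular_on_Pair[OF GT.ringed_space_axioms Gm.ringed X.ringed_space_axioms
          Gm_mult_regular(2)[OF GT.ringed_space_axioms f2 f2] y])
  \<comment> \<open>The three conditions provide the torus coordinates of the image, the way back
    with the inverse parameter, and the return from \<open>X\<close> to the starting point
    \<open>t\<close>.\<close>
  let ?D = "{z \<in> ?D2. ?y z \<in> V} \<inter> {z \<in> ?D2. (inverse (fst z), ?y z) \<in> dom ?e} \<inter> {z \<in> pts GT. snd z \<in> U}"
  have D: "openin (zar GT) ?D"
    by (intro openin_Int regular_on_preimage[OF y open_dense_open[OF V(1)]] regular_on_open[OF regular_on_compose[OF l re]]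
        regular_on_preimage[OF sn open_dense_open[OF U(1)]])
  let ?X1 = "{x. (1, x) \<in> dom ?e}"
  \<comment> \<open>At parameter \<open>1\<close> the action fixes the point, so all conditions
    reduce to conditions on \<open>t\<close> that hold on a nonempty open set.\<close>
  let ?Y = "{t \<in> dom \<theta>. the (\<theta> t) \<in> V \<inter> ?X1} \<inter> U"
  have VX: "open_dense (gvar X) (V \<inter> ?X1)" by (rule open_dense_Int[OF V(1) unit_dense[OF i]])
  have Y1: "openin (zar (var T)) {t \<in> dom \<theta>. the (\<theta> t) \<in> V \<inter> ?X1}"
    by (rule regular_on_preimage[OF rt open_dense_open[OF VX]])
  have Y: "openin (zar (var T)) ?Y" by (intro openin_Int Y1 open_dense_open[OF U(1)])
  have "pts (gvar X) \<noteq> {}"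
  proof -
    obtain t where "t \<in> U" using open_dense_meets[OF U(1) openin_topspace T_nonempty] by auto
    then obtain x where "\<theta> t = Some x" using U(2) by blast
    from regular_on_image[OF rt domI[of \<theta>, OF this]] show ?thesis by blast
  qed
  then obtain x where x: "x \<in> V \<inter> ?X1" using open_dense_meets[OF VX openin_topspace] by auto
  then obtain t where "\<theta> t = Some x" using V(2) by blast
  then have "t \<in> {t \<in> dom \<theta>. the (\<theta> t) \<in> V \<inter> ?X1}" using x by auto
  then have Yne: "?Y \<noteq> {}" using open_dense_meets[OF U(1) Y1] by blast
  have Yt: "\<exists>x. \<theta> t = Some x \<and> ?e (1, x) = Some x \<and> \<theta>_inv x = Some t \<and> x \<in> V \<and> t \<in> U \<and> t \<in> carrier T" if tY: "t \<in> ?Y" for t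
  proof -
    have "t \<in> U" using tY by (rule IntD2)
    then obtain x where x: "\<theta> t = Some x" "\<theta>_inv x = Some t" using U(2) by blast
    have "the (\<theta> t) \<in> V \<inter> ?X1" using IntD1[OF tY] by (rule CollectE) (erule conjunct2)
    then have xV: "x \<in> V" "(1, x) \<in> dom ?e" unfolding x(1) option.sel by (rule IntD1, elim IntD2[THEN CollectD])
    have "t \<in> carrier T" using subsetD[OF openin_subset[OF Y] tY] by (simp only: pts_T)
    then show ?thesis using x xV act_one_eq[OF i xV(2)] \<open>t \<in> U\<close> by (intro exI[of _ x] conjI)
  qed
  have YD: "(1, t) \<in> ?D \<and> (1, t) \<in> ?D3" if t: "t \<in> ?Y" for t
    using Yt[OF t] by auto
  \<comment> \<open>The composite is defined at the points \<open>(1, t)\<close> with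
    \<open>t\<close> in \<open>?Y\<close>, hence densely by irreducibility; only then does
    \<open>act_theta\<close> extend it.\<close>
  let ?comp = "\<lambda>(c, t). Option.bind (\<theta> t) (\<lambda>x. Option.bind (?e (c, x)) \<theta>_inv)"
  have A0: "?comp z = Some (the (\<theta>_inv (?y z)))" if "z \<in> ?D3" for z
    using that by (cases z) auto
  have domA0: "dom ?comp = ?D3"
  proof (intro equalityI subsetI)
    fix z assume "z \<in> dom ?comp"
    then obtain c t x y t' where z: "z = (c, t)" "\<theta> t = Some x" "?e (c, x) = Some y" "\<theta>_inv y = Some t'"
      by (cases z) (auto simp: bind_eq_Some_conv)
    have "t \<in> carrier T" using openin_subset[OF regular_on_open[OF rt]] z(2) by (auto simp: pts_T)
    then show "z \<in> ?D3" using z act_dom_pts(1)[OF i z(3)] by auto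
  next
    fix z assume "z \<in> ?D3"
    then show "z \<in> dom ?comp" using A0 by blast
  qed
  have "open_dense GT ?D3"
    using irreducible_open_dense[OF GT_irreducible regular_on_open[OF t']] YD Yne by blast
  then have dense: "open_dense GT (dom ?comp)" unfolding domA0 .
  have reg: "regular_on GT (dom ?comp) (var T) (\<lambda>z. the (?comp z))"
    unfolding domA0 by (rule regular_on_cong[OF GT.sheaf t']) (simp only: A0 option.sel)
  have A: "?A z = ?comp z" if "z \<in> dom ?comp" for z
    unfolding act_theta_def prod_group_simps
    by (rule rational_ext(2)[OF GT.ringed_space_axioms variety_T dense reg that])
  have 1: "?A (1, t) = Some t" if t: "t \<in> ?Y" for t
  proof -
    have "(1, t) \<in> dom ?comp" using YD[OF t] unfolding domA0 by blast
    then show ?thesis using A[of "(1, t)"] Yt[OF t] by auto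
  qed
  have 2: "\<exists>t'. ?A (c, t) = Some t' \<and> ?A (inverse c, t') = Some t \<and> (the (\<theta> t), the (\<theta> t')) \<in> step_rel"
    if ct: "(c, t) \<in> ?D" for c t
  proof -
    have "t \<in> U" using ct by auto
    then obtain x where x: "\<theta> t = Some x" "\<theta>_inv x = Some t" using U(2) by blast
    obtain y where y1: "?e (c, x) = Some y" using ct x by auto
    have y: "?e (c, x) = Some y" "y \<in> V" "(inverse c, y) \<in> dom ?e" using ct x y1 by (simp_all add: domI)
    obtain t' where t': "\<theta>_inv y = Some t'" "\<theta> t' = Some y" using V(2) y(2) by blast
    have ret: "?e (inverse c, y) = Some x" by (rule inverse_law[OF i y(1,3)])
    have "?comp (c, t) = Some t'" using x y t' by simp
    moreover from this have "?A (c, t) = ?comp (c, t)" by (intro A domI)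
    moreover have "?comp (inverse c, t') = Some t" using x t' ret by simp
    moreover from this have "?A (inverse c, t') = ?comp (inverse c, t')" by (intro A domI)
    moreover have "(x, y) \<in> step_rel"
      using act_dom_pts[OF i y(1)] i y(1) ret by (auto simp: step_rel_def)
    ultimately show ?thesis using x t' by (intro exI[of _ t']) simp
  qed
  have "?D \<noteq> {}" using YD Yne by blast
  then show ?thesis using D Y Yne 1 2 by (intro exI[of _ ?D] exI[of _ ?Y] conjI ballI allI impI)
qed

end

section \<open>Connected crystals\<close>

lemma prat_nonzero:
  assumes "f \<in> prat n"
  shows "\<exists>h\<in>pospoly n. \<forall>x. h x \<noteq> 0 \<longrightarrow> f x \<noteq> 0"
proof -
  obtain p q where pq: "p \<in> pospoly n" "q \<in> pospoly n" "\<forall>x. p x \<noteq> 0 \<longrightarrow> q x \<noteq> 0 \<longrightarrow> f x = p x / q x"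
    using prat_quotient[OF assms] by (elim bexE)
  then show ?thesis by (intro bexI[of _ "\<lambda>x. p x * q x"] pospoly_closed) auto
qed

lemma prat_finite_nonzero:
  assumes "finite A" "\<And>j. j \<in> A \<Longrightarrow> f j \<in> prat n"
  shows "\<exists>h\<in>pospoly n. \<forall>x. h x \<noteq> 0 \<longrightarrow> (\<forall>j\<in>A. f j x \<noteq> 0)"
proof -
  obtain h where h: "h \<in> pospoly n" "\<forall>x. h x \<noteq> 0 \<longrightarrow> (\<Prod>j\<in>A. f j x) \<noteq> 0"
    using prat_nonzero[OF prat_prod[of A f n, OF assms]] by blast
  have "\<forall>j\<in>A. f j x \<noteq> 0" if "h x \<noteq> 0" for x
    using h(2)[rule_format, OF that] assms(1) by simp
  then show ?thesis using h(1) by blast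
qed

locale positive_chart = geometric_chart T d \<phi> I X \<theta>
  for T :: "'t alg_group" and d \<phi> and I :: "'i set" and X :: "('i, 'a) gcrystal" and \<theta> :: "'t \<rightharpoonup> 'a" +
  fixes G H :: "'i \<Rightarrow> nat \<Rightarrow> (nat \<Rightarrow> complex) \<Rightarrow> complex"
  assumes GH: "i \<in> I \<Longrightarrow> j < d \<Longrightarrow> G i j \<in> prat (Suc d)" "i \<in> I \<Longrightarrow> j < d \<Longrightarrow> H i j \<in> prat (Suc d)"
    and act_coords: "i \<in> I \<Longrightarrow> c \<noteq> 0 \<Longrightarrow> t \<in> carrier T \<Longrightarrow>
      (\<forall>j<d. G i j ((\<phi> t)(d := c)) \<noteq> 0 \<and> H i j ((\<phi> t)(d := c)) \<noteq> 0) \<Longrightarrow>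
      act_theta X T \<theta> i (c, t) = Some (pt (\<lambda>j. G i j ((\<phi> t)(d := c)) * inverse (H i j ((\<phi> t)(d := c)))))"
    and connected: "crystal_connected I (ultra_discretization X T \<theta>)"
begin

definition E :: "'i \<Rightarrow> nat \<Rightarrow> (nat \<Rightarrow> complex) \<Rightarrow> complex" where
  "E i j z = G i j z * inverse (H i j z)"

sublocale act: positive_action I d E
proof
  show "E i j \<in> prat (Suc d)" if "i \<in> I" "j < d" for i j
    using prat.mult[OF GH(1)[OF that] prat.inv[OF GH(2)[OF that]]] unfolding E_def[abs_def] .
qed

text \<open>Sufficient for the coordinate formula of the action: point and parameter lie in the
  tori, and the convention on division by zero does not intervene.\<close>

definition nz :: "'i \<Rightarrow> (nat \<Rightarrow> complex) \<Rightarrow> bool" where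
  "nz i z \<longleftrightarrow> (\<forall>j<Suc d. z j \<noteq> 0) \<and> (\<forall>j<d. G i j z \<noteq> 0 \<and> H i j z \<noteq> 0)"

lemma nz_cong:
  assumes i: "i \<in> I" and "nz i x" and xy: "\<And>k. k < Suc d \<Longrightarrow> x k = y k"
  shows "nz i y"
proof -
  have "G i j x = G i j y" "H i j x = H i j y" if "j < d" for j
    by (rule prat_cong[OF GH(1)[OF i that] xy], assumption, rule prat_cong[OF GH(2)[OF i that] xy], assumption)
  then show ?thesis using assms(2) xy unfolding nz_def by simp
qed

lemma act_theta_stp:
  assumes i: "i \<in> I" and z: "nz i (s(d := c))"
  shows "act_theta X T \<theta> i (c, pt s) = Some (pt (act.stp i c s))" "pt s \<in> carrier T"
    "c \<noteq> 0" "\<phi> (pt s) = restrict s {..<d}" "\<phi> (pt (act.stp i c s)) = restrict (act.stp i c s) {..<d}"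
proof -
  have zj: "(s(d := c)) j \<noteq> 0" if "j < Suc d" for j using z that unfolding nz_def by blast
  show c: "c \<noteq> 0" using zj[of d] by simp
  have s: "s j \<noteq> 0" if "j < d" for j using zj[of j] that by simp
  have "act.stp i c s j \<noteq> 0" if "j < d" for j
    using z that by (simp add: act.stp_def E_def nz_def)
  then show "\<phi> (pt (act.stp i c s)) = restrict (act.stp i c s) {..<d}" by (intro \<phi>_pt[of "act.stp i c s"])
  show \<phi>s: "\<phi> (pt s) = restrict s {..<d}" by (rule \<phi>_pt[of s, OF s])
  show t: "pt s \<in> carrier T" by (rule pt_mem[of s, OF s])
  have e: "((\<phi> (pt s))(d := c)) j = (s(d := c)) j" if "j < Suc d" for j
    using that by (auto simp: \<phi>s less_Suc_eq)
  have eG: "G i j ((\<phi> (pt s))(d := c)) = G i j (s(d := c))" "H i j ((\<phi> (pt s))(d := c)) = H i j (s(d := c))"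
    if j: "j < d" for j
    by (rule prat_cong[OF GH(1)[OF i j]], rule e, assumption) (rule prat_cong[OF GH(2)[OF i j]], rule e)
  have "act_theta X T \<theta> i (c, pt s) =
      Some (pt (\<lambda>j. G i j ((\<phi> (pt s))(d := c)) * inverse (H i j ((\<phi> (pt s))(d := c)))))"
    by (rule act_coords[OF i c t]) (use z eG in \<open>simp add: nz_def\<close>)
  also have "pt (\<lambda>j. G i j ((\<phi> (pt s))(d := c)) * inverse (H i j ((\<phi> (pt s))(d := c)))) = pt (act.stp i c s)"
    by (rule pt_cong) (simp add: eG act.stp_def E_def)
  finally show "act_theta X T \<theta> i (c, pt s) = Some (pt (act.stp i c s))" .
qed

text \<open>The coordinates may themselves be positive functions, so that the condition can be
  imposed after a substitution; being positive at positive points, the polynomial is not identically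
  zero.\<close>

lemma nz_generic:
  assumes i: "i \<in> I" and g: "\<And>j. j < Suc d \<Longrightarrow> g j \<in> prat n"
  shows "\<exists>h\<in>pospoly n. \<forall>x. h x \<noteq> 0 \<longrightarrow> nz i (\<lambda>j. g j x)"
proof -
  have "(\<lambda>x. G i j (\<lambda>k. g k x)) \<in> prat n" "(\<lambda>x. H i j (\<lambda>k. g k x)) \<in> prat n" if "j < d" for j
    using prat_subst[OF GH(1)[OF i that] g] prat_subst[OF GH(2)[OF i that] g] by auto
  then obtain h1 h2 h3 where h: "h1 \<in> pospoly n" "\<forall>x. h1 x \<noteq> 0 \<longrightarrow> (\<forall>j\<in>{..<d}. G i j (\<lambda>k. g k x) \<noteq> 0)"
    "h2 \<in> pospoly n" "\<forall>x. h2 x \<noteq> 0 \<longrightarrow> (\<forall>j\<in>{..<d}. H i j (\<lambda>k. g k x) \<noteq> 0)"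
    "h3 \<in> pospoly n" "\<forall>x. h3 x \<noteq> 0 \<longrightarrow> (\<forall>j\<in>{..<Suc d}. g j x \<noteq> 0)"
    using prat_finite_nonzero[of "{..<d}" "\<lambda>j x. G i j (\<lambda>k. g k x)" n]
      prat_finite_nonzero[of "{..<d}" "\<lambda>j x. H i j (\<lambda>k. g k x)" n]
      prat_finite_nonzero[of "{..<Suc d}" g n] g by auto
  show ?thesis
    by (rule bexI[of _ "\<lambda>x. h1 x * (h2 x * h3 x)"]) (use h in \<open>auto simp: nz_def intro!: pospoly_closed\<close>)
qed

definition related :: "(nat \<Rightarrow> complex) \<Rightarrow> (nat \<Rightarrow> complex) \<Rightarrow> bool" where
  "related s s' \<longleftrightarrow> (the (\<theta> (pt s)), the (\<theta> (pt s'))) \<in> orbit_relation I X"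

text \<open>Expresses the open set of \<open>good_set\<close> by a polynomial in the coordinates,
  multiplied by one that ensures \<open>nz\<close>.\<close>

lemma good_polynomial:
  assumes i: "i \<in> I"
  shows "\<exists>f\<in>polyfuns (Suc d). (\<exists>z. f z \<noteq> 0) \<and> (\<forall>z. f z \<noteq> 0 \<longrightarrow> nz i z) \<and>
    (\<forall>s c. f (s(d := c)) \<noteq> 0 \<longrightarrow> related s (act.stp i c s) \<and>
      act_theta X T \<theta> i (inverse c, pt (act.stp i c s)) = Some (pt s))"
proof -
  obtain D Y where D: "openin (zar GT) D" "D \<noteq> {}" and good: "\<forall>c t. (c, t) \<in> D \<longrightarrow> (\<exists>t'. act_theta X T \<theta> i (c, t) = Some t' \<and>
      act_theta X T \<theta> i (inverse c, t') = Some t \<and> (the (\<theta> t), the (\<theta> t')) \<in> step_rel)"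
    using good_set[OF i] by (elim exE conjE)
  obtain f where f: "f \<in> polyfuns (Suc d)" "\<exists>z. f z \<noteq> 0"
    and fD: "\<forall>c t. c \<noteq> 0 \<longrightarrow> t \<in> carrier T \<longrightarrow> f ((\<phi> t)(d := c)) \<noteq> 0 \<longrightarrow> (c, t) \<in> D"
    using GT_open_contains[OF D] by (elim bexE conjE)
  obtain h where h: "h \<in> pospoly (Suc d)" "\<forall>x. h x \<noteq> 0 \<longrightarrow> nz i (\<lambda>j. x j)"
    using nz_generic[OF i, of "\<lambda>j x. x j"] prat.coord by blast
  have p: "(\<lambda>z. f z * h z) \<in> polyfuns (Suc d)" by (rule polyfuns.mult[OF f(1) pospoly_polyfuns[OF h(1)]])
  have "\<exists>z. f z * h z \<noteq> 0"
    using polyfuns_mult_nonzero[OF f(1) pospoly_polyfuns[OF h(1)]] f(2) pospoly_pos_nonzero[OF h(1) posvec_ones] by blast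
  moreover have "related s (act.stp i c s) \<and> act_theta X T \<theta> i (inverse c, pt (act.stp i c s)) = Some (pt s)"
    if fh: "f (s(d := c)) * h (s(d := c)) \<noteq> 0" for s c
  proof -
    have "nz i (s(d := c))" using h(2)[rule_format, of "s(d := c)"] fh by auto
    note a = act_theta_stp[OF i this]
    have "f ((\<phi> (pt s))(d := c)) = f (s(d := c))"
      by (rule polyfuns_cong[OF f(1)]) (auto simp: a(4) less_Suc_eq)
    then have "(c, pt s) \<in> D" using fD a(2,3) fh by simp
    then obtain t' where t': "act_theta X T \<theta> i (c, pt s) = Some t'" "act_theta X T \<theta> i (inverse c, t') = Some (pt s)"
      "(the (\<theta> (pt s)), the (\<theta> t')) \<in> step_rel" using good by blast
    then have "t' = pt (act.stp i c s)" using a(1) by simp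
    then show ?thesis using t' by (auto simp: related_def orbit_relation_eq)
  qed
  ultimately show ?thesis using p h(2) by (intro bexI[OF _ p] conjI allI impI) auto
qed

text \<open>On an open set of the torus the rational map can be compared with its formula, which
  gives the law there; as an identity of positive functions it spreads to all positive
  points.\<close>

lemma stp_one:
  assumes i: "i \<in> I" and s: "posvec s" and j: "j < d"
  shows "act.stp i 1 s j = s j"
proof -
  obtain D Y where Y: "openin (zar (var T)) Y" "Y \<noteq> {}" "\<forall>t\<in>Y. act_theta X T \<theta> i (1, t) = Some t"
    using good_set[OF i] by (elim exE conjE)
  obtain f where f: "f \<in> polyfuns d" "\<exists>z. f z \<noteq> 0" and fY: "\<forall>t\<in>carrier T. f (\<phi> t) \<noteq> 0 \<longrightarrow> t \<in> Y"
    using T_open_contains[OF Y(1,2)] by (elim bexE conjE)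
  let ?g = "\<lambda>k s. if k < d then s k else 1 :: complex"
  have g: "?g k \<in> prat d" for k by (cases "k < d") (auto intro: prat.intros)
  obtain h where h: "h \<in> pospoly d" "\<forall>x. h x \<noteq> 0 \<longrightarrow> nz i (\<lambda>k. ?g k x)"
    using nz_generic[OF i, of ?g d, OF g] by blast
  have e: "E i j (\<lambda>k. ?g k s) = E i j (s(d := 1))" for s
    by (rule prat_cong[OF act.E[OF i j]]) auto
  obtain u where u: "f u * h u \<noteq> 0"
    using polyfuns_mult_nonzero[OF f(1) pospoly_polyfuns[OF h(1)]] f(2) pospoly_pos_nonzero[OF h(1) posvec_ones] by blast
  have "E i j (\<lambda>k. ?g k s) = s j"
  proof (rule prat_identity[OF prat_subst[OF act.E[OF i j], where g = ?g, OF g] prat.coord[OF j]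
        polyfuns.mult[OF f(1) pospoly_polyfuns[OF h(1)]] u _ s])
    fix x assume x: "f x * h x \<noteq> 0"
    have "nz i ((\<lambda>k. ?g k x)(d := 1))" using h(2)[rule_format, of x] x by (simp add: fun_upd_idem)
    then have "nz i ((\<lambda>k. if k < d then x k else 1)(d := 1))" .
    note a = act_theta_stp[OF i this]
    let ?x = "\<lambda>k. ?g k x"
    have "f (\<phi> (pt ?x)) = f x"
      by (rule polyfuns_cong[OF f(1)]) (simp add: a(4))
    then have "pt ?x \<in> Y" using fY a(2) x by simp
    then have "act_theta X T \<theta> i (1, pt ?x) = Some (pt ?x)" using Y(3) by blast
    then have "pt (act.stp i 1 ?x) = pt ?x" using a(1) by simp
    then have "\<phi> (pt (act.stp i 1 ?x)) j = \<phi> (pt ?x) j" by simp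
    then have "act.stp i 1 ?x j = ?x j" using j by (simp only: a(4,5) restrict_apply lessThan_iff if_True)
    then show "E i j (\<lambda>k. ?g k x) = x j" using j by (simp add: act.stp_def fun_upd_idem)
  qed
  then show ?thesis using j e by (simp add: act.stp_def)
qed

text \<open>Same principle as for the unit law, with the parameter as an additional
  variable.\<close>

lemma stp_inverse:
  assumes i: "i \<in> I" and s: "posvec s" and c: "c \<in> posreal" and j: "j < d"
  shows "act.stp i c (act.stp i (inverse c) s) j = s j"
proof -
  obtain f where f: "f \<in> polyfuns (Suc d)" "\<exists>z. f z \<noteq> 0" and fnz: "\<forall>z. f z \<noteq> 0 \<longrightarrow> nz i z"
    and fg: "\<forall>s c. f (s(d := c)) \<noteq> 0 \<longrightarrow> related s (act.stp i c s) \<and>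
      act_theta X T \<theta> i (inverse c, pt (act.stp i c s)) = Some (pt s)"
    using good_polynomial[OF i] by (elim bexE conjE)
  let ?g = "\<lambda>k z. if k < d then E i k z else inverse (z d)"
  have g: "?g k \<in> prat (Suc d)" for k
    using act.E[OF i, of k] by (cases "k < d") (auto intro: prat.intros)
  obtain h where h: "h \<in> pospoly (Suc d)" "\<forall>x. h x \<noteq> 0 \<longrightarrow> nz i (\<lambda>k. ?g k x)"
    using nz_generic[OF i, of ?g "Suc d", OF g] by blast
  have e: "E i j (\<lambda>k. ?g k z) = act.stp i (inverse (z d)) (act.stp i (z d) z) j" for z
  proof -
    have "E i j (\<lambda>k. ?g k z) = E i j ((act.stp i (z d) z)(d := inverse (z d)))"
      by (rule prat_cong[OF act.E[OF i j]]) (auto simp: act.stp_def)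
    then show ?thesis using j by (simp add: act.stp_def)
  qed
  obtain u where u: "f u * h u \<noteq> 0"
    using polyfuns_mult_nonzero[OF f(1) pospoly_polyfuns[OF h(1)]] f(2) pospoly_pos_nonzero[OF h(1) posvec_ones] by blast
  \<comment> \<open>The identity concerns a parameter followed by its inverse, so it is applied with
    the parameter \<open>inverse c\<close>.\<close>
  let ?z = "s(d := inverse c)"
  have pz: "posvec ?z" using s c by (intro posvec_upd) auto
  have "E i j (\<lambda>k. ?g k ?z) = ?z j"
  proof (rule prat_identity[OF prat_subst[OF act.E[OF i j], where g = ?g, OF g] prat.coord
        polyfuns.mult[OF f(1) pospoly_polyfuns[OF h(1)]] u _ pz])
    show "j < Suc d" using j by simp
    fix x assume x: "f x * h x \<noteq> 0"
    have "nz i (x(d := x d))" using fnz x by simp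
    note a = act_theta_stp[OF i this]
    let ?s = "act.stp i (x d) x"
    have r: "act_theta X T \<theta> i (inverse (x d), pt ?s) = Some (pt x)" using fg[rule_format, of x "x d"] x by simp
    have "nz i (\<lambda>k. ?g k x)" using h(2) x by auto
    then have "nz i (?s(d := inverse (x d)))"
      by (rule nz_cong[OF i]) (auto simp: act.stp_def less_Suc_eq)
    note b = act_theta_stp[OF i this]
    have "pt (act.stp i (inverse (x d)) ?s) = pt x" using b(1) r by simp
    then have "\<phi> (pt (act.stp i (inverse (x d)) ?s)) j = \<phi> (pt x) j" by simp
    then show "E i j (\<lambda>k. ?g k x) = x j" unfolding e using j by (simp only: a(4) b(5) restrict_apply lessThan_iff if_True)
  qed
  moreover have "act.stp i (inverse c) ?z = act.stp i (inverse c) s"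
    by (rule act.stp_cong[OF i]) auto
  ultimately show ?thesis using j unfolding e by simp
qed

text \<open>Exponents of the coordinate functions are the same for all curves with given exponents;
  the monomial curve among them computes the ultra-discretization.\<close>

lemma tropical_step:
  assumes i: "i \<in> I"
  shows "\<exists>b'. cr_e (ultra_discretization X T \<theta>) i n (cochar b) = cochar b' \<and>
    (\<forall>y. (\<forall>k<Suc d. has_exp (\<lambda>c. y c k) ((b(d := n)) k)) \<longrightarrow> (\<forall>j<d. has_exp (\<lambda>c. E i j (y c)) (b' j)))"
proof -
  have "\<forall>j. \<exists>v. j < d \<longrightarrow> (\<forall>y. (\<forall>k<Suc d. has_exp (\<lambda>c. y c k) ((b(d := n)) k)) \<longrightarrow> has_exp (\<lambda>c. E i j (y c)) v)"
    using prat_has_exp[OF act.E[OF i]] by blast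
  then obtain b' where b': "\<forall>j. j < d \<longrightarrow> (\<forall>y. (\<forall>k<Suc d. has_exp (\<lambda>c. y c k) ((b(d := n)) k)) \<longrightarrow>
      has_exp (\<lambda>c. E i j (y c)) (b' j))" by (rule choice[THEN exE])
  have "UD_map (prod_group Gm T) T (act_theta X T \<theta> i) (\<lambda>c\<in>carrier Gm. (c powi n, cochar b c)) = cochar b'"
  proof (rule UD_map_cochar[where G = "G i" and H = "H i"])
    show "G i j \<in> prat (Suc d) \<and> H i j \<in> prat (Suc d)" if "j < d" for j using GH[OF i that] by simp
    fix c t assume "c \<noteq> 0" "t \<in> carrier T"
      "\<forall>j<d. G i j ((\<phi> t)(d := c)) \<noteq> 0 \<and> H i j ((\<phi> t)(d := c)) \<noteq> 0"
    then show "act_theta X T \<theta> i (c, t) =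
        Some (pt (\<lambda>j. G i j ((\<phi> t)(d := c)) * inverse (H i j ((\<phi> t)(d := c)))))" by (rule act_coords[OF i])
  next
    fix j assume j: "j < d"
    have "\<forall>k<Suc d. has_exp (\<lambda>c. complex_of_real c powi (b(d := n)) k) ((b(d := n)) k)"
      using has_exp_powi by blast
    from b'[rule_format, OF j, OF this[rule_format]]
    show "has_exp (\<lambda>c. G i j (\<lambda>k. complex_of_real c powi (b(d := n)) k) *
      inverse (H i j (\<lambda>k. complex_of_real c powi (b(d := n)) k))) (b' j)" unfolding E_def .
  qed
  then show ?thesis using b' by (intro exI[of _ b']) (simp add: ultra_discretization_def)
qed

text \<open>A path in the crystal from the zero cocharacter to \<open>cochar b\<close> is translated
  letter by letter into a word whose parameters are powers of \<open>c\<close>; constant curves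
  correspond to the zero cocharacter.\<close>

lemma tropical_words:
  "\<exists>u n. set u \<subseteq> I \<and> (\<forall>s. posvec s \<longrightarrow>
    (\<forall>j<d. has_exp (\<lambda>c. act.word_act u 0 (\<lambda>k. complex_of_real c powi n k) s j) (b j)))"
proof -
  let ?B = "ultra_discretization X T \<theta>"
  have "cochar (\<lambda>_. 0) \<in> cr_set ?B" "cochar b \<in> cr_set ?B"
    using cochar_cocharacter by (auto simp: ultra_discretization_def)
  then have "(cochar (\<lambda>_. 0), cochar b) \<in> {(b, cr_e ?B i n b) |b i n. b \<in> cr_set ?B \<and> i \<in> I}\<^sup>*"
    using connected unfolding crystal_connected_def by blast
  \<comment> \<open>The exponent vector is existential because a cocharacter does not see the
    entries from \<open>d\<close> on.\<close>
  then have "\<exists>\<beta> u n. cochar b = cochar \<beta> \<and> set u \<subseteq> I \<and> (\<forall>s. posvec s \<longrightarrow>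
    (\<forall>j<d. has_exp (\<lambda>c. act.word_act u 0 (\<lambda>k. complex_of_real c powi n k) s j) (\<beta> j)))"
  proof (induction rule: rtrancl_induct)
    case base
    show ?case
      by (rule exI[of _ "\<lambda>_. 0"], rule exI[of _ "[]"]) (auto simp: posvec_def intro!: has_exp_const)
  next
    case (step x y)
    obtain \<beta> u n where \<beta>: "x = cochar \<beta>" "set u \<subseteq> I" "\<forall>s. posvec s \<longrightarrow>
      (\<forall>j<d. has_exp (\<lambda>c. act.word_act u 0 (\<lambda>k. complex_of_real c powi n k) s j) (\<beta> j))"
      using step.IH by (elim exE conjE)
    obtain i m where im: "i \<in> I" "y = cr_e ?B i m x" using step.hyps(2) by auto
    obtain \<beta>' where \<beta>': "y = cochar \<beta>'" "\<forall>y. (\<forall>k<Suc d. has_exp (\<lambda>c. y c k) ((\<beta>(d := m)) k)) \<longrightarrow>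
      (\<forall>j<d. has_exp (\<lambda>c. E i j (y c)) (\<beta>' j))"
      using tropical_step[OF im(1), of m \<beta>] im(2) \<beta>(1) by auto
    \<comment> \<open>The new letter acts last and therefore reads the first parameter.\<close>
    let ?n = "case_nat m n"
    have "has_exp (\<lambda>c. act.word_act (i # u) 0 (\<lambda>k. complex_of_real c powi ?n k) s j) (\<beta>' j)"
      if s: "posvec s" and j: "j < d" for s j
    proof -
      let ?y = "\<lambda>c. (act.word_act u 0 (\<lambda>k. complex_of_real c powi n k) s)(d := complex_of_real c powi m)"
      have "\<forall>k<Suc d. has_exp (\<lambda>c. ?y c k) ((\<beta>(d := m)) k)"
        using \<beta>(3) s has_exp_powi by (auto simp: less_Suc_eq)
      then have all: "\<forall>j<d. has_exp (\<lambda>c. E i j (?y c)) (\<beta>' j)"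
        by (rule mp[OF spec[OF \<beta>'(2), of ?y]])
      have "has_exp (\<lambda>c. E i j (?y c)) (\<beta>' j)" by (rule all[rule_format, OF j])
      moreover have "act.word_act (i # u) 0 (\<lambda>k. complex_of_real c powi ?n k) s j = E i j (?y c)" for c
      proof -
        have "act.word_act u (Suc 0) (\<lambda>k. complex_of_real c powi ?n k) s k =
            act.word_act u 0 (\<lambda>k. complex_of_real c powi n k) s k" if "k < d" for k
          by (rule act.word_act_cong[OF \<beta>(2) _ _ that]) auto
        then have "act.stp i (complex_of_real c powi m) (act.word_act u (Suc 0) (\<lambda>k. complex_of_real c powi ?n k) s) =
            act.stp i (complex_of_real c powi m) (act.word_act u 0 (\<lambda>k. complex_of_real c powi n k) s)"
          by (intro act.stp_cong im(1))
        then show ?thesis using j by (simp add: act.stp_def)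
      qed
      ultimately show ?thesis by simp
    qed
    then show ?case using \<beta>'(1) \<beta>(2) im(1)
      by (intro exI[of _ \<beta>'] exI[of _ "i # u"] exI[of _ ?n]) simp
  qed
  then obtain \<beta> u n where \<beta>: "cochar b = cochar \<beta>" "set u \<subseteq> I" "\<forall>s. posvec s \<longrightarrow>
    (\<forall>j<d. has_exp (\<lambda>c. act.word_act u 0 (\<lambda>k. complex_of_real c powi n k) s j) (\<beta> j))"
    by (elim exE conjE)
  have "\<beta> j = b j" if j: "j < d" for j
  proof (rule powi_exponent_unique)
    show "c powi \<beta> j = c powi b j" if "c \<noteq> 0" for c :: complex
      using \<phi>_cochar[OF that j, of b] \<phi>_cochar[OF that j, of \<beta>] \<beta>(1) by simp
  qed
  then show ?thesis using \<beta>(2,3) by (intro exI[of _ u] exI[of _ n]) simp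
qed

text \<open>The open set found in coordinates is carried to \<open>X\<close>; once an orbit contains
  a nonempty open set, \<open>orbit_open\<close> makes the whole orbit open.\<close>

theorem prehomogeneous_X: "prehomogeneous I X"
proof -
  have "\<forall>i. \<exists>f. i \<in> I \<longrightarrow> f \<in> polyfuns (Suc d) \<and> (\<exists>z. f z \<noteq> 0) \<and>
      (\<forall>s c. f (s(d := c)) \<noteq> 0 \<longrightarrow> related s (act.stp i c s))"
  proof
    fix i
    show "\<exists>f. i \<in> I \<longrightarrow> f \<in> polyfuns (Suc d) \<and> (\<exists>z. f z \<noteq> 0) \<and>
        (\<forall>s c. f (s(d := c)) \<noteq> 0 \<longrightarrow> related s (act.stp i c s))"
    proof (cases "i \<in> I")
      case True
      from good_polynomial[OF this] obtain f where "f \<in> polyfuns (Suc d)" "\<exists>z. f z \<noteq> 0"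
        "\<forall>s c. f (s(d := c)) \<noteq> 0 \<longrightarrow> related s (act.stp i c s) \<and>
          act_theta X T \<theta> i (inverse c, pt (act.stp i c s)) = Some (pt s)" by (elim bexE conjE)
      then show ?thesis by (intro exI[of _ f]) simp
    qed simp
  qed
  then obtain f where f: "\<forall>i. i \<in> I \<longrightarrow> f i \<in> polyfuns (Suc d) \<and> (\<exists>z. f i z \<noteq> 0) \<and>
      (\<forall>s c. f i (s(d := c)) \<noteq> 0 \<longrightarrow> related s (act.stp i c s))" by (rule choice[THEN exE])
  interpret orb: positive_orbits I d E f related
  proof
    fix i s c j and s' s'' r r' b
    show "i \<in> I \<Longrightarrow> posvec s \<Longrightarrow> j < d \<Longrightarrow> act.stp i 1 s j = s j" by (rule stp_one)
    show "i \<in> I \<Longrightarrow> posvec s \<Longrightarrow> c \<in> posreal \<Longrightarrow> j < d \<Longrightarrow> act.stp i c (act.stp i (inverse c) s) j = s j"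
      by (rule stp_inverse)
    show "f i \<in> polyfuns (Suc d)" "\<exists>z. f i z \<noteq> 0" if "i \<in> I" using f that by simp_all
    show "related s (act.stp i c s)" if "i \<in> I" "f i (s(d := c)) \<noteq> 0" using f that by simp
    show "\<exists>u n. set u \<subseteq> I \<and> (\<forall>s. posvec s \<longrightarrow>
      (\<forall>j<d. has_exp (\<lambda>c. act.word_act u 0 (\<lambda>k. complex_of_real c powi n k) s j) (b j)))"
      by (rule tropical_words)
    show "related s s" by (simp add: related_def orbit_relation_eq)
    show "related s s''" if "related s s'" "related s' s''"
      using that unfolding related_def orbit_relation_eq by (rule rtrancl_trans)
    show "related r r'" if "related s s'" "\<And>j. j < d \<Longrightarrow> s j = r j" "\<And>j. j < d \<Longrightarrow> s' j = r' j"
    proof -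
      have "pt s = pt r" "pt s' = pt r'" using that(2,3) by (auto intro!: pt_cong)
      then show ?thesis using that(1) unfolding related_def by simp
    qed
  qed
  obtain s0 N where N: "N \<in> polyfuns d" "\<exists>s. N s \<noteq> 0" "\<forall>s. N s \<noteq> 0 \<longrightarrow> related s0 s"
    using orb.open_orbit by blast
  let ?V = "{t \<in> carrier T. N (\<phi> t) \<noteq> 0}"
  have V: "openin (zar (var T)) ?V"
    by (rule T.nonzero_open[OF T_open T.polyfun_regular[OF N(1) T_open coord_regular]])
  obtain z where z: "posvec z" "N z \<noteq> 0" using N(1,2) polyfuns_nonzero_pos by metis
  have zj: "z j \<noteq> 0" for j using z(1) posreal_nonzero by (auto simp: posvec_def)
  have "N (\<phi> (pt z)) = N z" by (rule polyfuns_cong[OF N(1)]) (use \<phi>_pt[of z, OF zj] in simp)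
  then have "pt z \<in> ?V" using z(2) pt_mem[of z, OF zj] by simp
  then have Vne: "?V \<noteq> {}" by blast
  obtain U where U: "open_dense (var T) U" "\<forall>t\<in>U. \<exists>y. \<theta> t = Some y \<and> \<theta>_inv y = Some t"
    using inverse_\<theta> unfolding inverse_rational_def generically_def by (elim conjE exE)
  obtain W where W: "open_dense (gvar X) W" "\<forall>y\<in>W. \<exists>t. \<theta>_inv y = Some t \<and> \<theta> t = Some y"
    using inverse_\<theta> unfolding inverse_rational_def generically_def by (elim conjE exE)
  \<comment> \<open>The point given by \<open>s0\<close> may lie outside the domain of
    \<open>\<theta>\<close>, where \<open>the\<close> yields an unspecified value; so the orbit is
    based at a point \<open>t1\<close> at which \<open>\<theta>\<close> is defined.\<close>
  obtain t1 where t1: "t1 \<in> ?V" "t1 \<in> U" using open_dense_meets[OF U(1) V Vne] by blast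
  obtain x1 where x1: "\<theta> t1 = Some x1" "\<theta>_inv x1 = Some t1" using U(2) t1(2) by blast
  have x1p: "x1 \<in> pts (gvar X)"
    using regular_on_image[OF rational_map_regular[OF \<theta>_rational], of t1] x1 by auto
  have rel: "(x1, the (\<theta> t)) \<in> orbit_relation I X" if t: "t \<in> ?V" for t
  proof -
    have "related s0 (\<phi> t1)" "related s0 (\<phi> t)" using N(3) t t1(1) by auto
    then have "(the (\<theta> (pt s0)), x1) \<in> orbit_relation I X" "(the (\<theta> (pt s0)), the (\<theta> t)) \<in> orbit_relation I X"
      using pt_\<phi> t t1(1) x1 by (auto simp: related_def)
    then show ?thesis using orbit_sym unfolding orbit_relation_eq by (meson rtrancl_trans)
  qed
  let ?\<Omega> = "orbit_relation I X `` {x1}"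
  have ri: "regular_on (gvar X) (dom \<theta>_inv) (var T) (\<lambda>y. the (\<theta>_inv y))"
    using inverse_\<theta> by (intro rational_map_regular) (simp add: inverse_rational_def)
  \<comment> \<open>Pulling back along \<open>\<theta>_inv\<close> gives an open set of
    \<open>X\<close>, and on \<open>W\<close> its points are really values of
    \<open>\<theta>\<close>.\<close>
  let ?M = "{y \<in> dom \<theta>_inv. the (\<theta>_inv y) \<in> ?V}"
  have M: "openin (zar (gvar X)) ?M" by (rule regular_on_preimage[OF ri V])
  have "x1 \<in> ?M" using x1 t1 by auto
  then have "?M \<inter> W \<noteq> {}" using open_dense_meets[OF W(1) M] by blast
  moreover have "openin (zar (gvar X)) (?M \<inter> W)" by (intro openin_Int M open_dense_open[OF W(1)])
  moreover have "?M \<inter> W \<subseteq> ?\<Omega>"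
  proof
    fix y assume y: "y \<in> ?M \<inter> W"
    then obtain t where t: "\<theta>_inv y = Some t" "\<theta> t = Some y" using W(2) by blast
    then have "t \<in> ?V" using y by auto
    from rel[OF this] show "y \<in> ?\<Omega>" using t by auto
  qed
  ultimately have o: "openin (zar (gvar X)) ?\<Omega>" by (intro orbit_open)
  have "x1 \<in> ?\<Omega>" by (simp add: orbit_relation_eq)
  then have "open_dense (gvar X) ?\<Omega>" using irreducible_open_dense[OF X_irreducible o] by blast
  then show ?thesis unfolding prehomogeneous_def using x1p by blast
qed

end

theorem theorem3p3:
  fixes I :: "'i set"
    and a :: "'i \<Rightarrow> 'i \<Rightarrow> int"
    and X :: "('i, 'a) gcrystal"
    and T :: "'t alg_group"
    and \<theta> :: "'t \<rightharpoonup> 'a"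
    and B :: "('i, complex \<Rightarrow> 't) free_crystal"
  assumes "symmetrizable_GCM I a"
    and "geometric_crystal I a X"
    and "positive_structure I X T \<theta>"
    and "B = ultra_discretization X T \<theta>"
    and "crystal_connected I B"
  shows "prehomogeneous I X"
proof -
  have "alg_torus T" using assms(3) by (simp add: positive_structure_def)
  then obtain d \<phi> where T: "group T" "variety (var T)" "pts (var T) = carrier T"
    "\<phi> \<in> iso T (std_torus d)" "fspace_iso (var T) (var (std_torus d)) \<phi>"
    unfolding alg_torus_def by (elim conjE exE)
  have "geometric_chart T d \<phi> I X \<theta>"
  proof (rule geometric_chart.intro[OF torus_chart.intro[OF T(2,3,1,4,5)]], rule geometric_chart_axioms.intro)
    show "variety (gvar X)" using assms(2) by (simp add: geometric_crystal_def)
    show "rational_action (gvar X) (act X i)" "open_dense (gvar X) {x. (1, x) \<in> dom (act X i)}" if "i \<in> I" for i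
      using assms(2) that by (auto simp: geometric_crystal_def)
    show "birational_map (var T) (gvar X) \<theta>" using assms(3) by (simp add: positive_structure_def)
  qed
  then interpret geometric_chart T d \<phi> I X \<theta> .
  \<comment> \<open>Numerators and denominators are chosen together as a pair, so that a single
    choice over all letters suffices.\<close>
  have "\<forall>i. \<exists>GH. i \<in> I \<longrightarrow> (\<forall>j<d. fst GH j \<in> prat (Suc d) \<and> snd GH j \<in> prat (Suc d)) \<and>
    (\<forall>c t. c \<noteq> 0 \<longrightarrow> t \<in> carrier T \<longrightarrow> (\<forall>j<d. fst GH j ((\<phi> t)(d := c)) \<noteq> 0 \<and> snd GH j ((\<phi> t)(d := c)) \<noteq> 0) \<longrightarrow>
      act_theta X T \<theta> i (c, t) = Some (pt (\<lambda>j. fst GH j ((\<phi> t)(d := c)) * inverse (snd GH j ((\<phi> t)(d := c))))))"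
  proof
    fix i
    show "\<exists>GH. i \<in> I \<longrightarrow> (\<forall>j<d. fst GH j \<in> prat (Suc d) \<and> snd GH j \<in> prat (Suc d)) \<and>
      (\<forall>c t. c \<noteq> 0 \<longrightarrow> t \<in> carrier T \<longrightarrow> (\<forall>j<d. fst GH j ((\<phi> t)(d := c)) \<noteq> 0 \<and> snd GH j ((\<phi> t)(d := c)) \<noteq> 0) \<longrightarrow>
        act_theta X T \<theta> i (c, t) = Some (pt (\<lambda>j. fst GH j ((\<phi> t)(d := c)) * inverse (snd GH j ((\<phi> t)(d := c))))))"
    proof (cases "i \<in> I")
      case True
      then have "positive_map (prod_group Gm T) T (act_theta X T \<theta> i)"
        using assms(3) by (simp add: positive_structure_def)
      from positive_map_coordinates[OF this] obtain G H where
        "\<forall>j<d. G j \<in> prat (Suc d) \<and> H j \<in> prat (Suc d)"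
        "\<forall>c t. c \<noteq> 0 \<longrightarrow> t \<in> carrier T \<longrightarrow> (\<forall>j<d. G j ((\<phi> t)(d := c)) \<noteq> 0 \<and> H j ((\<phi> t)(d := c)) \<noteq> 0) \<longrightarrow>
          act_theta X T \<theta> i (c, t) = Some (pt (\<lambda>j. G j ((\<phi> t)(d := c)) * inverse (H j ((\<phi> t)(d := c)))))"
        by (elim exE conjE)
      then show ?thesis by (intro exI[of _ "(G, H)"] impI conjI) simp_all
    qed simp
  qed
  then obtain GH where GH: "\<forall>i. i \<in> I \<longrightarrow> (\<forall>j<d. fst (GH i) j \<in> prat (Suc d) \<and> snd (GH i) j \<in> prat (Suc d)) \<and>
    (\<forall>c t. c \<noteq> 0 \<longrightarrow> t \<in> carrier T \<longrightarrow> (\<forall>j<d. fst (GH i) j ((\<phi> t)(d := c)) \<noteq> 0 \<and> snd (GH i) j ((\<phi> t)(d := c)) \<noteq> 0) \<longrightarrow>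
      act_theta X T \<theta> i (c, t) = Some (pt (\<lambda>j. fst (GH i) j ((\<phi> t)(d := c)) * inverse (snd (GH i) j ((\<phi> t)(d := c))))))"
    by (rule choice[THEN exE])
  interpret positive_chart T d \<phi> I X \<theta> "\<lambda>i. fst (GH i)" "\<lambda>i. snd (GH i)"
    by unfold_locales (use GH assms(4,5) in auto)
  show ?thesis by (rule prehomogeneous_X)
qed

end
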